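(* Let $K=2$ and let $g:X\to\mathbb{R}^d$ be measurable. Suppose that: (i) each $\Pi_k$ ($k=1,2$) is a Gibbs kernel with respect to $(h_k,\pi)$ for some measurable $h_k:X\to\mathbb{R}^{m_k}$, $m_k\ge1$; (ii) there is a probability measure $\psi$ on $(X,\mathscr{X})$ such that for each $k=1,2$, each $A\in\mathscr{X}$ with $\psi(A)>0$ and each $x\in X$ there is a positive integer $t$ with $P_k^{2t}(x,A)>0$; (iii) for $k=1,2$ there are sets $D_k\in\mathscr{X}$ that are small with respect to $P_k^2$, constants $\lambda_k<1$ and $b_k<\infty$, and measurable functions $W_k:X\to[1,\infty)$ with $P_k^2W_k(x)\le \lambda_kW_k(x)+b_kI_{D_k}(x)$ for all $x\in X$; (iv) $\int\pi(dx)W_k^2(x)<\infty$ for each $k$; (v) $|a^Tg(x)|\le W_k(x)$ for all $x\in X$, all $k$ and all $a\in\mathbb{R}^d$ with $\|a\|_2\le 1$; (vi) $\int\pi(dx)g(x)=0$; (vii) $\Pi_2g=g$ $\pi$-a.e.; (viii) $\int\pi(dx)gg^T$ is positive definite. For a $d\times d$ matrix $C$ let $\Sigma_C$ be the asymptotic variance of $\sum_{t=0}^{M-1}\big[g(X_t)-C^T\{g(X_t)-\Pi_{\sigma^t(1)}g(X_t)\}\big]$ along the deterministic sweep chain $\{X_t\}$ with arbitrary initial law. Let $\Sigma_0,\Sigma_1,\Sigma_2$ be $\Sigma_C$ for $C=0_{d\times d}$, $C=I_{d\times d}$, $C=2I_{d\times d}$ respectively, let $\Sigma_{\tilde C}$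 be $\Sigma_C$ for the optimal weight $\tilde C=U^\dagger V$, and let $\Sigma_{\mathrm{LWK}}$ be the asymptotic variance of $\sum_{t=0}^{M-1}\Pi_1g(X_t)$ along the same chain. Put $A=\int\pi(dx)gg^T$ and $B=\int\pi(dx)(\Pi_1g)(\Pi_1g)^T$. Then $\Sigma_2=\Sigma_{\mathrm{LWK}}$ and $\Sigma_{\tilde C}\le\Sigma_2<\Sigma_1<\Sigma_0$, with $$\Sigma_{\tilde C}-\Sigma_2=-2B(A-B)^{-1}B\le0,\qquad \Sigma_2-\Sigma_1=-(A+3B)/2<0,\qquad \Sigma_1-\Sigma_0=-(B+3A)/2<0.$$
   Context: $X$ is a complete separable metric space with Borel $\sigma$-algebra $\mathscr{X}$, $\pi$ is a probability measure on $(X,\mathscr{X})$, and $\Pi_1,\Pi_2:X\times\mathscr{X}\to[0,1]$ are probability kernels ($K=2$). A kernel $\Pi$ is a Gibbs kernel with respect to $(h,\pi)$ if it is a regular conditional distribution given $\sigma(h)$ under $\pi$: for each $A\in\mathscr{X}$, $\Pi(\cdot,A)=E_\pi\{I_A\mid\sigma(h)\}$ $\pi$-a.e. For a function $u$, $\Pi u(x)=\int\Pi(x,dy)u(y)$ (elementwise for vector valued $u$; for real-valued $\pi$-integrable $u$ the integral converges absolutely for $\pi$-a.e. $x$, and we set $\Pi u(x)=0$ where it does not). $I_A$ (for a set $A$) is an indicator function. $\sigma(1)=2$, $\sigma(2)=1$; $\sigma^t$ is the $t$-fold iterate. $P_k^0u=u$, $P_k^tu=\Pi_{\sigma^0(k)}\Pi_{\sigma^1(k)}\cdots\Pi_{\sigma^{t-1}(k)}u$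 for $t\ge1$, and $P_k^t(x,A)=P_k^tI_A(x)$. A set $D\in\mathscr{X}$ is small with respect to a probability kernel $P$ if there are an integer $m>0$ and a non-trivial measure $\nu_m$ on $(X,\mathscr{X})$ with $P^m(x,B)\ge\nu_m(B)$ for all $x\in D$, $B\in\mathscr{X}$. The deterministic sweep chain with initial law $\nu$ is the Markov chain with $X_0\sim\nu$ and, given $X_0,\dots,X_t$, $X_{t+1}\sim\Pi_{\sigma^t(1)}(X_t,\cdot)$. The asymptotic variance of sums $S_M$ is the $d\times d$ positive semidefinite matrix $\Sigma$ such that $M^{-1/2}S_M$ converges in distribution, as $M\to\infty$, to a random vector with characteristic function $t\mapsto\exp\{-t^T\Sigma t/2\}$. With control variate basis function $f=g$ and Gibbs kernels, $U=\frac12\sum_{k=1}^2\int\pi(dx)\{gg^T-(\Pi_kg)(\Pi_kg)^T\}$ and $V=\int\pi(dx)gg^T$; $^\dagger$ is the Moore–Penrose pseudoinverse; $\tilde C=U^\dagger V$ minimizes $\Sigma_C$ over $C$. For symmetric matrices, $A\ge B$ means $A-B$ is positive semidefinite, and $A>B$ means $A-B$ is positive semidefinite with at least one nonzero eigenvalue.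
   Formalization: In (iii), P_k^2 W_k(x) is read as the [0,∞]-valued integral of W_k, so it must be finite at every x; under the convention of setting divergent integrals to 0, the drift condition would hold trivially on π-null sets and the claim for arbitrary initial laws would fail. *)

theory Defs
  imports "HOL-Probability.Probability"
begin

definition gibbs_kernel ::
    "('a::polish_space \<Rightarrow> 'a measure) \<Rightarrow> ('a \<Rightarrow> real^'m) \<Rightarrow> 'a measure \<Rightarrow> bool" where
  "gibbs_kernel P h \<mu> \<longleftrightarrow>
     P \<in> borel \<rightarrow>\<^sub>M prob_algebra borel \<and>
     (\<forall>A\<in>sets borel. AE x in \<mu>.
        measure (P x) A = real_cond_exp \<mu> (vimage_algebra (space \<mu>) h borel) (indicator A) x)"

text \<open>The action of a kernel on a vector valued function is elementwise; each component of the
  Bochner integral is 0 at points where it does not converge absolutely.\<close>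

definition kernel_vec :: "('a \<Rightarrow> 'a measure) \<Rightarrow> ('a \<Rightarrow> real^'d) \<Rightarrow> 'a \<Rightarrow> real^'d" where
  "kernel_vec P u x = (\<chi> i. LINT y|P x. u y $ i)"

primrec kernel_pow :: "('a::polish_space \<Rightarrow> 'a measure) \<Rightarrow> nat \<Rightarrow> 'a \<Rightarrow> 'a measure" where
  "kernel_pow P 0 = return borel"
| "kernel_pow P (Suc m) = (\<lambda>x. P x \<bind> kernel_pow P m)"

definition small_set :: "('a::polish_space \<Rightarrow> 'a measure) \<Rightarrow> 'a set \<Rightarrow> bool" where
  "small_set P D \<longleftrightarrow> D \<in> sets borel \<and>
     (\<exists>m>0. \<exists>\<nu>. sets \<nu> = sets borel \<and> emeasure \<nu> (space \<nu>) \<noteq> 0 \<and>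
        (\<forall>x\<in>D. \<forall>B\<in>sets borel. emeasure (kernel_pow P m x) B \<ge> emeasure \<nu> B))"

text \<open>The two components are numbered 1 and 2, and \<open>sweep_next\<close> swaps them. The kernel
  \<open>sweep_kernel Q k t\<close> applies the components \<open>k\<close>, \<open>sweep_next k\<close>, ... in turn, for \<open>t\<close> steps.\<close>

definition sweep_next :: "nat \<Rightarrow> nat" where
  "sweep_next k = (if k = 1 then 2 else 1)"

primrec sweep_kernel ::
    "(nat \<Rightarrow> 'a::polish_space \<Rightarrow> 'a measure) \<Rightarrow> nat \<Rightarrow> nat \<Rightarrow> 'a \<Rightarrow> 'a measure" where
  "sweep_kernel Q k 0 = return borel"
| "sweep_kernel Q k (Suc t) = (\<lambda>x. Q k x \<bind> sweep_kernel Q (sweep_next k) t)"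

lemma measurable_sweep_kernel:
  assumes "\<And>j. j \<in> {1,2} \<Longrightarrow> Q j \<in> borel \<rightarrow>\<^sub>M prob_algebra borel" and "k \<in> {1,2}"
  shows "sweep_kernel Q k t \<in> borel \<rightarrow>\<^sub>M prob_algebra borel"
  using assms(2)
proof (induction t arbitrary: k)
  case 0
  show ?case
    by (simp add: measurable_return_prob_space)
next
  case (Suc t)
  have "sweep_kernel Q (sweep_next k) t \<in> borel \<rightarrow>\<^sub>M prob_algebra borel"
    by (rule Suc.IH) (simp add: sweep_next_def)
  then show ?case
    using assms(1)[OF Suc.prems] by (simp add: measurable_bind_prob_space)
qed

lemma nn_integral_sweep_kernel:
  assumes "\<And>j. j \<in> {1,2} \<Longrightarrow> Q j \<in> borel \<rightarrow>\<^sub>M prob_algebra borel" and "k \<in> {1,2}"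
    and "u \<in> borel_measurable borel"
  shows "(\<integral>\<^sup>+z. u z \<partial>sweep_kernel Q k (Suc t) x) =
         (\<integral>\<^sup>+y. (\<integral>\<^sup>+z. u z \<partial>sweep_kernel Q (sweep_next k) t y) \<partial>Q k x)"
proof -
  have "sweep_kernel Q (sweep_next k) t \<in> borel \<rightarrow>\<^sub>M prob_algebra borel"
    by (rule measurable_sweep_kernel[OF assms(1)]) (auto simp: sweep_next_def)
  moreover have "sets (Q k x) = sets borel"
    using assms(1)[OF assms(2)] by (metis measurable_prob_algebraD subprob_measurableD(2) UNIV_I space_borel)
  ultimately show ?thesis
    using assms(3) by (simp add: nn_integral_bind[where B = borel] measurable_prob_algebraD
        cong: measurable_cong_sets)
qed

definition sweep_chain ::
    "(nat \<Rightarrow> 'a::polish_space \<Rightarrow> 'a measure) \<Rightarrow> 'a measure \<Rightarrow> 'b measure \<Rightarrow> (nat \<Rightarrow> 'b \<Rightarrow> 'a) \<Rightarrow> bool"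
  where
  "sweep_chain Q \<nu> N X \<longleftrightarrow>
     prob_space N \<and> (\<forall>t. X t \<in> N \<rightarrow>\<^sub>M borel) \<and> distr N borel (X 0) = \<nu> \<and>
     (\<forall>t. \<forall>A\<in>sets borel. AE \<omega> in N.
        real_cond_exp N
          (vimage_algebra (space N) (\<lambda>\<omega>. \<lambda>i\<in>{..t}. X i \<omega>) (\<Pi>\<^sub>M i\<in>{..t}. borel))
          (\<lambda>\<omega>. indicator A (X (Suc t) \<omega>)) \<omega>
        = measure (Q ((sweep_next ^^ t) 1) (X t \<omega>)) A)"

definition outer :: "real^'d \<Rightarrow> real^'d^'d" where
  "outer v = (\<chi> i j. v $ i * v $ j)"

definition pos_semidef :: "real^'d^'d \<Rightarrow> bool" where
  "pos_semidef A \<longleftrightarrow> transpose A = A \<and> (\<forall>v. v \<bullet> (A *v v) \<ge> 0)"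

definition pos_def :: "real^'d^'d \<Rightarrow> bool" where
  "pos_def A \<longleftrightarrow> transpose A = A \<and> (\<forall>v. v \<noteq> 0 \<longrightarrow> v \<bullet> (A *v v) > 0)"

definition mat_le :: "real^'d^'d \<Rightarrow> real^'d^'d \<Rightarrow> bool" where
  "mat_le B A \<longleftrightarrow> pos_semidef (A - B)"

text \<open>The strict order asks for one nonzero eigenvalue only, not for positive definiteness.\<close>

definition mat_less :: "real^'d^'d \<Rightarrow> real^'d^'d \<Rightarrow> bool" where
  "mat_less B A \<longleftrightarrow> pos_semidef (A - B) \<and>
     (\<exists>l v. l \<noteq> 0 \<and> v \<noteq> 0 \<and> (A - B) *v v = l *\<^sub>R v)"

definition moore_penrose :: "real^'d^'d \<Rightarrow> real^'d^'d" where
  "moore_penrose A = (THE X. A ** X ** A = A \<and> X ** A ** X = X \<and>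
     transpose (A ** X) = A ** X \<and> transpose (X ** A) = X ** A)"

lemma moore_penrose_eqI:
  assumes "A ** X ** A = A" "X ** A ** X = X"
    and "transpose (A ** X) = A ** X" "transpose (X ** A) = X ** A"
  shows "moore_penrose A = X"
  unfolding moore_penrose_def
proof (rule the_equality)
  fix Y assume "A ** Y ** A = A \<and> Y ** A ** Y = Y \<and>
    transpose (A ** Y) = A ** Y \<and> transpose (Y ** A) = Y ** A"
  then have Y: "A ** Y ** A = A" "Y ** A ** Y = Y"
    "transpose (A ** Y) = A ** Y" "transpose (Y ** A) = Y ** A"
    by blast+
  have "A ** X = transpose ((A ** Y) ** (A ** X))"
    by (simp only: matrix_mul_assoc Y(1) assms(3))
  also have "\<dots> = (A ** X) ** (A ** Y)"
    by (simp only: matrix_transpose_mul[of "A ** Y" "A ** X"] Y(3) assms(3))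
  also have "\<dots> = A ** Y"
    by (simp only: matrix_mul_assoc assms(1))
  finally have AX: "A ** X = A ** Y" .
  have "X ** A = transpose ((X ** A) ** (Y ** A))"
    by (metis matrix_mul_assoc Y(1) assms(4))
  also have "\<dots> = (Y ** A) ** (X ** A)"
    by (simp only: matrix_transpose_mul[of "X ** A" "Y ** A"] Y(4) assms(4))
  also have "\<dots> = Y ** A"
    by (metis matrix_mul_assoc assms(1))
  finally have XA: "X ** A = Y ** A" .
  show "Y = X"
    by (metis AX XA Y(2) assms(2) matrix_mul_assoc)
qed (intro conjI assms)

text \<open>Convergence in distribution of random vectors, tested on bounded continuous functions.\<close>

definition conv_in_distr :: "'b measure \<Rightarrow> (nat \<Rightarrow> 'b \<Rightarrow> real^'d) \<Rightarrow> (real^'d) measure \<Rightarrow> bool" where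
  "conv_in_distr N Y L \<longleftrightarrow>
     (\<forall>n. Y n \<in> borel_measurable N) \<and>
     (\<forall>f :: real^'d \<Rightarrow> real. continuous_on UNIV f \<and> bounded (range f) \<longrightarrow>
        (\<lambda>n. LINT \<omega>|N. f (Y n \<omega>)) \<longlonglongrightarrow> (LINT y|L. f y))"

definition asymptotic_variance ::
    "'b measure \<Rightarrow> (nat \<Rightarrow> 'b \<Rightarrow> real^'d) \<Rightarrow> real^'d^'d \<Rightarrow> bool" where
  "asymptotic_variance N S \<Sigma> \<longleftrightarrow>
     pos_semidef \<Sigma> \<and>
     (\<exists>L. prob_space L \<and> sets L = sets borel \<and>
        (\<forall>s. (CLINT y|L. iexp (s \<bullet> y)) = of_real (exp (- (s \<bullet> (\<Sigma> *v s)) / 2))) \<and>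
        conv_in_distr N (\<lambda>n \<omega>. (1 / sqrt (real n)) *\<^sub>R S n \<omega>) L)"

definition cv_summand ::
    "(nat \<Rightarrow> 'a \<Rightarrow> 'a measure) \<Rightarrow> ('a \<Rightarrow> real^'d) \<Rightarrow> real^'d^'d \<Rightarrow> nat \<Rightarrow> 'a \<Rightarrow> real^'d" where
  "cv_summand Q g C t x = g x - transpose C *v (g x - kernel_vec (Q ((sweep_next ^^ t) 1)) g x)"

end

theory Submission
  imports Defs "HOL-Real_Asymp.Real_Asymp"
begin

text \<open>A Gibbs kernel acts on \<open>L\<^sup>2(\<pi>)\<close> as the orthogonal projection onto the \<open>\<sigma>(h)\<close>-measurable
  functions. Since \<open>\<Pi>\<^sub>1\<close> is self-adjoint, the drift condition for \<open>\<Pi>\<^sub>1 \<Pi>\<^sub>2\<close> and a conditional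
  Cauchy--Schwarz inequality bound the mass that a function invariant under \<open>\<Pi>\<^sub>2\<close> can put outside the
  small set, and minorisation controls it on the small set. This yields \<open>\<parallel>\<Pi>\<^sub>1 f\<parallel>\<^sup>2 \<le> r \<parallel>f\<parallel>\<^sup>2\<close> with \<open>r < 1\<close>
  for all mean zero \<open>f = \<Pi>\<^sub>2 f\<close>, so the Poisson equation is solved by a geometric series in \<open>L\<^sup>2(\<pi>)\<close>.

  Under \<open>\<pi>\<close>, the characteristic functions of the sums then follow by telescoping a product of
  kernels twisted by martingale increments. The same drift makes the singular part of the law of the
  chain die out, so that this law converges to \<open>\<pi>\<close> in total variation from any start. The limiting
  covariances are quadratic in \<open>C\<close> with coefficients \<open>A\<close> and \<open>B\<close>, and \<open>B \<le> r A\<close> makes \<open>A - B\<close> positive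
  definite; the comparisons are then matrix algebra.\<close>

section \<open>Regular conditional distributions\<close>

text \<open>Two obstacles shape the proof. First, a Gibbs kernel is a projection only up to
  \<pi>-null sets, while the chain may start anywhere, even on a \<pi>-null set. So the spectral
  work is done in L2(\<pi>), and the drift and small set conditions, which hold at every point, have
  to show that an exceptional null set is left eventually. Second, the conditional variance of the
  martingale increment is not constant, so replacing one twisted factor by its Gaussian value costs
  order 1/n, and n such costs need not be small in total. What saves the sum is that the leading
  part of each cost is a centred function with many kernels in front of it, so mixing averages it
  out. The rate is r = (l + R) / (1 + R), with l the drift rate and R = 4 * 4^m b / \<beta>: the
  energy of f under m sweeps is at most 4 * 4^m (||f||^2 - ||K1 f||^2), where m and \<beta> are the
  order and mass of the minorisation and b is the drift constant. Only one projection defect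
  appears, since f is fixed by the other kernel.\<close>

lemma (in prob_space) norm_integral_le:
  fixes f :: "'a \<Rightarrow> 'b::{banach, second_countable_topology}"
  assumes "\<And>x. norm (f x) \<le> B"
  shows "norm (\<integral>x. f x \<partial>M) \<le> B"
proof (cases "integrable M f")
  case True
  have "norm (\<integral>x. f x \<partial>M) \<le> (\<integral>x. norm (f x) \<partial>M)"
    by (rule integral_norm_bound)
  also have "\<dots> \<le> (\<integral>x. B \<partial>M)"
    using True assms by (intro integral_mono) auto
  finally show ?thesis
    by (simp add: prob_space)
next
  case False
  then show ?thesis
    using order_trans[OF norm_ge_zero assms] by (simp add: not_integrable_integral_eq)
qed

lemma sigma_finite_subalgebra_prob:
  assumes "prob_space N" "subalgebra N F"
  shows "sigma_finite_subalgebra N F"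
  using assms finite_measure_subalgebra_is_sigma_finite[of N F]
  by (simp add: finite_measure_subalgebra_def finite_measure_subalgebra_axioms_def prob_space_def)

text \<open>Conditional monotone convergence, for the limit step of the induction over measurable
  functions below. Conditional expectations increase only almost everywhere, so monotone convergence
  enters in its AE form on that side.\<close>

lemma (in sigma_finite_subalgebra) nn_cond_exp_SUP:
  assumes inc: "incseq U" and U[measurable]: "\<And>i. U i \<in> borel_measurable M"
  shows "AE x in M. nn_cond_exp M F (\<lambda>x. SUP i. U i x) x = (SUP i. nn_cond_exp M F (U i) x)"
proof -
  have mono: "AE x in M. nn_cond_exp M F (U i) x \<le> nn_cond_exp M F (U (Suc i)) x" for i
    using incseq_SucD[OF inc, of i] by (intro nn_cond_exp_mono AE_I2 U) (simp add: le_fun_def)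
  have "AE x in M. (SUP i. nn_cond_exp M F (U i) x) = nn_cond_exp M F (\<lambda>x. SUP i. U i x) x"
  proof (rule nn_cond_exp_charact)
    fix A assume A[measurable]: "A \<in> sets F"
    then have A'[measurable]: "A \<in> sets M"
      using subalg by (auto simp: subalgebra_def)
    have "(\<integral>\<^sup>+ x \<in> A. (SUP i. U i x) \<partial>M) = (\<integral>\<^sup>+ x. (SUP i. U i x * indicator A x) \<partial>M)"
      by (simp add: SUP_mult_right_ennreal)
    also have "\<dots> = (SUP i. \<integral>\<^sup>+ x. U i x * indicator A x \<partial>M)"
    proof (rule nn_integral_monotone_convergence_SUP)
      show "incseq (\<lambda>i x. U i x * indicator A x)"
        unfolding incseq_def le_fun_def
        by (intro allI impI mult_right_mono) (simp_all add: incseqD[OF inc, THEN le_funD])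
    qed simp
    also have "\<dots> = (SUP i. \<integral>\<^sup>+ x. indicator A x * nn_cond_exp M F (U i) x \<partial>M)"
      by (subst nn_cond_exp_intg) (auto simp: mult.commute)
    also have "\<dots> = (\<integral>\<^sup>+ x. (SUP i. indicator A x * nn_cond_exp M F (U i) x) \<partial>M)"
    proof (rule nn_integral_monotone_convergence_SUP_AE[symmetric])
      show "AE x in M. indicator A x * nn_cond_exp M F (U i) x
          \<le> indicator A x * nn_cond_exp M F (U (Suc i)) x" for i
        using mono[of i] by eventually_elim (auto intro: mult_left_mono)
    qed auto
    finally show "(\<integral>\<^sup>+ x \<in> A. (SUP i. U i x) \<partial>M)
        = (\<integral>\<^sup>+ x \<in> A. (SUP i. nn_cond_exp M F (U i) x) \<partial>M)"
      by (simp add: SUP_mult_left_ennreal[symmetric] mult.commute)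
  qed auto
  then show ?thesis
    by (simp add: eq_commute)
qed

text \<open>The locale serves two purposes: with \<open>Y\<close> the identity, \<open>K\<close> is
  a Gibbs kernel; with \<open>Y\<close> the next state of the chain and \<open>F\<close> the past,
  it is the Markov property. The condition is imposed on sets and extended to functions
  below.\<close>

locale regular_cond_distr = prob_space N for N :: "'b measure" +
  fixes F :: "'b measure" and Y :: "'b \<Rightarrow> 'a" and M :: "'a measure" and K :: "'b \<Rightarrow> 'a measure"
  assumes subalg: "subalgebra N F"
    and Y[measurable]: "Y \<in> N \<rightarrow>\<^sub>M M"
    and K_prob[measurable]: "K \<in> N \<rightarrow>\<^sub>M prob_algebra M"
    and K_set: "\<And>A. A \<in> sets M \<Longrightarrow>
      AE \<omega> in N. real_cond_exp N F (\<lambda>\<omega>. indicator A (Y \<omega>)) \<omega> = measure (K \<omega>) A"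
begin

sublocale sigma_finite_subalgebra N F
  using sigma_finite_subalgebra_prob[OF prob_space_axioms subalg] .

lemma K_subprob[measurable]: "K \<in> N \<rightarrow>\<^sub>M subprob_algebra M"
  by (rule measurable_prob_algebraD) simp

lemma sets_K[measurable_cong]: "\<omega> \<in> space N \<Longrightarrow> sets (K \<omega>) = sets M"
  using K_subprob by (rule subprob_measurableD)

lemma prob_space_K: "\<omega> \<in> space N \<Longrightarrow> prob_space (K \<omega>)"
  using measurable_space[OF K_prob] by (auto simp: space_prob_algebra)

lemma measurable_nn_integral_K[measurable]:
  "h \<in> borel_measurable M \<Longrightarrow> (\<lambda>\<omega>. \<integral>\<^sup>+y. h y \<partial>K \<omega>) \<in> borel_measurable N"
  by (rule measurable_compose[OF K_subprob nn_integral_measurable_subprob_algebra])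

text \<open>In \<open>ennreal\<close> no integrability has to be tracked; the real and complex
  versions are read off from this one.\<close>

lemma nn_cond_exp_eq:
  assumes "h \<in> borel_measurable M"
  shows "AE \<omega> in N. nn_cond_exp N F (\<lambda>\<omega>. h (Y \<omega>)) \<omega> = (\<integral>\<^sup>+y. h y \<partial>K \<omega>)"
  using assms
proof induction
  case (cong f g)
  have "AE \<omega> in N. nn_cond_exp N F (\<lambda>\<omega>. g (Y \<omega>)) \<omega> = nn_cond_exp N F (\<lambda>\<omega>. f (Y \<omega>)) \<omega>"
    using cong.hyps measurable_space[OF Y] by (intro nn_cond_exp_cong) (auto intro!: AE_I2)
  moreover have "AE \<omega> in N. (\<integral>\<^sup>+y. f y \<partial>K \<omega>) = (\<integral>\<^sup>+y. g y \<partial>K \<omega>)"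
  proof (rule AE_I2)
    fix \<omega> assume "\<omega> \<in> space N"
    then have "space (K \<omega>) = space M"
      using sets_K sets_eq_imp_space_eq by blast
    then show "(\<integral>\<^sup>+y. f y \<partial>K \<omega>) = (\<integral>\<^sup>+y. g y \<partial>K \<omega>)"
      using cong.hyps(3) by (intro nn_integral_cong) auto
  qed
  ultimately show ?case
    using cong.IH by eventually_elim simp
next
  case (set A)
  note [measurable] = set
  \<comment> \<open>\<open>real_cond_exp\<close> also subtracts the part coming from the negative
    part, which has to be seen to vanish for an indicator. The bound by 1 below shows that
    \<open>enn2real\<close> loses nothing on the positive part.\<close>
  have "AE \<omega> in N. nn_cond_exp N F (\<lambda>\<omega>. ennreal (- indicator A (Y \<omega>))) \<omega> = 0"
  proof -
    have "(\<lambda>\<omega>. ennreal (- indicator A (Y \<omega>))) = (\<lambda>_. 0)"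
      by (auto simp: indicator_def ennreal_neg)
    then show ?thesis
      using AE_symmetric[OF nn_cond_exp_F_meas[of "\<lambda>_. 0"]] by simp
  qed
  moreover have "AE \<omega> in N. nn_cond_exp N F (\<lambda>\<omega>. indicator A (Y \<omega>)) \<omega> \<le> nn_cond_exp N F (\<lambda>_. 1) \<omega>"
    by (rule nn_cond_exp_mono) (auto simp: indicator_def)
  moreover have "AE \<omega> in N. 1 = nn_cond_exp N F (\<lambda>_. 1) \<omega>"
    by (rule nn_cond_exp_F_meas) simp
  moreover note K_set[OF set]
  ultimately show ?case
    using AE_space
  proof eventually_elim
    case (elim \<omega>)
    interpret K: prob_space "K \<omega>"
      using prob_space_K[OF elim(5)] .
    have "nn_cond_exp N F (\<lambda>\<omega>. indicator A (Y \<omega>)) \<omega> < \<top>"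
      using elim(2,3) by (metis ennreal_one_less_top le_less_trans)
    moreover have "enn2real (nn_cond_exp N F (\<lambda>\<omega>. indicator A (Y \<omega>)) \<omega>) = measure (K \<omega>) A"
      using elim(1,4) by (simp add: real_cond_exp_def ennreal_indicator)
    ultimately have "nn_cond_exp N F (\<lambda>\<omega>. indicator A (Y \<omega>)) \<omega> = emeasure (K \<omega>) A"
      by (metis K.emeasure_eq_measure ennreal_enn2real)
    then show ?case
      using set sets_K[OF elim(5)] by simp
  qed
next
  case (mult u c)
  note [measurable] = mult.hyps(2)
  have "AE \<omega> in N. c * nn_cond_exp N F (\<lambda>\<omega>. u (Y \<omega>)) \<omega> = nn_cond_exp N F (\<lambda>\<omega>. c * u (Y \<omega>)) \<omega>"
    by (rule nn_cond_exp_prod) auto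
  then show ?case
    using mult.IH AE_space
    by eventually_elim (simp add: nn_integral_cmult cong: measurable_cong_sets)
next
  case (add u v)
  note [measurable] = add.hyps(1,3)
  have "AE \<omega> in N. nn_cond_exp N F (\<lambda>\<omega>. v (Y \<omega>)) \<omega> + nn_cond_exp N F (\<lambda>\<omega>. u (Y \<omega>)) \<omega>
      = nn_cond_exp N F (\<lambda>\<omega>. v (Y \<omega>) + u (Y \<omega>)) \<omega>"
    by (rule nn_cond_exp_sum) auto
  then show ?case
    using add.IH AE_space
    by eventually_elim (simp add: nn_integral_add cong: measurable_cong_sets)
next
  case (seq U)
  note [measurable] = seq.hyps(1)
  have "AE \<omega> in N. nn_cond_exp N F (\<lambda>\<omega>. SUP i. U i (Y \<omega>)) \<omega>
      = (SUP i. nn_cond_exp N F (\<lambda>\<omega>. U i (Y \<omega>)) \<omega>)"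
    using seq.hyps(3) by (intro nn_cond_exp_SUP) (auto simp: incseq_def le_fun_def)
  moreover have "AE \<omega> in N. \<forall>i. nn_cond_exp N F (\<lambda>\<omega>. U i (Y \<omega>)) \<omega> = (\<integral>\<^sup>+y. U i y \<partial>K \<omega>)"
    using seq.IH by (simp add: AE_all_countable)
  ultimately show ?case
    using AE_space
  proof eventually_elim
    case (elim \<omega>)
    have "(\<integral>\<^sup>+y. (SUP i. U i y) \<partial>K \<omega>) = (SUP i. \<integral>\<^sup>+y. U i y \<partial>K \<omega>)"
      using seq.hyps(3) sets_K[OF elim(3)]
      by (intro nn_integral_monotone_convergence_SUP) (simp_all cong: measurable_cong_sets)
    then show ?case
      using elim by (simp add: image_comp)
  qed
qed

text \<open>The conditional expectation of \<bar>h\<bar> has finite mean, hence is finite almost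
  everywhere. This gives absolute convergence under \<open>K \<omega>\<close>, after which positive
  and negative part can be subtracted.\<close>

lemma integral_K:
  fixes h :: "'a \<Rightarrow> real"
  assumes [measurable]: "h \<in> borel_measurable M" and "integrable N (\<lambda>\<omega>. h (Y \<omega>))"
  shows "AE \<omega> in N. integrable (K \<omega>) h"
    and "AE \<omega> in N. real_cond_exp N F (\<lambda>\<omega>. h (Y \<omega>)) \<omega> = (\<integral>y. h y \<partial>K \<omega>)"
proof -
  have "(\<integral>\<^sup>+\<omega>. 1 * nn_cond_exp N F (\<lambda>\<omega>. ennreal \<bar>h (Y \<omega>)\<bar>) \<omega> \<partial>N) = (\<integral>\<^sup>+\<omega>. ennreal \<bar>h (Y \<omega>)\<bar> \<partial>N)"
    by (subst nn_cond_exp_intg) auto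
  also have "\<dots> < \<infinity>"
    using assms(2) by (simp add: integrable_iff_bounded)
  finally have "AE \<omega> in N. nn_cond_exp N F (\<lambda>\<omega>. ennreal \<bar>h (Y \<omega>)\<bar>) \<omega> \<noteq> \<infinity>"
    by (intro nn_integral_noteq_infinite) auto
  moreover have "AE \<omega> in N. nn_cond_exp N F (\<lambda>\<omega>. ennreal \<bar>h (Y \<omega>)\<bar>) \<omega> = (\<integral>\<^sup>+y. ennreal \<bar>h y\<bar> \<partial>K \<omega>)"
    by (rule nn_cond_exp_eq) simp
  ultimately show int: "AE \<omega> in N. integrable (K \<omega>) h"
    using AE_space
    by eventually_elim (simp add: integrable_iff_bounded less_top cong: measurable_cong_sets)
  have "AE \<omega> in N. nn_cond_exp N F (\<lambda>\<omega>. ennreal (h (Y \<omega>))) \<omega> = (\<integral>\<^sup>+y. ennreal (h y) \<partial>K \<omega>)"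
    "AE \<omega> in N. nn_cond_exp N F (\<lambda>\<omega>. ennreal (- h (Y \<omega>))) \<omega> = (\<integral>\<^sup>+y. ennreal (- h y) \<partial>K \<omega>)"
    by (rule nn_cond_exp_eq, simp)+
  then show "AE \<omega> in N. real_cond_exp N F (\<lambda>\<omega>. h (Y \<omega>)) \<omega> = (\<integral>y. h y \<partial>K \<omega>)"
    using int by eventually_elim (simp add: real_cond_exp_def real_lebesgue_integral_def)
qed

lemma integral_mult_K:
  fixes h :: "'a \<Rightarrow> real"
  assumes [measurable]: "h \<in> borel_measurable M" "Z \<in> borel_measurable F"
    and "integrable N (\<lambda>\<omega>. h (Y \<omega>))" "integrable N (\<lambda>\<omega>. Z \<omega> * h (Y \<omega>))"
  shows "integrable N (\<lambda>\<omega>. Z \<omega> * (\<integral>y. h y \<partial>K \<omega>))"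
    and "(\<integral>\<omega>. Z \<omega> * (\<integral>y. h y \<partial>K \<omega>) \<partial>N) = (\<integral>\<omega>. Z \<omega> * h (Y \<omega>) \<partial>N)"
proof -
  have [measurable]: "Z \<in> borel_measurable N"
    using assms(2) measurable_from_subalg subalg by blast
  have eq: "AE \<omega> in N. Z \<omega> * real_cond_exp N F (\<lambda>\<omega>. h (Y \<omega>)) \<omega> = Z \<omega> * (\<integral>y. h y \<partial>K \<omega>)"
    using integral_K(2)[OF assms(1,3)] by eventually_elim simp
  have [measurable]: "(\<lambda>\<omega>. h (Y \<omega>)) \<in> borel_measurable N"
    by simp
  note ce = real_cond_exp_intg[OF assms(4,2)]
  show "integrable N (\<lambda>\<omega>. Z \<omega> * (\<integral>y. h y \<partial>K \<omega>))"
    by (rule integrable_cong_AE[THEN iffD1, OF _ _ eq]) (auto intro: ce)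
  have "(\<integral>\<omega>. Z \<omega> * (\<integral>y. h y \<partial>K \<omega>) \<partial>N)
      = (\<integral>\<omega>. Z \<omega> * real_cond_exp N F (\<lambda>\<omega>. h (Y \<omega>)) \<omega> \<partial>N)"
    by (rule integral_cong_AE[OF _ _ AE_symmetric[OF eq]]) auto
  then show "(\<integral>\<omega>. Z \<omega> * (\<integral>y. h y \<partial>K \<omega>) \<partial>N) = (\<integral>\<omega>. Z \<omega> * h (Y \<omega>) \<partial>N)"
    using ce by simp
qed

text \<open>The chain is handled through characteristic functions, so complex factors occur, whereas
  \<open>real_cond_exp\<close> is real. Splitting both factors gives four real products, each
  covered by \<open>integral_mult_K\<close>; the bound 1 makes everything integrable.\<close>

lemma complex_integral_mult_K:
  fixes h :: "'a \<Rightarrow> complex" and Z :: "'b \<Rightarrow> complex"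
  assumes [measurable]: "h \<in> borel_measurable M" "Z \<in> borel_measurable F"
    and h: "\<And>y. cmod (h y) \<le> 1" and Z: "\<And>\<omega>. cmod (Z \<omega>) \<le> 1"
  shows "(\<integral>\<omega>. Z \<omega> * (\<integral>y. h y \<partial>K \<omega>) \<partial>N) = (\<integral>\<omega>. Z \<omega> * h (Y \<omega>) \<partial>N)"
proof -
  have [measurable]: "Z \<in> borel_measurable N"
    using assms(2) measurable_from_subalg subalg by blast
  have bnd: "\<bar>Re (h y)\<bar> \<le> 1" "\<bar>Im (h y)\<bar> \<le> 1" "\<bar>Re (Z \<omega>)\<bar> \<le> 1" "\<bar>Im (Z \<omega>)\<bar> \<le> 1" for y \<omega>
    using abs_Re_le_cmod abs_Im_le_cmod h Z order_trans by blast+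
  have prod: "\<bar>a * b\<bar> \<le> 1" if "\<bar>a\<bar> \<le> 1" "\<bar>b\<bar> \<le> 1" for a b :: real
    using mult_mono[OF that] by (simp add: abs_mult)
  have R: "integrable N (\<lambda>\<omega>. z \<omega> * (\<integral>y. k y \<partial>K \<omega>))"
    "(\<integral>\<omega>. z \<omega> * (\<integral>y. k y \<partial>K \<omega>) \<partial>N) = (\<integral>\<omega>. z \<omega> * k (Y \<omega>) \<partial>N)"
    "integrable N (\<lambda>\<omega>. z \<omega> * k (Y \<omega>))"
    if [measurable]: "z \<in> borel_measurable F" "z \<in> borel_measurable N" "k \<in> borel_measurable M"
      and b: "\<And>\<omega>. \<bar>z \<omega>\<bar> \<le> 1" "\<And>y. \<bar>k y\<bar> \<le> 1" for z k :: "_ \<Rightarrow> real"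
  proof -
    have i1: "integrable N (\<lambda>\<omega>. k (Y \<omega>))"
      by (rule integrable_const_bound[where B = 1]) (simp_all add: b)
    have i2: "integrable N (\<lambda>\<omega>. z \<omega> * k (Y \<omega>))"
      by (rule integrable_const_bound[where B = 1]) (simp_all only: real_norm_def prod b simp_thms AE_I2, simp)
    note i = i1 i2
    then show "integrable N (\<lambda>\<omega>. z \<omega> * k (Y \<omega>))"
      by simp
    show "integrable N (\<lambda>\<omega>. z \<omega> * (\<integral>y. k y \<partial>K \<omega>))"
      by (rule integral_mult_K(1)[OF _ _ i]) simp_all
    show "(\<integral>\<omega>. z \<omega> * (\<integral>y. k y \<partial>K \<omega>) \<partial>N) = (\<integral>\<omega>. z \<omega> * k (Y \<omega>) \<partial>N)"
      by (rule integral_mult_K(2)[OF _ _ i]) simp_all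
  qed
  have hK: "(\<integral>y. h y \<partial>K \<omega>) = Complex (\<integral>y. Re (h y) \<partial>K \<omega>) (\<integral>y. Im (h y) \<partial>K \<omega>)"
    if "\<omega> \<in> space N" for \<omega>
  proof -
    interpret K: prob_space "K \<omega>"
      using prob_space_K[OF that] .
    have "integrable (K \<omega>) h"
      using h sets_K[OF that]
      by (intro K.integrable_const_bound[where B = 1]) (auto cong: measurable_cong_sets)
    then show ?thesis
      by (simp add: complex_eq_iff)
  qed
  define a b where "a = (\<lambda>\<omega>. Re (Z \<omega>))" and "b = (\<lambda>\<omega>. Im (Z \<omega>))"
  define c d where "c = (\<lambda>y. Re (h y))" and "d = (\<lambda>y. Im (h y))"
  have [measurable]: "a \<in> borel_measurable F" "b \<in> borel_measurable F" "a \<in> borel_measurable N"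
    "b \<in> borel_measurable N" "c \<in> borel_measurable M" "d \<in> borel_measurable M"
    unfolding a_def b_def c_def d_def by simp_all
  have bd: "\<bar>a \<omega>\<bar> \<le> 1" "\<bar>b \<omega>\<bar> \<le> 1" "\<bar>c y\<bar> \<le> 1" "\<bar>d y\<bar> \<le> 1" for \<omega> y
    unfolding a_def b_def c_def d_def using bnd by auto
  have Rs: "integrable N (\<lambda>\<omega>. z \<omega> * (\<integral>y. k y \<partial>K \<omega>))"
    "(\<integral>\<omega>. z \<omega> * (\<integral>y. k y \<partial>K \<omega>) \<partial>N) = (\<integral>\<omega>. z \<omega> * k (Y \<omega>) \<partial>N)"
    "integrable N (\<lambda>\<omega>. z \<omega> * k (Y \<omega>))"
    if "z \<in> {a, b}" "k \<in> {c, d}" for z k :: "_ \<Rightarrow> real"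
    using that bd by (auto intro: R)
  have 1: "integrable N (\<lambda>\<omega>. Z \<omega> * (\<integral>y. h y \<partial>K \<omega>))"
  proof (rule integrable_const_bound[where B = 1])
    show "AE \<omega> in N. cmod (Z \<omega> * (\<integral>y. h y \<partial>K \<omega>)) \<le> 1"
    proof (rule AE_I2)
      fix \<omega> assume "\<omega> \<in> space N"
      then interpret K: prob_space "K \<omega>"
        using prob_space_K by simp
      have "cmod (\<integral>y. h y \<partial>K \<omega>) \<le> 1"
        using h by (rule K.norm_integral_le)
      then show "cmod (Z \<omega> * (\<integral>y. h y \<partial>K \<omega>)) \<le> 1"
        using Z[of \<omega>] mult_mono[of "cmod (Z \<omega>)" 1 "cmod (\<integral>y. h y \<partial>K \<omega>)" 1]
        by (simp add: norm_mult)
    qed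
  qed simp
  have 2: "integrable N (\<lambda>\<omega>. Z \<omega> * h (Y \<omega>))"
    using mult_mono[OF Z h] by (intro integrable_const_bound[where B = 1]) (auto simp: norm_mult)
  show ?thesis
  proof (rule complex_eqI)
    have "Re (\<integral>\<omega>. Z \<omega> * (\<integral>y. h y \<partial>K \<omega>) \<partial>N)
        = (\<integral>\<omega>. a \<omega> * (\<integral>y. c y \<partial>K \<omega>) - b \<omega> * (\<integral>y. d y \<partial>K \<omega>) \<partial>N)"
      unfolding integral_Re[OF 1, symmetric]
      by (rule Bochner_Integration.integral_cong) (auto simp: hK a_def b_def c_def d_def)
    also have "\<dots> = (\<integral>\<omega>. a \<omega> * c (Y \<omega>) - b \<omega> * d (Y \<omega>) \<partial>N)"
      by (simp add: Rs)
    also have "\<dots> = Re (\<integral>\<omega>. Z \<omega> * h (Y \<omega>) \<partial>N)"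
      unfolding integral_Re[OF 2, symmetric] by (simp add: a_def b_def c_def d_def)
    finally show "Re (\<integral>\<omega>. Z \<omega> * (\<integral>y. h y \<partial>K \<omega>) \<partial>N) = Re (\<integral>\<omega>. Z \<omega> * h (Y \<omega>) \<partial>N)" .
    have "Im (\<integral>\<omega>. Z \<omega> * (\<integral>y. h y \<partial>K \<omega>) \<partial>N)
        = (\<integral>\<omega>. a \<omega> * (\<integral>y. d y \<partial>K \<omega>) + b \<omega> * (\<integral>y. c y \<partial>K \<omega>) \<partial>N)"
      unfolding integral_Im[OF 1, symmetric]
      by (rule Bochner_Integration.integral_cong) (auto simp: hK a_def b_def c_def d_def)
    also have "\<dots> = (\<integral>\<omega>. a \<omega> * d (Y \<omega>) + b \<omega> * c (Y \<omega>) \<partial>N)"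
      by (simp add: Rs)
    also have "\<dots> = Im (\<integral>\<omega>. Z \<omega> * h (Y \<omega>) \<partial>N)"
      unfolding integral_Im[OF 2, symmetric] by (simp add: a_def b_def c_def d_def)
    finally show "Im (\<integral>\<omega>. Z \<omega> * (\<integral>y. h y \<partial>K \<omega>) \<partial>N) = Im (\<integral>\<omega>. Z \<omega> * h (Y \<omega>) \<partial>N)" .
  qed
qed

end

section \<open>Stationary kernels\<close>

text \<open>Kept polymorphic, since it acts on real functions in the L2 arguments and on complex
  ones in the characteristic functions. Where the integral does not converge absolutely its value is
  0.\<close>

definition kint :: "('a \<Rightarrow> 'b measure) \<Rightarrow> ('b \<Rightarrow> 'c) \<Rightarrow> 'a \<Rightarrow> 'c::{banach, second_countable_topology}" where
  "kint K f x = (\<integral>y. f y \<partial>K x)"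

section \<open>Square integrable functions\<close>

definition sq_int :: "'a measure \<Rightarrow> ('a \<Rightarrow> real) \<Rightarrow> bool" where
  "sq_int M f \<longleftrightarrow> f \<in> borel_measurable M \<and> integrable M (\<lambda>x. (f x)\<^sup>2)"

lemma sq_int_measurable[measurable_dest]: "sq_int M f \<Longrightarrow> f \<in> borel_measurable M"
  by (simp add: sq_int_def)

lemma sq_int_square: "sq_int M f \<Longrightarrow> integrable M (\<lambda>x. (f x)\<^sup>2)"
  by (simp add: sq_int_def)

lemma abs_mult_le_squares: "\<bar>a * b\<bar> \<le> a\<^sup>2 + (b::real)\<^sup>2"
proof -
  have "0 \<le> (\<bar>a\<bar> - \<bar>b\<bar>)\<^sup>2 + (a\<^sup>2 + b\<^sup>2)"
    by simp
  then show ?thesis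
    by (simp add: power2_diff abs_mult)
qed

lemma sq_int_mult:
  assumes f: "sq_int M f" and g: "sq_int M g"
  shows "integrable M (\<lambda>x. f x * g x)"
proof (rule Bochner_Integration.integrable_bound)
  show "(\<lambda>x. f x * g x) \<in> borel_measurable M"
    using sq_int_measurable[OF f] sq_int_measurable[OF g] by simp
  show "integrable M (\<lambda>x. (f x)\<^sup>2 + (g x)\<^sup>2)"
    using f g by (simp add: sq_int_def)
  show "AE x in M. norm (f x * g x) \<le> norm ((f x)\<^sup>2 + (g x)\<^sup>2)"
    using abs_mult_le_squares[of "f _" "g _"] by (intro AE_I2) simp
qed

lemma sq_int_cmult: "sq_int M f \<Longrightarrow> sq_int M (\<lambda>x. c * f x)"
  by (auto simp: sq_int_def power_mult_distrib)

lemma sq_int_add: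
  assumes f: "sq_int M f" and g: "sq_int M g"
  shows "sq_int M (\<lambda>x. f x + g x)"
  using sq_int_mult[OF f g] f g by (auto simp: sq_int_def power2_sum mult.assoc)

lemma sq_int_diff:
  assumes f: "sq_int M f" and g: "sq_int M g"
  shows "sq_int M (\<lambda>x. f x - g x)"
  using sq_int_mult[OF f g] f g by (auto simp: sq_int_def power2_diff mult.assoc)

lemma sq_int_sum: "(\<And>i. i \<in> I \<Longrightarrow> sq_int M (f i)) \<Longrightarrow> sq_int M (\<lambda>x. \<Sum>i\<in>I. f i x)"
proof (induction I rule: infinite_finite_induct)
  case (insert i I)
  then show ?case
    using sq_int_add[of M "f i" "\<lambda>x. \<Sum>i\<in>I. f i x"] by simp
qed (simp_all add: sq_int_def)

lemma sq_int_cong_AE: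
  assumes "sq_int M f" "AE x in M. f x = g x" and g: "g \<in> borel_measurable M"
  shows "sq_int M g"
proof -
  note [measurable] = sq_int_measurable[OF assms(1)] g
  have "integrable M (\<lambda>x. (g x)\<^sup>2)"
  proof (rule integrable_cong_AE[THEN iffD1, OF _ _ _ sq_int_square[OF assms(1)]])
    show "AE x in M. (f x)\<^sup>2 = (g x)\<^sup>2"
      using assms(2) by eventually_elim simp
  qed simp_all
  then show ?thesis
    using g by (simp add: sq_int_def)
qed

lemma (in prob_space) sq_int_const: "sq_int M (\<lambda>x. c)"
  by (simp add: sq_int_def)

lemma (in prob_space) sq_int_integrable: "sq_int M f \<Longrightarrow> integrable M f"
  using sq_int_mult[OF _ sq_int_const[of 1]] by simp

lemma (in prob_space) square_expectation_le:
  assumes "sq_int M f"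
  shows "(expectation f)\<^sup>2 \<le> expectation (\<lambda>x. (f x)\<^sup>2)"
proof -
  have "0 \<le> variance f"
    by simp
  also have "variance f = expectation (\<lambda>x. (f x)\<^sup>2) - (expectation f)\<^sup>2"
    using sq_int_integrable[OF assms] sq_int_square[OF assms] by (rule variance_eq)
  finally show ?thesis
    by simp
qed

text \<open>Stationarity alone lets a kernel act on almost everywhere classes and contract L1 and
  L2. Unlike self-adjointness it survives composition, so the sweep kernel and its powers are
  covered as well.\<close>

locale stationary_kernel = prob_space M for M :: "'a measure" +
  fixes K :: "'a \<Rightarrow> 'a measure"
  assumes K_prob[measurable]: "K \<in> M \<rightarrow>\<^sub>M prob_algebra M"
    and invariant: "\<And>A. A \<in> sets M \<Longrightarrow> (\<integral>\<^sup>+x. emeasure (K x) A \<partial>M) = emeasure M A"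
begin

lemma K_subprob[measurable]: "K \<in> M \<rightarrow>\<^sub>M subprob_algebra M"
  by (rule measurable_prob_algebraD) simp

lemma sets_K[measurable_cong]: "x \<in> space M \<Longrightarrow> sets (K x) = sets M"
  using K_subprob by (rule subprob_measurableD)

lemma space_K: "x \<in> space M \<Longrightarrow> space (K x) = space M"
  using K_subprob by (rule subprob_measurableD)

lemma prob_space_K: "x \<in> space M \<Longrightarrow> prob_space (K x)"
  using measurable_space[OF K_prob] by (auto simp: space_prob_algebra)

lemma measurable_nn_integral_K[measurable]:
  "h \<in> borel_measurable M \<Longrightarrow> (\<lambda>x. \<integral>\<^sup>+y. h y \<partial>K x) \<in> borel_measurable M"
  by (rule measurable_compose[OF K_subprob nn_integral_measurable_subprob_algebra])

lemma measurable_nn_integral_K2[measurable]: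
  "(\<lambda>(x, y). h x y) \<in> borel_measurable (M \<Otimes>\<^sub>M M) \<Longrightarrow> (\<lambda>x. \<integral>\<^sup>+y. h x y \<partial>K x) \<in> borel_measurable M"
  by (rule nn_integral_measurable_subprob_algebra2[OF _ K_subprob])

lemma measurable_kint[measurable]: "h \<in> borel_measurable M \<Longrightarrow> kint K h \<in> borel_measurable M"
  unfolding kint_def by (rule measurable_compose[OF K_subprob integral_measurable_subprob_algebra])

lemma bind_K: "M \<bind> K = M"
proof (rule measure_eqI)
  show sets: "sets (M \<bind> K) = sets M"
    by (rule sets_bind[OF sets_K not_empty])
  show "emeasure (M \<bind> K) A = emeasure M A" if "A \<in> sets (M \<bind> K)" for A
    using that invariant[of A] by (simp add: sets emeasure_bind[OF not_empty K_subprob])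
qed

lemma nn_integral_K:
  assumes "h \<in> borel_measurable M"
  shows "(\<integral>\<^sup>+x. \<integral>\<^sup>+y. h y \<partial>K x \<partial>M) = (\<integral>\<^sup>+x. h x \<partial>M)"
  using nn_integral_bind[OF assms K_subprob] by (simp add: bind_K)

text \<open>By invariance the mean mass that the kernel puts on a null set of \<open>M\<close> is
  zero, so almost every \<open>K x\<close> ignores it. This makes \<open>kint K\<close> well defined
  on classes of functions that agree almost everywhere.\<close>

lemma AE_K:
  assumes "AE x in M. P x"
  shows "AE x in M. AE y in K x. P y"
proof -
  obtain Z where Z: "{x \<in> space M. \<not> P x} \<subseteq> Z" "emeasure M Z = 0" "Z \<in> sets M"
    using AE_E[OF assms] by blast
  then have "AE x in M. emeasure (K x) Z = 0"
    using invariant[of Z] nn_integral_0_iff_AE[of "\<lambda>x. emeasure (K x) Z" M]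
    by (simp add: measurable_compose[OF K_subprob measurable_emeasure_subprob_algebra])
  then show ?thesis
    using AE_space
  proof eventually_elim
    case (elim x)
    show ?case
      by (rule AE_I[where N = Z]) (use Z elim space_K sets_K in auto)
  qed
qed

text \<open>All three parts come from invariance applied to the norm of \<open>f\<close>, whose
  double integral is the L1 norm.\<close>

lemma integrable_K:
  fixes f :: "'a \<Rightarrow> 'c::{banach, second_countable_topology}"
  assumes "integrable M f"
  shows "AE x in M. integrable (K x) f" "integrable M (kint K f)"
    "(\<integral>x. norm (kint K f x) \<partial>M) \<le> (\<integral>x. norm (f x) \<partial>M)"
proof -
  note [measurable] = borel_measurable_integrable[OF assms]
  have fin: "(\<integral>\<^sup>+x. \<integral>\<^sup>+y. norm (f y) \<partial>K x \<partial>M) = ennreal (\<integral>x. norm (f x) \<partial>M)"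
    using assms by (subst nn_integral_K) (auto intro!: nn_integral_eq_integral)
  then have "AE x in M. (\<integral>\<^sup>+y. norm (f y) \<partial>K x) \<noteq> \<infinity>"
    by (intro nn_integral_noteq_infinite) auto
  then show int: "AE x in M. integrable (K x) f"
    using AE_space
    by eventually_elim (simp add: integrable_iff_bounded less_top cong: measurable_cong_sets)
  have "(\<integral>\<^sup>+x. norm (kint K f x) \<partial>M) \<le> (\<integral>\<^sup>+x. \<integral>\<^sup>+y. norm (f y) \<partial>K x \<partial>M)"
    by (rule nn_integral_mono_AE) (use int in eventually_elim, simp add: kint_def integral_norm_bound_ennreal)
  then have le: "(\<integral>\<^sup>+x. norm (kint K f x) \<partial>M) \<le> ennreal (\<integral>x. norm (f x) \<partial>M)"
    by (simp add: fin)
  then show i: "integrable M (kint K f)"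
    by (simp add: integrable_iff_bounded le_less_trans[OF le])
  show "(\<integral>x. norm (kint K f x) \<partial>M) \<le> (\<integral>x. norm (f x) \<partial>M)"
    using le nn_integral_eq_integral[OF integrable_norm[OF i]] by (simp add: integral_nonneg_AE)
qed

lemma kint_cong_AE:
  fixes f g :: "'a \<Rightarrow> 'c::{banach, second_countable_topology}"
  assumes "AE x in M. f x = g x" and [measurable]: "f \<in> borel_measurable M" "g \<in> borel_measurable M"
  shows "AE x in M. kint K f x = kint K g x"
  using AE_K[OF assms(1)] AE_space
  by eventually_elim (auto simp: kint_def intro!: integral_cong_AE cong: measurable_cong_sets)

lemma kint_add:
  fixes f g :: "'a \<Rightarrow> 'c::{banach, second_countable_topology}"
  assumes "integrable M f" "integrable M g"
  shows "AE x in M. kint K (\<lambda>x. f x + g x) x = kint K f x + kint K g x"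
  using integrable_K(1)[OF assms(1)] integrable_K(1)[OF assms(2)]
  by eventually_elim (simp add: kint_def)

lemma kint_diff:
  fixes f g :: "'a \<Rightarrow> 'c::{banach, second_countable_topology}"
  assumes "integrable M f" "integrable M g"
  shows "AE x in M. kint K (\<lambda>x. f x - g x) x = kint K f x - kint K g x"
  using integrable_K(1)[OF assms(1)] integrable_K(1)[OF assms(2)]
  by eventually_elim (simp add: kint_def)

lemma kint_cmult:
  fixes c :: real shows "kint K (\<lambda>x. c * f x) x = c * kint K f x"
  by (simp add: kint_def)

lemma kint_const: "x \<in> space M \<Longrightarrow> kint K (\<lambda>_. c) x = c"
  using prob_space.prob_space[OF prob_space_K] by (simp add: kint_def)

lemma kint_sum:
  fixes f :: "'i \<Rightarrow> 'a \<Rightarrow> 'c::{banach, second_countable_topology}"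
  assumes "finite I" "\<And>i. i \<in> I \<Longrightarrow> integrable M (f i)"
  shows "AE x in M. kint K (\<lambda>x. \<Sum>i\<in>I. f i x) x = (\<Sum>i\<in>I. kint K (f i) x)"
proof -
  have "AE x in M. \<forall>i\<in>I. integrable (K x) (f i)"
    using integrable_K(1)[OF assms(2)] by (simp add: AE_finite_all[OF assms(1)])
  then show ?thesis
    by eventually_elim (simp add: kint_def Bochner_Integration.integral_sum)
qed

lemma integral_kint:
  fixes f :: "'a \<Rightarrow> real"
  assumes "integrable M f"
  shows "(\<integral>x. kint K f x \<partial>M) = (\<integral>x. f x \<partial>M)"
proof -
  note [measurable] = borel_measurable_integrable[OF assms]
  have pos: "(\<integral>x. kint K h x \<partial>M) = (\<integral>x. h x \<partial>M)"
    if h: "integrable M h" "\<And>x. 0 \<le> h x" for h :: "'a \<Rightarrow> real"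
  proof -
    note [measurable] = borel_measurable_integrable[OF h(1)]
    have "ennreal (\<integral>x. kint K h x \<partial>M) = (\<integral>\<^sup>+x. kint K h x \<partial>M)"
      by (rule nn_integral_eq_integral[symmetric, OF integrable_K(2)[OF h(1)]])
        (simp add: kint_def h(2))
    also have "\<dots> = (\<integral>\<^sup>+x. \<integral>\<^sup>+y. h y \<partial>K x \<partial>M)"
      by (rule nn_integral_cong_AE)
        (use integrable_K(1)[OF h(1)] in eventually_elim, simp add: kint_def nn_integral_eq_integral h(2))
    also have "\<dots> = ennreal (\<integral>x. h x \<partial>M)"
      using h by (simp add: nn_integral_K nn_integral_eq_integral)
    finally show ?thesis
      using h(2) by (simp add: kint_def integral_nonneg_AE)
  qed
  define p n where "p = (\<lambda>x. max (f x) 0)" and "n = (\<lambda>x. max (- f x) 0)"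
  have pn: "integrable M p" "integrable M n" "f = (\<lambda>x. p x - n x)"
    unfolding p_def n_def using assms by (auto intro!: integrable_max simp: fun_eq_iff)
  note k = integrable_K(2)[OF pn(1)] integrable_K(2)[OF pn(2)]
  have "AE x in M. kint K f x = kint K p x - kint K n x"
    using kint_diff[OF pn(1,2)] pn(3) by simp
  then have "(\<integral>x. kint K f x \<partial>M) = (\<integral>x. kint K p x - kint K n x \<partial>M)"
    by (rule integral_cong_AE[rotated 2]) (use k in simp_all)
  also have "\<dots> = (\<integral>x. p x \<partial>M) - (\<integral>x. n x \<partial>M)"
    using k pos[OF pn(1)] pos[OF pn(2)] by (simp add: p_def n_def)
  also have "\<dots> = (\<integral>x. p x - n x \<partial>M)"
    by (rule Bochner_Integration.integral_diff[OF pn(1,2), symmetric])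
  also have "\<dots> = (\<integral>x. f x \<partial>M)"
    using pn(3) by simp
  finally show ?thesis .
qed

lemma kint_square_le:
  assumes "sq_int M f"
  shows "AE x in M. (kint K f x)\<^sup>2 \<le> kint K (\<lambda>x. (f x)\<^sup>2) x"
  using integrable_K(1)[OF sq_int_square[OF assms]] AE_space
proof eventually_elim
  case (elim x)
  interpret Kx: prob_space "K x"
    using prob_space_K[OF elim(2)] .
  have "sq_int (K x) f"
    using elim sq_int_measurable[OF assms] sets_K by (simp add: sq_int_def cong: measurable_cong_sets)
  then show ?case
    using Kx.square_expectation_le by (simp add: kint_def)
qed

text \<open>Jensen's inequality under each \<open>K x\<close>, integrated against the invariant
  law.\<close>

lemma sq_int_kint:
  assumes f: "sq_int M f"
  shows "sq_int M (kint K f)" "(\<integral>x. (kint K f x)\<^sup>2 \<partial>M) \<le> (\<integral>x. (f x)\<^sup>2 \<partial>M)"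
proof -
  note [measurable] = sq_int_measurable[OF f]
  note i = integrable_K(2)[OF sq_int_square[OF f]]
  have i2: "integrable M (\<lambda>x. (kint K f x)\<^sup>2)"
    by (rule Bochner_Integration.integrable_bound[OF i])
      (measurable, use kint_square_le[OF f] in eventually_elim, simp)
  then show "sq_int M (kint K f)"
    by (simp add: sq_int_def)
  have "(\<integral>x. (kint K f x)\<^sup>2 \<partial>M) \<le> (\<integral>x. kint K (\<lambda>x. (f x)\<^sup>2) x \<partial>M)"
    by (rule integral_mono_AE[OF i2 i kint_square_le[OF f]])
  then show "(\<integral>x. (kint K f x)\<^sup>2 \<partial>M) \<le> (\<integral>x. (f x)\<^sup>2 \<partial>M)"
    by (simp add: integral_kint[OF sq_int_square[OF f]])
qed

text \<open>The Dirichlet form of the kernel, up to the factor \<open>2\<close>.\<close>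

definition energy :: "('a \<Rightarrow> real) \<Rightarrow> ennreal" where
  "energy f = (\<integral>\<^sup>+x. \<integral>\<^sup>+y. ennreal ((f x - f y)\<^sup>2) \<partial>K x \<partial>M)"

text \<open>Expanding the square leaves three terms; invariance gives the square at \<open>y\<close>
  the same mean as the square at \<open>x\<close>, which produces the first factor 2.\<close>

lemma energy_eq:
  assumes f: "sq_int M f"
  shows "energy f = ennreal (2 * (\<integral>x. (f x)\<^sup>2 \<partial>M) - 2 * (\<integral>x. f x * kint K f x \<partial>M))"
proof -
  note [measurable] = sq_int_measurable[OF f]
  let ?s = "\<lambda>x. (f x)\<^sup>2 - 2 * (f x * kint K f x) + kint K (\<lambda>x. (f x)\<^sup>2) x"
  note ints = sq_int_square[OF f] sq_int_mult[OF f sq_int_kint(1)[OF f]] integrable_K(2)[OF sq_int_square[OF f]]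
  have eq: "AE x in M. (\<integral>\<^sup>+y. ennreal ((f x - f y)\<^sup>2) \<partial>K x) = ennreal (?s x) \<and> 0 \<le> ?s x"
    using integrable_K(1)[OF sq_int_square[OF f]] integrable_K(1)[OF sq_int_integrable[OF f]] AE_space
  proof eventually_elim
    case (elim x)
    interpret Kx: prob_space "K x"
      using prob_space_K[OF elim(3)] .
    have i: "integrable (K x) (\<lambda>y. (f x - f y)\<^sup>2)"
      using elim(1,2) by (simp add: power2_diff)
    have s: "(\<integral>y. (f x - f y)\<^sup>2 \<partial>K x) = ?s x"
      using elim(1,2) by (simp add: power2_diff kint_def Kx.prob_space mult.assoc)
    have "0 \<le> (\<integral>y. (f x - f y)\<^sup>2 \<partial>K x)"
      by simp
    then show ?case
      using nn_integral_eq_integral[OF i] s by simp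
  qed
  have "energy f = (\<integral>\<^sup>+x. ennreal (?s x) \<partial>M)"
    unfolding energy_def using eq by (intro nn_integral_cong_AE) auto
  also have "\<dots> = ennreal (\<integral>x. ?s x \<partial>M)"
    using eq ints by (intro nn_integral_eq_integral) auto
  also have "(\<integral>x. ?s x \<partial>M) = 2 * (\<integral>x. (f x)\<^sup>2 \<partial>M) - 2 * (\<integral>x. f x * kint K f x \<partial>M)"
    using ints integral_kint[OF sq_int_square[OF f]] by simp
  finally show ?thesis .
qed

end

text \<open>A step of \<open>R\<close> is a step of \<open>K\<close> to some y followed by a step of
  \<open>L\<close> to z. The energy bound uses (a - c)^2 \<le> 2 (a - b)^2 + 2 (b - c)^2 along this
  path; by stationarity of \<open>K\<close> the midpoint y has law \<open>M\<close>, so the second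
  term is the energy of \<open>L\<close>.\<close>

lemma
  fixes f :: "'a \<Rightarrow> real"
  assumes "stationary_kernel M K" "stationary_kernel M L"
    and bind: "\<And>x. x \<in> space M \<Longrightarrow> R x = K x \<bind> L"
  shows stationary_kernel_bind: "stationary_kernel M R"
    and energy_bind_le: "f \<in> borel_measurable M \<Longrightarrow>
      stationary_kernel.energy M R f \<le> 2 * stationary_kernel.energy M K f + 2 * stationary_kernel.energy M L f"
    and nn_integral_kernel_bind: "\<And>h x. h \<in> borel_measurable M \<Longrightarrow> x \<in> space M \<Longrightarrow>
      (\<integral>\<^sup>+z. h z \<partial>R x) = (\<integral>\<^sup>+y. \<integral>\<^sup>+z. h z \<partial>L y \<partial>K x)"
proof -
  interpret K: stationary_kernel M K by fact
  interpret L: stationary_kernel M L by fact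
  have nn: "(\<integral>\<^sup>+z. h z \<partial>R x) = (\<integral>\<^sup>+y. \<integral>\<^sup>+z. h z \<partial>L y \<partial>K x)"
    if [measurable]: "h \<in> borel_measurable M" and x: "x \<in> space M" for h x
    unfolding bind[OF x] by (rule nn_integral_bind[where B = M]) (use x K.sets_K in \<open>simp_all cong: measurable_cong_sets\<close>)
  then show "\<And>h x. h \<in> borel_measurable M \<Longrightarrow> x \<in> space M \<Longrightarrow>
      (\<integral>\<^sup>+z. h z \<partial>R x) = (\<integral>\<^sup>+y. \<integral>\<^sup>+z. h z \<partial>L y \<partial>K x)" .
  have R_prob: "R \<in> M \<rightarrow>\<^sub>M prob_algebra M"
    using measurable_bind_prob_space[OF K.K_prob L.K_prob] bind by (simp cong: measurable_cong)
  show R: "stationary_kernel M R"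
  proof
    show "R \<in> M \<rightarrow>\<^sub>M prob_algebra M"
      by (fact R_prob)
    fix A assume A[measurable]: "A \<in> sets M"
    have "(\<integral>\<^sup>+x. emeasure (R x) A \<partial>M) = (\<integral>\<^sup>+x. \<integral>\<^sup>+z. indicator A z \<partial>R x \<partial>M)"
      using subprob_measurableD(2)[OF measurable_prob_algebraD[OF R_prob]]
      by (intro nn_integral_cong) simp
    also have "\<dots> = (\<integral>\<^sup>+x. \<integral>\<^sup>+y. \<integral>\<^sup>+z. indicator A z \<partial>L y \<partial>K x \<partial>M)"
      by (intro nn_integral_cong nn) simp_all
    also have "\<dots> = emeasure M A"
      by (subst K.nn_integral_K, simp, subst L.nn_integral_K) simp_all
    finally show "(\<integral>\<^sup>+x. emeasure (R x) A \<partial>M) = emeasure M A" .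
  qed
  then interpret R: stationary_kernel M R .
  show "R.energy f \<le> 2 * K.energy f + 2 * L.energy f" if [measurable]: "f \<in> borel_measurable M"
  proof -
    have "R.energy f = (\<integral>\<^sup>+x. \<integral>\<^sup>+y. \<integral>\<^sup>+z. ennreal ((f x - f z)\<^sup>2) \<partial>L y \<partial>K x \<partial>M)"
      unfolding R.energy_def by (intro nn_integral_cong nn) simp_all
    also have "\<dots> \<le> (\<integral>\<^sup>+x. \<integral>\<^sup>+y. 2 * ennreal ((f x - f y)\<^sup>2) + 2 * (\<integral>\<^sup>+z. ennreal ((f y - f z)\<^sup>2) \<partial>L y) \<partial>K x \<partial>M)"
    proof (intro nn_integral_mono)
      fix x y assume x: "x \<in> space M" and y: "y \<in> space (K x)"
      have y: "y \<in> space M"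
        using x y K.space_K by simp
      interpret Ly: prob_space "L y"
        using L.prob_space_K[OF y] .
      have le: "(f x - f z)\<^sup>2 \<le> 2 * (f x - f y)\<^sup>2 + 2 * (f y - f z)\<^sup>2" for z
        using zero_le_power2[of "(f x - f y) - (f y - f z)"] by (simp add: power2_eq_square algebra_simps)
      have "(\<integral>\<^sup>+z. ennreal ((f x - f z)\<^sup>2) \<partial>L y)
          \<le> (\<integral>\<^sup>+z. 2 * ennreal ((f x - f y)\<^sup>2) + 2 * ennreal ((f y - f z)\<^sup>2) \<partial>L y)"
      proof (rule nn_integral_mono)
        fix z
        have "ennreal ((f x - f z)\<^sup>2) \<le> ennreal (2 * (f x - f y)\<^sup>2 + 2 * (f y - f z)\<^sup>2)"
          by (rule ennreal_leI[OF le])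
        then show "ennreal ((f x - f z)\<^sup>2) \<le> 2 * ennreal ((f x - f y)\<^sup>2) + 2 * ennreal ((f y - f z)\<^sup>2)"
          by (simp add: ennreal_plus ennreal_mult)
      qed
      also have "\<dots> = 2 * ennreal ((f x - f y)\<^sup>2) + 2 * (\<integral>\<^sup>+z. ennreal ((f y - f z)\<^sup>2) \<partial>L y)"
        using L.sets_K[OF y] Ly.emeasure_space_1
        by (simp add: nn_integral_add nn_integral_cmult cong: measurable_cong_sets)
      finally show "(\<integral>\<^sup>+z. ennreal ((f x - f z)\<^sup>2) \<partial>L y)
          \<le> 2 * ennreal ((f x - f y)\<^sup>2) + 2 * (\<integral>\<^sup>+z. ennreal ((f y - f z)\<^sup>2) \<partial>L y)" .
    qed
    also have "\<dots> = (\<integral>\<^sup>+x. 2 * (\<integral>\<^sup>+y. ennreal ((f x - f y)\<^sup>2) \<partial>K x)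
        + 2 * (\<integral>\<^sup>+y. \<integral>\<^sup>+z. ennreal ((f y - f z)\<^sup>2) \<partial>L y \<partial>K x) \<partial>M)"
    proof (rule nn_integral_cong)
      fix x assume x[measurable]: "x \<in> space M"
      have [measurable]: "(\<lambda>y. \<integral>\<^sup>+z. ennreal ((f y - f z)\<^sup>2) \<partial>L y) \<in> borel_measurable M"
        by simp
      show "(\<integral>\<^sup>+y. 2 * ennreal ((f x - f y)\<^sup>2) + 2 * (\<integral>\<^sup>+z. ennreal ((f y - f z)\<^sup>2) \<partial>L y) \<partial>K x)
        = 2 * (\<integral>\<^sup>+y. ennreal ((f x - f y)\<^sup>2) \<partial>K x)
        + 2 * (\<integral>\<^sup>+y. \<integral>\<^sup>+z. ennreal ((f y - f z)\<^sup>2) \<partial>L y \<partial>K x)"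
        using K.sets_K[OF x] by (simp add: nn_integral_add nn_integral_cmult cong: measurable_cong_sets)
    qed
    also have "\<dots> = 2 * K.energy f + 2 * L.energy f"
      unfolding K.energy_def L.energy_def
      by (simp add: nn_integral_add nn_integral_cmult K.nn_integral_K)
    finally show ?thesis .
  qed
qed

section \<open>The spectral gap\<close>

locale gibbs = regular_cond_distr M F "\<lambda>x. x" M K
  for M :: "'a measure" and F :: "'a measure" and K :: "'a \<Rightarrow> 'a measure"
begin

sublocale stationary_kernel M K
proof
  show "K \<in> M \<rightarrow>\<^sub>M prob_algebra M"
    by (rule K_prob)
  fix A assume A[measurable]: "A \<in> sets M"
  have "(\<integral>\<^sup>+x. emeasure (K x) A \<partial>M) = (\<integral>\<^sup>+x. \<integral>\<^sup>+z. indicator A z \<partial>K x \<partial>M)"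
    using sets_K by (intro nn_integral_cong) simp
  also have "\<dots> = (\<integral>\<^sup>+x. 1 * nn_cond_exp M F (indicator A) x \<partial>M)"
    using nn_cond_exp_eq[of "indicator A"] by (intro nn_integral_cong_AE) (auto simp: eq_commute)
  also have "\<dots> = emeasure M A"
    by (subst nn_cond_exp_intg) auto
  finally show "(\<integral>\<^sup>+x. emeasure (K x) A \<partial>M) = emeasure M A" .
qed

lemma kint_eq:
  assumes "integrable M f"
  shows "AE x in M. kint K f x = real_cond_exp M F f x"
  using integral_K(2)[OF borel_measurable_integrable[OF assms] assms] by (simp add: kint_def eq_commute)

text \<open>A Gibbs kernel is a conditional expectation, so factors measurable for \<open>F\<close>
  move through it. The weight has to agree with such a factor \<open>u'\<close> only almost
  everywhere, since invariance under a kernel gives no more than that.\<close>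

lemma nn_integral_pull:
  assumes [measurable]: "u \<in> borel_measurable M" "h \<in> borel_measurable M"
    and eq: "AE x in M. u x = u' x" and [measurable]: "u' \<in> borel_measurable F"
  shows "(\<integral>\<^sup>+x. u x * (\<integral>\<^sup>+y. h y \<partial>K x) \<partial>M) = (\<integral>\<^sup>+x. u x * h x \<partial>M)"
proof -
  have "(\<integral>\<^sup>+x. u x * (\<integral>\<^sup>+y. h y \<partial>K x) \<partial>M) = (\<integral>\<^sup>+x. u' x * nn_cond_exp M F h x \<partial>M)"
    by (rule nn_integral_cong_AE) (use nn_cond_exp_eq[OF assms(2)] eq in eventually_elim, simp)
  also have "\<dots> = (\<integral>\<^sup>+x. u' x * h x \<partial>M)"
    by (rule nn_cond_exp_intg) auto
  also have "\<dots> = (\<integral>\<^sup>+x. u x * h x \<partial>M)"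
    by (rule nn_integral_cong_AE) (use eq in eventually_elim, simp)
  finally show ?thesis .
qed

lemma nn_integral_selfadjoint:
  assumes [measurable]: "f \<in> borel_measurable M" "h \<in> borel_measurable M"
  shows "(\<integral>\<^sup>+x. (\<integral>\<^sup>+y. f y \<partial>K x) * (\<integral>\<^sup>+y. h y \<partial>K x) \<partial>M) = (\<integral>\<^sup>+x. f x * (\<integral>\<^sup>+y. h y \<partial>K x) \<partial>M)"
proof -
  have "AE x in M. (\<integral>\<^sup>+y. h y \<partial>K x) = nn_cond_exp M F h x"
    using nn_cond_exp_eq[OF assms(2)] by eventually_elim simp
  from nn_integral_pull[OF _ assms(1) this borel_measurable_nn_cond_exp] show ?thesis
    by (simp add: mult.commute)
qed

text \<open>The mark of an orthogonal projection: the residual of \<open>f\<close> is orthogonal to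
  the range.\<close>

lemma integral_kint_mult:
  assumes f: "sq_int M f" and g: "sq_int M g"
  shows "(\<integral>x. kint K g x * kint K f x \<partial>M) = (\<integral>x. kint K g x * f x \<partial>M)"
proof -
  note [measurable] = sq_int_measurable[OF f] sq_int_measurable[OF g]
  have eq: "AE x in M. kint K g x * f x = real_cond_exp M F g x * f x"
    using kint_eq[OF sq_int_integrable[OF g]] by eventually_elim simp
  have "integrable M (\<lambda>x. real_cond_exp M F g x * f x)"
    by (rule integrable_cong_AE[THEN iffD1, OF _ _ eq]) (simp_all add: sq_int_mult sq_int_kint f g)
  note ce = real_cond_exp_intg(2)[OF this borel_measurable_cond_exp]
  have "(\<integral>x. kint K g x * kint K f x \<partial>M) = (\<integral>x. real_cond_exp M F g x * real_cond_exp M F f x \<partial>M)"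
    by (rule integral_cong_AE)
      (simp_all, use kint_eq[OF sq_int_integrable[OF g]] kint_eq[OF sq_int_integrable[OF f]] in eventually_elim, simp)
  also have "\<dots> = (\<integral>x. kint K g x * f x \<partial>M)"
    by (subst ce, simp) (rule integral_cong_AE[OF _ _ AE_symmetric[OF eq]], simp_all)
  finally show ?thesis .
qed

lemma kint_selfadjoint:
  assumes f: "sq_int M f" and g: "sq_int M g"
  shows "(\<integral>x. g x * kint K f x \<partial>M) = (\<integral>x. kint K g x * f x \<partial>M)"
  using integral_kint_mult[OF f g] integral_kint_mult[OF g f] by (simp add: mult.commute)

lemma kint_idem:
  fixes f :: "'a \<Rightarrow> real"
  assumes "integrable M f"
  shows "AE x in M. kint K (kint K f) x = kint K f x"
proof -
  note [measurable] = borel_measurable_integrable[OF assms]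
  have "AE x in M. real_cond_exp M F (kint K f) x = real_cond_exp M F (real_cond_exp M F f) x"
    by (rule real_cond_exp_cong[OF kint_eq[OF assms]]) simp_all
  moreover have "AE x in M. real_cond_exp M F (real_cond_exp M F f) x = real_cond_exp M F f x"
    by (rule real_cond_exp_F_meas) (auto simp: assms)
  ultimately show ?thesis
    using kint_eq[OF assms] kint_eq[OF integrable_K(2)[OF assms]] by eventually_elim simp
qed

end

locale two_gibbs = g1: gibbs M F1 K1 + g2: gibbs M F2 K2
  for M :: "'a measure" and F1 F2 :: "'a measure" and K1 K2 :: "'a \<Rightarrow> 'a measure"
begin

text \<open>Conditional Cauchy--Schwarz with the weight \<open>V = E(W | F2)\<close> turns the drift inequality into
  a bound for the projection of \<open>\<phi>\<close>.\<close>

lemma drift_projection_bound: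
  assumes P: "\<And>x h. x \<in> space M \<Longrightarrow> h \<in> borel_measurable M \<Longrightarrow>
      (\<integral>\<^sup>+y. h y \<partial>P x) = (\<integral>\<^sup>+y. \<integral>\<^sup>+z. h z \<partial>K2 y \<partial>K1 x)"
    and W[measurable]: "W \<in> borel_measurable M" and W1: "\<And>x. 1 \<le> W x" and W_int: "integrable M W"
    and D[measurable]: "D \<in> sets M" and lam: "0 \<le> lam" and b: "0 \<le> b"
    and drift: "\<And>x. x \<in> space M \<Longrightarrow>
      (\<integral>\<^sup>+y. ennreal (W y) \<partial>P x) \<le> ennreal (lam * W x + b * indicator D x)"
    and \<phi>: "sq_int M \<phi>" "AE x in M. kint K2 \<phi> x = \<phi> x"
  shows "(\<integral>x. (kint K1 \<phi> x)\<^sup>2 \<partial>M) \<le> lam * (\<integral>x. (\<phi> x)\<^sup>2 \<partial>M) + b * (\<integral>x. (\<phi> x)\<^sup>2 * indicator D x \<partial>M)"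
proof -
  note [measurable] = sq_int_measurable[OF \<phi>(1)]
  define V where "V x = (\<integral>\<^sup>+y. ennreal (W y) \<partial>K2 x)" for x
  \<comment> \<open>\<open>V\<close> = K2 W may be infinite on a null set; \<open>v\<close> is a
    finite version of it. The cut at 1 changes nothing almost everywhere, because W \<ge> 1, and
    keeps the quotient in \<open>w\<close> harmless.\<close>
  define v where "v x = max 1 (enn2real (V x))" for x
  define w where "w x = ennreal ((\<phi> x)\<^sup>2 / v x)" for x
  have [measurable]: "V \<in> borel_measurable M"
    unfolding V_def by simp
  then have [measurable]: "v \<in> borel_measurable M" "w \<in> borel_measurable M"
    unfolding v_def w_def by simp_all
  have v1: "1 \<le> v x" for x
    by (simp add: v_def)
  have "(\<integral>\<^sup>+x. V x \<partial>M) = (\<integral>\<^sup>+x. ennreal (W x) \<partial>M)"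
    unfolding V_def by (rule g2.nn_integral_K) simp
  then have "(\<integral>\<^sup>+x. V x \<partial>M) \<noteq> \<infinity>"
    using W_int W1 order_trans[OF zero_le_one W1] by (simp add: nn_integral_eq_integral)
  then have "AE x in M. V x \<noteq> \<infinity>"
    by (rule nn_integral_noteq_infinite[rotated]) simp
  moreover have "AE x in M. 1 \<le> V x"
  proof (rule AE_I2)
    fix x assume x: "x \<in> space M"
    have "(\<integral>\<^sup>+y. 1 \<partial>K2 x) \<le> V x"
      unfolding V_def using ennreal_leI[OF W1] by (intro nn_integral_mono) simp
    then show "1 \<le> V x"
      using prob_space.emeasure_space_1[OF g2.prob_space_K[OF x]] by simp
  qed
  ultimately have Vv: "AE x in M. V x = ennreal (v x)"
  proof eventually_elim
    case (elim x)
    then have "1 \<le> enn2real (V x)"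
      by (metis enn2real_1 enn2real_mono less_top infinity_ennreal_def)
    then show ?case
      using elim by (simp add: v_def less_top)
  qed
  have wV: "AE x in M. w x * V x = ennreal ((\<phi> x)\<^sup>2)"
    using Vv
  proof eventually_elim
    case (elim x)
    then show ?case
      using v1[of x] by (simp add: w_def ennreal_mult[symmetric])
  qed
  \<comment> \<open>Cauchy--Schwarz under \<open>K1 x\<close> for the factorisation of |\<phi>| into
    |\<phi>| / sqrt v and sqrt v.\<close>
  have CS: "AE x in M. ennreal ((kint K1 \<phi> x)\<^sup>2) \<le> (\<integral>\<^sup>+y. w y \<partial>K1 x) * (\<integral>\<^sup>+y. ennreal (v y) \<partial>K1 x)"
    using AE_space
  proof eventually_elim
    case (elim x)
    let ?f = "\<lambda>y. ennreal (\<bar>\<phi> y\<bar> / sqrt (v y))" and ?g = "\<lambda>y. ennreal (sqrt (v y))"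
    have "?f \<in> borel_measurable M" "?g \<in> borel_measurable M"
      by simp_all
    then have meas: "?f \<in> borel_measurable (K1 x)" "?g \<in> borel_measurable (K1 x)"
      using measurable_cong_sets[OF g1.sets_K[OF elim] refl] by blast+
    have pos: "0 \<le> v y" "v y \<noteq> 0" for y
      using v1[of y] by auto
    have f2: "(?f y)\<^sup>2 = w y" and g2: "(?g y)\<^sup>2 = ennreal (v y)" and fg: "?f y * ?g y = ennreal (norm (\<phi> y))" for y
      using pos[of y] by (simp_all add: w_def ennreal_power power_divide ennreal_mult[symmetric])
    have "ennreal (norm (kint K1 \<phi> x)) \<le> (\<integral>\<^sup>+y. ennreal (norm (\<phi> y)) \<partial>K1 x)"
      unfolding kint_def
      by (cases "integrable (K1 x) \<phi>")
        (simp_all add: integral_norm_bound_ennreal not_integrable_integral_eq del: real_norm_def)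
    then have "(ennreal (norm (kint K1 \<phi> x)))\<^sup>2 \<le> (\<integral>\<^sup>+y. ennreal (norm (\<phi> y)) \<partial>K1 x)\<^sup>2"
      by (rule power_mono) (rule zero_le)
    also have "\<dots> = (\<integral>\<^sup>+y. ?f y * ?g y \<partial>K1 x)\<^sup>2"
      unfolding fg ..
    also have "(\<integral>\<^sup>+y. ?f y * ?g y \<partial>K1 x)\<^sup>2 \<le> (\<integral>\<^sup>+y. (?f y)\<^sup>2 \<partial>K1 x) * (\<integral>\<^sup>+y. (?g y)\<^sup>2 \<partial>K1 x)"
      by (rule Cauchy_Schwarz_nn_integral[OF meas])
    also have "\<dots> = (\<integral>\<^sup>+y. w y \<partial>K1 x) * (\<integral>\<^sup>+y. ennreal (v y) \<partial>K1 x)"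
      unfolding f2 g2 ..
    finally show ?case
      by (simp add: ennreal_power)
  qed
  \<comment> \<open>K1 v = K1 K2 W = P W, so the drift inequality bounds the second factor.\<close>
  have Kv: "AE x in M. (\<integral>\<^sup>+y. ennreal (v y) \<partial>K1 x) \<le> ennreal (lam * W x + b * indicator D x)"
    using g1.AE_K[OF Vv] AE_space
  proof eventually_elim
    case (elim x)
    have "(\<integral>\<^sup>+y. ennreal (v y) \<partial>K1 x) = (\<integral>\<^sup>+y. V y \<partial>K1 x)"
      using elim(1) by (intro nn_integral_cong_AE) auto
    also have "\<dots> = (\<integral>\<^sup>+y. ennreal (W y) \<partial>P x)"
      using P[OF elim(2), of "\<lambda>y. ennreal (W y)"] by (simp add: V_def)
    also have "\<dots> \<le> ennreal (lam * W x + b * indicator D x)"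
      by (rule drift[OF elim(2)])
    finally show ?case .
  qed
  \<comment> \<open>To move \<open>w\<close> through K2 a version measurable for \<open>F2\<close>
    is required: \<phi> has one because K2 fixes it, and \<open>v\<close> has one because it comes
    from the conditional expectation of \<open>W\<close>.\<close>
  define \<phi>' where "\<phi>' = real_cond_exp M F2 \<phi>"
  have \<phi>': "AE x in M. \<phi> x = \<phi>' x"
    using \<phi>(2) g2.kint_eq[OF g1.sq_int_integrable[OF \<phi>(1)]] unfolding \<phi>'_def by eventually_elim simp
  define w' where "w' x = ennreal ((\<phi>' x)\<^sup>2 / max 1 (enn2real (nn_cond_exp M F2 (\<lambda>x. ennreal (W x)) x)))" for x
  have [measurable]: "w' \<in> borel_measurable F2"
    unfolding w'_def \<phi>'_def by simp
  have ww': "AE x in M. w x = w' x"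
    using \<phi>' g2.nn_cond_exp_eq[of "\<lambda>x. ennreal (W x)", simplified]
    by eventually_elim (simp add: w_def w'_def v_def V_def)
  \<comment> \<open>The weight is tuned so that the growth of \<open>W\<close> disappears: E(w W) =
    E(w K2 W) = E(w V) = E(\<phi>^2).\<close>
  have wW: "(\<integral>\<^sup>+x. w x * ennreal (W x) \<partial>M) = (\<integral>\<^sup>+x. ennreal ((\<phi> x)\<^sup>2) \<partial>M)"
  proof -
    have "(\<integral>\<^sup>+x. w x * ennreal (W x) \<partial>M) = (\<integral>\<^sup>+x. w x * V x \<partial>M)"
      unfolding V_def by (rule g2.nn_integral_pull[symmetric, OF _ _ ww']) simp_all
    also have "\<dots> = (\<integral>\<^sup>+x. ennreal ((\<phi> x)\<^sup>2) \<partial>M)"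
      by (rule nn_integral_cong_AE[OF wV])
    finally show ?thesis .
  qed
  have "(\<integral>\<^sup>+x. ennreal ((kint K1 \<phi> x)\<^sup>2) \<partial>M) \<le> (\<integral>\<^sup>+x. (\<integral>\<^sup>+y. w y \<partial>K1 x) * (\<integral>\<^sup>+y. ennreal (v y) \<partial>K1 x) \<partial>M)"
    by (rule nn_integral_mono_AE[OF CS])
  \<comment> \<open>Self-adjointness takes the projection off \<open>w\<close>, so the pointwise
    bound on K1 v can be multiplied by \<open>w\<close> itself.\<close>
  also have "\<dots> = (\<integral>\<^sup>+x. w x * (\<integral>\<^sup>+y. ennreal (v y) \<partial>K1 x) \<partial>M)"
    by (rule g1.nn_integral_selfadjoint) simp_all
  also have "\<dots> \<le> (\<integral>\<^sup>+x. ennreal lam * (w x * ennreal (W x)) + ennreal b * (ennreal ((\<phi> x)\<^sup>2 * indicator D x)) \<partial>M)"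
  proof (rule nn_integral_mono_AE, use Kv in eventually_elim)
    fix x assume le: "(\<integral>\<^sup>+y. ennreal (v y) \<partial>K1 x) \<le> ennreal (lam * W x + b * indicator D x)"
    have W0: "0 \<le> W x"
      using W1[of x] by simp
    have wle: "w x \<le> ennreal ((\<phi> x)\<^sup>2)"
      unfolding w_def using v1[of x] by (intro ennreal_leI) (simp add: divide_le_eq mult_le_cancel_left1)
    have "w x * (\<integral>\<^sup>+y. ennreal (v y) \<partial>K1 x) \<le> w x * ennreal (lam * W x + b * indicator D x)"
      by (rule mult_left_mono[OF le]) simp
    also have "\<dots> = ennreal lam * (w x * ennreal (W x)) + ennreal b * (w x * indicator D x)"
      using lam b W0
      by (simp add: ennreal_plus ennreal_mult distrib_left ennreal_indicator ac_simps)
    also have "\<dots> \<le> ennreal lam * (w x * ennreal (W x)) + ennreal b * (ennreal ((\<phi> x)\<^sup>2) * indicator D x)"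
      by (intro add_mono mult_left_mono mult_right_mono wle order_refl) simp_all
    finally show "w x * (\<integral>\<^sup>+y. ennreal (v y) \<partial>K1 x)
        \<le> ennreal lam * (w x * ennreal (W x)) + ennreal b * (ennreal ((\<phi> x)\<^sup>2 * indicator D x))"
      by (simp add: ennreal_mult ennreal_indicator)
  qed
  also have "\<dots> = ennreal lam * (\<integral>\<^sup>+x. ennreal ((\<phi> x)\<^sup>2) \<partial>M) + ennreal b * (\<integral>\<^sup>+x. ennreal ((\<phi> x)\<^sup>2 * indicator D x) \<partial>M)"
    by (simp add: nn_integral_add nn_integral_cmult wW)
  also have "\<dots> = ennreal (lam * (\<integral>x. (\<phi> x)\<^sup>2 \<partial>M) + b * (\<integral>x. (\<phi> x)\<^sup>2 * indicator D x \<partial>M))"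
    using lam b
    by (subst nn_integral_eq_integral[OF sq_int_square[OF \<phi>(1)]], simp,
        subst nn_integral_eq_integral[OF integrable_real_mult_indicator[OF D sq_int_square[OF \<phi>(1)]]], simp)
      (simp add: ennreal_mult ennreal_plus integral_nonneg_AE)
  finally have "ennreal (\<integral>x. (kint K1 \<phi> x)\<^sup>2 \<partial>M)
      \<le> ennreal (lam * (\<integral>x. (\<phi> x)\<^sup>2 \<partial>M) + b * (\<integral>x. (\<phi> x)\<^sup>2 * indicator D x \<partial>M))"
    by (subst (asm) nn_integral_eq_integral[OF sq_int_square[OF g1.sq_int_kint(1)[OF \<phi>(1)]]]) simp_all
  then show ?thesis
    using lam b by (subst (asm) ennreal_le_iff) (simp_all add: integral_nonneg_AE)
qed

end

text \<open>By minorisation the energy dominates the integral of (f x - f z)^2 over x in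
  \<open>D\<close> under \<open>M\<close> and z under \<nu>. Some z does no worse than the average,
  and c = f z. The strict bound by \<open>e\<close> leaves room for this choice.\<close>

lemma (in stationary_kernel) small_set_energy:
  fixes f :: "'a \<Rightarrow> real"
  assumes f[measurable]: "f \<in> borel_measurable M" and D[measurable]: "D \<in> sets M"
    and \<nu>: "sets \<nu> = sets M" "emeasure \<nu> (space \<nu>) \<noteq> 0"
    and small: "\<And>x B. x \<in> D \<Longrightarrow> B \<in> sets M \<Longrightarrow> emeasure \<nu> B \<le> emeasure (K x) B"
    and e: "energy f < ennreal e"
  shows "\<exists>c. (\<integral>\<^sup>+x. ennreal ((f x - c)\<^sup>2 * indicator D x) \<partial>M) * emeasure \<nu> (space \<nu>) \<le> ennreal e"
proof (cases "D = {}")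
  case True
  then show ?thesis
    by simp
next
  case False
  note [measurable_cong] = \<nu>(1)
  have D_space: "D \<subseteq> space M"
    using sets.sets_into_space[OF D] .
  \<comment> \<open>A point of \<open>D\<close> puts \<nu> below a probability measure, which makes
    \<nu> finite and Fubini applicable.\<close>
  have "emeasure \<nu> (space \<nu>) \<le> 1"
    using False small D_space prob_space.emeasure_le_1[OF prob_space_K] \<nu>(1)
    by (metis all_not_in_conv order_trans sets.top subsetD)
  then interpret \<nu>: finite_measure \<nu>
    by (intro finite_measureI) (auto simp: top_unique)
  interpret pair_sigma_finite M \<nu> ..
  define J where "J z = (\<integral>\<^sup>+x. ennreal ((f x - f z)\<^sup>2 * indicator D x) \<partial>M)" for z
  have "(\<integral>\<^sup>+z. J z \<partial>\<nu>) = (\<integral>\<^sup>+x. (\<integral>\<^sup>+z. ennreal ((f x - f z)\<^sup>2 * indicator D x) \<partial>\<nu>) \<partial>M)"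
    unfolding J_def by (rule Fubini') simp
  also have "\<dots> \<le> energy f"
    unfolding energy_def
  proof (intro nn_integral_mono)
    fix x assume x: "x \<in> space M"
    show "(\<integral>\<^sup>+z. ennreal ((f x - f z)\<^sup>2 * indicator D x) \<partial>\<nu>) \<le> (\<integral>\<^sup>+z. ennreal ((f x - f z)\<^sup>2) \<partial>K x)"
    proof (cases "x \<in> D")
      case True
      then have "\<nu> \<le> K x"
        using small[OF True] \<nu>(1) sets_K[OF x] by (simp add: le_measure)
      then show ?thesis
        using True \<nu>(1) sets_K[OF x] by (simp add: nn_integral_mono_measure)
    qed simp
  qed
  also have "\<dots> < ennreal e"
    by (rule e)
  finally have lt: "(\<integral>\<^sup>+z. J z \<partial>\<nu>) < ennreal e" .
  show ?thesis
  proof (rule ccontr)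
    assume "\<not> ?thesis"
    then have J: "ennreal e < J z * emeasure \<nu> (space \<nu>)" for z
      unfolding J_def by (metis not_le)
    have [measurable]: "J \<in> borel_measurable \<nu>"
      unfolding J_def by measurable
    have "ennreal e * emeasure \<nu> (space \<nu>) = (\<integral>\<^sup>+z. ennreal e \<partial>\<nu>)"
      by simp
    also have "\<dots> \<le> (\<integral>\<^sup>+z. J z * emeasure \<nu> (space \<nu>) \<partial>\<nu>)"
      using J by (intro nn_integral_mono) (simp add: less_imp_le)
    also have "\<dots> = (\<integral>\<^sup>+z. J z \<partial>\<nu>) * emeasure \<nu> (space \<nu>)"
      by (rule nn_integral_multc) simp
    also have "\<dots> < ennreal e * emeasure \<nu> (space \<nu>)"
      using lt \<nu>(2) by (intro ennreal_mult_strict_right_mono) (auto simp: less_top[symmetric] zero_less_iff_neq_zero)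
    finally show False
      by simp
  qed
qed

lemma stationary_kernel_pow:
  assumes M: "sets M = sets borel" and P: "stationary_kernel M P"
  shows "stationary_kernel M (kernel_pow P m)"
proof (induction m)
  case 0
  interpret stationary_kernel M P by fact
  show ?case
  proof
    show "kernel_pow P 0 \<in> M \<rightarrow>\<^sub>M prob_algebra M"
      using measurable_return_prob_space[of M] ext[of "return M" "return borel", OF return_cong[OF M]]
      by simp
    fix A assume "A \<in> sets M"
    then show "(\<integral>\<^sup>+x. emeasure (kernel_pow P 0 x) A \<partial>M) = emeasure M A"
      using M by simp
  qed
next
  case (Suc m)
  show ?case
    by (rule stationary_kernel_bind[OF P Suc]) simp
qed

text \<open>The midpoint inequality costs c_(m+1) = 2 + 2 c_m per additional step, and c_m = 4^m
  dominates this recursion.\<close>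

lemma energy_kernel_pow_le:
  assumes M: "sets M = sets borel" and P: "stationary_kernel M P" and f: "f \<in> borel_measurable M"
  shows "stationary_kernel.energy M (kernel_pow P m) f \<le> 2 ^ (2 * m) * stationary_kernel.energy M P f"
proof (induction m)
  case 0
  interpret R: stationary_kernel M "kernel_pow P 0"
    by (rule stationary_kernel_pow[OF M P])
  have "R.energy f = 0"
    unfolding R.energy_def using f M
    by (simp add: nn_integral_return cong: measurable_cong_sets)
  then show ?case
    by simp
next
  case (Suc m)
  have "stationary_kernel.energy M (kernel_pow P (Suc m)) f
      \<le> 2 * stationary_kernel.energy M P f + 2 * stationary_kernel.energy M (kernel_pow P m) f"
    by (rule energy_bind_le[OF P stationary_kernel_pow[OF M P] _ f]) simp
  also have "\<dots> \<le> 2 * stationary_kernel.energy M P f + 2 * (2 ^ (2 * m) * stationary_kernel.energy M P f)"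
    using Suc by (intro add_left_mono mult_left_mono) simp_all
  also have "\<dots> = (2 + 2 * 2 ^ (2 * m)) * stationary_kernel.energy M P f"
    by (simp add: distrib_right mult.assoc)
  also have "\<dots> \<le> 2 ^ (2 * Suc m) * stationary_kernel.energy M P f"
  proof (rule mult_right_mono)
    have "(2::nat) + 2 * 2 ^ (2 * m) \<le> 2 ^ (2 * Suc m)"
      by (simp add: add.commute)
    then have "of_nat (2 + 2 * 2 ^ (2 * m)) \<le> (of_nat (2 ^ (2 * Suc m)) :: ennreal)"
      by (rule of_nat_mono)
    then show "(2::ennreal) + 2 * 2 ^ (2 * m) \<le> 2 ^ (2 * Suc m)"
      by (simp only: of_nat_add of_nat_mult of_nat_power of_nat_numeral)
  qed simp
  finally show ?case .
qed

text \<open>The drift controls a function outside the small set, and the energy of the iterated kernel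
  controls it on the small set.\<close>

theorem spectral_gap:
  fixes M :: "'a::polish_space measure"
  assumes gibbs: "two_gibbs M F1 F2 K1 K2" and M: "sets M = sets borel"
    and P: "\<And>x. x \<in> space M \<Longrightarrow> P x = K1 x \<bind> K2"
    and W[measurable]: "W \<in> borel_measurable M" and W1: "\<And>x. 1 \<le> W x" and W_int: "integrable M W"
    and small: "small_set P D" and lam: "lam < 1"
    and drift: "\<And>x. (\<integral>\<^sup>+y. ennreal (W y) \<partial>P x) \<le> ennreal (lam * W x + b * indicator D x)"
  obtains r where "0 \<le> r" "r < 1"
    "\<And>f. sq_int M f \<Longrightarrow> (\<integral>x. f x \<partial>M) = 0 \<Longrightarrow> AE x in M. kint K2 f x = f x \<Longrightarrow>
      (\<integral>x. (kint K1 f x)\<^sup>2 \<partial>M) \<le> r * (\<integral>x. (f x)\<^sup>2 \<partial>M)"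
proof -
  interpret two_gibbs M F1 F2 K1 K2 by fact
  have P_stat: "stationary_kernel M P"
    by (rule stationary_kernel_bind[OF g1.stationary_kernel_axioms g2.stationary_kernel_axioms P])
  have Pnn: "(\<integral>\<^sup>+y. h y \<partial>P x) = (\<integral>\<^sup>+y. \<integral>\<^sup>+z. h z \<partial>K2 y \<partial>K1 x)"
    if "x \<in> space M" "h \<in> borel_measurable M" for x h
    by (rule nn_integral_kernel_bind[OF g1.stationary_kernel_axioms g2.stationary_kernel_axioms P that(2,1)])
  \<comment> \<open>Clipping at 0 keeps the drift inequality valid, because \<open>W\<close> is
    positive, and makes both coefficients nonnegative.\<close>
  define l b' where "l = max lam 0" and "b' = max b 0"
  have l: "0 \<le> l" "l < 1" "0 \<le> b'"
    using lam by (auto simp: l_def b'_def)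
  have drift': "(\<integral>\<^sup>+y. ennreal (W y) \<partial>P x) \<le> ennreal (l * W x + b' * indicator D x)" for x
  proof -
    have "lam * W x \<le> l * W x" "b * indicator D x \<le> b' * indicator D x"
      using W1[of x] by (auto simp: l_def b'_def intro!: mult_right_mono)
    then show ?thesis
      using order_trans[OF drift ennreal_leI] by (meson add_mono)
  qed
  have D: "D \<in> sets M"
    using small M by (simp add: small_set_def)
  obtain m \<nu> where \<nu>: "sets \<nu> = sets M" "emeasure \<nu> (space \<nu>) \<noteq> 0"
    and min': "\<forall>x\<in>D. \<forall>B\<in>sets M. emeasure (kernel_pow P m x) B \<ge> emeasure \<nu> B"
    using small unfolding small_set_def M by blast
  have min: "x \<in> D \<Longrightarrow> B \<in> sets M \<Longrightarrow> emeasure \<nu> B \<le> emeasure (kernel_pow P m x) B" for x B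
    using min' by blast
  interpret R: stationary_kernel M "kernel_pow P m"
    by (rule stationary_kernel_pow[OF M P_stat])
  \<comment> \<open>If \<open>D\<close> is empty nothing bounds the mass of \<nu>, which could be
    infinite; the value 1 is then a placeholder.\<close>
  define \<beta> where "\<beta> = (if D = {} then 1 else measure \<nu> (space \<nu>))"
  have \<nu>_fin: "emeasure \<nu> (space \<nu>) = ennreal \<beta>" if ne: "D \<noteq> {}"
  proof -
    obtain x where x: "x \<in> D"
      using ne by auto
    then have "x \<in> space M"
      using sets.sets_into_space[OF D] by auto
    then have "emeasure \<nu> (space \<nu>) \<le> 1"
      using min[OF x sets.top] prob_space.emeasure_le_1[OF R.prob_space_K] sets_eq_imp_space_eq[OF \<nu>(1)]
        order_trans by metis
    then have "emeasure \<nu> (space \<nu>) \<noteq> \<top>"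
      by (auto simp: top_unique)
    then show ?thesis
      using ne unfolding \<beta>_def by (simp add: emeasure_eq_ennreal_measure)
  qed
  have \<beta>: "0 < \<beta>"
    using \<nu>_fin \<nu>(2) by (cases "D = {}") (auto simp: \<beta>_def zero_less_measure_iff)
  \<comment> \<open>The price of the energy estimate on \<open>D\<close>: 4^m for the power of
    \<open>P\<close>, 2 for its composition from K1 and K2, 2 from the energy of K1, all scaled by
    b' / \<beta>.\<close>
  define R where "R = b' / \<beta> * (4 * 2 ^ (2 * m))"
  have R0: "0 \<le> R"
    using l \<beta> by (simp add: R_def)
  show ?thesis
  proof (rule that[of "(l + R) / (1 + R)"])
    show "0 \<le> (l + R) / (1 + R)" "(l + R) / (1 + R) < 1"
      using l R0 by simp_all
    fix f assume f: "sq_int M f" and mean: "(\<integral>x. f x \<partial>M) = 0" and inv: "AE x in M. kint K2 f x = f x"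
    note [measurable] = sq_int_measurable[OF f]
    define X Y where "X = (\<integral>x. (f x)\<^sup>2 \<partial>M)" and "Y = (\<integral>x. (kint K1 f x)\<^sup>2 \<partial>M)"
    have XY: "Y \<le> X"
      unfolding X_def Y_def by (rule g1.sq_int_kint(2)[OF f])
    \<comment> \<open>For a projection the quadratic form is the squared norm, so the energy of K1
      is 2 (X - Y), while the energy of K2 vanishes on functions that K2 fixes.\<close>
    have "(\<integral>x. f x * kint K1 f x \<partial>M) = Y"
      using g1.kint_selfadjoint[OF f f] g1.integral_kint_mult[OF f f]
      by (simp add: Y_def power2_eq_square)
    then have e1: "g1.energy f = ennreal (2 * (X - Y))"
      using g1.energy_eq[OF f] by (simp add: X_def algebra_simps)
    have "(\<integral>x. f x * kint K2 f x \<partial>M) = X"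
      unfolding X_def by (rule integral_cong_AE) (simp_all, use inv in eventually_elim, simp add: power2_eq_square)
    then have e2: "g2.energy f = 0"
      using g2.energy_eq[OF f] by (simp add: X_def)
    have "R.energy f \<le> 2 ^ (2 * m) * stationary_kernel.energy M P f"
      by (rule energy_kernel_pow_le[OF M P_stat]) simp
    also have "\<dots> \<le> 2 ^ (2 * m) * (2 * g1.energy f + 2 * g2.energy f)"
      by (intro mult_left_mono energy_bind_le[OF g1.stationary_kernel_axioms g2.stationary_kernel_axioms P]) simp_all
    also have "\<dots> = ennreal (2 ^ (2 * m) * (4 * (X - Y)))"
    proof -
      have "ennreal (2 ^ (2 * m) * (4 * (X - Y))) = ennreal (2 ^ (2 * m)) * (ennreal 2 * ennreal (2 * (X - Y)))"
        using XY by (subst ennreal_mult[symmetric], simp_all)+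
      then show ?thesis
        unfolding e1 e2 by (simp add: ennreal_power[symmetric])
    qed
    finally have eR: "R.energy f \<le> ennreal (2 ^ (2 * m) * (4 * (X - Y)))" .
    \<comment> \<open>The slack \<open>e\<close> pays for the strict inequality that
      \<open>small_set_energy\<close> asks for.\<close>
    have "Y * (1 + R) \<le> (l + R) * X + e" if e: "0 < e" for e
    proof -
      define e' where "e' = (if b' = 0 then 1 else e * \<beta> / b')"
      have e': "0 < e'" "b' / \<beta> * e' \<le> e"
        using e \<beta> l by (auto simp: e'_def)
      define T where "T = 2 ^ (2 * m) * (4 * (X - Y)) + e'"
      have T: "0 < T"
        using e' XY by (simp add: T_def add_nonneg_pos)
      have "R.energy f < ennreal T"
        by (rule le_less_trans[OF eR], rule ennreal_lessI) (use T e'(1) in \<open>simp_all add: T_def\<close>)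
      from R.small_set_energy[OF sq_int_measurable[OF f] D \<nu> min this]
      obtain c where c: "(\<integral>\<^sup>+x. ennreal ((f x - c)\<^sup>2 * indicator D x) \<partial>M) * emeasure \<nu> (space \<nu>) \<le> ennreal T"
        by (rule exE)
      \<comment> \<open>The drift bound wants smallness on \<open>D\<close>, which the energy gives
        only up to a constant. So it is applied to f - c, which K2 still fixes.\<close>
      define \<phi> where "\<phi> = (\<lambda>x. f x - c)"
      have \<phi>: "sq_int M \<phi>"
        unfolding \<phi>_def by (intro sq_int_diff f g1.sq_int_const)
      note [measurable] = sq_int_measurable[OF \<phi>]
      have iD: "integrable M (\<lambda>x. (\<phi> x)\<^sup>2 * indicator D x)"
        using sq_int_square[OF \<phi>] D by (rule integrable_real_mult_indicator[rotated])
      have bD: "(\<integral>x. (\<phi> x)\<^sup>2 * indicator D x \<partial>M) \<le> T / \<beta>"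
      proof (cases "D = {}")
        case True
        then show ?thesis
          using T \<beta> by simp
      next
        case False
        have "ennreal ((\<integral>x. (\<phi> x)\<^sup>2 * indicator D x \<partial>M) * \<beta>) \<le> ennreal T"
          using c \<nu>_fin[OF False] \<beta> nn_integral_eq_integral[OF iD]
          by (simp add: \<phi>_def ennreal_mult integral_nonneg_AE)
        then show ?thesis
          using T \<beta> by (simp add: ennreal_le_iff pos_le_divide_eq)
      qed
      have K1\<phi>: "AE x in M. kint K1 \<phi> x = kint K1 f x - c"
        using g1.kint_diff[OF g1.sq_int_integrable[OF f] g1.sq_int_integrable[OF g1.sq_int_const[of c]]] AE_space
        by eventually_elim (simp add: \<phi>_def g1.kint_const)
      have K2\<phi>: "AE x in M. kint K2 \<phi> x = \<phi> x"
        using g2.kint_diff[OF g1.sq_int_integrable[OF f] g1.sq_int_integrable[OF g1.sq_int_const[of c]]] AE_space inv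
        by eventually_elim (simp add: \<phi>_def g2.kint_const)
      have sq: "(\<integral>x. (h x - c)\<^sup>2 \<partial>M) = (\<integral>x. (h x)\<^sup>2 \<partial>M) + c\<^sup>2"
        if "sq_int M h" "(\<integral>x. h x \<partial>M) = 0" for h
        using that sq_int_square[OF that(1)] g1.sq_int_integrable[OF that(1)]
        by (simp add: power2_diff g1.prob_space)
      have "(\<integral>x. (kint K1 \<phi> x)\<^sup>2 \<partial>M) = (\<integral>x. (kint K1 f x - c)\<^sup>2 \<partial>M)"
        by (rule integral_cong_AE) (simp_all, use K1\<phi> in eventually_elim, simp)
      also have "\<dots> = Y + c\<^sup>2"
        using sq[OF g1.sq_int_kint(1)[OF f]] g1.integral_kint[OF g1.sq_int_integrable[OF f]] mean
        by (simp add: Y_def)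
      finally have "Y + c\<^sup>2 = (\<integral>x. (kint K1 \<phi> x)\<^sup>2 \<partial>M)" ..
      also have "\<dots> \<le> l * (\<integral>x. (\<phi> x)\<^sup>2 \<partial>M) + b' * (\<integral>x. (\<phi> x)\<^sup>2 * indicator D x \<partial>M)"
        by (rule drift_projection_bound[OF Pnn W W1 W_int D l(1,3) drift' \<phi> K2\<phi>])
      also have "\<dots> \<le> l * (X + c\<^sup>2) + b' * (T / \<beta>)"
        using sq[OF f mean] bD l by (intro add_mono mult_left_mono) (simp_all add: \<phi>_def X_def)
      also have "b' * (T / \<beta>) = R * (X - Y) + b' / \<beta> * e'"
        by (simp add: R_def T_def add_divide_distrib diff_divide_distrib algebra_simps)
      \<comment> \<open>As \<open>f\<close> has mean zero, both sides carry c^2, on the right with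
        the coefficient l < 1. So it cancels, and the unknown constant drops out.\<close>
      also have "l * (X + c\<^sup>2) \<le> l * X + c\<^sup>2"
        using l by (simp add: distrib_left mult_left_le_one_le)
      finally show ?thesis
        using e'(2) by (simp add: algebra_simps)
    qed
    then have "Y * (1 + R) \<le> (l + R) * X"
      by (rule field_le_epsilon)
    then show "(\<integral>x. (kint K1 f x)\<^sup>2 \<partial>M) \<le> (l + R) / (1 + R) * (\<integral>x. (f x)\<^sup>2 \<partial>M)"
      using R0 by (simp add: X_def[symmetric] Y_def[symmetric] field_simps)
  qed
qed

section \<open>Convergence in total variation\<close>

text \<open>A quantitative Lebesgue decomposition: off the null set \<open>Z\<close> and a further
  set of small \<rho>-mass, \<rho> has a density bounded by \<open>C\<close>. With \<open>T\<close>
  above both measures and k = dM/dT, the density of \<rho> with respect to \<open>M\<close> is at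
  most 1/k where k > 0. So \<open>Z\<close> is where k = 0, and the small set is where k is positive
  but tiny.\<close>

lemma bounded_density_decomposition:
  fixes M \<rho> :: "'a measure"
  assumes "finite_measure M" "finite_measure \<rho>" and sets: "sets \<rho> = sets M"
  obtains Z where "Z \<in> sets M" "emeasure M Z = 0"
    "\<And>e. 0 < e \<Longrightarrow> \<exists>B\<in>sets M. \<exists>C\<ge>0. emeasure \<rho> B \<le> ennreal e \<and>
      (\<forall>w\<in>borel_measurable M. (\<integral>\<^sup>+x. w x * indicator (space M - (Z \<union> B)) x \<partial>\<rho>) \<le> ennreal C * (\<integral>\<^sup>+x. w x \<partial>M))"
proof -
  interpret M: finite_measure M by fact
  interpret \<rho>: finite_measure \<rho> by fact
  define T where "T = sup_measure' \<rho> M"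
  have sT[measurable_cong]: "sets T = sets M"
    unfolding T_def using sets_sup_measure'[OF sets[symmetric]] sets by simp
  have spT: "space T = space M" "space \<rho> = space M"
    using sets_eq_imp_space_eq[OF sT] sets_eq_imp_space_eq[OF sets] by auto
  have le\<rho>: "emeasure \<rho> X \<le> emeasure T X" and leM: "emeasure M X \<le> emeasure T X" if "X \<in> sets M" for X
    unfolding T_def using that sets
    by (auto intro: le_emeasure_sup_measure'1 le_emeasure_sup_measure'2)
  have "emeasure T X \<le> emeasure \<rho> X + emeasure M X" if "X \<in> sets M" for X
    unfolding T_def using that sets
    by (subst emeasure_sup_measure') (auto intro!: SUP_least add_mono emeasure_mono)
  then have "emeasure T (space T) \<le> emeasure \<rho> (space M) + emeasure M (space M)"
    by (simp add: spT)
  also have "\<dots> < \<top>"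
    by (simp add: less_top[symmetric])
  finally interpret T: finite_measure T
    by (intro finite_measureI) simp
  have "absolutely_continuous T M"
    unfolding absolutely_continuous_def null_sets_def using leM sT by (force simp: le_zero_eq[symmetric] simp del: le_zero_eq)
  then obtain k where k[measurable]: "k \<in> borel_measurable T" and kM: "density T k = M"
    using T.Radon_Nikodym[of M] sT by auto
  have [measurable]: "k \<in> borel_measurable M"
    using k sT by (simp cong: measurable_cong_sets)
  define Z where "Z = {x \<in> space M. k x = 0}"
  have Z: "Z \<in> sets M"
    unfolding Z_def by simp
  have MZ: "emeasure M Z = 0"
  proof -
    have "emeasure M Z = (\<integral>\<^sup>+x. k x * indicator Z x \<partial>T)"
      using Z sT by (subst kM[symmetric]) (rule emeasure_density, simp_all)
    also have "\<dots> = (\<integral>\<^sup>+x. 0 \<partial>T)"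
      by (rule nn_integral_cong) (auto simp: Z_def indicator_def)
    finally show ?thesis
      by simp
  qed
  show ?thesis
  proof (rule that[OF Z MZ])
    fix e :: real assume e: "0 < e"
    define B where "B n = {x \<in> space M. 0 < k x \<and> k x < ennreal (1 / Suc n)}" for n
    have B: "B n \<in> sets M" for n
      unfolding B_def by simp
    have "(\<lambda>n. measure \<rho> (B n)) \<longlonglongrightarrow> measure \<rho> (\<Inter>n. B n)"
    proof (rule \<rho>.finite_Lim_measure_decseq)
      show "range B \<subseteq> sets \<rho>"
        unfolding sets using B by blast
      show "decseq B"
      proof (rule decseq_SucI, rule subsetI)
        fix n x assume x: "x \<in> B (Suc n)"
        have "ennreal (1 / Suc (Suc n)) \<le> ennreal (1 / Suc n)"
          by (intro ennreal_leI frac_le) simp_all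
        with x show "x \<in> B n"
          unfolding B_def by (blast intro: order.strict_trans2)
      qed
    qed
    also have "(\<Inter>n. B n) = {}"
    proof (rule ccontr)
      assume "(\<Inter>n. B n) \<noteq> {}"
      then obtain x where x: "0 < k x" "k x < ennreal (1 / Suc n)" for n
        by (auto simp: B_def)
      then obtain a where a: "k x = ennreal a" "0 \<le> a"
        by (metis ennreal_cases order_less_imp_not_less less_top top.not_eq_extremum not_less_iff_gr_or_eq)
      then have "0 < a" "\<And>n. a < 1 / Suc n"
        using x by (auto simp: ennreal_less_iff)
      then show False
        using reals_Archimedean[of a] by (metis inverse_eq_divide not_less_iff_gr_or_eq)
    qed
    finally have "eventually (\<lambda>n. measure \<rho> (B n) < e) sequentially"
      using e by (auto intro: order_tendstoD(2))
    then obtain n where n: "measure \<rho> (B n) < e"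
      by (auto simp: eventually_sequentially)
    show "\<exists>B\<in>sets M. \<exists>C\<ge>0. emeasure \<rho> B \<le> ennreal e \<and>
      (\<forall>w\<in>borel_measurable M. (\<integral>\<^sup>+x. w x * indicator (space M - (Z \<union> B)) x \<partial>\<rho>) \<le> ennreal C * (\<integral>\<^sup>+x. w x \<partial>M))"
    proof (intro bexI[of _ "B n"] exI[of _ "real (Suc n)"] conjI ballI B)
      show "emeasure \<rho> (B n) \<le> ennreal e"
        using n by (simp add: \<rho>.emeasure_eq_measure ennreal_leI)
      fix w :: "'a \<Rightarrow> ennreal" assume w: "w \<in> borel_measurable M"
      have [measurable]: "w \<in> borel_measurable T"
        using w sT by (simp cong: measurable_cong_sets)
      let ?I = "indicator (space M - (Z \<union> B n)) :: 'a \<Rightarrow> ennreal"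
      have [measurable]: "space M - (Z \<union> B n) \<in> sets T"
        unfolding sT using Z B by blast
      have "(\<integral>\<^sup>+x. w x * ?I x \<partial>\<rho>) \<le> (\<integral>\<^sup>+x. w x * ?I x \<partial>T)"
        using le\<rho> sets sT by (intro nn_integral_mono_measure) (simp_all add: le_measure)
      also have "\<dots> \<le> (\<integral>\<^sup>+x. ennreal (Suc n) * (k x * w x) \<partial>T)"
      proof (rule nn_integral_mono)
        fix x assume x: "x \<in> space T"
        show "w x * ?I x \<le> ennreal (Suc n) * (k x * w x)"
        proof (cases "x \<in> Z \<union> B n")
          case False
          then have "ennreal (1 / Suc n) \<le> k x"
            using x spT by (auto simp: Z_def B_def not_less zero_less_iff_neq_zero)
          then have "ennreal (Suc n) * ennreal (1 / Suc n) \<le> ennreal (Suc n) * k x"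
            by (rule mult_left_mono) simp
          moreover have "ennreal (Suc n) * ennreal (1 / Suc n) = 1"
            by (subst ennreal_mult[symmetric]) simp_all
          ultimately have "1 \<le> ennreal (Suc n) * k x"
            by simp
          then have "1 * w x \<le> (ennreal (Suc n) * k x) * w x"
            by (rule mult_right_mono) simp
          then show ?thesis
            using False x spT by (simp add: mult.assoc)
        qed (auto simp: indicator_def)
      qed
      also have "\<dots> = ennreal (Suc n) * (\<integral>\<^sup>+x. k x * w x \<partial>T)"
        by (rule nn_integral_cmult) simp
      also have "(\<integral>\<^sup>+x. k x * w x \<partial>T) = (\<integral>\<^sup>+x. w x \<partial>M)"
        by (subst kM[symmetric]) (simp add: nn_integral_density)
      finally show "(\<integral>\<^sup>+x. w x * ?I x \<partial>\<rho>) \<le> ennreal (real (Suc n)) * (\<integral>\<^sup>+x. w x \<partial>M)" .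
    qed simp
  qed
qed

text \<open>Adding to \<open>Z\<close> all points that jump into it with positive probability keeps
  it null, by invariance. The union over all repetitions cannot be entered from outside.\<close>

lemma (in stationary_kernel) absorbing_complement:
  assumes Z: "Z \<in> sets M" "emeasure M Z = 0"
  obtains Z' where "Z \<subseteq> Z'" "Z' \<in> sets M" "emeasure M Z' = 0"
    "\<And>x. x \<in> space M \<Longrightarrow> x \<notin> Z' \<Longrightarrow> emeasure (K x) Z' = 0"
proof -
  have em[measurable]: "(\<lambda>x. emeasure (K x) A) \<in> borel_measurable M" if "A \<in> sets M" for A
    using that by (rule measurable_compose[OF K_subprob measurable_emeasure_subprob_algebra])
  define S where "S A = A \<union> {x \<in> space M. emeasure (K x) A \<noteq> 0}" for A
  define Y where "Y n = (S ^^ n) Z" for n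
  have Y: "Y n \<in> sets M \<and> emeasure M (Y n) = 0" for n
  proof (induction n)
    case (Suc n)
    then have [measurable]: "Y n \<in> sets M"
      by simp
    have "AE x in M. emeasure (K x) (Y n) = 0"
      using invariant[of "Y n"] Suc nn_integral_0_iff_AE[OF em, of "Y n"] by simp
    then have "emeasure M {x \<in> space M. emeasure (K x) (Y n) \<noteq> 0} = 0"
      by (subst (asm) AE_iff_measurable[OF _ refl]) simp_all
    moreover have "{x \<in> space M. emeasure (K x) (Y n) \<noteq> 0} \<in> sets M"
      by measurable
    ultimately have "Y n \<union> {x \<in> space M. emeasure (K x) (Y n) \<noteq> 0} \<in> null_sets M"
      using Suc by (intro null_sets.Un) auto
    then show ?case
      by (auto simp: Y_def S_def)
  qed (use Z in \<open>simp add: Y_def\<close>)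
  show ?thesis
  proof (rule that[of "\<Union>n. Y n"])
    show "Z \<subseteq> (\<Union>n. Y n)"
      using UN_upper[of 0 UNIV Y] by (simp add: Y_def)
    have "(\<Union>n. Y n) \<in> null_sets M"
      using Y by (intro null_sets_UN) auto
    then show "(\<Union>n. Y n) \<in> sets M" "emeasure M (\<Union>n. Y n) = 0"
      by auto
    fix x assume x: "x \<in> space M" "x \<notin> (\<Union>n. Y n)"
    have "emeasure (K x) (Y n) = 0" for n
    proof -
      have "x \<notin> Y (Suc n)"
        using x by blast
      then show ?thesis
        using x(1) by (auto simp: Y_def S_def)
    qed
    then have "(\<Union>n. Y n) \<in> null_sets (K x)"
      using Y sets_K[OF x(1)] by (intro null_sets_UN) auto
    then show "emeasure (K x) (\<Union>n. Y n) = 0"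
      by auto
  qed
qed

text \<open>Meant for the kernel of one full sweep. Drift and minorisation hold at every point, so
  conclusions drawn here reach starting points in null sets of \<open>M\<close>.\<close>

locale drift_kernel = stationary_kernel M P for M :: "'a::polish_space measure" and P +
  fixes W :: "'a \<Rightarrow> real" and D :: "'a set" and lam b :: real
  assumes sets_M: "sets M = sets borel"
    and W[measurable]: "W \<in> borel_measurable M" and W1: "\<And>x. 1 \<le> W x" and W_int: "integrable M W"
    and small: "small_set P D" and lam: "lam < 1"
    and drift: "\<And>x. (\<integral>\<^sup>+y. ennreal (W y) \<partial>P x) \<le> ennreal (lam * W x + b * indicator D x)"
begin

lemma space_M: "space M = UNIV"
  using sets_eq_imp_space_eq[OF sets_M] by simp

lemma D_sets[measurable]: "D \<in> sets M"
  using small sets_M by (simp add: small_set_def)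

text \<open>On a null \<open>D\<close> the drift would shrink the mean of \<open>W\<close> by a
  factor below 1, while invariance preserves it; and that mean is finite and at least 1.\<close>

lemma small_set_charged: "emeasure M D \<noteq> 0"
proof
  assume "emeasure M D = 0"
  then have D: "AE x in M. x \<notin> D"
    by (intro AE_not_in) (auto intro: null_setsI)
  define l where "l = max lam 0"
  have l: "0 \<le> l" "l < 1"
    using lam by (auto simp: l_def)
  have W0: "0 \<le> W x" for x
    using W1[of x] by simp
  have "ennreal (\<integral>x. W x \<partial>M) = (\<integral>\<^sup>+x. ennreal (W x) \<partial>M)"
    using W_int W0 by (simp add: nn_integral_eq_integral)
  also have "\<dots> = (\<integral>\<^sup>+x. \<integral>\<^sup>+y. ennreal (W y) \<partial>P x \<partial>M)"
    by (rule nn_integral_K[symmetric]) simp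
  also have "\<dots> \<le> (\<integral>\<^sup>+x. ennreal (l * W x) \<partial>M)"
  proof (rule nn_integral_mono_AE, use D in eventually_elim)
    fix x assume x: "x \<notin> D"
    have "lam * W x \<le> l * W x"
      using W0 by (auto simp: l_def intro: mult_right_mono)
    then show "(\<integral>\<^sup>+y. ennreal (W y) \<partial>P x) \<le> ennreal (l * W x)"
      using drift[of x] x by (auto intro: order_trans ennreal_leI)
  qed
  also have "\<dots> = ennreal (l * (\<integral>x. W x \<partial>M))"
    using W_int W0 l by (subst nn_integral_eq_integral) auto
  finally have "(\<integral>x. W x \<partial>M) \<le> l * (\<integral>x. W x \<partial>M)"
    using W0 l by (subst (asm) ennreal_le_iff) (auto intro!: mult_nonneg_nonneg integral_nonneg_AE)
  moreover have "1 \<le> (\<integral>x. W x \<partial>M)"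
    using W_int W1 integral_mono[of M "\<lambda>_. 1" W] by (simp add: prob_space)
  ultimately show False
    using l mult_strict_right_mono[of l 1 "\<integral>x. W x \<partial>M"] by simp
qed

text \<open>On the small set a harmonic function is at most \<open>(1 - \<beta>)\<close> times its supremum, and the
  drift carries this bound to all points.\<close>

lemma harmonic_zero:
  assumes Z[measurable]: "Z \<in> sets M" and MZ: "emeasure M Z = 0"
    and q[measurable]: "q \<in> borel_measurable M" and q1: "\<And>x. q x \<le> 1" and qZ: "\<And>x. x \<notin> Z \<Longrightarrow> q x = 0"
    and harmonic: "\<And>x. (\<integral>\<^sup>+y. q y \<partial>P x) = q x"
  shows "q x = (0 :: ennreal)"
proof -
  obtain m \<nu> where \<nu>: "sets \<nu> = sets M" "emeasure \<nu> (space \<nu>) \<noteq> 0"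
    and min: "\<forall>x\<in>D. \<forall>B\<in>sets M. emeasure (kernel_pow P m x) B \<ge> emeasure \<nu> B"
    using small unfolding small_set_def sets_M by blast
  have stat: "stationary_kernel M (kernel_pow P n)" for n
    by (rule stationary_kernel_pow[OF sets_M stationary_kernel_axioms])
  interpret R: stationary_kernel M "kernel_pow P m"
    by (rule stat)
  have harm: "(\<integral>\<^sup>+y. q y \<partial>kernel_pow P n x) = q x" for n x
  proof (induction n arbitrary: x)
    case 0
    then show ?case
      using q sets_M by (simp add: nn_integral_return cong: measurable_cong_sets)
  next
    case (Suc n)
    have "(\<integral>\<^sup>+y. q y \<partial>kernel_pow P (Suc n) x) = (\<integral>\<^sup>+y. \<integral>\<^sup>+z. q z \<partial>kernel_pow P n y \<partial>P x)"
      by (rule nn_integral_kernel_bind[OF stationary_kernel_axioms stat[of n], where R = "kernel_pow P (Suc n)"])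
        (simp_all add: space_M)
    then show ?case
      by (simp add: Suc harmonic)
  qed
  \<comment> \<open>\<open>D\<close> has positive mass and almost every point has P^m(x, Z) = 0, so
    some point of \<open>D\<close> does, and \<nu> lies below its law.\<close>
  have \<nu>Z: "emeasure \<nu> Z = 0"
  proof -
    have "AE x in M. emeasure (kernel_pow P m x) Z = 0"
      using R.invariant[OF Z] MZ nn_integral_0_iff_AE[of "\<lambda>x. emeasure (kernel_pow P m x) Z" M]
      by (simp add: measurable_compose[OF R.K_subprob measurable_emeasure_subprob_algebra])
    then have "\<exists>x\<in>D. emeasure (kernel_pow P m x) Z = 0"
    proof (rule contrapos_pp)
      assume "\<not> (\<exists>x\<in>D. emeasure (kernel_pow P m x) Z = 0)"
      then have *: "D \<subseteq> {x \<in> space M. emeasure (kernel_pow P m x) Z \<noteq> 0}"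
        by (auto simp: space_M)
      show "\<not> (AE x in M. emeasure (kernel_pow P m x) Z = 0)"
      proof
        assume "AE x in M. emeasure (kernel_pow P m x) Z = 0"
        then have "AE x in M. x \<notin> D"
          by (rule eventually_mono) (use * in auto)
        then have "D \<in> null_sets M"
          by (subst AE_iff_null_sets[OF D_sets])
        then show False
          using small_set_charged by auto
      qed
    qed
    then show ?thesis
      using min Z by (metis le_zero_eq)
  qed
  define \<beta> where "\<beta> = measure \<nu> (space \<nu>)"
  have "D \<noteq> {}"
    using small_set_charged by auto
  then have \<nu>1: "emeasure \<nu> (space \<nu>) \<le> 1"
    using min prob_space.emeasure_le_1[OF R.prob_space_K] sets_eq_imp_space_eq[OF \<nu>(1)] space_M
    by (metis UNIV_I all_not_in_conv order_trans sets.top)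
  then have \<nu>_eq: "emeasure \<nu> (space \<nu>) = ennreal \<beta>"
    unfolding \<beta>_def by (intro emeasure_eq_ennreal_measure) (auto simp: top_unique)
  then have \<beta>: "0 < \<beta>" "\<beta> \<le> 1"
    using \<nu>(2) \<nu>1 unfolding \<beta>_def by (auto simp: zero_less_measure_iff)
  \<comment> \<open>All the mass of \<nu> sits off \<open>Z\<close>, so from \<open>D\<close> the
    chain is outside \<open>Z\<close> after m steps with probability at least \<beta>.\<close>
  have PZ: "emeasure (kernel_pow P m x) Z \<le> ennreal (1 - \<beta>)" if x: "x \<in> D" for x
  proof -
    interpret Rx: prob_space "kernel_pow P m x"
      using R.prob_space_K space_M by simp
    have "sets (kernel_pow P m x) = sets M"
      using R.sets_K space_M by simp
    note s = this sets_eq_imp_space_eq[OF this]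
    have "emeasure \<nu> (space M - Z) = ennreal \<beta>"
    proof -
      have "Z \<in> null_sets \<nu>"
        using \<nu>Z Z \<nu>(1) by auto
      then show ?thesis
        using \<nu>_eq sets_eq_imp_space_eq[OF \<nu>(1)] emeasure_Diff_null_set[of Z \<nu> "space \<nu>"]
        by (simp add: sets.top[of \<nu>, unfolded sets_eq_imp_space_eq[OF \<nu>(1)]])
    qed
    then have "ennreal \<beta> \<le> emeasure (kernel_pow P m x) (space M - Z)"
      using min x Z by (metis sets.compl_sets)
    then have "\<beta> \<le> measure (kernel_pow P m x) (space (kernel_pow P m x) - Z)"
      using s by (simp add: Rx.emeasure_eq_measure)
    then have "measure (kernel_pow P m x) Z \<le> 1 - \<beta>"
      using Rx.prob_compl[of Z] s Z by simp
    then show ?thesis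
      by (simp add: Rx.emeasure_eq_measure ennreal_leI)
  qed
  define c where "c = enn2real (SUP x. q x)"
  have "(SUP x. q x) \<le> 1"
    using q1 by (intro SUP_least) simp
  moreover from this have "(SUP x. q x) < \<top>"
    by (rule le_less_trans) simp
  ultimately have c: "(SUP x. q x) = ennreal c" "0 \<le> c" "c \<le> 1"
    unfolding c_def by (simp_all add: enn2real_leI)
  have qc: "q x \<le> ennreal c" for x
    unfolding c(1)[symmetric] by (rule SUP_upper) simp
  have qD: "q x \<le> ennreal ((1 - \<beta>) * c)" if x: "x \<in> D" for x
  proof -
    have s: "sets (kernel_pow P m x) = sets M"
      using R.sets_K space_M by simp
    have "q x = (\<integral>\<^sup>+y. q y \<partial>kernel_pow P m x)"
      by (rule harm[symmetric])
    also have "\<dots> \<le> (\<integral>\<^sup>+y. ennreal c * indicator Z y \<partial>kernel_pow P m x)"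
    proof (rule nn_integral_mono)
      show "q y \<le> ennreal c * indicator Z y" for y
        using qc[of y] qZ[of y] by (cases "y \<in> Z") auto
    qed
    also have "\<dots> = ennreal c * emeasure (kernel_pow P m x) Z"
      using s Z by (simp add: nn_integral_cmult_indicator)
    also have "\<dots> \<le> ennreal c * ennreal (1 - \<beta>)"
      by (rule mult_left_mono[OF PZ[OF x]]) simp
    finally show ?thesis
      using c \<beta> by (simp add: ennreal_mult[symmetric] mult.commute)
  qed
  define l where "l = max lam 0"
  have l: "0 \<le> l" "l < 1"
    using lam by (auto simp: l_def)
  have W0: "0 \<le> W x" for x
    using W1[of x] by simp
  have dn: "0 \<le> (1 - \<beta>) * c"
    using c \<beta> by simp
  \<comment> \<open>The start is q \<le> 1 \<le> W. On \<open>D\<close> the bound is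
    \<open>qD\<close>; off \<open>D\<close>, harmonicity and the drift gain one factor
    \<open>l\<close>. Letting n grow removes \<open>W\<close>, and then c \<le> (1 - \<beta>)
    c.\<close>
  have step: "q x \<le> ennreal ((1 - \<beta>) * c + l ^ n * W x)" for n x
  proof (induction n arbitrary: x)
    case 0
    have "1 \<le> (1 - \<beta>) * c + W x"
      using dn W1[of x] by simp
    then show ?case
      using order_trans[OF q1[of x], of "ennreal ((1 - \<beta>) * c + W x)"] ennreal_leI by fastforce
  next
    case (Suc n)
    show ?case
    proof (cases "x \<in> D")
      case True
      have "(1 - \<beta>) * c \<le> (1 - \<beta>) * c + l ^ Suc n * W x"
        using l W0[of x] by simp
      then show ?thesis
        using order_trans[OF qD[OF True]] ennreal_leI by blast
    next
      case False
      have s: "sets (P x) = sets M"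
        using sets_K space_M by simp
      have [measurable]: "W \<in> borel_measurable (P x)"
        using W s by (simp cong: measurable_cong_sets)
      interpret Px: prob_space "P x"
        using prob_space_K space_M by simp
      have "lam * W x \<le> l * W x"
        using W0 by (auto simp: l_def intro: mult_right_mono)
      then have dr: "(\<integral>\<^sup>+y. ennreal (W y) \<partial>P x) \<le> ennreal (l * W x)"
        using drift[of x] False by (auto intro: order_trans ennreal_leI)
      have "q x = (\<integral>\<^sup>+y. q y \<partial>P x)"
        by (rule harmonic[symmetric])
      also have "\<dots> \<le> (\<integral>\<^sup>+y. ennreal ((1 - \<beta>) * c) + ennreal (l ^ n) * ennreal (W y) \<partial>P x)"
      proof (rule nn_integral_mono)
        show "q y \<le> ennreal ((1 - \<beta>) * c) + ennreal (l ^ n) * ennreal (W y)" for y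
          using Suc[of y] dn l W0[of y] by (simp add: ennreal_mult ennreal_plus)
      qed
      also have "\<dots> = ennreal ((1 - \<beta>) * c) + ennreal (l ^ n) * (\<integral>\<^sup>+y. ennreal (W y) \<partial>P x)"
        using Px.emeasure_space_1 by (simp add: nn_integral_add nn_integral_cmult)
      also have "\<dots> \<le> ennreal ((1 - \<beta>) * c) + ennreal (l ^ n) * ennreal (l * W x)"
        by (intro add_left_mono mult_left_mono dr) simp
      also have "\<dots> = ennreal ((1 - \<beta>) * c + l ^ Suc n * W x)"
        using dn l W0[of x] by (simp add: ennreal_mult ennreal_plus mult.assoc mult.left_commute)
      finally show ?thesis .
    qed
  qed
  have "q x \<le> ennreal ((1 - \<beta>) * c)" for x
  proof (rule LIMSEQ_le_const)
    have "(\<lambda>n. (1 - \<beta>) * c + l ^ n * W x) \<longlonglongrightarrow> (1 - \<beta>) * c + 0 * W x"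
      by (intro tendsto_intros LIMSEQ_power_zero) (use l in simp)
    then show "(\<lambda>n. ennreal ((1 - \<beta>) * c + l ^ n * W x)) \<longlonglongrightarrow> ennreal ((1 - \<beta>) * c)"
      using tendsto_ennrealI by fastforce
  qed (use step in auto)
  then have "ennreal c \<le> ennreal ((1 - \<beta>) * c)"
    unfolding c(1)[symmetric] by (intro SUP_least)
  then have "c \<le> (1 - \<beta>) * c"
    using dn by (simp add: ennreal_le_iff)
  then have "c = 0"
    using c \<beta> by (simp add: left_diff_distrib mult_le_0_iff)
  then show ?thesis
    using qc[of x] by simp
qed

text \<open>The probability of being in \<open>Z\<close> after n steps decreases in n, because
  \<open>Z\<close> cannot be entered from outside. Its limit is harmonic and vanishes off
  \<open>Z\<close>, so \<open>harmonic_zero\<close> applies.\<close>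

lemma escape_null_set:
  assumes Z[measurable]: "Z \<in> sets M" and MZ: "emeasure M Z = 0"
    and absorbing: "\<And>x. x \<notin> Z \<Longrightarrow> emeasure (P x) Z = 0"
    and \<rho>: "\<And>n. prob_space (\<rho> n)" "\<And>n. sets (\<rho> n) = sets M" "\<And>n. \<rho> (Suc n) = \<rho> n \<bind> P"
  shows "(\<lambda>n. emeasure (\<rho> n) Z) \<longlonglongrightarrow> 0"
proof -
  define q where "q n = ((\<lambda>u x. \<integral>\<^sup>+y. u y \<partial>P x) ^^ n) (indicator Z)" for n
  have q0: "q 0 = indicator Z" and qS: "q (Suc n) = (\<lambda>x. \<integral>\<^sup>+y. q n y \<partial>P x)" for n
    by (simp_all add: q_def)
  have q[measurable]: "q n \<in> borel_measurable M" for n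
    by (induction n) (simp_all add: q0 qS)
  have sP: "sets (P x) = sets M" for x
    using sets_K space_M by simp
  have pP: "prob_space (P x)" for x
    using prob_space_K space_M by simp
  have "q (Suc n) x \<le> q n x" for n x
  proof (induction n arbitrary: x)
    case 0
    have "emeasure (P x) Z \<le> indicator Z x"
      using absorbing[of x] prob_space.emeasure_le_1[OF pP, of x Z] by (cases "x \<in> Z") auto
    then show ?case
      using sP Z by (simp add: q0 qS)
  next
    case (Suc n)
    then show ?case
      unfolding qS[of n] qS[of "Suc n"] by (intro nn_integral_mono)
  qed
  then have dec: "decseq q"
    by (intro decseq_SucI le_funI)
  have dec': "decseq (\<lambda>n. q n x)" for x
    using decseqD[OF dec] by (intro decseq_SucI) (simp add: le_fun_def)
  define q' where "q' x = (INF n. q n x)" for x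
  have q'_meas: "q' \<in> borel_measurable M"
    unfolding q'_def by simp
  have qle: "q n x \<le> indicator Z x" for n x
    using decseqD[OF dec', of 0 n x] by (simp add: q0)
  have q'_le: "q' x \<le> indicator Z x" for x
    unfolding q'_def using qle[of 0 x] by (intro INF_lower2[of 0]) simp_all
  have fin: "(\<integral>\<^sup>+x. q 0 x \<partial>N) < \<infinity>" if "prob_space N" "sets N = sets M" for N
    using le_less_trans[OF prob_space.emeasure_le_1[OF that(1), of Z], of \<top>] that(2) Z
    by (simp add: q0)
  have INF: "(\<integral>\<^sup>+x. q' x \<partial>N) = (INF n. \<integral>\<^sup>+x. q n x \<partial>N)" if "prob_space N" "sets N = sets M" for N
    unfolding q'_def using fin[OF that] that(2)
    by (intro nn_integral_monotone_convergence_INF_decseq[OF dec]) (simp_all cong: measurable_cong_sets)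
  have "q' x = 0" for x
  proof (rule harmonic_zero[OF Z MZ q'_meas])
    show "q' x \<le> 1" "x \<notin> Z \<Longrightarrow> q' x = 0" for x
      using q'_le[of x] by (cases "x \<in> Z"; simp)+
    fix x
    have "(\<integral>\<^sup>+y. q' y \<partial>P x) = (INF n. q (Suc n) x)"
      using INF[OF pP sP] by (simp add: qS)
    also have "\<dots> = q' x"
      unfolding q'_def
    proof (rule antisym)
      show "(INF n. q (Suc n) x) \<le> (INF n. q n x)"
        using decseqD[OF dec', of _ "Suc _"] by (intro INF_mono) (meson UNIV_I le_SucI order_refl)
      show "(INF n. q n x) \<le> (INF n. q (Suc n) x)"
        by (intro INF_mono) blast
    qed
    finally show "(\<integral>\<^sup>+y. q' y \<partial>P x) = q' x" .
  qed
  moreover have "decseq (\<lambda>n. \<integral>\<^sup>+x. q n x \<partial>\<rho> 0)"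
    using decseqD[OF dec'] by (auto simp: decseq_def intro!: nn_integral_mono)
  ultimately have lim: "(\<lambda>n. \<integral>\<^sup>+x. q n x \<partial>\<rho> 0) \<longlonglongrightarrow> 0"
    using LIMSEQ_INF[of "\<lambda>n. \<integral>\<^sup>+x. q n x \<partial>\<rho> 0"] INF[OF \<rho>(1,2)[of 0]] by simp
  \<comment> \<open>Steps are moved from the law to the function, so that the limit is taken under
    the fixed law \<rho> 0.\<close>
  have it: "(\<integral>\<^sup>+x. q k x \<partial>\<rho> n) = (\<integral>\<^sup>+x. q (k + n) x \<partial>\<rho> 0)" for k n
  proof (induction n arbitrary: k)
    case (Suc n)
    have "P \<in> \<rho> n \<rightarrow>\<^sub>M subprob_algebra M"
      using K_subprob measurable_cong_sets[OF \<rho>(2) refl] by blast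
    then have "(\<integral>\<^sup>+x. q k x \<partial>\<rho> (Suc n)) = (\<integral>\<^sup>+x. q (Suc k) x \<partial>\<rho> n)"
      by (simp add: \<rho>(3) qS nn_integral_bind[OF q])
    then show ?case
      by (simp add: Suc)
  qed simp
  have "(\<integral>\<^sup>+x. q n x \<partial>\<rho> 0) = emeasure (\<rho> n) Z" for n
  proof -
    have "Z \<in> sets (\<rho> n)"
      using Z \<rho>(2) by blast
    then have "emeasure (\<rho> n) Z = (\<integral>\<^sup>+x. q 0 x \<partial>\<rho> n)"
      unfolding q0 by simp
    also have "\<dots> = (\<integral>\<^sup>+x. q (0 + n) x \<partial>\<rho> 0)"
      by (rule it)
    finally show ?thesis
      by simp
  qed
  with lim show ?thesis
    by simp
qed

end

context drift_kernel
begin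

text \<open>The singular part of the law of the chain dies out because it sits on a null set, and on
  the part with bounded density the \<open>L\<^sup>2\<close> contraction applies, uniformly in \<open>h\<close>.\<close>

theorem total_variation_convergence:
  assumes contraction: "\<And>h :: 'a \<Rightarrow> real. h \<in> borel_measurable M \<Longrightarrow> (\<And>x. \<bar>h x\<bar> \<le> 2) \<Longrightarrow> (\<integral>x. h x \<partial>M) = 0 \<Longrightarrow>
      (\<integral>x. (kint P h x)\<^sup>2 \<partial>M) \<le> r * (\<integral>x. (h x)\<^sup>2 \<partial>M)"
    and r: "0 \<le> r" "r < 1"
    and \<rho>: "\<And>n. prob_space (\<rho> n)" "\<And>n. sets (\<rho> n) = sets M" "\<And>n. \<rho> (Suc n) = \<rho> n \<bind> P"
    and e: "0 < e"
  shows "\<exists>n. \<forall>h :: 'a \<Rightarrow> real. h \<in> borel_measurable M \<longrightarrow> (\<forall>x. \<bar>h x\<bar> \<le> 1) \<longrightarrow> \<bar>(\<integral>x. h x \<partial>\<rho> n) - (\<integral>x. h x \<partial>M)\<bar> \<le> e"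
proof -
  have finM: "finite_measure M"
    by unfold_locales
  \<comment> \<open>The conclusion of the decomposition for the law at time n, named so that one
    \<open>Z n\<close> can be chosen per time.\<close>
  define S where "S n Z \<longleftrightarrow> (\<forall>e>0. \<exists>B\<in>sets M. \<exists>C\<ge>0. emeasure (\<rho> n) B \<le> ennreal e \<and>
      (\<forall>w\<in>borel_measurable M. (\<integral>\<^sup>+x. w x * indicator (space M - (Z \<union> B)) x \<partial>\<rho> n) \<le> ennreal C * (\<integral>\<^sup>+x. w x \<partial>M)))"
    for n Z
  have "\<exists>Z. Z \<in> sets M \<and> emeasure M Z = 0 \<and> S n Z" for n
    unfolding S_def by (rule bounded_density_decomposition[OF finM prob_space.finite_measure[OF \<rho>(1)] \<rho>(2)]) blast
  then have "\<forall>n. \<exists>Z. Z \<in> sets M \<and> emeasure M Z = 0 \<and> S n Z"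
    by (rule allI)
  from choice[OF this] obtain Z where Z: "\<And>n. Z n \<in> sets M" "\<And>n. emeasure M (Z n) = 0" and S: "\<And>n. S n (Z n)"
    by blast
  have "(\<Union>n. Z n) \<in> null_sets M"
    using Z by (intro null_sets_UN) auto
  then have "(\<Union>n. Z n) \<in> sets M" "emeasure M (\<Union>n. Z n) = 0"
    by auto
  \<comment> \<open>One absorbing null set contains the singular parts at all times, so the time n
    can be chosen afterwards from the escape of mass.\<close>
  then obtain Z' where Z': "(\<Union>n. Z n) \<subseteq> Z'" "Z' \<in> sets M" "emeasure M Z' = 0"
    and abs': "\<And>x. x \<in> space M \<Longrightarrow> x \<notin> Z' \<Longrightarrow> emeasure (P x) Z' = 0"
    by (rule absorbing_complement) blast
  have abs: "\<And>x. x \<notin> Z' \<Longrightarrow> emeasure (P x) Z' = 0"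
    using abs' space_M by blast
  have "\<forall>\<^sub>F n in sequentially. emeasure (\<rho> n) Z' < ennreal (e / 8)"
    using escape_null_set[of Z' \<rho>, OF Z'(2,3) abs \<rho>] e by (intro order_tendstoD(2)) auto
  then obtain n where n: "emeasure (\<rho> n) Z' < ennreal (e / 8)"
    by (auto simp: eventually_sequentially)
  \<comment> \<open>\<open>C\<close> depends on n and on the accuracy. Only after it the number
    \<open>l\<close> of further steps is chosen, large enough for the contraction to beat
    \<open>C\<close>.\<close>
  obtain B C where B[measurable]: "B \<in> sets M" and C: "0 \<le> C" and B': "emeasure (\<rho> n) B \<le> ennreal (e / 8)"
    and bd: "\<And>w. w \<in> borel_measurable M \<Longrightarrow>
      (\<integral>\<^sup>+x. w x * indicator (space M - (Z n \<union> B)) x \<partial>\<rho> n) \<le> ennreal C * (\<integral>\<^sup>+x. w x \<partial>M)"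
    using S[of n] e unfolding S_def by (elim allE[of _ "e / 8"]) auto
  have "(\<lambda>l. C * sqrt (r ^ l)) \<longlonglongrightarrow> C * sqrt 0"
    by (intro tendsto_intros LIMSEQ_power_zero) (use r in simp)
  then have "\<forall>\<^sub>F l in sequentially. C * sqrt (r ^ l) < e / 4"
    using e by (intro order_tendstoD(2)) auto
  then obtain l where l: "C * sqrt (r ^ l) < e / 4"
    by (auto simp: eventually_sequentially)
  interpret \<rho>n: prob_space "\<rho> n"
    by (rule \<rho>)
  show ?thesis
  proof (intro exI[of _ "n + l"] allI impI)
    fix h :: "'a \<Rightarrow> real" assume h: "h \<in> borel_measurable M" "\<forall>x. \<bar>h x\<bar> \<le> 1"
    define u where "u = (kint P ^^ l) h"
    have pP: "prob_space (P x)" for x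
      using prob_space_K space_M by simp
    have iter: "(kint P ^^ j) h \<in> borel_measurable M \<and> (\<forall>x. \<bar>(kint P ^^ j) h x\<bar> \<le> 1)" for j
    proof (induction j)
      case (Suc j)
      then show ?case
        using prob_space.norm_integral_le[OF pP, of "(kint P ^^ j) h" 1]
        by (auto simp: kint_def[abs_def] measurable_kint[unfolded kint_def[abs_def]])
    qed (use h in simp)
    have [measurable]: "u \<in> borel_measurable M" and u1: "\<bar>u x\<bar> \<le> 1" for x
      using iter[of l] by (auto simp: u_def)
    have int_u: "(\<integral>x. h x \<partial>\<rho> (n + j)) = (\<integral>x. (kint P ^^ j) h x \<partial>\<rho> n)" for j
      using h
    proof (induction j arbitrary: h)
      case (Suc j)
      have m: "P \<in> \<rho> (n + j) \<rightarrow>\<^sub>M subprob_algebra M"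
        using K_subprob measurable_cong_sets[OF \<rho>(2) refl] by blast
      have "(\<integral>x. h x \<partial>\<rho> (n + Suc j)) = (\<integral>x. h x \<partial>(\<rho> (n + j) \<bind> P))"
        by (simp add: \<rho>(3))
      also have "\<dots> = (\<integral>x. kint P h x \<partial>\<rho> (n + j))"
        unfolding kint_def
        by (rule integral_bind[OF Suc.prems(1) _ m prob_space.finite_measure[OF \<rho>(1)], where B = 1 and B' = 1])
          (use Suc.prems(2) prob_space.emeasure_space_1[OF pP] in auto)
      also have "\<dots> = (\<integral>x. (kint P ^^ j) (kint P h) x \<partial>\<rho> n)"
        using Suc.prems prob_space.norm_integral_le[OF pP, of h 1]
        by (intro Suc.IH) (auto simp: kint_def)
      finally show ?case
        by (simp add: funpow_swap1)
    qed simp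
    define c where "c = (\<integral>x. h x \<partial>M)"
    have c: "\<bar>c\<bar> \<le> 1"
      using norm_integral_le[of h 1] h by (simp add: c_def)
    have bounded_sq: "sq_int M v" if "v \<in> borel_measurable M" "\<And>x. \<bar>v x\<bar> \<le> K" for v K
    proof -
      have "(v x)\<^sup>2 \<le> K\<^sup>2" for x
        using power_mono[OF that(2)[of x] abs_ge_zero, where n = 2] by simp
      then show ?thesis
        using that(1) by (auto simp: sq_int_def intro!: integrable_const_bound[where B = "K\<^sup>2"])
    qed
    \<comment> \<open>The iterates and the mean of \<open>h\<close> are bounded by 1, so the centred
      iterates are bounded by 2, the range in which the contraction is available.\<close>
    have v: "sq_int M (\<lambda>x. (kint P ^^ j) h x - c) \<and> (\<integral>x. (kint P ^^ j) h x - c \<partial>M) = 0 \<and>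
        (\<integral>x. ((kint P ^^ j) h x - c)\<^sup>2 \<partial>M) \<le> r ^ j" for j
    proof (induction j)
      case 0
      have "sq_int M h"
        using h by (intro bounded_sq[of _ 1]) auto
      then have s: "sq_int M (\<lambda>x. h x - c)" "integrable M h" "integrable M (\<lambda>x. (h x)\<^sup>2)"
        by (auto intro: sq_int_diff sq_int_const sq_int_integrable simp: sq_int_square)
      have "(\<integral>x. (h x - c)\<^sup>2 \<partial>M) = (\<integral>x. (h x)\<^sup>2 \<partial>M) - c\<^sup>2"
        using s by (simp add: power2_diff prob_space c_def power2_eq_square algebra_simps)
      also have "\<dots> \<le> 1"
      proof -
        have "(\<integral>x. (h x)\<^sup>2 \<partial>M) \<le> (\<integral>x. 1 \<partial>M)"
          using s h by (intro integral_mono) (auto simp: abs_square_le_1)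
        then show ?thesis
          by (simp add: prob_space) (smt (verit) zero_le_power2)
      qed
      finally show ?case
        using s by (simp add: prob_space c_def)
    next
      case (Suc j)
      let ?v = "\<lambda>x. (kint P ^^ j) h x - c"
      have s: "sq_int M (\<lambda>x. (kint P ^^ i) h x)" for i
        using iter[of i] by (intro bounded_sq[of _ 1]) auto
      have "AE x in M. kint P ?v x = kint P ((kint P ^^ j) h) x - kint P (\<lambda>_. c) x"
        by (rule kint_diff) (use s[of j] sq_int_integrable in auto)
      then have eq: "AE x in M. kint P ?v x = (kint P ^^ Suc j) h x - c"
        using AE_space by eventually_elim (simp add: kint_const)
      have s': "sq_int M (\<lambda>x. (kint P ^^ Suc j) h x - c)"
        by (intro sq_int_diff s sq_int_const)
      note m = sq_int_measurable[OF s'] sq_int_measurable[OF sq_int_kint(1)[OF conjunct1[OF Suc]]]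
      have "(\<integral>x. (kint P ^^ Suc j) h x - c \<partial>M) = (\<integral>x. kint P ?v x \<partial>M)"
        by (rule integral_cong_AE) (use m eq in auto)
      also have "\<dots> = 0"
        using Suc by (simp add: integral_kint sq_int_integrable)
      finally have z: "(\<integral>x. (kint P ^^ Suc j) h x - c \<partial>M) = 0" .
      have "(\<integral>x. ((kint P ^^ Suc j) h x - c)\<^sup>2 \<partial>M) = (\<integral>x. (kint P ?v x)\<^sup>2 \<partial>M)"
        by (rule integral_cong_AE) (use m eq in auto)
      also have "\<dots> \<le> r * (\<integral>x. (?v x)\<^sup>2 \<partial>M)"
      proof (rule contraction)
        show "?v \<in> borel_measurable M"
          by (rule borel_measurable_diff) (use iter[of j] in simp_all)
        have "\<bar>(kint P ^^ j) h x\<bar> \<le> 1" for x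
          using iter[of j] by blast
        then show "\<bar>?v x\<bar> \<le> 2" for x
          using c order_trans[OF abs_triangle_ineq4 add_mono, of "(kint P ^^ j) h x" 1 c 1] by simp
      qed (use Suc in blast)
      also have "\<dots> \<le> r * r ^ j"
        using Suc r by (intro mult_left_mono) auto
      finally show ?case
        using s' z by simp
    qed
    \<comment> \<open>This deviation is at most 2. On \<open>Z'\<close> and \<open>B\<close> that
      costs e/2 in all; elsewhere the density bound and Cauchy--Schwarz leave C sqrt(r^l) <
      e/4.\<close>
    define w where "w x = \<bar>u x - c\<bar>" for x
    have [measurable]: "w \<in> borel_measurable M"
      unfolding w_def by simp
    have w2: "0 \<le> w x" "w x \<le> 2" for x
      using u1[of x] c by (auto simp: w_def)
    have w_int: "sq_int M w"
      using w2 by (intro bounded_sq[of _ 2]) auto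
    have "(\<integral>x. w x \<partial>M)\<^sup>2 \<le> (\<integral>x. (w x)\<^sup>2 \<partial>M)"
      by (rule square_expectation_le[OF w_int])
    also have "\<dots> \<le> r ^ l"
      using v[of l] by (simp add: w_def u_def)
    finally have wM: "(\<integral>x. w x \<partial>M) \<le> sqrt (r ^ l)"
      by (rule real_le_rsqrt)
    have meas\<rho>: "v \<in> borel_measurable (\<rho> n)" if "v \<in> borel_measurable M" for v :: "'a \<Rightarrow> real"
      using that measurable_cong_sets[OF \<rho>(2) refl] by blast
    note [measurable] = Z(1) Z'(2)
    have "(\<lambda>x. 2 * indicator Z' x + 2 * indicator B x :: ennreal) \<in> borel_measurable M"
      "(\<lambda>x. ennreal (w x) * indicator (space M - (Z n \<union> B)) x) \<in> borel_measurable M"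
      "(\<lambda>x. 2 * indicator Z' x :: ennreal) \<in> borel_measurable M" "(\<lambda>x. 2 * indicator B x :: ennreal) \<in> borel_measurable M"
      by measurable
    then have meas_ind: "(\<lambda>x. 2 * indicator Z' x + 2 * indicator B x :: ennreal) \<in> borel_measurable (\<rho> n)"
      "(\<lambda>x. ennreal (w x) * indicator (space M - (Z n \<union> B)) x) \<in> borel_measurable (\<rho> n)"
      "(\<lambda>x. 2 * indicator Z' x :: ennreal) \<in> borel_measurable (\<rho> n)" "(\<lambda>x. 2 * indicator B x :: ennreal) \<in> borel_measurable (\<rho> n)"
      using measurable_cong_sets[OF \<rho>(2) refl] by blast+
    have "Z' \<in> sets (\<rho> n)" "B \<in> sets (\<rho> n)"
      using Z'(2) B \<rho>(2) by blast+
    note ind_sets = this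
    have "(\<integral>\<^sup>+x. ennreal (w x) \<partial>\<rho> n) \<le> (\<integral>\<^sup>+x. (2 * indicator Z' x + 2 * indicator B x) +
        ennreal (w x) * indicator (space M - (Z n \<union> B)) x \<partial>\<rho> n)"
    proof (rule nn_integral_mono)
      fix x
      have "ennreal (w x) \<le> 2"
        using ennreal_leI[OF w2(2)[of x]] by simp
      then show "ennreal (w x) \<le> (2 * indicator Z' x + 2 * indicator B x) +
        ennreal (w x) * indicator (space M - (Z n \<union> B)) x"
      proof (cases "x \<in> Z n \<union> B")
        case True
        then have "x \<in> Z' \<or> x \<in> B"
          using Z'(1) by blast
        then have "indicator Z' x = (1::ennreal) \<or> indicator B x = (1::ennreal)"
          by auto
        then have "(2::ennreal) \<le> 2 * indicator Z' x + 2 * indicator B x"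
          by (auto intro: add_increasing add_increasing2)
        with \<open>ennreal (w x) \<le> 2\<close> show ?thesis
          using True by (auto simp: indicator_def[of "space M - _"] intro: order_trans)
      qed (simp add: space_M)
    qed
    also have "\<dots> = (\<integral>\<^sup>+x. 2 * indicator Z' x + 2 * indicator B x \<partial>\<rho> n) +
        (\<integral>\<^sup>+x. ennreal (w x) * indicator (space M - (Z n \<union> B)) x \<partial>\<rho> n)"
      by (rule nn_integral_add[OF meas_ind(1,2)])
    also have "(\<integral>\<^sup>+x. 2 * indicator Z' x + 2 * indicator B x \<partial>\<rho> n) = 2 * emeasure (\<rho> n) Z' + 2 * emeasure (\<rho> n) B"
      unfolding nn_integral_add[OF meas_ind(3,4)] using ind_sets by (simp add: nn_integral_cmult_indicator)
    also have "2 * emeasure (\<rho> n) Z' + 2 * emeasure (\<rho> n) B + (\<integral>\<^sup>+x. ennreal (w x) * indicator (space M - (Z n \<union> B)) x \<partial>\<rho> n)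
        \<le> 2 * ennreal (e / 8) + 2 * ennreal (e / 8) + ennreal C * (\<integral>\<^sup>+x. ennreal (w x) \<partial>M)"
      using n B' by (intro add_mono mult_left_mono bd) auto
    also have "(\<integral>\<^sup>+x. ennreal (w x) \<partial>M) = ennreal (\<integral>x. w x \<partial>M)"
      using w2 sq_int_integrable[OF w_int] by (intro nn_integral_eq_integral) auto
    also have "2 * ennreal (e / 8) + 2 * ennreal (e / 8) + ennreal C * ennreal (\<integral>x. w x \<partial>M)
        = ennreal (2 * (e / 8) + 2 * (e / 8) + C * (\<integral>x. w x \<partial>M))"
    proof -
      have "0 \<le> (\<integral>x. w x \<partial>M)"
        using w2 by (simp add: integral_nonneg_AE)
      moreover have "2 * ennreal (e / 8) = ennreal (2 * (e / 8))"
        using ennreal_mult[of 2 "e / 8"] e by simp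
      ultimately show ?thesis
        using e C by (simp only: ennreal_mult[symmetric])
          (subst ennreal_plus[symmetric], simp_all)+
    qed
    also have "\<dots> \<le> ennreal e"
    proof (rule ennreal_leI)
      have "C * (\<integral>x. w x \<partial>M) \<le> C * sqrt (r ^ l)"
        by (rule mult_left_mono[OF wM C])
      then show "2 * (e / 8) + 2 * (e / 8) + C * (\<integral>x. w x \<partial>M) \<le> e"
        using l e by simp
    qed
    finally have w\<rho>: "(\<integral>\<^sup>+x. ennreal (w x) \<partial>\<rho> n) \<le> ennreal e" .
    have iw: "integrable (\<rho> n) w"
      using w2 meas\<rho>[of w] by (intro \<rho>n.integrable_const_bound[where B = 2]) auto
    have iu: "integrable (\<rho> n) u"
      using u1 meas\<rho>[of u] by (intro \<rho>n.integrable_const_bound[where B = 1]) auto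
    have "(\<integral>x. h x \<partial>\<rho> (n + l)) - c = (\<integral>x. u x - c \<partial>\<rho> n)"
      using iu by (simp add: int_u u_def \<rho>n.prob_space)
    also have "\<bar>\<dots>\<bar> \<le> (\<integral>x. w x \<partial>\<rho> n)"
      unfolding w_def using integral_abs_bound[of "\<rho> n" "\<lambda>x. u x - c"] by simp
    also have "\<dots> \<le> e"
      using w\<rho> w2 e nn_integral_eq_integral[OF iw] by (simp add: ennreal_le_iff)
    finally show "\<bar>(\<integral>x. h x \<partial>\<rho> (n + l)) - (\<integral>x. h x \<partial>M)\<bar> \<le> e"
      by (simp add: c_def)
  qed
qed

end

section \<open>Characteristic functions along a Poisson equation\<close>

text \<open>The integrand depends on the base point, so \<open>L x\<close> is first replaced by the
  law of the pair (x, y), whose integrand is fixed.\<close>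

lemma integral_measurable_subprob_algebra2:
  fixes f :: "'a \<Rightarrow> 'b \<Rightarrow> 'c::{banach, second_countable_topology}"
  assumes f[measurable]: "(\<lambda>(x, y). f x y) \<in> borel_measurable (M \<Otimes>\<^sub>M N)"
    and L[measurable]: "L \<in> M \<rightarrow>\<^sub>M subprob_algebra N"
  shows "(\<lambda>x. \<integral>y. f x y \<partial>L x) \<in> borel_measurable M"
proof -
  note integral_measurable_subprob_algebra[measurable]
  note measurable_distr2[measurable]
  have "(\<lambda>x. integral\<^sup>L (distr (L x) (M \<Otimes>\<^sub>M N) (\<lambda>y. (x, y))) (\<lambda>(x, y). f x y)) \<in> borel_measurable M"
    by measurable
  then show ?thesis
    by (rule measurable_cong[THEN iffD1, rotated]) (simp add: integral_distr)
qed

lemma (in stationary_kernel) measurable_integral_K2: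
  fixes f :: "'a \<Rightarrow> 'a \<Rightarrow> 'c::{banach, second_countable_topology}"
  assumes "(\<lambda>(x, y). f x y) \<in> borel_measurable (M \<Otimes>\<^sub>M M)"
  shows "(\<lambda>x. \<integral>y. f x y \<partial>K x) \<in> borel_measurable M"
  by (rule integral_measurable_subprob_algebra2[OF assms K_subprob])

lemma norm_min_le: "0 \<le> (a::real) \<Longrightarrow> 0 \<le> b \<Longrightarrow> norm (min a b) \<le> norm a"
  by (simp add: min_def)

text \<open>The m-step expectation operator of the inhomogeneous chain from time \<open>t\<close>
  on; the kernel of the earliest time acts last.\<close>

primrec kiter :: "(nat \<Rightarrow> 'a \<Rightarrow> 'a measure) \<Rightarrow> nat \<Rightarrow> nat \<Rightarrow> ('a \<Rightarrow> 'c) \<Rightarrow> 'a \<Rightarrow> 'c::{banach, second_countable_topology}" where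
  "kiter \<kappa> t 0 h = h"
| "kiter \<kappa> t (Suc j) h = kint (\<kappa> t) (kiter \<kappa> (Suc t) j h)"

lemma cmod_iexp_diff_one_le: "cmod (iexp x - 1) \<le> 2"
  using norm_triangle_ineq4[of "iexp x" 1] by simp

text \<open>A two-periodic chain with kernels \<open>\<kappa> t\<close>, summands \<open>f t\<close> and solution \<open>u\<close> of the Poisson
  equation \<open>f t = u t - \<kappa> t (u (t + 1))\<close>, which makes \<open>u (t + 1) y - (u t x - f t x)\<close> a
  martingale increment of the step from \<open>x\<close> to \<open>y\<close>.\<close>

locale poisson_chain = prob_space M for M :: "'a measure" +
  fixes \<kappa> :: "nat \<Rightarrow> 'a \<Rightarrow> 'a measure" and u f :: "nat \<Rightarrow> 'a \<Rightarrow> real"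
  assumes space_M: "space M = UNIV"
    and stat: "\<And>t. stationary_kernel M (\<kappa> t)"
    and periodic: "\<And>t. \<kappa> (Suc (Suc t)) = \<kappa> t" "\<And>t. u (Suc (Suc t)) = u t" "\<And>t. f (Suc (Suc t)) = f t"
    and u: "\<And>t. sq_int M (u t)" and f: "\<And>t. sq_int M (f t)"
    and poisson: "\<And>t. AE x in M. kint (\<kappa> t) (u (Suc t)) x = u t x - f t x"
    and mixing: "\<And>t w. integrable M w \<Longrightarrow> (\<integral>x. w x \<partial>M) = 0 \<Longrightarrow>
      (\<lambda>m. \<integral>x. \<bar>kiter \<kappa> t m w x\<bar> \<partial>M) \<longlonglongrightarrow> (0 :: real)"
begin

lemma u_meas[measurable]: "u t \<in> borel_measurable M" and f_meas[measurable]: "f t \<in> borel_measurable M"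
  using u f by (simp_all add: sq_int_def)

definition d :: "nat \<Rightarrow> 'a \<Rightarrow> 'a \<Rightarrow> real" where
  "d t x y = u (Suc t) y - (u t x - f t x)"

text \<open>The kernel twisted by the character of the martingale increment. The product of n such
  kernels, applied to 1, is the conditional characteristic function of the martingale sum given the
  start.\<close>

definition tw :: "real \<Rightarrow> nat \<Rightarrow> ('a \<Rightarrow> complex) \<Rightarrow> 'a \<Rightarrow> complex" where
  "tw \<theta> t h x = (\<integral>y. iexp (\<theta> * d t x y) * h y \<partial>\<kappa> t x)"

primrec twi :: "real \<Rightarrow> nat \<Rightarrow> nat \<Rightarrow> ('a \<Rightarrow> complex) \<Rightarrow> 'a \<Rightarrow> complex" where
  "twi \<theta> t 0 h = h"
| "twi \<theta> t (Suc j) h = tw \<theta> t (twi \<theta> (Suc t) j h)"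

definition v :: "nat \<Rightarrow> 'a \<Rightarrow> real" where
  "v t x = (\<integral>y. (d t x y)\<^sup>2 \<partial>\<kappa> t x)"

definition s :: "nat \<Rightarrow> real" where
  "s t = (\<integral>x. v t x \<partial>M)"

definition L1 :: "('a \<Rightarrow> complex) \<Rightarrow> real" where
  "L1 h = (\<integral>x. cmod (h x) \<partial>M)"

lemma measurable_d[measurable]: "(\<lambda>(x, y). d t x y) \<in> borel_measurable (M \<Otimes>\<^sub>M M)"
  unfolding d_def by measurable

lemma measurable_tw[measurable]:
  assumes [measurable]: "h \<in> borel_measurable M"
  shows "tw \<theta> t h \<in> borel_measurable M"
  unfolding tw_def by (rule stationary_kernel.measurable_integral_K2[OF stat]) measurable

lemma measurable_cond:
  "x \<in> space M \<Longrightarrow> g \<in> borel_measurable M \<Longrightarrow> g \<in> borel_measurable (\<kappa> t x)"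
  using measurable_cong_sets[OF stationary_kernel.sets_K[OF stat] refl] by blast

lemma d_cond: "x \<in> space M \<Longrightarrow> d t x \<in> borel_measurable (\<kappa> t x)"
  unfolding d_def by (rule measurable_cond) simp_all

text \<open>The twist has modulus 1, so twisted kernels contract L1 uniformly in \<theta>. This lets
  errors be carried through arbitrarily long products.\<close>

lemma tw_bound:
  assumes "integrable M h"
  shows "AE x in M. integrable (\<kappa> t x) (\<lambda>y. iexp (\<theta> * d t x y) * h y)"
    and "AE x in M. cmod (tw \<theta> t h x) \<le> kint (\<kappa> t) (\<lambda>y. cmod (h y)) x"
proof -
  interpret K: stationary_kernel M "\<kappa> t"
    by (rule stat)
  show 1: "AE x in M. integrable (\<kappa> t x) (\<lambda>y. iexp (\<theta> * d t x y) * h y)"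
    using K.integrable_K(1)[OF assms] AE_space
  proof eventually_elim
    case (elim x)
    note [measurable] = d_cond[OF elim(2), of t]
    show ?case
      by (rule Bochner_Integration.integrable_bound[OF elim(1)]) (use elim(1) in \<open>simp_all add: norm_mult\<close>)
  qed
  show "AE x in M. cmod (tw \<theta> t h x) \<le> kint (\<kappa> t) (\<lambda>y. cmod (h y)) x"
    using 1
  proof eventually_elim
    case (elim x)
    then show ?case
      unfolding tw_def kint_def using integral_norm_bound[of "\<kappa> t x" "\<lambda>y. iexp (\<theta> * d t x y) * h y"]
      by (simp add: norm_mult)
  qed
qed

lemma integrable_tw:
  assumes "integrable M h"
  shows "integrable M (tw \<theta> t h)" and "L1 (tw \<theta> t h) \<le> L1 h"
proof -
  interpret K: stationary_kernel M "\<kappa> t"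
    by (rule stat)
  note [measurable] = borel_measurable_integrable[OF assms]
  have i: "integrable M (\<lambda>x. cmod (h x))"
    using assms by simp
  show 1: "integrable M (tw \<theta> t h)"
    by (rule Bochner_Integration.integrable_bound[OF K.integrable_K(2)[OF i]])
      (simp, use tw_bound(2)[OF assms, of \<theta> t] in eventually_elim, simp add: order_trans[OF _ abs_ge_self])
  have "L1 (tw \<theta> t h) \<le> (\<integral>x. kint (\<kappa> t) (\<lambda>y. cmod (h y)) x \<partial>M)"
    unfolding L1_def using 1 by (intro integral_mono_AE K.integrable_K(2) i tw_bound(2) assms) simp
  then show "L1 (tw \<theta> t h) \<le> L1 h"
    by (simp add: K.integral_kint[OF i] L1_def)
qed

lemma L1_add: "integrable M g \<Longrightarrow> integrable M h \<Longrightarrow> L1 (\<lambda>x. g x + h x) \<le> L1 g + L1 h"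
proof -
  assume i: "integrable M g" "integrable M h"
  have "L1 (\<lambda>x. g x + h x) \<le> (\<integral>x. cmod (g x) + cmod (h x) \<partial>M)"
    unfolding L1_def using i by (intro integral_mono norm_triangle_ineq) simp_all
  also have "\<dots> = L1 g + L1 h"
    unfolding L1_def using i by simp
  finally show ?thesis .
qed

lemma L1_cmult: "L1 (\<lambda>x. c * h x) = cmod c * L1 h"
  by (simp add: L1_def norm_mult)

lemma L1_cong_AE:
  assumes "AE x in M. g x = h x" "g \<in> borel_measurable M" "h \<in> borel_measurable M"
  shows "L1 g = L1 h"
  unfolding L1_def using assms by (intro integral_cong_AE) auto

lemma L1_nonneg: "0 \<le> L1 h"
  by (simp add: L1_def)

lemma tw_cong_AE:
  assumes "AE x in M. g x = h x" "g \<in> borel_measurable M" "h \<in> borel_measurable M"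
  shows "AE x in M. tw \<theta> t g x = tw \<theta> t h x"
proof -
  interpret K: stationary_kernel M "\<kappa> t"
    by (rule stat)
  show ?thesis
    using K.AE_K[OF assms(1)] AE_space
  proof eventually_elim
    case (elim x)
    note [measurable] = d_cond[OF elim(2), of t] measurable_cond[OF elim(2) assms(2), of t]
      measurable_cond[OF elim(2) assms(3), of t]
    show ?case
      unfolding tw_def by (rule integral_cong_AE) (simp_all, use elim(1) in eventually_elim, simp)
  qed
qed

lemma tw_add:
  assumes "integrable M g" "integrable M h"
  shows "AE x in M. tw \<theta> t (\<lambda>x. g x + h x) x = tw \<theta> t g x + tw \<theta> t h x"
  using tw_bound(1)[OF assms(1), of t \<theta>] tw_bound(1)[OF assms(2), of t \<theta>]
  by eventually_elim (simp add: tw_def distrib_left)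

lemma tw_cmult: "tw \<theta> t (\<lambda>x. c * h x) = (\<lambda>x. c * tw \<theta> t h x)"
  by (simp add: fun_eq_iff tw_def mult.left_commute)

lemma integrable_twi:
  assumes "integrable M h"
  shows "integrable M (twi \<theta> t j h)" "L1 (twi \<theta> t j h) \<le> L1 h"
proof (induction j arbitrary: t)
  case (Suc j)
  {
    case 1
    show ?case
      using Suc.IH(1) by (simp add: integrable_tw(1))
  next
    case 2
    show ?case
      using integrable_tw(2)[OF Suc.IH(1), of \<theta> t "Suc t"] Suc.IH(2)[of "Suc t"] by simp
  }
qed (use assms in simp_all)

lemma twi_add:
  assumes "integrable M g" "integrable M h"
  shows "AE x in M. twi \<theta> t j (\<lambda>x. g x + h x) x = twi \<theta> t j g x + twi \<theta> t j h x"
proof (induction j arbitrary: t)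
  case (Suc j)
  note i = integrable_twi(1)[OF assms(1)] integrable_twi(1)[OF assms(2)]
    integrable_twi(1)[OF Bochner_Integration.integrable_add[OF assms]]
  note m = borel_measurable_integrable[OF i(1)] borel_measurable_integrable[OF i(2)] borel_measurable_integrable[OF i(3)]
  have "AE x in M. tw \<theta> t (twi \<theta> (Suc t) j (\<lambda>x. g x + h x)) x
      = tw \<theta> t (\<lambda>x. twi \<theta> (Suc t) j g x + twi \<theta> (Suc t) j h x) x"
    by (rule tw_cong_AE[OF Suc]) (use m in simp_all)
  then show ?case
    using tw_add[OF i(1,2), of \<theta> t \<theta> "Suc t" j \<theta> "Suc t" j] by eventually_elim simp
qed simp

lemma twi_cmult: "twi \<theta> t j (\<lambda>x. c * h x) = (\<lambda>x. c * twi \<theta> t j h x)"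
  by (induction j arbitrary: t) (simp_all add: tw_cmult)

text \<open>\<open>twi\<close> is built from the left, whereas the telescoping argument lengthens a
  prefix at its right end.\<close>

lemma twi_snoc: "twi \<theta> t j (tw \<theta> (t + j) h) = twi \<theta> t (Suc j) h"
proof (induction j arbitrary: t)
  case (Suc j)
  show ?case
    using Suc[of "Suc t"] by simp
qed simp

lemma twi_append: "twi \<theta> t (i + j) h = twi \<theta> t i (twi \<theta> (t + i) j h)"
  by (induction i arbitrary: t) simp_all

lemma two_periodic:
  assumes "\<And>t. F (Suc (Suc t)) = F t"
  shows "F t = F (t mod 2)"
  by (induction t rule: induct_nat_012) (simp_all add: assms)

lemma d_periodic: "d (Suc (Suc t)) = d t"
  by (simp add: fun_eq_iff d_def periodic)

lemma tw_periodic: "tw \<theta> (Suc (Suc t)) = tw \<theta> t"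
  by (simp add: fun_eq_iff tw_def d_periodic periodic)

lemma twi_periodic: "twi \<theta> (Suc (Suc t)) j h = twi \<theta> t j h"
  by (induction j arbitrary: t) (simp_all add: tw_periodic)

lemma v_periodic: "v (Suc (Suc t)) = v t" and s_periodic: "s (Suc (Suc t)) = s t"
  by (simp_all add: fun_eq_iff v_def s_def d_periodic periodic)

text \<open>Where the Poisson equation holds, \<open>u t x - f t x\<close> is the conditional mean
  of \<open>u (Suc t)\<close>; so \<open>d\<close> is centred and \<open>v\<close> is a conditional
  variance.\<close>

lemma conditional_moments:
  shows "AE x in M. integrable (\<kappa> t x) (d t x) \<and> integrable (\<kappa> t x) (\<lambda>y. (d t x y)\<^sup>2) \<and>
      (\<integral>y. d t x y \<partial>\<kappa> t x) = 0 \<and> v t x = kint (\<kappa> t) (\<lambda>y. (u (Suc t) y)\<^sup>2) x - (u t x - f t x)\<^sup>2"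
proof -
  interpret K: stationary_kernel M "\<kappa> t"
    by (rule stat)
  show ?thesis
    using K.integrable_K(1)[OF sq_int_square[OF u[of "Suc t"]]] K.integrable_K(1)[OF sq_int_integrable[OF u[of "Suc t"]]]
      AE_space poisson[of t]
  proof eventually_elim
    case (elim x)
    interpret Kx: prob_space "\<kappa> t x"
      using K.prob_space_K[OF elim(3)] .
    have e: "Kx.expectation (u (Suc t)) = u t x - f t x"
      using elim(4) by (simp add: kint_def)
    define p where "p = u t x - f t x"
    have d2: "(d t x y)\<^sup>2 = (u (Suc t) y)\<^sup>2 - 2 * p * u (Suc t) y + p\<^sup>2" for y
      unfolding d_def p_def[symmetric] by (simp add: power2_eq_square algebra_simps)
    have "v t x = kint (\<kappa> t) (\<lambda>y. (u (Suc t) y)\<^sup>2) x - p\<^sup>2"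
      unfolding v_def d2 using elim(1,2) e[folded p_def]
      by (simp add: Kx.prob_space kint_def mult.assoc power2_eq_square)
    then have veq: "v t x = kint (\<kappa> t) (\<lambda>y. (u (Suc t) y)\<^sup>2) x - (u t x - f t x)\<^sup>2"
      by (simp add: p_def)
    have "integrable (\<kappa> t x) (\<lambda>y. (d t x y)\<^sup>2)"
      unfolding d2 using elim(1,2) by simp
    then show ?case
      using veq elim(2) e by (simp add: d_def[abs_def] Kx.prob_space)
  qed
qed

lemma uf: "sq_int M (\<lambda>x. u t x - f t x)"
  by (rule sq_int_diff[OF u f])

lemma v_meas[measurable]: "v t \<in> borel_measurable M"
  unfolding v_def by (rule stationary_kernel.measurable_integral_K2[OF stat]) measurable

lemma v_int: "integrable M (v t)" and s_eq: "s t = (\<integral>x. (u (Suc t) x)\<^sup>2 \<partial>M) - (\<integral>x. (u t x - f t x)\<^sup>2 \<partial>M)"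
  and s_nonneg: "0 \<le> s t"
proof -
  interpret K: stationary_kernel M "\<kappa> t"
    by (rule stat)
  have eq: "AE x in M. v t x = kint (\<kappa> t) (\<lambda>y. (u (Suc t) y)\<^sup>2) x - (u t x - f t x)\<^sup>2"
    using conditional_moments[of t] by eventually_elim simp
  note i = K.integrable_K(2)[OF sq_int_square[OF u[of "Suc t"]]] sq_int_square[OF uf[of t]]
  note m = borel_measurable_integrable[OF i(1)] borel_measurable_integrable[OF i(2)]
  show "integrable M (v t)"
    by (rule integrable_cong_AE[THEN iffD2, OF _ _ eq]) (use m i in simp_all)
  have "s t = (\<integral>x. kint (\<kappa> t) (\<lambda>y. (u (Suc t) y)\<^sup>2) x - (u t x - f t x)\<^sup>2 \<partial>M)"
    unfolding s_def by (rule integral_cong_AE[OF _ _ eq]) (use m in simp_all)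
  then show "s t = (\<integral>x. (u (Suc t) x)\<^sup>2 \<partial>M) - (\<integral>x. (u t x - f t x)\<^sup>2 \<partial>M)"
    using i K.integral_kint[OF sq_int_square[OF u[of "Suc t"]]] by simp
  show "0 \<le> s t"
    by (simp add: s_def v_def)
qed

lemma bounded_integrable: "g \<in> borel_measurable M \<Longrightarrow> (\<And>x. cmod (g x) \<le> C) \<Longrightarrow> integrable M g"
  by (rule integrable_const_bound[where B = C]) auto

text \<open>The truncated third moment in the error of the second order expansion of a
  characteristic function. The minimum keeps it finite under second moments alone and still lets it
  vanish as \<theta> tends to 0.\<close>

definition rem :: "real \<Rightarrow> nat \<Rightarrow> real" where
  "rem \<theta> t = (\<integral>x. \<integral>y. min (6 * (d t x y)\<^sup>2) (\<bar>\<theta>\<bar> * \<bar>d t x y\<bar> ^ 3) \<partial>\<kappa> t x \<partial>M)"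

lemma integrable_cond_min:
  assumes "x \<in> space M" "integrable (\<kappa> t x) (\<lambda>y. (d t x y)\<^sup>2)"
  shows "integrable (\<kappa> t x) (\<lambda>y. min (6 * (d t x y)\<^sup>2) (\<bar>\<theta>\<bar> * \<bar>d t x y\<bar> ^ 3))"
proof (rule Bochner_Integration.integrable_bound)
  show "integrable (\<kappa> t x) (\<lambda>y. 6 * (d t x y)\<^sup>2)"
    using assms by simp
  show "(\<lambda>y. min (6 * (d t x y)\<^sup>2) (\<bar>\<theta>\<bar> * \<bar>d t x y\<bar> ^ 3)) \<in> borel_measurable (\<kappa> t x)"
    using d_cond[OF assms(1), of t] by measurable
  show "AE y in \<kappa> t x. norm (min (6 * (d t x y)\<^sup>2) (\<bar>\<theta>\<bar> * \<bar>d t x y\<bar> ^ 3)) \<le> norm (6 * (d t x y)\<^sup>2)"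
    by (intro AE_I2 norm_min_le) simp_all
qed

text \<open>Dominated convergence twice, with majorant 6 d^2 under the kernel and 6 v under
  \<open>M\<close>.\<close>

lemma rem_tendsto_0:
  assumes "\<theta> \<longlonglongrightarrow> 0"
  shows "(\<lambda>n. rem (\<theta> n) t) \<longlonglongrightarrow> 0"
proof -
  let ?m = "\<lambda>n x y. min (6 * (d t x y)\<^sup>2) (\<bar>\<theta> n\<bar> * \<bar>d t x y\<bar> ^ 3)"
  have m0: "0 \<le> ?m n x y" and m6: "?m n x y \<le> 6 * (d t x y)\<^sup>2" for n x y
    by simp_all
  have mm: "(\<lambda>x. \<integral>y. ?m n x y \<partial>\<kappa> t x) \<in> borel_measurable M" for n
    by (rule stationary_kernel.measurable_integral_K2[OF stat]) measurable
  have "(\<lambda>n. \<integral>x. (\<integral>y. ?m n x y \<partial>\<kappa> t x) \<partial>M) \<longlonglongrightarrow> (\<integral>x. 0 \<partial>M)"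
  proof (rule integral_dominated_convergence)
    show "integrable M (\<lambda>x. 6 * v t x)"
      using v_int by simp
    show "AE x in M. (\<lambda>n. \<integral>y. ?m n x y \<partial>\<kappa> t x) \<longlonglongrightarrow> 0"
      using conditional_moments[of t] AE_space
    proof eventually_elim
      case (elim x)
      have "(\<lambda>n. \<integral>y. ?m n x y \<partial>\<kappa> t x) \<longlonglongrightarrow> (\<integral>y. 0 \<partial>\<kappa> t x)"
      proof (rule integral_dominated_convergence)
        show "integrable (\<kappa> t x) (\<lambda>y. 6 * (d t x y)\<^sup>2)"
          using elim by simp
        show "AE y in \<kappa> t x. (\<lambda>n. ?m n x y) \<longlonglongrightarrow> 0"
        proof (rule AE_I2)
          fix y
          have "(\<lambda>n. ?m n x y) \<longlonglongrightarrow> min (6 * (d t x y)\<^sup>2) (\<bar>0\<bar> * \<bar>d t x y\<bar> ^ 3)"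
            by (intro tendsto_intros assms)
          then show "(\<lambda>n. ?m n x y) \<longlonglongrightarrow> 0"
            by simp
        qed
        show "AE y in \<kappa> t x. norm (?m n x y) \<le> 6 * (d t x y)\<^sup>2" for n
          by (rule AE_I2, rule order_trans[OF norm_min_le]) simp_all
        show "(\<lambda>y. ?m n x y) \<in> borel_measurable (\<kappa> t x)" for n
          using d_cond[OF elim(2)] by measurable
      qed simp
      then show ?case
        by simp
    qed
    show "AE x in M. norm (\<integral>y. ?m n x y \<partial>\<kappa> t x) \<le> 6 * v t x" for n
      using conditional_moments[of t] AE_space
    proof eventually_elim
      case (elim x)
      have "norm (\<integral>y. ?m n x y \<partial>\<kappa> t x) = (\<integral>y. ?m n x y \<partial>\<kappa> t x)"
        using m0 by (simp only: real_norm_def) (simp add: integral_nonneg_AE)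
      also have "\<dots> \<le> (\<integral>y. 6 * (d t x y)\<^sup>2 \<partial>\<kappa> t x)"
      proof (rule integral_mono)
        show "integrable (\<kappa> t x) (\<lambda>y. 6 * (d t x y)\<^sup>2)"
          using elim by simp
        show "integrable (\<kappa> t x) (\<lambda>y. ?m n x y)"
          using elim by (intro integrable_cond_min) auto
      qed simp
      finally show ?case
        by (simp add: v_def)
    qed
  qed (use mm in simp_all)
  then show ?thesis
    by (simp add: rem_def)
qed

text \<open>The second order expansion under each conditional law, integrated over \<open>M\<close>;
  the linear term is absent because \<open>d\<close> is centred.\<close>

lemma tw_one_expansion:
  "(\<integral>x. cmod (tw \<theta> t (\<lambda>_. 1) x - (1 - \<theta>\<^sup>2 * v t x / 2)) \<partial>M) \<le> \<theta>\<^sup>2 / 6 * rem \<theta> t"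
proof -
  interpret K: stationary_kernel M "\<kappa> t"
    by (rule stat)
  let ?m = "\<lambda>x y. min (6 * (d t x y)\<^sup>2) (\<bar>\<theta>\<bar> * \<bar>d t x y\<bar> ^ 3)"
  have mm: "(\<lambda>x. \<integral>y. ?m x y \<partial>\<kappa> t x) \<in> borel_measurable M"
    by (rule K.measurable_integral_K2) measurable
  have m0: "0 \<le> ?m x y" for x y
    by simp
  have bound: "AE x in M. cmod (tw \<theta> t (\<lambda>_. 1) x - (1 - \<theta>\<^sup>2 * v t x / 2)) \<le> \<theta>\<^sup>2 / 6 * (\<integral>y. ?m x y \<partial>\<kappa> t x) \<and>
      (\<integral>y. ?m x y \<partial>\<kappa> t x) \<le> 6 * v t x"
    using conditional_moments[of t] AE_space
  proof eventually_elim
    case (elim x)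
    interpret Kx: prob_space "\<kappa> t x"
      using K.prob_space_K[OF elim(2)] .
    have "char (distr (\<kappa> t x) borel (d t x)) \<theta> = tw \<theta> t (\<lambda>_. 1) x"
      using d_cond[OF elim(2)] by (simp add: char_def integral_distr tw_def)
    moreover have "cmod (char (distr (\<kappa> t x) borel (d t x)) \<theta> - (1 - \<theta>\<^sup>2 * v t x / 2))
        \<le> \<theta>\<^sup>2 / 6 * (\<integral>y. ?m x y \<partial>\<kappa> t x)"
      by (rule Kx.char_approx3') (use elim d_cond in \<open>auto simp: v_def\<close>)
    moreover have "(\<integral>y. ?m x y \<partial>\<kappa> t x) \<le> (\<integral>y. 6 * (d t x y)\<^sup>2 \<partial>\<kappa> t x)"
    proof (rule integral_mono)
      show "integrable (\<kappa> t x) (\<lambda>y. 6 * (d t x y)\<^sup>2)"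
        using elim by simp
      show "integrable (\<kappa> t x) (\<lambda>y. ?m x y)"
        using elim by (intro integrable_cond_min) auto
    qed simp
    ultimately show ?case
      by (simp add: v_def)
  qed
  have im: "integrable M (\<lambda>x. \<integral>y. ?m x y \<partial>\<kappa> t x)"
  proof (rule Bochner_Integration.integrable_bound)
    show "integrable M (\<lambda>x. 6 * v t x)"
      using v_int by simp
    show "AE x in M. norm (\<integral>y. ?m x y \<partial>\<kappa> t x) \<le> norm (6 * v t x)"
      using bound
    proof eventually_elim
      case (elim x)
      have "0 \<le> (\<integral>y. ?m x y \<partial>\<kappa> t x)"
        by (simp add: integral_nonneg_AE)
      then show ?case
        using elim by (simp only: real_norm_def) linarith
    qed
  qed (rule mm)
  have iv: "integrable M (\<lambda>x. complex_of_real (1 - \<theta>\<^sup>2 * v t x / 2))"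
    using v_int by (intro integrable_of_real) simp
  have "integrable M (tw \<theta> t (\<lambda>_. 1))"
    by (rule integrable_tw) simp
  then have "integrable M (\<lambda>x. cmod (tw \<theta> t (\<lambda>_. 1) x - (1 - \<theta>\<^sup>2 * v t x / 2)))"
    using iv by (intro integrable_norm Bochner_Integration.integrable_diff) simp_all
  then have "(\<integral>x. cmod (tw \<theta> t (\<lambda>_. 1) x - (1 - \<theta>\<^sup>2 * v t x / 2)) \<partial>M)
      \<le> (\<integral>x. \<theta>\<^sup>2 / 6 * (\<integral>y. ?m x y \<partial>\<kappa> t x) \<partial>M)"
    using im bound by (intro integral_mono_AE) auto
  then show ?thesis
    by (simp add: rem_def)
qed

end

text \<open>1 - y \<le> exp(- y) \<le> 1 / (1 + y) \<le> 1 - y + y^2.\<close>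

lemma exp_neg_bounds:
  assumes "0 \<le> (y::real)"
  shows "\<bar>(1 - y) - exp (- y)\<bar> \<le> y\<^sup>2"
proof -
  have "exp (- y) \<le> 1 / (1 + y)"
    using exp_ge_add_one_self[of y] assms by (simp add: exp_minus inverse_eq_divide frac_le)
  also have "\<dots> \<le> 1 - y + y\<^sup>2"
  proof -
    have "(1 - y + y\<^sup>2) * (1 + y) = 1 + y ^ 3"
      by (simp add: algebra_simps power2_eq_square power3_eq_cube)
    then show ?thesis
      using assms by (simp add: pos_divide_le_eq)
  qed
  finally show ?thesis
    using exp_ge_add_one_self[of "- y"] by simp
qed

lemma tendsto_0_sandwich:
  fixes a b :: "nat \<Rightarrow> real"
  assumes "\<And>n. 0 \<le> a n" "\<And>n. a n \<le> b n" "b \<longlonglongrightarrow> 0"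
  shows "a \<longlonglongrightarrow> 0"
  by (rule tendsto_sandwich[OF _ _ tendsto_const assms(3)]) (use assms in simp_all)

text \<open>The conditional characteristic function of the sum of n summands from time
  \<open>t\<close> on, given the state at that time. The recursion encodes the Markov property, so
  measures on paths do not enter until the chain itself appears.\<close>

primrec path_char :: "(nat \<Rightarrow> 'a \<Rightarrow> 'a measure) \<Rightarrow> (nat \<Rightarrow> 'a \<Rightarrow> real) \<Rightarrow> real \<Rightarrow> nat \<Rightarrow> nat \<Rightarrow> 'a \<Rightarrow> complex" where
  "path_char \<kappa> f \<theta> t 0 = (\<lambda>_. 1)"
| "path_char \<kappa> f \<theta> t (Suc n) = (\<lambda>x. iexp (\<theta> * f t x) * kint (\<kappa> t) (path_char \<kappa> f \<theta> (Suc t) n) x)"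

section \<open>Comparison with the Gaussian characteristic function\<close>

context poisson_chain
begin

lemma prob_\<kappa>: "prob_space (\<kappa> t x)"
  using stationary_kernel.prob_space_K[OF stat] space_M by simp

lemma twi_cong_AE:
  assumes "AE x in M. g x = h x" "integrable M g" "integrable M h"
  shows "AE x in M. twi \<theta> t j g x = twi \<theta> t j h x"
proof (induction j arbitrary: t)
  case (Suc j)
  show ?case
    using tw_cong_AE[OF Suc[of "Suc t"]] borel_measurable_integrable[OF integrable_twi(1)] assms(2,3) by simp
qed (use assms in simp)

lemma integrable_kiter:
  fixes h :: "'a \<Rightarrow> 'c::{banach, second_countable_topology}"
  assumes "integrable M h"
  shows "integrable M (kiter \<kappa> t m h)"
  by (induction m arbitrary: t) (simp_all add: assms stationary_kernel.integrable_K(2)[OF stat])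

lemma kiter_of_real: "kiter \<kappa> t m (\<lambda>x. complex_of_real (w x)) = (\<lambda>x. complex_of_real (kiter \<kappa> t m w x))"
  by (induction m arbitrary: t) (simp_all add: kint_def[abs_def])

lemma tw_tendsto:
  assumes h: "integrable M h" and \<theta>: "\<theta> \<longlonglongrightarrow> 0"
  shows "(\<lambda>n. L1 (\<lambda>x. tw (\<theta> n) t h x - kint (\<kappa> t) h x)) \<longlonglongrightarrow> 0"
proof -
  interpret K: stationary_kernel M "\<kappa> t"
    by (rule stat)
  note hm = borel_measurable_integrable[OF h]
  note [measurable] = hm
  have ih: "integrable M (\<lambda>x. cmod (h x))"
    using h by simp
  have "(\<lambda>n. \<integral>x. cmod (tw (\<theta> n) t h x - kint (\<kappa> t) h x) \<partial>M) \<longlonglongrightarrow> (\<integral>x. 0 \<partial>M)"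
  proof (rule integral_dominated_convergence)
    show "integrable M (\<lambda>x. 2 * kint (\<kappa> t) (\<lambda>y. cmod (h y)) x)"
      using K.integrable_K(2)[OF ih] by simp
    show "AE x in M. (\<lambda>n. cmod (tw (\<theta> n) t h x - kint (\<kappa> t) h x)) \<longlonglongrightarrow> 0"
      using K.integrable_K(1)[OF h] AE_space
    proof eventually_elim
      case (elim x)
      note [measurable] = d_cond[OF elim(2), of t] measurable_cond[OF elim(2) hm, of t]
      have "(\<lambda>n. tw (\<theta> n) t h x) \<longlonglongrightarrow> kint (\<kappa> t) h x"
        unfolding tw_def kint_def
      proof (rule integral_dominated_convergence)
        show "integrable (\<kappa> t x) (\<lambda>y. cmod (h y))"
          using elim by simp
        show "AE y in \<kappa> t x. (\<lambda>n. iexp (\<theta> n * d t x y) * h y) \<longlonglongrightarrow> h y"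
        proof (rule AE_I2)
          fix y
          have "(\<lambda>n. iexp (\<theta> n * d t x y) * h y) \<longlonglongrightarrow> iexp (0 * d t x y) * h y"
            by (intro tendsto_intros \<theta>)
          then show "(\<lambda>n. iexp (\<theta> n * d t x y) * h y) \<longlonglongrightarrow> h y"
            by simp
        qed
      qed (simp_all add: norm_mult)
      then show ?case
        by (simp add: tendsto_norm_zero LIM_zero)
    qed
    show "AE x in M. norm (cmod (tw (\<theta> n) t h x - kint (\<kappa> t) h x)) \<le> 2 * kint (\<kappa> t) (\<lambda>y. cmod (h y)) x" for n
      using tw_bound(2)[OF h, of "\<theta> n" t]
    proof eventually_elim
      case (elim x)
      have "cmod (tw (\<theta> n) t h x - kint (\<kappa> t) h x) \<le> cmod (tw (\<theta> n) t h x) + cmod (kint (\<kappa> t) h x)"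
        by (rule norm_triangle_ineq4)
      moreover have "cmod (kint (\<kappa> t) h x) \<le> kint (\<kappa> t) (\<lambda>y. cmod (h y)) x"
        unfolding kint_def by (rule integral_norm_bound)
      ultimately show ?case
        using elim by (simp only: real_norm_def abs_norm_cancel)
    qed
  qed (use K.measurable_kint[OF hm] in simp_all)
  then show ?thesis
    by (simp add: L1_def)
qed

text \<open>For a fixed number of factors the twist disappears as \<theta> tends to 0: the error
  already made passes through the next factor by L1 contraction, and \<open>tw_tendsto\<close>
  handles that factor.\<close>

lemma twi_tendsto:
  assumes h: "integrable M h" and \<theta>: "\<theta> \<longlonglongrightarrow> 0"
  shows "(\<lambda>n. L1 (\<lambda>x. twi (\<theta> n) t m h x - kiter \<kappa> t m h x)) \<longlonglongrightarrow> 0"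
proof (induction m arbitrary: t)
  case 0
  then show ?case
    by (simp add: L1_def)
next
  case (Suc m)
  let ?k = "kiter \<kappa> (Suc t) m h"
  let ?r = "\<lambda>n x. twi (\<theta> n) (Suc t) m h x - ?k x"
  have ik: "integrable M ?k" and ir: "integrable M (?r n)" for n
    using integrable_kiter[OF h] integrable_twi(1)[OF h] by simp_all
  show ?case
  proof (rule tendsto_0_sandwich)
    show "0 \<le> L1 (\<lambda>x. twi (\<theta> n) t (Suc m) h x - kiter \<kappa> t (Suc m) h x)" for n
      by (rule L1_nonneg)
    show "L1 (\<lambda>x. twi (\<theta> n) t (Suc m) h x - kiter \<kappa> t (Suc m) h x)
        \<le> L1 (?r n) + L1 (\<lambda>x. tw (\<theta> n) t ?k x - kint (\<kappa> t) ?k x)" for n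
    proof -
      have i: "integrable M (tw (\<theta> n) t (?r n))" "integrable M (\<lambda>x. tw (\<theta> n) t ?k x - kint (\<kappa> t) ?k x)"
        using integrable_tw(1)[OF ir] integrable_tw(1)[OF ik] stationary_kernel.integrable_K(2)[OF stat ik] by simp_all
      have "AE x in M. tw (\<theta> n) t (\<lambda>x. ?r n x + ?k x) x = tw (\<theta> n) t (?r n) x + tw (\<theta> n) t ?k x"
        by (rule tw_add[OF ir ik])
      then have "AE x in M. twi (\<theta> n) t (Suc m) h x - kiter \<kappa> t (Suc m) h x
          = tw (\<theta> n) t (?r n) x + (tw (\<theta> n) t ?k x - kint (\<kappa> t) ?k x)"
        by eventually_elim simp
      then have "L1 (\<lambda>x. twi (\<theta> n) t (Suc m) h x - kiter \<kappa> t (Suc m) h x)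
          = L1 (\<lambda>x. tw (\<theta> n) t (?r n) x + (tw (\<theta> n) t ?k x - kint (\<kappa> t) ?k x))"
        by (rule L1_cong_AE)
          (use borel_measurable_integrable[OF integrable_twi(1)[OF h]] borel_measurable_integrable[OF integrable_kiter[OF h]]
            borel_measurable_integrable[OF i(1)] borel_measurable_integrable[OF i(2)] in \<open>simp_all del: twi.simps kiter.simps\<close>)
      also have "\<dots> \<le> L1 (tw (\<theta> n) t (?r n)) + L1 (\<lambda>x. tw (\<theta> n) t ?k x - kint (\<kappa> t) ?k x)"
        by (rule L1_add[OF i])
      finally show ?thesis
        using integrable_tw(2)[OF ir, of "\<theta> n" t n] by simp
    qed
    show "(\<lambda>n. L1 (?r n) + L1 (\<lambda>x. tw (\<theta> n) t ?k x - kint (\<kappa> t) ?k x)) \<longlonglongrightarrow> 0"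
      using tendsto_add[OF Suc[of "Suc t"] tw_tendsto[OF ik \<theta>, of t]] by simp
  qed
qed

text \<open>The value of the twisted product if every increment were Gaussian with constant
  conditional variance \<open>s\<close>.\<close>

definition alpha :: "real \<Rightarrow> nat \<Rightarrow> nat \<Rightarrow> real" where
  "alpha \<theta> t n = exp (- (\<theta>\<^sup>2 / 2) * (\<Sum>j<n. s (t + j)))"

text \<open>The defect of one factor against its Gaussian value. Its leading part is - \<theta>^2 /
  2 times the centred conditional variance, so in general it is of order \<theta>^2 and no
  smaller.\<close>

definition w :: "real \<Rightarrow> nat \<Rightarrow> 'a \<Rightarrow> complex" where
  "w \<theta> t x = tw \<theta> t (\<lambda>_. 1) x - exp (- (\<theta>\<^sup>2 / 2) * s t)"

lemma alpha_Suc: "alpha \<theta> t (Suc n) = exp (- (\<theta>\<^sup>2 / 2) * s t) * alpha \<theta> (Suc t) n"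
  by (simp add: alpha_def sum.lessThan_Suc_shift exp_add[symmetric] algebra_simps del: sum.lessThan_Suc)

lemma alpha_bounds: "0 \<le> alpha \<theta> t n" "alpha \<theta> t n \<le> 1"
  using s_nonneg by (auto simp: alpha_def intro!: sum_nonneg mult_nonneg_nonneg)

lemma integrable_w: "integrable M (w \<theta> t)"
  unfolding w_def[abs_def] using integrable_tw(1)[of "\<lambda>_. 1" \<theta> t] by simp

text \<open>In the j-th term twisted kernels stand before the defect; behind it stand Gaussian
  values, which are constants of size at most 1 and factor out. The prefix of length
  \<open>i\<close> is carried along so that the induction can peel factors off at the left.\<close>

lemma telescoping_bound:
  "L1 (twi \<theta> t i (\<lambda>x. twi \<theta> (t + i) n (\<lambda>_. 1) x - alpha \<theta> (t + i) n))
    \<le> (\<Sum>j<n. L1 (twi \<theta> t (i + j) (w \<theta> (t + i + j))))"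
proof (induction n arbitrary: i)
  case 0
  have "twi \<theta> t i (\<lambda>x. 0 * 0) = (\<lambda>x. 0)"
    by (subst twi_cmult) simp
  then show ?case
    by (simp add: alpha_def L1_def)
next
  case (Suc n)
  define D where "D x = twi \<theta> (t + Suc i) n (\<lambda>_. 1) x - alpha \<theta> (t + Suc i) n" for x
  define a where "a = alpha \<theta> (t + Suc i) n"
  have iD: "integrable M D"
    unfolding D_def using integrable_twi(1)[of "\<lambda>_. 1"] by simp
  have ia: "integrable M (\<lambda>x. complex_of_real a * w \<theta> (t + i) x)"
    using integrable_w by simp
  have "AE x in M. tw \<theta> (t + i) (\<lambda>x. D x + a) x = tw \<theta> (t + i) D x + tw \<theta> (t + i) (\<lambda>_. a) x"
    by (rule tw_add[OF iD]) simp
  moreover have "tw \<theta> (t + i) (\<lambda>_. complex_of_real a) = (\<lambda>x. a * tw \<theta> (t + i) (\<lambda>_. 1) x)"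
    using tw_cmult[of \<theta> "t + i" "complex_of_real a" "\<lambda>_. 1"] by simp
  ultimately have "AE x in M. twi \<theta> (t + i) (Suc n) (\<lambda>_. 1) x - alpha \<theta> (t + i) (Suc n)
      = tw \<theta> (t + i) D x + a * w \<theta> (t + i) x"
    by (elim eventually_mono) (simp add: D_def a_def w_def alpha_Suc algebra_simps)
  then have "AE x in M. twi \<theta> t i (\<lambda>x. twi \<theta> (t + i) (Suc n) (\<lambda>_. 1) x - alpha \<theta> (t + i) (Suc n)) x
      = twi \<theta> t i (\<lambda>x. tw \<theta> (t + i) D x + a * w \<theta> (t + i) x) x"
    by (rule twi_cong_AE)
      (use integrable_twi(1)[of "\<lambda>_. 1" \<theta> "t + i" "Suc n"] integrable_tw(1)[OF iD, of \<theta> "t + i"] ia in simp_all)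
  moreover have "AE x in M. twi \<theta> t i (\<lambda>x. tw \<theta> (t + i) D x + a * w \<theta> (t + i) x) x
      = twi \<theta> t i (tw \<theta> (t + i) D) x + twi \<theta> t i (\<lambda>x. a * w \<theta> (t + i) x) x"
    by (rule twi_add[OF integrable_tw(1)[OF iD] ia])
  ultimately have eq: "AE x in M. twi \<theta> t i (\<lambda>x. twi \<theta> (t + i) (Suc n) (\<lambda>_. 1) x - alpha \<theta> (t + i) (Suc n)) x
      = twi \<theta> t (Suc i) D x + a * twi \<theta> t i (w \<theta> (t + i)) x"
    unfolding twi_snoc twi_cmult by eventually_elim simp
  have i1: "integrable M (twi \<theta> t (Suc i) D)" "integrable M (\<lambda>x. complex_of_real a * twi \<theta> t i (w \<theta> (t + i)) x)"
    using integrable_twi(1)[OF iD] integrable_twi(1)[OF integrable_w] by (simp_all del: twi.simps)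
  have i2: "integrable M (\<lambda>x. twi \<theta> (t + i) (Suc n) (\<lambda>_. 1) x - alpha \<theta> (t + i) (Suc n))"
    using integrable_twi(1)[of "\<lambda>_. 1"] by (simp del: twi.simps)
  have "L1 (twi \<theta> t i (\<lambda>x. twi \<theta> (t + i) (Suc n) (\<lambda>_. 1) x - alpha \<theta> (t + i) (Suc n)))
      = L1 (\<lambda>x. twi \<theta> t (Suc i) D x + a * twi \<theta> t i (w \<theta> (t + i)) x)"
    by (rule L1_cong_AE[OF eq])
      (use borel_measurable_integrable[OF integrable_twi(1)[OF i2]] borel_measurable_integrable[OF i1(1)]
        borel_measurable_integrable[OF i1(2)] in \<open>simp_all del: twi.simps\<close>)
  also have "\<dots> \<le> L1 (twi \<theta> t (Suc i) D) + cmod (complex_of_real a) * L1 (twi \<theta> t i (w \<theta> (t + i)))"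
    using L1_add[OF i1] by (simp add: L1_cmult)
  also have "\<dots> \<le> (\<Sum>j<n. L1 (twi \<theta> t (Suc i + j) (w \<theta> (t + Suc i + j)))) + 1 * L1 (twi \<theta> t i (w \<theta> (t + i)))"
  proof (intro add_mono mult_right_mono L1_nonneg)
    show "L1 (twi \<theta> t (Suc i) D) \<le> (\<Sum>j<n. L1 (twi \<theta> t (Suc i + j) (w \<theta> (t + Suc i + j))))"
      unfolding D_def by (rule Suc)
    show "cmod (complex_of_real a) \<le> 1"
      using alpha_bounds[of \<theta> "t + Suc i" n] by (simp add: a_def)
  qed
  also have "\<dots> = (\<Sum>j<Suc n. L1 (twi \<theta> t (i + j) (w \<theta> (t + i + j))))"
    by (simp add: sum.lessThan_Suc_shift del: sum.lessThan_Suc)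
  finally show ?case .
qed

definition V :: "nat \<Rightarrow> 'a \<Rightarrow> complex" where
  "V t x = complex_of_real (v t x - s t)"

text \<open>Bounds what a defect leaves after its leading part: the truncated third moment and the
  error in exp(- y) against 1 - y. Both are of smaller order than \<theta>^2.\<close>

definition \<delta> :: "real \<Rightarrow> nat \<Rightarrow> real" where
  "\<delta> \<theta> t = \<theta>\<^sup>2 / 6 * rem \<theta> t + (\<theta>\<^sup>2 / 2 * s t)\<^sup>2"

lemma integrable_V: "integrable M (V t)"
  unfolding V_def[abs_def] using v_int[of t] by (intro integrable_of_real) simp

lemma w_expansion: "L1 (\<lambda>x. w \<theta> t x + complex_of_real (\<theta>\<^sup>2 / 2) * V t x) \<le> \<delta> \<theta> t"
proof -
  let ?y = "\<theta>\<^sup>2 / 2 * s t"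
  have eq: "w \<theta> t x + complex_of_real (\<theta>\<^sup>2 / 2) * V t x
      = (tw \<theta> t (\<lambda>_. 1) x - (1 - \<theta>\<^sup>2 * v t x / 2)) + complex_of_real ((1 - ?y) - exp (- ?y))" for x
    by (simp add: w_def V_def algebra_simps)
  have "integrable M (tw \<theta> t (\<lambda>_. 1))"
    by (rule integrable_tw) simp
  then have i: "integrable M (\<lambda>x. tw \<theta> t (\<lambda>_. 1) x - complex_of_real (1 - \<theta>\<^sup>2 * v t x / 2))"
    using v_int by (intro Bochner_Integration.integrable_diff integrable_of_real) simp_all
  have "L1 (\<lambda>x. w \<theta> t x + complex_of_real (\<theta>\<^sup>2 / 2) * V t x)
      \<le> L1 (\<lambda>x. tw \<theta> t (\<lambda>_. 1) x - (1 - \<theta>\<^sup>2 * v t x / 2)) + L1 (\<lambda>x. complex_of_real ((1 - ?y) - exp (- ?y)))"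
    unfolding eq by (rule L1_add[OF i]) simp
  also have "L1 (\<lambda>x. complex_of_real ((1 - ?y) - exp (- ?y))) = \<bar>(1 - ?y) - exp (- ?y)\<bar>"
    unfolding L1_def norm_of_real by (simp add: prob_space)
  also have "\<dots> \<le> ?y\<^sup>2"
    by (rule exp_neg_bounds) (simp add: s_nonneg)
  finally show ?thesis
    using tw_one_expansion[of \<theta> t] by (simp add: \<delta>_def L1_def)
qed

text \<open>The leading part has \<open>m\<close> twisted kernels in front. Untwisting them costs
  little for fixed \<open>m\<close> and small \<theta>, and the untwisted ones make the centred
  function small by mixing.\<close>

lemma twi_w_bound:
  "L1 (twi \<theta> t m (w \<theta> r)) \<le> \<delta> \<theta> r + \<theta>\<^sup>2 / 2 * (L1 (\<lambda>x. twi \<theta> t m (V r) x - kiter \<kappa> t m (V r) x) + L1 (kiter \<kappa> t m (V r)))"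
proof -
  let ?g = "\<lambda>x. w \<theta> r x + complex_of_real (\<theta>\<^sup>2 / 2) * V r x"
  let ?h = "\<lambda>x. complex_of_real (- (\<theta>\<^sup>2 / 2)) * V r x"
  have i: "integrable M ?g" "integrable M ?h"
    using integrable_w integrable_V by simp_all
  have gh: "(\<lambda>x. ?g x + ?h x) = w \<theta> r"
    by (simp add: fun_eq_iff)
  have "AE x in M. twi \<theta> t m (w \<theta> r) x = twi \<theta> t m ?g x + twi \<theta> t m ?h x"
    using twi_add[OF i, of \<theta> t m] unfolding gh .
  then have "L1 (twi \<theta> t m (w \<theta> r)) = L1 (\<lambda>x. twi \<theta> t m ?g x + twi \<theta> t m ?h x)"
    by (rule L1_cong_AE)
      (use borel_measurable_integrable[OF integrable_twi(1)[OF integrable_w]] borel_measurable_integrable[OF integrable_twi(1)[OF i(1)]]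
        borel_measurable_integrable[OF integrable_twi(1)[OF i(2)]] in simp_all)
  also have "\<dots> \<le> L1 (twi \<theta> t m ?g) + L1 (twi \<theta> t m ?h)"
    by (rule L1_add[OF integrable_twi(1)[OF i(1)] integrable_twi(1)[OF i(2)]])
  also have "L1 (twi \<theta> t m ?g) \<le> \<delta> \<theta> r"
    using integrable_twi(2)[OF i(1)] w_expansion order_trans by blast
  also have "L1 (twi \<theta> t m ?h) = \<theta>\<^sup>2 / 2 * L1 (twi \<theta> t m (V r))"
    unfolding twi_cmult L1_cmult by (simp add: norm_mult norm_power)
  also have "L1 (twi \<theta> t m (V r)) \<le> L1 (\<lambda>x. twi \<theta> t m (V r) x - kiter \<kappa> t m (V r) x) + L1 (kiter \<kappa> t m (V r))"
    using L1_add[of "\<lambda>x. twi \<theta> t m (V r) x - kiter \<kappa> t m (V r) x" "kiter \<kappa> t m (V r)"]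
      integrable_twi(1)[OF integrable_V] integrable_kiter[OF integrable_V] by simp
  finally show ?thesis
    by (simp add: mult_left_mono)
qed

lemma w_periodic: "w \<theta> (Suc (Suc t)) = w \<theta> t" and V_periodic: "V (Suc (Suc t)) = V t"
  by (simp_all add: fun_eq_iff w_def V_def tw_periodic s_periodic v_periodic)

text \<open>Reduces a bound at all times to the two phases; the sum stands in for the
  maximum.\<close>

lemma mod_2_le:
  fixes F :: "nat \<Rightarrow> real"
  assumes "\<And>t. F (Suc (Suc t)) = F t" "\<And>t. 0 \<le> F t"
  shows "F t \<le> F 0 + F 1"
proof -
  have "F t = F (t mod 2)"
    by (rule two_periodic) (rule assms)
  moreover have "t mod 2 = 0 \<or> t mod 2 = 1"
    by auto
  ultimately show ?thesis
    using assms(2)[of 0] assms(2)[of 1] by auto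
qed

text \<open>Each of the n defects has order 1/n, so \<open>m\<close> is fixed first, by mixing, and
  n grows afterwards. The first \<open>m\<close> terms are few; in every later term only the
  \<open>m\<close> twisted kernels nearest to the defect are kept, the others being dropped by L1
  contraction.\<close>

theorem twi_limit:
  assumes S: "(\<lambda>n. real n * (\<theta> n)\<^sup>2) \<longlonglongrightarrow> S" and \<theta>: "\<theta> \<longlonglongrightarrow> 0"
  shows "(\<lambda>n. L1 (\<lambda>x. twi (\<theta> n) 0 n (\<lambda>_. 1) x - alpha (\<theta> n) 0 n)) \<longlonglongrightarrow> 0"
proof -
  \<comment> \<open>This is n times the bound of \<open>twi_w_bound\<close>. As n \<theta>^2 tends
    to \<open>S\<close>, it converges to S / 2 times the mixing error.\<close>
  define G where "G m t r n = real n * \<delta> (\<theta> n) r + real n * (\<theta> n)\<^sup>2 / 2 *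
      (L1 (\<lambda>x. twi (\<theta> n) t m (V r) x - kiter \<kappa> t m (V r) x) + L1 (kiter \<kappa> t m (V r)))" for m t r n
  have n\<delta>: "(\<lambda>n. real n * \<delta> (\<theta> n) r) \<longlonglongrightarrow> 0" for r
  proof -
    have "(\<lambda>n. (real n * (\<theta> n)\<^sup>2) * (rem (\<theta> n) r / 6 + (\<theta> n)\<^sup>2 * (s r)\<^sup>2 / 4)) \<longlonglongrightarrow> S * (0 / 6 + 0\<^sup>2 * (s r)\<^sup>2 / 4)"
      by (intro tendsto_intros S rem_tendsto_0 \<theta>) simp_all
    then show ?thesis
      by (simp add: \<delta>_def power2_eq_square algebra_simps)
  qed
  have G: "G m t r \<longlonglongrightarrow> S / 2 * L1 (kiter \<kappa> t m (V r))" for m t r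
  proof -
    have "G m t r \<longlonglongrightarrow> 0 + S / 2 * (0 + L1 (kiter \<kappa> t m (V r)))"
      unfolding G_def[abs_def] by (intro tendsto_intros S n\<delta> twi_tendsto integrable_V \<theta>) simp_all
    then show ?thesis
      by simp
  qed
  have G_bound: "real n * L1 (twi (\<theta> n) t m (w (\<theta> n) r)) \<le> G m t r n" for m t r n
    using mult_left_mono[OF twi_w_bound[of "\<theta> n" t m r], of "real n"] by (simp add: G_def algebra_simps)
  have lim: "(\<lambda>n. inverse (real n) * G 0 0 r n) \<longlonglongrightarrow> 0" for r
    using tendsto_mult[OF lim_inverse_n G[of 0 0 r]] by simp
  have Lw0: "(\<lambda>n. L1 (w (\<theta> n) r)) \<longlonglongrightarrow> 0" for r
  proof (rule tendsto_0_le[OF lim[of r], where K = 1])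
    show "\<forall>\<^sub>F n in sequentially. norm (L1 (w (\<theta> n) r)) \<le> norm (inverse (real n) * G 0 0 r n) * 1"
      using eventually_gt_at_top[of 0]
    proof eventually_elim
      case (elim n)
      have "L1 (w (\<theta> n) r) \<le> inverse (real n) * G 0 0 r n"
        using G_bound[of n 0 0 r] elim by (simp add: field_simps)
      then show ?case
        using L1_nonneg[of "w (\<theta> n) r"] by simp
    qed
  qed
  have mix: "(\<lambda>m. L1 (kiter \<kappa> t m (V r))) \<longlonglongrightarrow> 0" for t r
  proof -
    have "(\<lambda>m. \<integral>x. \<bar>kiter \<kappa> t m (\<lambda>x. v r x - s r) x\<bar> \<partial>M) \<longlonglongrightarrow> 0"
      by (rule mixing) (use v_int in \<open>simp_all add: s_def prob_space\<close>)
    then show ?thesis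
      unfolding V_def[abs_def] kiter_of_real L1_def by simp
  qed
  show ?thesis
  proof (rule LIMSEQ_I)
    fix e :: real assume e: "0 < e"
    \<comment> \<open>The four terms are the parities of the time at which the last m kernels start
      and of the time of the defect; periodicity reduces all other cases to these.\<close>
    define H where "H m = (L1 (kiter \<kappa> 0 m (V 0)) + L1 (kiter \<kappa> 0 m (V 1))) + (L1 (kiter \<kappa> 1 m (V 0)) + L1 (kiter \<kappa> 1 m (V 1)))" for m
    have "(\<lambda>m. S / 2 * H m) \<longlonglongrightarrow> S / 2 * ((0 + 0) + (0 + 0))"
      unfolding H_def by (intro tendsto_intros mix)
    then have "\<forall>\<^sub>F m in sequentially. S / 2 * H m < e"
      using e by (intro order_tendstoD(2)) simp_all
    then obtain m where m: "S / 2 * H m < e"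
      by (auto simp: eventually_sequentially)
    let ?T = "\<lambda>n. (real m * (L1 (w (\<theta> n) 0) + L1 (w (\<theta> n) 1)) +
      ((G m 0 0 n + G m 0 1 n) + (G m 1 0 n + G m 1 1 n)))"
    have bound: "L1 (\<lambda>x. twi (\<theta> n) 0 n (\<lambda>_. 1) x - alpha (\<theta> n) 0 n) \<le> ?T n" for n
    proof -
      define Lw where "Lw = L1 (w (\<theta> n) 0) + L1 (w (\<theta> n) 1)"
      define F where "F t r = L1 (twi (\<theta> n) t m (w (\<theta> n) r))" for t r
      define E where "E = (F 0 0 + F 0 1) + (F 1 0 + F 1 1)"
      have F0: "0 \<le> F t r" for t r
        by (simp add: F_def L1_nonneg)
      have Fle: "F t r \<le> E" for t r
      proof -
        have "F t r \<le> F 0 r + F 1 r"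
          by (rule mod_2_le[of "\<lambda>t. F t r"]) (simp_all add: F_def twi_periodic L1_nonneg)
        moreover have "F t r \<le> F t 0 + F t 1" for t
          by (rule mod_2_le[of "F t"]) (simp_all add: F_def w_periodic L1_nonneg)
        ultimately show ?thesis
          unfolding E_def by (meson add_mono order_trans)
      qed
      have Lw_pos: "0 \<le> Lw"
        by (simp add: Lw_def L1_nonneg)
      have summand_le: "L1 (twi (\<theta> n) 0 j (w (\<theta> n) j)) \<le> (if j < m then Lw else 0) + E" for j
      proof (cases "j < m")
        case True
        have "L1 (twi (\<theta> n) 0 j (w (\<theta> n) j)) \<le> L1 (w (\<theta> n) j)"
          by (rule integrable_twi(2)[OF integrable_w])
        also have "\<dots> \<le> Lw"
          unfolding Lw_def by (rule mod_2_le[of "\<lambda>j. L1 (w (\<theta> n) j)"]) (simp_all add: w_periodic L1_nonneg)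
        finally show ?thesis
          using True F0 by (simp add: E_def add_nonneg_nonneg add_increasing2)
      next
        case False
        then have "j = (j - m) + m"
          by simp
        then have "L1 (twi (\<theta> n) 0 j (w (\<theta> n) j)) = L1 (twi (\<theta> n) 0 (j - m) (twi (\<theta> n) (j - m) m (w (\<theta> n) j)))"
          using twi_append[of "\<theta> n" 0 "j - m" m] by simp
        also have "\<dots> \<le> F (j - m) j"
          unfolding F_def by (rule integrable_twi(2)[OF integrable_twi(1)[OF integrable_w]])
        finally show ?thesis
          using False Fle[of "j - m" j] by simp
      qed
      have "L1 (\<lambda>x. twi (\<theta> n) 0 n (\<lambda>_. 1) x - alpha (\<theta> n) 0 n) \<le> (\<Sum>j<n. L1 (twi (\<theta> n) 0 j (w (\<theta> n) j)))"
        using telescoping_bound[of "\<theta> n" 0 0 n] by simp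
      also have "\<dots> \<le> (\<Sum>j<n. (if j < m then Lw else 0) + E)"
        by (rule sum_mono) (rule summand_le)
      also have "\<dots> = real (card ({..<n} \<inter> {j. j < m})) * Lw + real n * E"
        by (simp add: sum.distrib sum.If_cases)
      also have "\<dots> \<le> real m * Lw + real n * E"
      proof (intro add_right_mono mult_right_mono Lw_pos)
        have "card ({..<n} \<inter> {j. j < m}) \<le> card {..<m}"
          by (intro card_mono) auto
        then show "real (card ({..<n} \<inter> {j. j < m})) \<le> real m"
          by simp
      qed
      also have "real n * E \<le> (G m 0 0 n + G m 0 1 n) + (G m 1 0 n + G m 1 1 n)"
        unfolding E_def F_def distrib_left by (intro add_mono G_bound)
      finally show ?thesis
        by (simp add: Lw_def)
    qed
    have "?T \<longlonglongrightarrow> real m * (0 + 0) + ((S / 2 * L1 (kiter \<kappa> 0 m (V 0)) + S / 2 * L1 (kiter \<kappa> 0 m (V 1))) +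
        (S / 2 * L1 (kiter \<kappa> 1 m (V 0)) + S / 2 * L1 (kiter \<kappa> 1 m (V 1))))"
      by (intro tendsto_intros Lw0 G)
    also have "real m * (0 + 0) + ((S / 2 * L1 (kiter \<kappa> 0 m (V 0)) + S / 2 * L1 (kiter \<kappa> 0 m (V 1))) +
        (S / 2 * L1 (kiter \<kappa> 1 m (V 0)) + S / 2 * L1 (kiter \<kappa> 1 m (V 1)))) = S / 2 * H m"
      by (simp add: H_def algebra_simps)
    finally have "\<forall>\<^sub>F n in sequentially. ?T n < e"
      using m by (rule order_tendstoD(2))
    then obtain N where "\<forall>n\<ge>N. ?T n < e"
      by (auto simp: eventually_sequentially)
    then have "norm (L1 (\<lambda>x. twi (\<theta> n) 0 n (\<lambda>_. 1) x - alpha (\<theta> n) 0 n) - 0) < e" if "n \<ge> N" for n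
      using that bound[of n] L1_nonneg[of "\<lambda>x. twi (\<theta> n) 0 n (\<lambda>_. 1) x - alpha (\<theta> n) 0 n"] by fastforce
    then show "\<exists>N. \<forall>n\<ge>N. norm (L1 (\<lambda>x. twi (\<theta> n) 0 n (\<lambda>_. 1) x - alpha (\<theta> n) 0 n) - 0) < e"
      by blast
  qed
qed

end

lemma path_char_measurable:
  assumes "\<And>t. stationary_kernel M (\<kappa> t)" "\<And>t. f t \<in> borel_measurable M"
  shows "path_char \<kappa> f \<theta> t n \<in> borel_measurable M"
proof (induction n arbitrary: t)
  case (Suc n)
  note [measurable] = assms(2) stationary_kernel.measurable_kint[OF assms(1) Suc]
  show ?case
    by simp
qed simp

lemma path_char_bound:
  assumes "\<And>t x. prob_space (\<kappa> t x)"
  shows "cmod (path_char \<kappa> f \<theta> t n x) \<le> 1"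
proof (induction n arbitrary: t x)
  case (Suc n)
  then show ?case
    using prob_space.norm_integral_le[OF assms, of "path_char \<kappa> f \<theta> (Suc t) n" 1]
    by (simp add: norm_mult kint_def)
qed simp

section \<open>From the martingale back to the sums\<close>

context poisson_chain
begin

text \<open>Multiplication by exp(i \<theta> u) turns twisted kernels into the path recursion, since
  u t x + d t x y = f t x + u (t + 1) y. Only the terminal value, where the recursion starts from 1,
  leaves an error, and L1 contraction carries it back.\<close>

lemma path_char_close:
  "L1 (\<lambda>x. iexp (\<theta> * u t x) * twi \<theta> t n (\<lambda>_. 1) x - path_char \<kappa> f \<theta> t n x)
    \<le> L1 (\<lambda>x. iexp (\<theta> * u (t + n) x) - 1)"
proof (induction n arbitrary: t)
  case 0
  then show ?case
    by simp
next
  case (Suc n)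
  interpret K: stationary_kernel M "\<kappa> t"
    by (rule stat)
  let ?A = "\<lambda>x. iexp (\<theta> * u (Suc t) x) * twi \<theta> (Suc t) n (\<lambda>_. 1) x"
  let ?B = "path_char \<kappa> f \<theta> (Suc t) n"
  have B_meas: "?B \<in> borel_measurable M"
    by (rule path_char_measurable[OF stat f_meas])
  have iB: "integrable M ?B"
    by (rule bounded_integrable[OF B_meas path_char_bound[OF prob_\<kappa>]])
  have it: "integrable M (twi \<theta> (Suc t) n (\<lambda>_. 1))"
    by (rule integrable_twi) simp
  note [measurable] = borel_measurable_integrable[OF it]
  have iA: "integrable M ?A"
    by (rule Bochner_Integration.integrable_bound[OF it]) (simp_all add: norm_mult)
  have eq: "iexp (\<theta> * u t x) * twi \<theta> t (Suc n) (\<lambda>_. 1) x = iexp (\<theta> * f t x) * kint (\<kappa> t) ?A x" for x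
  proof -
    have "iexp (\<theta> * u t x) * (iexp (\<theta> * d t x y) * h) = iexp (\<theta> * f t x) * (iexp (\<theta> * u (Suc t) y) * h)" for y h
      by (simp add: d_def mult.assoc[symmetric] exp_add[symmetric]) (simp add: algebra_simps)
    note shift = this
    have "iexp (\<theta> * u t x) * twi \<theta> t (Suc n) (\<lambda>_. 1) x
        = (CLINT y|\<kappa> t x. iexp (\<theta> * u t x) * (iexp (\<theta> * d t x y) * twi \<theta> (Suc t) n (\<lambda>_. 1) y))"
      unfolding twi.simps tw_def by (rule integral_mult_right_zero[symmetric])
    also have "\<dots> = (CLINT y|\<kappa> t x. iexp (\<theta> * f t x) * ?A y)"
      unfolding shift ..
    also have "\<dots> = iexp (\<theta> * f t x) * kint (\<kappa> t) ?A x"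
      unfolding kint_def by (rule integral_mult_right_zero)
    finally show ?thesis .
  qed
  have "AE x in M. kint (\<kappa> t) (\<lambda>x. ?A x - ?B x) x = kint (\<kappa> t) ?A x - kint (\<kappa> t) ?B x"
    by (rule K.kint_diff[OF iA iB])
  then have ae: "AE x in M. cmod (iexp (\<theta> * u t x) * twi \<theta> t (Suc n) (\<lambda>_. 1) x - path_char \<kappa> f \<theta> t (Suc n) x)
      = norm (kint (\<kappa> t) (\<lambda>x. ?A x - ?B x) x)"
    unfolding eq
    by eventually_elim (simp add: right_diff_distrib[symmetric] norm_mult)
  have m1: "(\<lambda>x. iexp (\<theta> * u t x) * twi \<theta> t (Suc n) (\<lambda>_. 1) x) \<in> borel_measurable M"
    using borel_measurable_integrable[OF integrable_twi(1)[of "\<lambda>_. 1" \<theta> t "Suc n"]] by (simp del: twi.simps)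
  have m2: "path_char \<kappa> f \<theta> t (Suc n) \<in> borel_measurable M"
    by (rule path_char_measurable[OF stat f_meas])
  have iAB: "integrable M (\<lambda>x. ?A x - ?B x)"
    using iA iB by simp
  note m3 = borel_measurable_integrable[OF K.integrable_K(2)[OF iAB]]
  have "L1 (\<lambda>x. iexp (\<theta> * u t x) * twi \<theta> t (Suc n) (\<lambda>_. 1) x - path_char \<kappa> f \<theta> t (Suc n) x)
      = (\<integral>x. norm (kint (\<kappa> t) (\<lambda>x. ?A x - ?B x) x) \<partial>M)"
    unfolding L1_def
    by (rule integral_cong_AE[OF measurable_compose[OF borel_measurable_diff[OF m1 m2] borel_measurable_norm]
          measurable_compose[OF m3 borel_measurable_norm] ae])
  also have "\<dots> \<le> (\<integral>x. norm (?A x - ?B x) \<partial>M)"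
    by (rule K.integrable_K(3)[OF iAB])
  also have "\<dots> \<le> L1 (\<lambda>x. iexp (\<theta> * u (t + Suc n) x) - 1)"
    using Suc[of "Suc t"] by (simp add: L1_def)
  finally show ?case .
qed

lemma iexp_u_tendsto:
  assumes "\<theta> \<longlonglongrightarrow> 0"
  shows "(\<lambda>n. L1 (\<lambda>x. iexp (\<theta> n * u t x) - 1)) \<longlonglongrightarrow> 0"
proof -
  have "(\<lambda>n. \<integral>x. cmod (iexp (\<theta> n * u t x) - 1) \<partial>M) \<longlonglongrightarrow> (\<integral>x. 0 \<partial>M)"
  proof (rule integral_dominated_convergence)
    show "AE x in M. (\<lambda>n. cmod (iexp (\<theta> n * u t x) - 1)) \<longlonglongrightarrow> 0"
    proof (rule AE_I2)
      fix x
      have "(\<lambda>n. cmod (iexp (\<theta> n * u t x) - 1)) \<longlonglongrightarrow> cmod (iexp (0 * u t x) - 1)"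
        by (intro tendsto_intros assms)
      then show "(\<lambda>n. cmod (iexp (\<theta> n * u t x) - 1)) \<longlonglongrightarrow> 0"
        by simp
    qed
    show "AE x in M. norm (cmod (iexp (\<theta> n * u t x) - 1)) \<le> 2" for n
      using cmod_iexp_diff_one_le by (intro AE_I2) (simp only: real_norm_def abs_norm_cancel)
  qed simp_all
  then show ?thesis
    by (simp add: L1_def)
qed

lemma twi_one_bound: "cmod (twi \<theta> t n (\<lambda>_. 1) x) \<le> 1"
proof (induction n arbitrary: t x)
  case (Suc n)
  then show ?case
    using prob_space.norm_integral_le[OF prob_\<kappa>, of "\<lambda>y. iexp (\<theta> * d t x y) * twi \<theta> (Suc t) n (\<lambda>_. 1) y" 1]
    by (simp add: norm_mult tw_def)
qed simp

text \<open>For odd n half the difference of the two phases is left over; it stays bounded and is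
  killed by the factor \<theta>^2 later.\<close>

lemma sum_s: "(\<Sum>j<n. s j) = real n * (s 0 + s 1) / 2 + (if even n then 0 else (s 0 - s 1) / 2)"
proof (induction n)
  case (Suc n)
  have "s n = s (n mod 2)"
    by (rule two_periodic) (rule s_periodic)
  then have "s n = (if even n then s 0 else s 1)"
    by (simp add: mod2_eq_if)
  with Suc show ?case
    by (simp add: field_simps)
qed simp

lemma alpha_tendsto:
  assumes S: "(\<lambda>n. real n * (\<theta> n)\<^sup>2) \<longlonglongrightarrow> S" and \<theta>: "\<theta> \<longlonglongrightarrow> 0"
  shows "(\<lambda>n. alpha (\<theta> n) 0 n) \<longlonglongrightarrow> exp (- S * (s 0 + s 1) / 4)"
proof -
  define C where "C = \<bar>(s 0 - s 1) / 2\<bar>"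
  define c where "c n = (if even n then 0 else (s 0 - s 1) / 2)" for n :: nat
  have cC: "\<bar>c n\<bar> \<le> C" for n
    by (simp add: c_def C_def)
  have "(\<lambda>n. (\<theta> n)\<^sup>2 * C) \<longlonglongrightarrow> 0\<^sup>2 * C"
    by (intro tendsto_intros \<theta>)
  then have lim: "(\<lambda>n. (\<theta> n)\<^sup>2 * C) \<longlonglongrightarrow> 0"
    by simp
  have c: "(\<lambda>n. (\<theta> n)\<^sup>2 * c n) \<longlonglongrightarrow> 0"
  proof (rule Lim_null_comparison[OF always_eventually lim], rule allI)
    show "norm ((\<theta> n)\<^sup>2 * c n) \<le> (\<theta> n)\<^sup>2 * C" for n
      using mult_left_mono[OF cC[of n], of "(\<theta> n)\<^sup>2"] by (simp add: abs_mult)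
  qed
  have "(\<lambda>n. exp (- (real n * (\<theta> n)\<^sup>2 * (s 0 + s 1) / 4 + (\<theta> n)\<^sup>2 * c n / 2))) \<longlonglongrightarrow> exp (- (S * (s 0 + s 1) / 4 + 0 / 2))"
    by (intro tendsto_intros S c) simp_all
  moreover have "alpha (\<theta> n) 0 n = exp (- (real n * (\<theta> n)\<^sup>2 * (s 0 + s 1) / 4 + (\<theta> n)\<^sup>2 * c n / 2))" for n
  proof -
    have "(\<Sum>j<n. s j) = real n * (s 0 + s 1) / 2 + c n"
      unfolding c_def by (rule sum_s)
    then have "(\<theta> n)\<^sup>2 / 2 * (\<Sum>j<n. s j) = real n * (\<theta> n)\<^sup>2 * (s 0 + s 1) / 4 + (\<theta> n)\<^sup>2 * c n / 2"
      by (simp add: distrib_left)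
    then show ?thesis
      by (simp only: alpha_def add_0_left mult_minus_left)
  qed
  ultimately show ?thesis
    by simp
qed

text \<open>The 4 in the exponent is 2 from the Gaussian and 2 from averaging over the
  phases.\<close>

theorem path_char_limit:
  assumes S: "(\<lambda>n. real n * (\<theta> n)\<^sup>2) \<longlonglongrightarrow> S" and \<theta>: "\<theta> \<longlonglongrightarrow> 0"
  shows "(\<lambda>n. CLINT x|M. path_char \<kappa> f (\<theta> n) 0 n x) \<longlonglongrightarrow> exp (- S * (s 0 + s 1) / 4)"
proof -
  let ?p = "\<lambda>n. path_char \<kappa> f (\<theta> n) 0 n" and ?w = "\<lambda>n. twi (\<theta> n) 0 n (\<lambda>_. 1)"
  let ?U = "\<lambda>n. L1 (\<lambda>x. iexp (\<theta> n * u 0 x) - 1) + L1 (\<lambda>x. iexp (\<theta> n * u 1 x) - 1)"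
  have pm: "?p n \<in> borel_measurable M" for n
    by (rule path_char_measurable[OF stat f_meas])
  have ip: "integrable M (?p n)" for n
    by (rule bounded_integrable[OF pm path_char_bound[OF prob_\<kappa>]])
  have iw: "integrable M (?w n)" for n
    by (rule integrable_twi) simp
  note wm = borel_measurable_integrable[OF iw]
  have bound: "cmod ((CLINT x|M. ?p n x) - alpha (\<theta> n) 0 n)
      \<le> ?U n + ?U n + L1 (\<lambda>x. ?w n x - alpha (\<theta> n) 0 n)" for n
  proof -
    note [measurable] = wm[of n] pm[of n]
    have iuw: "integrable M (\<lambda>x. iexp (\<theta> n * u 0 x) * ?w n x)"
      by (rule Bochner_Integration.integrable_bound[OF iw[of n]]) (simp_all add: norm_mult)
    \<comment> \<open>Three errors: from the path recursion to the twisted product, from dropping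
      the initial factor exp(i \<theta> u), and from the product to its Gaussian value.\<close>
    define a b c where "a x = ?p n x - iexp (\<theta> n * u 0 x) * ?w n x" and "b x = iexp (\<theta> n * u 0 x) * ?w n x - ?w n x"
      and "c x = ?w n x - alpha (\<theta> n) 0 n" for x
    have i: "integrable M a" "integrable M b" "integrable M c"
      unfolding a_def b_def c_def using ip[of n] iw[of n] iuw by simp_all
    have "(CLINT x|M. ?p n x) - alpha (\<theta> n) 0 n = (CLINT x|M. ?p n x - alpha (\<theta> n) 0 n)"
      using ip[of n] by (simp add: prob_space)
    also have "\<dots> = (CLINT x|M. a x + (b x + c x))"
      by (simp add: a_def b_def c_def)
    finally have "cmod ((CLINT x|M. ?p n x) - alpha (\<theta> n) 0 n) \<le> L1 (\<lambda>x. a x + (b x + c x))"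
      unfolding L1_def by (simp only: integral_norm_bound)
    also have "\<dots> \<le> L1 a + (L1 b + L1 c)"
      using L1_add[OF i(1) Bochner_Integration.integrable_add[OF i(2,3)]] L1_add[OF i(2,3)] by linarith
    also have "L1 a \<le> ?U n"
    proof -
      have "L1 a = L1 (\<lambda>x. iexp (\<theta> n * u 0 x) * ?w n x - ?p n x)"
        by (simp add: L1_def a_def norm_minus_commute)
      also have "\<dots> \<le> L1 (\<lambda>x. iexp (\<theta> n * u n x) - 1)"
        using path_char_close[of "\<theta> n" 0 n] by simp
      also have "\<dots> \<le> ?U n"
        by (rule mod_2_le[of "\<lambda>k. L1 (\<lambda>x. iexp (\<theta> n * u k x) - 1)"]) (simp_all add: periodic L1_nonneg)
      finally show ?thesis .
    qed
    also have "L1 b \<le> ?U n"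
    proof -
      have "L1 b \<le> L1 (\<lambda>x. iexp (\<theta> n * u 0 x) - 1)"
        unfolding L1_def
      proof (rule integral_mono)
        fix x
        have "b x = (iexp (\<theta> n * u 0 x) - 1) * ?w n x"
          by (simp add: b_def algebra_simps)
        then show "cmod (b x) \<le> cmod (iexp (\<theta> n * u 0 x) - 1)"
          using twi_one_bound[of "\<theta> n" 0 n x] by (simp add: norm_mult mult_left_le)
        show "integrable M (\<lambda>x. cmod (iexp (\<theta> n * u 0 x) - 1))"
          by (rule integrable_norm, rule bounded_integrable[OF _ cmod_iexp_diff_one_le]) simp
      qed (use i in simp)
      then show ?thesis
        using L1_nonneg[of "\<lambda>x. iexp (\<theta> n * u 1 x) - 1"] by simp
    qed
    finally show ?thesis
      by (simp add: c_def[abs_def])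
  qed
  have "(\<lambda>n. ?U n + ?U n + L1 (\<lambda>x. ?w n x - alpha (\<theta> n) 0 n)) \<longlonglongrightarrow> (0 + 0) + (0 + 0) + 0"
    by (rule tendsto_add[OF tendsto_add[OF tendsto_add[OF iexp_u_tendsto[OF \<theta>] iexp_u_tendsto[OF \<theta>]]
          tendsto_add[OF iexp_u_tendsto[OF \<theta>] iexp_u_tendsto[OF \<theta>]]] twi_limit[OF S \<theta>]])
  then have U: "(\<lambda>n. ?U n + ?U n + L1 (\<lambda>x. ?w n x - alpha (\<theta> n) 0 n)) \<longlonglongrightarrow> 0"
    by (simp only: add_0_right)
  have "(\<lambda>n. (CLINT x|M. ?p n x) - alpha (\<theta> n) 0 n) \<longlonglongrightarrow> 0"
    by (rule Lim_null_comparison[OF always_eventually U], rule allI) (rule bound)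
  from tendsto_add[OF this tendsto_of_real[OF alpha_tendsto[OF S \<theta>]]] show ?thesis
    by simp
qed

end

section \<open>The sweep chain\<close>

lemma (in prob_space) abs_integral_le_sqrt:
  assumes "sq_int M f"
  shows "(\<integral>x. \<bar>f x\<bar> \<partial>M) \<le> sqrt (\<integral>x. (f x)\<^sup>2 \<partial>M)"
proof -
  have "sq_int M (\<lambda>x. \<bar>f x\<bar>)"
    using assms sq_int_measurable[OF assms] by (simp add: sq_int_def)
  from square_expectation_le[OF this] show ?thesis
    by (intro real_le_rsqrt) simp
qed

text \<open>The data delivered by \<open>spectral_gap\<close>. A projection fixes its own range and
  contracts nothing there, so a gap for K1 can only be expected on the range of K2.\<close>

locale sweep_gap = two_gibbs M F1 F2 K1 K2 for M :: "'a measure" and F1 F2 K1 K2 +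
  fixes r :: real
  assumes r: "0 \<le> r" "r < 1"
    and gap: "\<And>f. sq_int M f \<Longrightarrow> (\<integral>x. f x \<partial>M) = 0 \<Longrightarrow> AE x in M. kint K2 f x = f x \<Longrightarrow>
      (\<integral>x. (kint K1 f x)\<^sup>2 \<partial>M) \<le> r * (\<integral>x. (f x)\<^sup>2 \<partial>M)"
begin

text \<open>One full sweep, written with two integrals and not with the composed kernel, because
  projection and self-adjointness belong to the single factors.\<close>

definition pair_op :: "('a \<Rightarrow> real) \<Rightarrow> 'a \<Rightarrow> real" where
  "pair_op v = kint K1 (kint K2 v)"

lemma pair_op_sq_int: "sq_int M v \<Longrightarrow> sq_int M (pair_op v)"
  unfolding pair_op_def by (intro g1.sq_int_kint(1) g2.sq_int_kint(1))

lemma pair_op_mean: "integrable M v \<Longrightarrow> (\<integral>x. pair_op v x \<partial>M) = (\<integral>x. v x \<partial>M)"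
  unfolding pair_op_def by (simp add: g1.integral_kint g2.integral_kint g2.integrable_K(2))

text \<open>\<open>kint K2 v\<close> again has mean zero and is fixed by K2, so the gap applies to
  it.\<close>

lemma pair_op_contraction:
  assumes v: "sq_int M v" and mean: "(\<integral>x. v x \<partial>M) = 0"
  shows "(\<integral>x. (pair_op v x)\<^sup>2 \<partial>M) \<le> r * (\<integral>x. (v x)\<^sup>2 \<partial>M)"
proof -
  have "(\<integral>x. (pair_op v x)\<^sup>2 \<partial>M) \<le> r * (\<integral>x. (kint K2 v x)\<^sup>2 \<partial>M)"
    unfolding pair_op_def
    by (rule gap) (use v mean in \<open>simp_all add: g2.sq_int_kint g2.integral_kint g2.kint_idem g1.sq_int_integrable\<close>)
  also have "\<dots> \<le> r * (\<integral>x. (v x)\<^sup>2 \<partial>M)"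
    using r by (intro mult_left_mono g2.sq_int_kint(2) v) auto
  finally show ?thesis .
qed

lemma pair_op_L1: "integrable M v \<Longrightarrow> (\<integral>x. \<bar>pair_op v x\<bar> \<partial>M) \<le> (\<integral>x. \<bar>v x\<bar> \<partial>M)"
  unfolding pair_op_def using g1.integrable_K(3)[OF g2.integrable_K(2), of v] g2.integrable_K(3)[of v] by simp

lemma pair_op_integrable: "integrable M v \<Longrightarrow> integrable M (pair_op v)"
  unfolding pair_op_def by (intro g1.integrable_K(2) g2.integrable_K(2))

lemma pair_op_diff:
  assumes "integrable M v" "integrable M w"
  shows "AE x in M. pair_op (\<lambda>x. v x - w x) x = pair_op v x - pair_op w x"
proof -
  note i = g2.integrable_K(2)[OF assms(1)] g2.integrable_K(2)[OF assms(2)]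
    g2.integrable_K(2)[OF Bochner_Integration.integrable_diff[OF assms]]
  have "AE x in M. kint K1 (kint K2 (\<lambda>x. v x - w x)) x = kint K1 (\<lambda>x. kint K2 v x - kint K2 w x) x"
    by (rule g1.kint_cong_AE[OF g2.kint_diff[OF assms]])
      (use borel_measurable_integrable[OF i(1)] borel_measurable_integrable[OF i(2)] borel_measurable_integrable[OF i(3)] in simp_all)
  then show ?thesis
    using g1.kint_diff[OF i(1,2)] unfolding pair_op_def by eventually_elim simp
qed

definition kernels :: "nat \<Rightarrow> 'a \<Rightarrow> 'a measure" where
  "kernels t = (if even t then K1 else K2)"

lemma stationary_kernels: "stationary_kernel M (kernels t)"
  using g1.stationary_kernel_axioms g2.stationary_kernel_axioms by (simp add: kernels_def)

lemma kernels_periodic: "kernels (Suc (Suc t)) = kernels t"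
  by (simp add: kernels_def)

lemma kiter_shift2: "kiter kernels (Suc (Suc t)) m h = kiter kernels t m h"
  by (induction m arbitrary: t) (simp_all add: kernels_periodic)

lemma kiter_L2:
  assumes w: "sq_int M w" and mean: "(\<integral>x. w x \<partial>M) = 0"
  shows "sq_int M (kiter kernels t m w) \<and> (\<integral>x. kiter kernels t m w x \<partial>M) = 0"
proof (induction m arbitrary: t)
  case (Suc m)
  interpret K: stationary_kernel M "kernels t"
    by (rule stationary_kernels)
  show ?case
    using Suc[of "Suc t"] by (simp add: K.sq_int_kint K.integral_kint g1.sq_int_integrable)
qed (use w mean in simp)

lemma kiter_even_decay:
  assumes w: "sq_int M w" and mean: "(\<integral>x. w x \<partial>M) = 0"
  shows "(\<integral>x. (kiter kernels 0 m w x)\<^sup>2 \<partial>M) \<le> r ^ (m div 2) * (\<integral>x. (w x)\<^sup>2 \<partial>M)"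
proof (induction m rule: induct_nat_012)
  case 1
  show ?case
    using g1.sq_int_kint(2)[OF w] by (simp add: kernels_def)
next
  case (ge2 m)
  note L2 = kiter_L2[OF w mean, of 0 m]
  have "(\<integral>x. (kiter kernels 0 (Suc (Suc m)) w x)\<^sup>2 \<partial>M) = (\<integral>x. (pair_op (kiter kernels 0 m w) x)\<^sup>2 \<partial>M)"
    using kiter_shift2[of 0 m w] by (simp add: pair_op_def kernels_def numeral_2_eq_2)
  also have "\<dots> \<le> r * (\<integral>x. (kiter kernels 0 m w x)\<^sup>2 \<partial>M)"
    using L2 by (intro pair_op_contraction) auto
  also have "\<dots> \<le> r * (r ^ (m div 2) * (\<integral>x. (w x)\<^sup>2 \<partial>M))"
    using r by (intro mult_left_mono ge2) auto
  finally show ?case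
    by simp
qed simp

text \<open>Starting at the odd phase spends one factor that merely does not expand; asking for
  \<open>Suc m\<close> factors absorbs it.\<close>

lemma kiter_decay:
  assumes w: "sq_int M w" and mean: "(\<integral>x. w x \<partial>M) = 0"
  shows "(\<integral>x. (kiter kernels t (Suc m) w x)\<^sup>2 \<partial>M) \<le> r ^ (m div 2) * (\<integral>x. (w x)\<^sup>2 \<partial>M)"
proof -
  have 0: "kiter kernels t m w = kiter kernels (t mod 2) m w" for t m
    by (induction t rule: induct_nat_012) (simp_all add: kiter_shift2 mod_Suc)
  show ?thesis
  proof (cases "even t")
    case True
    have "(\<integral>x. (kiter kernels 0 (Suc m) w x)\<^sup>2 \<partial>M) \<le> r ^ (Suc m div 2) * (\<integral>x. (w x)\<^sup>2 \<partial>M)"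
      by (rule kiter_even_decay[OF w mean])
    also have "\<dots> \<le> r ^ (m div 2) * (\<integral>x. (w x)\<^sup>2 \<partial>M)"
      using r by (intro mult_right_mono power_decreasing div_le_mono) auto
    finally show ?thesis
      using True 0[of t "Suc m"] by (simp del: kiter.simps)
  next
    case False
    have e: "kiter kernels (Suc t) m w = kiter kernels 0 m w"
      using False 0[of "Suc t" m] by (simp add: mod2_eq_if)
    have "(\<integral>x. (kiter kernels t (Suc m) w x)\<^sup>2 \<partial>M) \<le> (\<integral>x. (kiter kernels 0 m w x)\<^sup>2 \<partial>M)"
      using kiter_L2[OF w mean, of 0 m] unfolding kiter.simps e
      by (intro stationary_kernel.sq_int_kint(2)[OF stationary_kernels]) simp
    then show ?thesis
      using kiter_even_decay[OF w mean, of m] by linarith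
  qed
qed

lemma kiter_L1:
  assumes "integrable M v" "integrable M w"
  shows "integrable M (kiter kernels t m v) \<and> (\<integral>x. \<bar>kiter kernels t m v x - kiter kernels t m w x\<bar> \<partial>M) \<le> (\<integral>x. \<bar>v x - w x :: real\<bar> \<partial>M)"
  using assms
proof (induction m arbitrary: t v w)
  case (Suc m)
  interpret K: stationary_kernel M "kernels t"
    by (rule stationary_kernels)
  let ?v = "kiter kernels (Suc t) m v" and ?w = "kiter kernels (Suc t) m w"
  have i: "integrable M ?v" "integrable M ?w"
    using Suc.IH[OF Suc.prems(1,1)] Suc.IH[OF Suc.prems(2,2)] by auto
  note i' = K.integrable_K(2)[OF i(1)] K.integrable_K(2)[OF i(2)] K.integrable_K(2)[OF Bochner_Integration.integrable_diff[OF i]]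
  have "AE x in M. \<bar>kint (kernels t) ?v x - kint (kernels t) ?w x\<bar> = \<bar>kint (kernels t) (\<lambda>x. ?v x - ?w x) x\<bar>"
    using K.kint_diff[OF i] by eventually_elim simp
  then have "(\<integral>x. \<bar>kint (kernels t) ?v x - kint (kernels t) ?w x\<bar> \<partial>M) = (\<integral>x. \<bar>kint (kernels t) (\<lambda>x. ?v x - ?w x) x\<bar> \<partial>M)"
    by (rule integral_cong_AE[rotated 2])
      (use borel_measurable_integrable[OF i'(1)] borel_measurable_integrable[OF i'(2)] borel_measurable_integrable[OF i'(3)] in simp_all)
  also have "\<dots> \<le> (\<integral>x. \<bar>?v x - ?w x\<bar> \<partial>M)"
    using K.integrable_K(3)[OF Bochner_Integration.integrable_diff[OF i]] by simp
  also have "\<dots> \<le> (\<integral>x. \<bar>v x - w x\<bar> \<partial>M)"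
    using Suc.IH[OF Suc.prems] by blast
  finally show ?case
    using i' by simp
qed simp

text \<open>The conditional variances to which this is applied are integrable but need not be square
  integrable, while the decay lives in L2. So \<open>w\<close> is truncated and centred again, and
  L1 contraction carries the approximation error.\<close>

lemma kiter_mixing:
  fixes w :: "'a \<Rightarrow> real"
  assumes w: "integrable M w" and mean: "(\<integral>x. w x \<partial>M) = 0"
  shows "(\<lambda>m. \<integral>x. \<bar>kiter kernels t m w x\<bar> \<partial>M) \<longlonglongrightarrow> 0"
proof (rule LIMSEQ_I)
  fix e :: real assume e: "0 < e"
  note [measurable] = borel_measurable_integrable[OF w]
  define c where "c k x = max (- real k) (min (real k) (w x))" for k x
  have c_bound: "\<bar>c k x\<bar> \<le> real k" and c_w: "\<bar>c k x\<bar> \<le> \<bar>w x\<bar>" for k x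
    by (auto simp: c_def)
  have [measurable]: "c k \<in> borel_measurable M" for k
    unfolding c_def by simp
  have ic: "integrable M (c k)" for k
    by (rule Bochner_Integration.integrable_bound[OF w]) (use c_w in auto)
  have "(\<lambda>k. \<integral>x. \<bar>w x - c k x\<bar> \<partial>M) \<longlonglongrightarrow> (\<integral>x. 0 \<partial>M)"
  proof (rule integral_dominated_convergence)
    show "integrable M (\<lambda>x. 2 * \<bar>w x\<bar>)"
      using w by simp
    show "AE x in M. (\<lambda>k. \<bar>w x - c k x\<bar>) \<longlonglongrightarrow> 0"
    proof (rule AE_I2)
      fix x
      obtain k0 :: nat where "\<bar>w x\<bar> \<le> real k0"
        using real_arch_simple by blast
      then have "\<bar>w x - c k x\<bar> = 0" if "k \<ge> k0" for k
        using that by (auto simp: c_def)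
      then show "(\<lambda>k. \<bar>w x - c k x\<bar>) \<longlonglongrightarrow> 0"
        by (intro tendsto_eventually) (auto simp: eventually_sequentially)
    qed
    show "AE x in M. norm \<bar>w x - c k x\<bar> \<le> 2 * \<bar>w x\<bar>" for k
    proof (rule AE_I2)
      fix x
      show "norm \<bar>w x - c k x\<bar> \<le> 2 * \<bar>w x\<bar>"
        using c_w[of k x] by simp
    qed
  qed simp_all
  then have "\<forall>\<^sub>F k in sequentially. (\<integral>x. \<bar>w x - c k x\<bar> \<partial>M) < e / 4"
    using e by (intro order_tendstoD(2)) auto
  then obtain k where k: "(\<integral>x. \<bar>w x - c k x\<bar> \<partial>M) < e / 4"
    by (auto simp: eventually_sequentially)
  \<comment> \<open>Truncation spoils the zero mean; the correction is no larger than the truncation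
    error itself.\<close>
  define b where "b = (\<integral>x. c k x \<partial>M)"
  define w' where "w' x = c k x - b" for x
  have "\<bar>b\<bar> = \<bar>\<integral>x. w x - c k x \<partial>M\<bar>"
    using w ic mean by (simp add: b_def)
  also have "\<dots> \<le> (\<integral>x. \<bar>w x - c k x\<bar> \<partial>M)"
    by (rule integral_abs_bound)
  finally have b: "\<bar>b\<bar> < e / 4"
    using k by simp
  have "integrable M (\<lambda>x. (c k x)\<^sup>2)"
  proof (rule g1.integrable_const_bound[where B = "(real k)\<^sup>2"])
    have "(c k x)\<^sup>2 \<le> (real k)\<^sup>2" for x
      using power_mono[OF c_bound abs_ge_zero, where n = 2] by simp
    then show "AE x in M. norm ((c k x)\<^sup>2) \<le> (real k)\<^sup>2"
      by simp
  qed simp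
  then have sq: "sq_int M w'"
    unfolding w'_def by (intro sq_int_diff g1.sq_int_const) (simp add: sq_int_def)
  have mean': "(\<integral>x. w' x \<partial>M) = 0"
    unfolding w'_def using ic by (simp add: b_def g1.prob_space)
  have iw': "integrable M w'"
    by (rule g1.sq_int_integrable[OF sq])
  have "(\<integral>x. \<bar>w x - w' x\<bar> \<partial>M) \<le> (\<integral>x. \<bar>w x - c k x\<bar> + \<bar>b\<bar> \<partial>M)"
    using w ic iw' by (intro integral_mono) (auto simp: w'_def)
  also have "\<dots> < e / 2"
    using k b w ic by (simp add: g1.prob_space)
  finally have ww': "(\<integral>x. \<bar>w x - w' x\<bar> \<partial>M) < e / 2" .
  have half: "(\<lambda>m. r ^ (m div 2)) \<longlonglongrightarrow> 0"
  proof -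
    have "filterlim (\<lambda>m::nat. m div 2) at_top sequentially"
      unfolding filterlim_at_top eventually_sequentially
      by (metis div_le_mono nonzero_mult_div_cancel_left zero_neq_numeral)
    then show ?thesis
      using filterlim_compose[OF LIMSEQ_power_zero[of r]] r by simp
  qed
  have "(\<lambda>m. sqrt (r ^ (m div 2) * (\<integral>x. (w' x)\<^sup>2 \<partial>M))) \<longlonglongrightarrow> sqrt (0 * (\<integral>x. (w' x)\<^sup>2 \<partial>M))"
    by (intro tendsto_intros half)
  then have "\<forall>\<^sub>F m in sequentially. sqrt (r ^ (m div 2) * (\<integral>x. (w' x)\<^sup>2 \<partial>M)) < e / 2"
    using e by (intro order_tendstoD(2)) auto
  then obtain m0 where m0: "\<And>m. m \<ge> m0 \<Longrightarrow> sqrt (r ^ (m div 2) * (\<integral>x. (w' x)\<^sup>2 \<partial>M)) < e / 2"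
    by (auto simp: eventually_sequentially)
  have "(\<integral>x. \<bar>kiter kernels t (Suc m) w x\<bar> \<partial>M) < e" if m: "m \<ge> m0" for m
  proof -
    let ?v = "kiter kernels t (Suc m) w" and ?v' = "kiter kernels t (Suc m) w'"
    have i: "integrable M ?v" "integrable M ?v'"
      using kiter_L1[OF w w] kiter_L1[OF iw' iw'] by blast+
    have s: "sq_int M ?v'"
      using kiter_L2[OF sq mean'] by blast
    have "(\<integral>x. \<bar>?v x\<bar> \<partial>M) \<le> (\<integral>x. \<bar>?v x - ?v' x\<bar> + \<bar>?v' x\<bar> \<partial>M)"
      using i by (intro integral_mono) auto
    also have "\<dots> = (\<integral>x. \<bar>?v x - ?v' x\<bar> \<partial>M) + (\<integral>x. \<bar>?v' x\<bar> \<partial>M)"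
      using i by (intro Bochner_Integration.integral_add) simp_all
    also have "(\<integral>x. \<bar>?v' x\<bar> \<partial>M) \<le> sqrt (\<integral>x. (?v' x)\<^sup>2 \<partial>M)"
      by (rule g1.abs_integral_le_sqrt[OF s])
    also have "\<dots> \<le> sqrt (r ^ (m div 2) * (\<integral>x. (w' x)\<^sup>2 \<partial>M))"
      by (rule real_sqrt_le_mono[OF kiter_decay[OF sq mean']])
    also have "(\<integral>x. \<bar>?v x - ?v' x\<bar> \<partial>M) \<le> (\<integral>x. \<bar>w x - w' x\<bar> \<partial>M)"
      using kiter_L1[OF w iw'] by blast
    finally show ?thesis
      using ww' m0[OF m] by simp
  qed
  then have "norm ((\<integral>x. \<bar>kiter kernels t m w x\<bar> \<partial>M) - 0) < e" if "m \<ge> Suc m0" for m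
    using that by (cases m) (auto simp: integral_nonneg_AE simp del: kiter.simps)
  then show "\<exists>no. \<forall>m\<ge>no. norm ((\<integral>x. \<bar>kiter kernels t m w x\<bar> \<partial>M) - 0) < e"
    by blast
qed

end

section \<open>The chain on its probability space\<close>

lemma sweep_next_iterate: "(sweep_next ^^ t) 1 = (if even t then 1 else 2)"
  by (induction t) (simp_all add: sweep_next_def)

lemma sweep_kernel_two:
  assumes "Q 2 \<in> borel \<rightarrow>\<^sub>M prob_algebra borel"
  shows "sweep_kernel Q 1 2 x = Q 1 x \<bind> Q 2"
proof -
  have Q2: "Q 2 y \<bind> return borel = Q 2 y" for y
    using subprob_measurableD(2)[OF measurable_prob_algebraD[OF assms]] by (intro bind_return'') simp
  have n: "sweep_next 1 = 2"
    by (simp add: sweep_next_def)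
  have "sweep_kernel Q 1 2 x = sweep_kernel Q 1 (Suc (Suc 0)) x"
    by (simp only: numeral_2_eq_2)
  also have "\<dots> = Q 1 x \<bind> Q 2"
    unfolding sweep_kernel.simps n Q2 ..
  finally show ?thesis .
qed

locale chain =
  fixes Q :: "nat \<Rightarrow> 'a::polish_space \<Rightarrow> 'a measure" and \<nu> :: "'a measure" and N :: "'b measure" and X :: "nat \<Rightarrow> 'b \<Rightarrow> 'a"
  assumes Q: "\<And>k. k \<in> {1,2} \<Longrightarrow> Q k \<in> borel \<rightarrow>\<^sub>M prob_algebra borel"
    and chain: "sweep_chain Q \<nu> N X"
begin

sublocale prob_space N
  using chain by (simp add: sweep_chain_def)

definition \<kappa> :: "nat \<Rightarrow> 'a \<Rightarrow> 'a measure" where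
  "\<kappa> t = Q ((sweep_next ^^ t) 1)"

definition past :: "nat \<Rightarrow> 'b measure" where
  "past t = vimage_algebra (space N) (\<lambda>\<omega>. \<lambda>i\<in>{..t}. X i \<omega>) (\<Pi>\<^sub>M i\<in>{..t}. borel)"

lemma \<kappa>: "\<kappa> t \<in> borel \<rightarrow>\<^sub>M prob_algebra borel"
  unfolding \<kappa>_def sweep_next_iterate by (rule Q) simp

lemma X_meas: "X t \<in> N \<rightarrow>\<^sub>M borel"
  using chain by (simp add: sweep_chain_def)

lemma subalgebra_past: "subalgebra N (past t)"
proof -
  have "(\<lambda>\<omega>. \<lambda>i\<in>{..t}. X i \<omega>) \<in> N \<rightarrow>\<^sub>M (\<Pi>\<^sub>M i\<in>{..t}. borel)"
    by (rule measurable_restrict) (rule X_meas)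
  then show ?thesis
    unfolding subalgebra_def past_def by (intro conjI sets_image_in_sets) simp_all
qed

lemma X_past: "i \<le> t \<Longrightarrow> X i \<in> past t \<rightarrow>\<^sub>M borel"
proof -
  assume i: "i \<le> t"
  have s: "space (past t) = space N"
    by (simp add: past_def)
  have "(\<lambda>\<omega>. \<lambda>i\<in>{..t}. X i \<omega>) \<in> past t \<rightarrow>\<^sub>M (\<Pi>\<^sub>M i\<in>{..t}. borel)"
    unfolding past_def by (rule measurable_vimage_algebra1) (auto simp: space_PiM)
  from measurable_compose[OF this measurable_component_singleton[of i]] i
  have "(\<lambda>\<omega>. (\<lambda>i\<in>{..t}. X i \<omega>) i) \<in> past t \<rightarrow>\<^sub>M borel"
    by simp
  then show ?thesis
    using i by simp
qed

text \<open>The chain is defined by conditioning on its whole past, so its law of motion is a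
  regular conditional distribution whose kernel depends on the present state only.\<close>

lemma transition: "regular_cond_distr N (past t) (X (Suc t)) borel (\<lambda>\<omega>. \<kappa> t (X t \<omega>))"
proof
  show "subalgebra N (past t)"
    by (rule subalgebra_past)
  show "X (Suc t) \<in> N \<rightarrow>\<^sub>M borel"
    by (rule X_meas)
  show "(\<lambda>\<omega>. \<kappa> t (X t \<omega>)) \<in> N \<rightarrow>\<^sub>M prob_algebra borel"
    by (rule measurable_compose[OF X_meas \<kappa>])
  show "AE \<omega> in N. real_cond_exp N (past t) (\<lambda>\<omega>. indicator A (X (Suc t) \<omega>)) \<omega> = measure (\<kappa> t (X t \<omega>)) A"
    if "A \<in> sets borel" for A
    using chain that by (simp add: sweep_chain_def past_def \<kappa>_def)
qed

lemma law_Suc: "distr N borel (X (Suc t)) = distr N borel (X t) \<bind> \<kappa> t"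
proof -
  interpret T: regular_cond_distr N "past t" "X (Suc t)" borel "\<lambda>\<omega>. \<kappa> t (X t \<omega>)"
    by (rule transition)
  have k: "\<kappa> t \<in> distr N borel (X t) \<rightarrow>\<^sub>M subprob_algebra borel"
    using measurable_prob_algebraD[OF \<kappa>] by simp
  show ?thesis
  proof (rule measure_eqI)
    have "sets (distr N borel (X t) \<bind> \<kappa> t) = sets borel"
      using not_empty subprob_measurableD(2)[OF k] by (intro sets_bind) auto
    then show "sets (distr N borel (X (Suc t))) = sets (distr N borel (X t) \<bind> \<kappa> t)"
      by simp
    fix A assume "A \<in> sets (distr N borel (X (Suc t)))"
    then have A: "A \<in> sets borel"
      by simp
    have "emeasure (distr N borel (X (Suc t))) A = (\<integral>\<^sup>+\<omega>. indicator A (X (Suc t) \<omega>) \<partial>N)"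
      using A X_meas by (subst nn_integral_distr[symmetric, where M' = borel]) simp_all
    also have "\<dots> = (\<integral>\<^sup>+\<omega>. 1 * nn_cond_exp N (past t) (\<lambda>\<omega>. indicator A (X (Suc t) \<omega>)) \<omega> \<partial>N)"
      using A by (subst T.nn_cond_exp_intg) (simp_all add: measurable_compose[OF X_meas])
    also have "\<dots> = (\<integral>\<^sup>+\<omega>. emeasure (\<kappa> t (X t \<omega>)) A \<partial>N)"
    proof (rule nn_integral_cong_AE)
      have "AE \<omega> in N. nn_cond_exp N (past t) (\<lambda>\<omega>. indicator A (X (Suc t) \<omega>)) \<omega> = (\<integral>\<^sup>+y. indicator A y \<partial>\<kappa> t (X t \<omega>))"
        by (rule T.nn_cond_exp_eq) (use A in simp)
      then show "AE \<omega> in N. 1 * nn_cond_exp N (past t) (\<lambda>\<omega>. indicator A (X (Suc t) \<omega>)) \<omega> = emeasure (\<kappa> t (X t \<omega>)) A"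
        using AE_space
      proof eventually_elim
        case (elim \<omega>)
        then show ?case
          using A T.sets_K[OF elim(2)] by simp
      qed
    qed
    also have "\<dots> = (\<integral>\<^sup>+x. emeasure (\<kappa> t x) A \<partial>distr N borel (X t))"
    proof (rule nn_integral_distr[OF X_meas, symmetric])
      have "(\<lambda>x. emeasure (\<kappa> t x) A) \<in> borel_measurable borel"
        by (rule measurable_compose[OF measurable_prob_algebraD[OF \<kappa>] measurable_emeasure_subprob_algebra[OF A]])
      then show "(\<lambda>x. emeasure (\<kappa> t x) A) \<in> borel_measurable (distr N borel (X t))"
        by simp
    qed
    also have "\<dots> = emeasure (distr N borel (X t) \<bind> \<kappa> t) A"
      using A k by (subst emeasure_bind[where N = borel]) simp_all
    finally show "emeasure (distr N borel (X (Suc t))) A = emeasure (distr N borel (X t) \<bind> \<kappa> t) A" .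
  qed
qed

text \<open>Observed at even times the chain is homogeneous, as convergence in total variation
  requires.\<close>

lemma law_even_Suc: "distr N borel (X (2 * Suc n)) = distr N borel (X (2 * n)) \<bind> sweep_kernel Q 1 2"
proof -
  have k: "\<kappa> t \<in> borel \<rightarrow>\<^sub>M subprob_algebra borel" for t
    by (rule measurable_prob_algebraD[OF \<kappa>])
  have "distr N borel (X (2 * Suc n)) = (distr N borel (X (2 * n)) \<bind> \<kappa> (2 * n)) \<bind> \<kappa> (Suc (2 * n))"
    using law_Suc[of "Suc (2 * n)"] law_Suc[of "2 * n"] by simp
  also have "\<dots> = distr N borel (X (2 * n)) \<bind> (\<lambda>x. \<kappa> (2 * n) x \<bind> \<kappa> (Suc (2 * n)))"
    using k by (intro bind_assoc[where N = borel and R = borel]) simp_all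
  also have "(\<lambda>x. \<kappa> (2 * n) x \<bind> \<kappa> (Suc (2 * n))) = sweep_kernel Q 1 2"
    unfolding \<kappa>_def sweep_next_iterate by (simp add: fun_eq_iff sweep_kernel_two[OF Q] del: One_nat_def)
  finally show ?thesis .
qed

text \<open>Induction over the number of summands already released from the recursion:
  \<open>Z\<close> collects them and is measurable for the past, and the kernel integral that comes
  next is a conditional expectation.\<close>

lemma path_integral:
  assumes f: "\<And>t. f t \<in> borel_measurable borel"
    and meas: "\<And>t n. path_char \<kappa> f \<theta> t n \<in> borel_measurable borel"
    and bound: "\<And>t n x. cmod (path_char \<kappa> f \<theta> t n x) \<le> 1"
  shows "(CLINT \<omega>|N. iexp (\<theta> * (\<Sum>j<n. f (m + j) (X (m + j) \<omega>)))) = (CLINT \<omega>|N. path_char \<kappa> f \<theta> m n (X m \<omega>))"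
proof -
  define Z where "Z j \<omega> = iexp (\<theta> * (\<Sum>i<j. f (m + i) (X (m + i) \<omega>)))" for j \<omega>
  have "(CLINT \<omega>|N. Z j \<omega> * path_char \<kappa> f \<theta> (m + j) (n - j) (X (m + j) \<omega>)) = (CLINT \<omega>|N. path_char \<kappa> f \<theta> m n (X m \<omega>))"
    if "j \<le> n" for j
    using that
  proof (induction j)
    case 0
    then show ?case
      by (simp add: Z_def)
  next
    case (Suc j)
    let ?h = "path_char \<kappa> f \<theta> (Suc (m + j)) (n - Suc j)"
    interpret T: regular_cond_distr N "past (m + j)" "X (Suc (m + j))" borel "\<lambda>\<omega>. \<kappa> (m + j) (X (m + j) \<omega>)"
      by (rule transition)
    have nj: "n - j = Suc (n - Suc j)"
      using Suc by simp
    have Z_meas: "Z (Suc j) \<in> borel_measurable (past (m + j))"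
    proof -
      have "(\<lambda>\<omega>. f (m + i) (X (m + i) \<omega>)) \<in> borel_measurable (past (m + j))" if "i < Suc j" for i
        using that by (intro measurable_compose[OF X_past f]) simp
      then have "(\<lambda>\<omega>. \<Sum>i<Suc j. f (m + i) (X (m + i) \<omega>)) \<in> borel_measurable (past (m + j))"
        by (intro borel_measurable_sum) simp
      note [measurable] = this
      show ?thesis
        unfolding Z_def by measurable
    qed
    have "(CLINT \<omega>|N. path_char \<kappa> f \<theta> m n (X m \<omega>)) = (CLINT \<omega>|N. Z j \<omega> * path_char \<kappa> f \<theta> (m + j) (n - j) (X (m + j) \<omega>))"
      using Suc by simp
    also have "\<dots> = (CLINT \<omega>|N. Z (Suc j) \<omega> * (\<integral>y. ?h y \<partial>\<kappa> (m + j) (X (m + j) \<omega>)))"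
      unfolding nj by (simp add: Z_def kint_def exp_add distrib_left mult_ac)
    also have "\<dots> = (CLINT \<omega>|N. Z (Suc j) \<omega> * ?h (X (Suc (m + j)) \<omega>))"
      by (rule T.complex_integral_mult_K[OF meas Z_meas bound]) (simp add: Z_def)
    finally show ?case
      by simp
  qed
  from this[of n] show ?thesis
    by (simp add: Z_def)
qed

text \<open>The first \<open>2 j\<close> steps are negligible after normalisation, and from there on the law of the
  chain may be replaced by \<open>M\<close>.\<close>

theorem characteristic_function_limit:
  fixes M :: "'a measure" and f :: "nat \<Rightarrow> 'a \<Rightarrow> real"
  assumes M: "prob_space M" "sets M = sets borel"
    and f: "\<And>t. f t \<in> borel_measurable borel" and periodic: "\<And>t. f (Suc (Suc t)) = f t"
    and meas: "\<And>\<theta> t n. path_char \<kappa> f \<theta> t n \<in> borel_measurable borel"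
    and bound: "\<And>\<theta> t n x. cmod (path_char \<kappa> f \<theta> t n x) \<le> 1"
    and tv: "\<And>e. 0 < e \<Longrightarrow> \<exists>n. \<forall>h :: 'a \<Rightarrow> real. h \<in> borel_measurable M \<longrightarrow> (\<forall>x. \<bar>h x\<bar> \<le> 1) \<longrightarrow>
      \<bar>(\<integral>x. h x \<partial>distr N borel (X (2 * n))) - (\<integral>x. h x \<partial>M)\<bar> \<le> e"
    and lim: "\<And>\<theta>. (\<lambda>n. real n * (\<theta> n)\<^sup>2) \<longlonglongrightarrow> 1 \<Longrightarrow> \<theta> \<longlonglongrightarrow> 0 \<Longrightarrow>
      (\<lambda>n. CLINT x|M. path_char \<kappa> f (\<theta> n) 0 n x) \<longlonglongrightarrow> c"
  shows "(\<lambda>n. CLINT \<omega>|N. iexp (1 / sqrt (real n) * (\<Sum>t<n. f t (X t \<omega>)))) \<longlonglongrightarrow> c"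
proof (rule LIMSEQ_I)
  fix e :: real assume e: "0 < e"
  obtain j where j: "\<And>h :: 'a \<Rightarrow> real. h \<in> borel_measurable M \<Longrightarrow> (\<And>x. \<bar>h x\<bar> \<le> 1) \<Longrightarrow>
      \<bar>(\<integral>x. h x \<partial>distr N borel (X (2 * j))) - (\<integral>x. h x \<partial>M)\<bar> \<le> e / 8"
    using tv[of "e / 8"] e by auto
  define m where "m = 2 * j"
  \<comment> \<open>After dropping m steps, n summands remain, but the scale is still that of all n
    + m; n \<theta>^2 tends to 1 nevertheless.\<close>
  define \<theta> where "\<theta> n = 1 / sqrt (real (n + m))" for n
  define H where "H \<omega> = (\<Sum>t<m. f t (X t \<omega>))" for \<omega>
  have [measurable]: "(\<lambda>\<omega>. f t (X t \<omega>)) \<in> borel_measurable N" for t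
    by (rule measurable_compose[OF X_meas f])
  have [measurable]: "H \<in> borel_measurable N"
    unfolding H_def by measurable
  have \<theta>0: "\<theta> \<longlonglongrightarrow> 0"
  proof -
    have "(\<lambda>n. 1 / sqrt (real n)) \<longlonglongrightarrow> 0"
      by real_asymp
    from LIMSEQ_ignore_initial_segment[OF this, of m] show ?thesis
      unfolding \<theta>_def[abs_def] .
  qed
  have \<theta>1: "(\<lambda>n. real n * (\<theta> n)\<^sup>2) \<longlonglongrightarrow> 1"
  proof -
    have "(\<lambda>n. real n / (real n + real m)) \<longlonglongrightarrow> 1"
      by real_asymp
    then show ?thesis
      by (simp add: \<theta>_def power_divide)
  qed
  define a where "a n = (CLINT \<omega>|N. iexp (\<theta> n * (\<Sum>t<n + m. f t (X t \<omega>))))" for n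
  define b where "b n = (CLINT \<omega>|N. iexp (\<theta> n * (\<Sum>t<n. f (m + t) (X (m + t) \<omega>))))" for n
  have ab: "cmod (a n - b n) \<le> (\<integral>\<omega>. cmod (iexp (\<theta> n * H \<omega>) - 1) \<partial>N)" for n
  proof -
    have split: "(\<Sum>t<n + m. f t (X t \<omega>)) = H \<omega> + (\<Sum>t<n. f (m + t) (X (m + t) \<omega>))" for \<omega>
      unfolding H_def by (induction n) (simp_all add: add.commute[of m])
    have eq: "iexp (\<theta> n * (\<Sum>t<n + m. f t (X t \<omega>))) - iexp (\<theta> n * (\<Sum>t<n. f (m + t) (X (m + t) \<omega>)))
        = (iexp (\<theta> n * H \<omega>) - 1) * iexp (\<theta> n * (\<Sum>t<n. f (m + t) (X (m + t) \<omega>)))" for \<omega>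
      unfolding split by (simp add: distrib_left exp_add left_diff_distrib)
    have ii: "integrable N (\<lambda>\<omega>. iexp (\<theta> n * (\<Sum>t\<in>T. f (g t) (X (g t) \<omega>))))" for T g
      by (rule integrable_const_bound[where B = 1]) simp_all
    have diff: "a n - b n = (CLINT \<omega>|N. iexp (\<theta> n * (\<Sum>t<n + m. f t (X t \<omega>))) - iexp (\<theta> n * (\<Sum>t<n. f (m + t) (X (m + t) \<omega>))))"
      unfolding a_def b_def using ii[of "\<lambda>t. t" "{..<n + m}"] ii[of "\<lambda>t. m + t" "{..<n}"]
      by (intro Bochner_Integration.integral_diff[symmetric])
    have "cmod (a n - b n) \<le> (\<integral>\<omega>. cmod ((iexp (\<theta> n * H \<omega>) - 1) * iexp (\<theta> n * (\<Sum>t<n. f (m + t) (X (m + t) \<omega>)))) \<partial>N)"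
      unfolding diff eq by (rule integral_norm_bound)
    then show ?thesis
      unfolding norm_mult norm_exp_i_times by (simp only: mult_1_right)
  qed
  have "(\<lambda>n. \<integral>\<omega>. cmod (iexp (\<theta> n * H \<omega>) - 1) \<partial>N) \<longlonglongrightarrow> (\<integral>\<omega>. 0 \<partial>N)"
  proof (rule integral_dominated_convergence)
    show "AE \<omega> in N. (\<lambda>n. cmod (iexp (\<theta> n * H \<omega>) - 1)) \<longlonglongrightarrow> 0"
    proof (rule AE_I2)
      fix \<omega>
      have "(\<lambda>n. cmod (iexp (\<theta> n * H \<omega>) - 1)) \<longlonglongrightarrow> cmod (iexp (0 * H \<omega>) - 1)"
        by (intro tendsto_intros \<theta>0)
      then show "(\<lambda>n. cmod (iexp (\<theta> n * H \<omega>) - 1)) \<longlonglongrightarrow> 0"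
        by simp
    qed
    show "AE \<omega> in N. norm (cmod (iexp (\<theta> n * H \<omega>) - 1)) \<le> 2" for n
      using cmod_iexp_diff_one_le by (intro AE_I2) (simp only: real_norm_def abs_norm_cancel)
  qed simp_all
  then have ab_lim: "(\<lambda>n. \<integral>\<omega>. cmod (iexp (\<theta> n * H \<omega>) - 1) \<partial>N) \<longlonglongrightarrow> 0"
    by simp
  \<comment> \<open>\<open>m\<close> is even, so the remaining chain starts at the original
    phase.\<close>
  have shift: "path_char \<kappa> f \<theta> m n = path_char \<kappa> f \<theta> 0 n" for \<theta> n
  proof -
    have per: "path_char \<kappa> f \<theta> (Suc (Suc t)) n = path_char \<kappa> f \<theta> t n" for t
      by (induction n arbitrary: t) (simp_all add: periodic \<kappa>_def sweep_next_iterate del: One_nat_def funpow.simps)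
    show ?thesis
      unfolding m_def by (induction j) (simp_all add: per)
  qed
  \<comment> \<open>One choice of the waiting time serves all n, because the recursion is bounded by
    1 and total variation is uniform over such functions. Real and imaginary part cost e/8
    each.\<close>
  have bM: "cmod (b n - (CLINT x|M. path_char \<kappa> f (\<theta> n) 0 n x)) \<le> e / 4" for n
  proof -
    let ?p = "path_char \<kappa> f (\<theta> n) 0 n" and ?D = "distr N borel (X m)"
    interpret M: prob_space M by fact
    interpret D: prob_space ?D
      by (rule prob_space_distr[OF X_meas])
    have pM: "?p \<in> borel_measurable M"
      using meas M(2) measurable_cong_sets by blast
    have iM: "integrable M ?p"
      using bound pM by (intro M.integrable_const_bound[where B = 1]) auto
    have iD: "integrable ?D ?p"
      using bound meas by (intro D.integrable_const_bound[where B = 1]) auto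
    have "b n = (CLINT \<omega>|N. ?p (X m \<omega>))"
      unfolding b_def path_integral[OF f meas bound] shift ..
    also have "\<dots> = (CLINT x|?D. ?p x)"
      by (rule integral_distr[OF X_meas meas, symmetric])
    finally have "b n - (CLINT x|M. ?p x) = (CLINT x|?D. ?p x) - (CLINT x|M. ?p x)"
      by simp
    moreover have "\<bar>Re ((CLINT x|?D. ?p x) - (CLINT x|M. ?p x))\<bar> \<le> e / 8"
      using j[of "\<lambda>x. Re (?p x)"] pM iM iD order_trans[OF abs_Re_le_cmod bound] by (simp add: m_def)
    moreover have "\<bar>Im ((CLINT x|?D. ?p x) - (CLINT x|M. ?p x))\<bar> \<le> e / 8"
      using j[of "\<lambda>x. Im (?p x)"] pM iM iD order_trans[OF abs_Im_le_cmod bound] by (simp add: m_def)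
    ultimately show ?thesis
      using cmod_le[of "b n - (CLINT x|M. ?p x)"] by simp
  qed
  have "\<forall>\<^sub>F n in sequentially. (\<integral>\<omega>. cmod (iexp (\<theta> n * H \<omega>) - 1) \<partial>N) < e / 4"
    using e by (intro order_tendstoD(2)[OF ab_lim]) simp
  moreover have "\<forall>\<^sub>F n in sequentially. dist (CLINT x|M. path_char \<kappa> f (\<theta> n) 0 n x) c < e / 4"
    using e by (intro tendstoD lim \<theta>1 \<theta>0) simp
  ultimately have "\<forall>\<^sub>F n in sequentially. cmod (a n - c) < e"
  proof eventually_elim
    case (elim n)
    let ?y = "CLINT x|M. path_char \<kappa> f (\<theta> n) 0 n x"
    have "cmod (a n - c) \<le> cmod (a n - b n) + cmod (b n - ?y) + cmod (?y - c)"
      using norm_triangle_ineq[of "a n - b n" "b n - ?y"] norm_triangle_ineq[of "a n - ?y" "?y - c"] by simp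
    then show ?case
      using ab[of n] bM[of n] elim e by (simp add: dist_norm)
  qed
  then obtain n0 where n0: "\<And>n. n \<ge> n0 \<Longrightarrow> cmod (a n - c) < e"
    by (auto simp: eventually_sequentially)
  show "\<exists>no. \<forall>n\<ge>no. norm ((CLINT \<omega>|N. iexp (1 / sqrt (real n) * (\<Sum>t<n. f t (X t \<omega>)))) - c) < e"
  proof (intro exI[of _ "n0 + m"] allI impI)
    fix n assume "n \<ge> n0 + m"
    then have "n - m \<ge> n0" "n = (n - m) + m"
      by simp_all
    then show "norm ((CLINT \<omega>|N. iexp (1 / sqrt (real n) * (\<Sum>t<n. f t (X t \<omega>)))) - c) < e"
      using n0[of "n - m"] unfolding a_def \<theta>_def by simp
  qed
qed

end

section \<open>The Poisson equation and the limiting variances\<close>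

context sweep_gap
begin

text \<open>\<open>G\<close> is the Neumann series of the sweep operator, built pointwise. With r <
  t < 1 the series of p_i^2 / t^i is integrable, and Cauchy--Schwarz against the series of t^i turns
  it into a square integrable majorant of the series of |p_i|.\<close>

theorem poisson_solution:
  assumes g: "sq_int M g" and mean: "(\<integral>x. g x \<partial>M) = 0"
  obtains G where "sq_int M G" "AE x in M. pair_op G x = G x - g x"
proof -
  define p where "p i = (pair_op ^^ i) g" for i
  define A where "A = (\<integral>x. (g x)\<^sup>2 \<partial>M)"
  define t where "t = (1 + r) / 2"
  have t: "0 < t" "t < 1" "r < t"
    using r by (auto simp: t_def)
  have p0: "p 0 = g" and pS: "p (Suc i) = pair_op (p i)" for i
    by (simp_all add: p_def)
  have p: "sq_int M (p i) \<and> (\<integral>x. p i x \<partial>M) = 0 \<and> (\<integral>x. (p i x)\<^sup>2 \<partial>M) \<le> r ^ i * A" for i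
  proof (induction i)
    case (Suc i)
    have "(\<integral>x. (p (Suc i) x)\<^sup>2 \<partial>M) \<le> r * (\<integral>x. (p i x)\<^sup>2 \<partial>M)"
      unfolding pS using Suc by (intro pair_op_contraction) auto
    also have "\<dots> \<le> r * (r ^ i * A)"
      using Suc r by (intro mult_left_mono) auto
    finally show ?case
      using Suc by (simp add: pS pair_op_sq_int pair_op_mean g1.sq_int_integrable)
  qed (use g mean in \<open>simp add: p0 A_def\<close>)
  have [measurable]: "p i \<in> borel_measurable M" for i
    using p[of i] by (simp add: sq_int_measurable)
  have A0: "0 \<le> A"
    by (simp add: A_def)
  define h where "h i x = (p i x)\<^sup>2 / t ^ i" for i x
  have [measurable]: "h i \<in> borel_measurable M" for i
    unfolding h_def by simp
  have h0: "0 \<le> h i x" for i x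
    using t by (simp add: h_def)
  have ih: "integrable M (h i)" for i
    unfolding h_def using p[of i] by (simp add: sq_int_square)
  have h_le: "(\<integral>x. h i x \<partial>M) \<le> (r / t) ^ i * A" for i
    unfolding h_def using p[of i] t by (simp add: power_divide divide_right_mono)
  have rt: "0 \<le> r / t" "r / t < 1"
    using r t by auto
  have summ: "summable (\<lambda>i. (r / t) ^ i * A)"
    using rt by (intro summable_mult2 summable_geometric) simp
  have fin: "(\<integral>\<^sup>+x. (\<Sum>i. ennreal (h i x)) \<partial>M) < \<infinity>"
  proof -
    have "(\<integral>\<^sup>+x. (\<Sum>i. ennreal (h i x)) \<partial>M) = (\<Sum>i. \<integral>\<^sup>+x. ennreal (h i x) \<partial>M)"
      by (rule nn_integral_suminf) simp
    also have "\<dots> = (\<Sum>i. ennreal (\<integral>x. h i x \<partial>M))"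
      using ih h0 by (simp add: nn_integral_eq_integral)
    also have "\<dots> \<le> (\<Sum>i. ennreal ((r / t) ^ i * A))"
      using h_le by (intro suminf_le ennreal_leI) auto
    also have "\<dots> < \<infinity>"
      using summ rt A0 by (simp add: suminf_ennreal2 less_top[symmetric])
    finally show ?thesis .
  qed
  have AE_h: "AE x in M. summable (\<lambda>i. h i x)"
  proof -
    have "AE x in M. (\<Sum>i. ennreal (h i x)) \<noteq> \<infinity>"
      using fin by (intro nn_integral_noteq_infinite) auto
    then show ?thesis
      by eventually_elim (use h0 summable_suminf_not_top in auto)
  qed
  define H where "H x = (\<Sum>i. h i x)" for x
  have [measurable]: "H \<in> borel_measurable M"
    unfolding H_def by simp
  have iH: "integrable M H"
  proof -
    have "AE x in M. ennreal (norm (H x)) = (\<Sum>i. ennreal (h i x))"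
      using AE_h
    proof eventually_elim
      case (elim x)
      have "0 \<le> H x"
        unfolding H_def using elim h0 by (rule suminf_nonneg)
      then show ?case
        using elim h0 by (simp add: H_def suminf_ennreal2)
    qed
    then have "(\<integral>\<^sup>+x. ennreal (norm (H x)) \<partial>M) = (\<integral>\<^sup>+x. (\<Sum>i. ennreal (h i x)) \<partial>M)"
      by (rule nn_integral_cong_AE)
    then show ?thesis
      using fin by (simp add: integrable_iff_bounded)
  qed
  define G where "G x = (\<Sum>i. p i x)" for x
  define a where "a x = (\<Sum>i. \<bar>p i x\<bar>)" for x
  have [measurable]: "G \<in> borel_measurable M" "a \<in> borel_measurable M"
    unfolding G_def a_def by simp_all
  define T where "T = 1 / (1 - t)"
  have st: "(\<lambda>i. t ^ i) sums T"
    unfolding T_def using t by (intro geometric_sums) simp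
  have AE_p: "AE x in M. summable (\<lambda>i. \<bar>p i x\<bar>) \<and> (a x)\<^sup>2 \<le> T * H x"
    using AE_h
  proof eventually_elim
    case (elim x)
    have le: "\<bar>p i x\<bar> \<le> t ^ i + h i x" for i
    proof -
      have "\<bar>sqrt (t ^ i) * (p i x / sqrt (t ^ i))\<bar> \<le> (sqrt (t ^ i))\<^sup>2 + (p i x / sqrt (t ^ i))\<^sup>2"
        by (rule abs_mult_le_squares)
      then show ?thesis
        using t by (simp add: h_def power_divide)
    qed
    have s: "summable (\<lambda>i. \<bar>p i x\<bar>)"
      by (rule summable_comparison_test'[where g = "\<lambda>i. t ^ i + h i x" and N = 0])
        (use le elim st in \<open>auto intro: summable_add sums_summable\<close>)
    have part: "(\<Sum>i<n. \<bar>p i x\<bar>)\<^sup>2 \<le> T * H x" for n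
    proof -
      have "(\<Sum>i<n. \<bar>p i x\<bar>) = (\<Sum>i<n. sqrt (t ^ i) * (\<bar>p i x\<bar> / sqrt (t ^ i)))"
        using t by simp
      then have "(\<Sum>i<n. \<bar>p i x\<bar>)\<^sup>2 \<le> (\<Sum>i<n. (sqrt (t ^ i))\<^sup>2) * (\<Sum>i<n. (\<bar>p i x\<bar> / sqrt (t ^ i))\<^sup>2)"
        by (simp only: Cauchy_Schwarz_ineq_sum)
      also have "\<dots> = (\<Sum>i<n. t ^ i) * (\<Sum>i<n. h i x)"
        using t by (simp add: h_def power_divide)
      also have "\<dots> \<le> T * H x"
      proof (rule mult_mono)
        show "(\<Sum>i<n. t ^ i) \<le> T"
          using st t sum_le_suminf[of "\<lambda>i. t ^ i" "{..<n}"] by (auto simp: sums_iff)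
        show "(\<Sum>i<n. h i x) \<le> H x"
          unfolding H_def using elim h0 by (intro sum_le_suminf) auto
        show "0 \<le> T" "0 \<le> (\<Sum>i<n. h i x)"
          using t h0 by (auto simp: T_def intro: sum_nonneg)
      qed
      finally show ?thesis .
    qed
    have "(\<lambda>n. (\<Sum>i<n. \<bar>p i x\<bar>)\<^sup>2) \<longlonglongrightarrow> (a x)\<^sup>2"
      unfolding a_def using s by (intro tendsto_power summable_LIMSEQ)
    then have "(a x)\<^sup>2 \<le> T * H x"
      by (rule LIMSEQ_le_const2) (use part in auto)
    with s show ?case
      by simp
  qed
  have a_sq: "sq_int M a"
    unfolding sq_int_def
  proof
    show "integrable M (\<lambda>x. (a x)\<^sup>2)"
    proof (rule Bochner_Integration.integrable_bound)
      show "integrable M (\<lambda>x. T * H x)"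
        using iH by simp
      show "AE x in M. norm ((a x)\<^sup>2) \<le> norm (T * H x)"
        using AE_p by eventually_elim auto
    qed simp
  qed simp
  have ia: "integrable M a"
    by (rule g1.sq_int_integrable[OF a_sq])
  define S where "S n x = (\<Sum>i<n. p i x)" for n x
  have S_le: "AE x in M. \<forall>n. \<bar>S n x\<bar> \<le> a x \<and> \<bar>G x\<bar> \<le> a x \<and> (\<lambda>n. S n x) \<longlonglongrightarrow> G x"
    using AE_p
  proof eventually_elim
    case (elim x)
    then have s: "summable (\<lambda>i. \<bar>p i x\<bar>)"
      by simp
    have "\<bar>S n x\<bar> \<le> (\<Sum>i<n. \<bar>p i x\<bar>)" for n
      unfolding S_def by (rule sum_abs)
    moreover have "(\<Sum>i<n. \<bar>p i x\<bar>) \<le> a x" for n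
      unfolding a_def using s by (intro sum_le_suminf) auto
    moreover have "\<bar>G x\<bar> \<le> a x"
      unfolding G_def a_def by (rule summable_rabs[OF s])
    moreover have "(\<lambda>n. S n x) \<longlonglongrightarrow> G x"
      unfolding S_def G_def by (rule summable_LIMSEQ[OF summable_rabs_cancel[OF s]])
    ultimately show ?case
      by (meson order_trans)
  qed
  have G_sq: "sq_int M G"
    unfolding sq_int_def
  proof
    show "integrable M (\<lambda>x. (G x)\<^sup>2)"
    proof (rule Bochner_Integration.integrable_bound[OF sq_int_square[OF a_sq]])
      show "AE x in M. norm ((G x)\<^sup>2) \<le> norm ((a x)\<^sup>2)"
        using S_le by eventually_elim (auto intro: power2_le_iff_abs_le[THEN iffD2] simp: abs_le_square_iff[symmetric])
    qed simp
  qed simp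
  have iG: "integrable M G"
    by (rule g1.sq_int_integrable[OF G_sq])
  have ip: "integrable M (p i)" for i
    using p[of i] g1.sq_int_integrable by blast
  have iS: "integrable M (S n)" for n
    unfolding S_def using ip by simp
  have S_lim: "(\<lambda>n. \<integral>x. \<bar>G x - S n x\<bar> \<partial>M) \<longlonglongrightarrow> 0"
  proof -
    have "(\<lambda>n. \<integral>x. \<bar>G x - S n x\<bar> \<partial>M) \<longlonglongrightarrow> (\<integral>x. 0 \<partial>M)"
    proof (rule integral_dominated_convergence)
      show "integrable M (\<lambda>x. 2 * a x)"
        using ia by simp
      show "AE x in M. (\<lambda>n. \<bar>G x - S n x\<bar>) \<longlonglongrightarrow> 0"
        using S_le
      proof eventually_elim
        case (elim x)
        then have "(\<lambda>n. \<bar>G x - S n x\<bar>) \<longlonglongrightarrow> \<bar>G x - G x\<bar>"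
          by (intro tendsto_intros) auto
        then show ?case
          by simp
      qed
      show "AE x in M. norm \<bar>G x - S n x\<bar> \<le> 2 * a x" for n
        using S_le
      proof eventually_elim
        case (elim x)
        then have "\<bar>S n x\<bar> \<le> a x" "\<bar>G x\<bar> \<le> a x"
          by auto
        then show ?case
          by simp
      qed
    qed (use borel_measurable_integrable[OF iS] in simp_all)
    then show ?thesis
      by simp
  qed
  have S_Suc: "S (Suc n) x = S n x + p n x" for n x
    by (simp add: S_def)
  \<comment> \<open>The operator shifts a partial sum and loses the term \<open>g\<close>; L1
    contraction then passes to the limit.\<close>
  have PS: "AE x in M. pair_op (S n) x = S (Suc n) x - g x" for n
  proof (induction n)
    case 0
    have "pair_op (\<lambda>x. 0) = (\<lambda>x. 0)"
      by (simp add: pair_op_def kint_def[abs_def])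
    then show ?case
      by (simp add: S_def[abs_def] p0)
  next
    case (Suc n)
    have "AE x in M. pair_op (\<lambda>x. S (Suc n) x - S n x) x = pair_op (S (Suc n)) x - pair_op (S n) x"
      by (rule pair_op_diff[OF iS iS])
    then have "AE x in M. pair_op (p n) x = pair_op (S (Suc n)) x - pair_op (S n) x"
      by (simp add: S_Suc)
    with Suc show ?case
      by eventually_elim (simp add: S_Suc[of "Suc n"] pS)
  qed
  have "(\<integral>x. \<bar>pair_op G x - (G x - g x)\<bar> \<partial>M) \<le> (\<integral>x. \<bar>G x - S n x\<bar> \<partial>M) + (\<integral>x. \<bar>G x - S (Suc n) x\<bar> \<partial>M)" for n
  proof -
    have i: "integrable M (pair_op G)" "integrable M (pair_op (S n))" "integrable M (pair_op (\<lambda>x. G x - S n x))"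
      using iG iS[of n] by (simp_all add: pair_op_integrable)
    note im = borel_measurable_integrable[OF i(1)] borel_measurable_integrable[OF i(2)] borel_measurable_integrable[OF i(3)]
    have "(\<integral>x. \<bar>pair_op G x - (G x - g x)\<bar> \<partial>M) \<le> (\<integral>x. \<bar>pair_op (\<lambda>x. G x - S n x) x\<bar> + \<bar>G x - S (Suc n) x\<bar> \<partial>M)"
    proof (rule integral_mono_AE)
      show "AE x in M. \<bar>pair_op G x - (G x - g x)\<bar> \<le> \<bar>pair_op (\<lambda>x. G x - S n x) x\<bar> + \<bar>G x - S (Suc n) x\<bar>"
        using pair_op_diff[OF iG iS[of n]] PS[of n] by eventually_elim linarith
    qed (use i iG iS g1.sq_int_integrable[OF g] in simp_all)
    also have "\<dots> = (\<integral>x. \<bar>pair_op (\<lambda>x. G x - S n x) x\<bar> \<partial>M) + (\<integral>x. \<bar>G x - S (Suc n) x\<bar> \<partial>M)"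
      using i iG iS by (intro Bochner_Integration.integral_add) simp_all
    also have "(\<integral>x. \<bar>pair_op (\<lambda>x. G x - S n x) x\<bar> \<partial>M) \<le> (\<integral>x. \<bar>G x - S n x\<bar> \<partial>M)"
      using iG iS by (intro pair_op_L1) simp
    finally show ?thesis
      by simp
  qed
  then have "(\<integral>x. \<bar>pair_op G x - (G x - g x)\<bar> \<partial>M) \<le> 0 + 0"
    by (intro LIMSEQ_le_const[OF tendsto_add[OF S_lim LIMSEQ_Suc[OF S_lim]]]) auto
  then have "(\<integral>x. \<bar>pair_op G x - (G x - g x)\<bar> \<partial>M) = 0"
    by (simp add: antisym integral_nonneg_AE)
  moreover have "integrable M (\<lambda>x. \<bar>pair_op G x - (G x - g x)\<bar>)"
    using pair_op_integrable[OF iG] iG g1.sq_int_integrable[OF g] by simp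
  ultimately have "AE x in M. \<bar>pair_op G x - (G x - g x)\<bar> = 0"
    by (subst (asm) integral_nonneg_eq_0_iff_AE) simp_all
  then have "AE x in M. pair_op G x = G x - g x"
    by eventually_elim simp
  with G_sq that show ?thesis
    by blast
qed

text \<open>The two Poisson equations express the summands through \<open>u0\<close> and
  \<open>u1\<close>, so measurability of the summands is enough to make them square
  integrable.\<close>

lemma poisson_chainI:
  assumes space: "space M = UNIV" and "sq_int M u0" "sq_int M u1"
    and f_meas: "\<And>t. f t \<in> borel_measurable M" and periodic: "\<And>t. f (Suc (Suc t)) = f t"
    and f0: "AE x in M. kint K1 u1 x = u0 x - f 0 x" and f1: "AE x in M. kint K2 u0 x = u1 x - f 1 x"
  shows "poisson_chain M kernels (\<lambda>t. if even t then u0 else u1) f"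
proof
  have par: "f t = (if even t then f 0 else f 1)" for t
    by (induction t rule: induct_nat_012) (simp_all add: periodic)
  have s0: "sq_int M (f 0)"
  proof (rule sq_int_cong_AE)
    show "sq_int M (\<lambda>x. u0 x - kint K1 u1 x)"
      using assms by (intro sq_int_diff g1.sq_int_kint(1))
    show "AE x in M. u0 x - kint K1 u1 x = f 0 x"
      using f0 by eventually_elim simp
  qed (rule f_meas)
  have s1: "sq_int M (f 1)"
  proof (rule sq_int_cong_AE)
    show "sq_int M (\<lambda>x. u1 x - kint K2 u0 x)"
      using assms by (intro sq_int_diff g2.sq_int_kint(1))
    show "AE x in M. u1 x - kint K2 u0 x = f 1 x"
      using f1 by eventually_elim simp
  qed (rule f_meas)
  show "sq_int M (f t)" for t
    by (subst par) (use s0 s1 in simp)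
  show "AE x in M. kint (kernels t) (if even (Suc t) then u0 else u1) x = (if even t then u0 else u1) x - f t x" for t
    by (subst par) (use f0 f1 in \<open>simp add: kernels_def\<close>)
  show "(\<lambda>m. \<integral>x. \<bar>kiter kernels t m w x\<bar> \<partial>M) \<longlonglongrightarrow> 0" if "integrable M w" "(\<integral>x. w x \<partial>M) = 0" for t and w :: "'a \<Rightarrow> real"
    by (rule kiter_mixing[OF that])
qed (use assms kernels_periodic stationary_kernel.K_prob[OF stationary_kernels] stationary_kernel.invariant[OF stationary_kernels] in auto)

text \<open>Removes the kernels from products with \<open>G\<close>. By the Poisson equation G - g
  lies in the range of K1, whence K1 G = G - g + K1 g; the rest is self-adjointness.\<close>

lemma poisson_inner_products:
  assumes g: "sq_int M g" and h: "sq_int M h" and G: "sq_int M G"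
    and inv: "AE x in M. kint K2 h x = h x" and pois: "AE x in M. pair_op G x = G x - g x"
  shows "(\<integral>x. kint K2 G x * h x \<partial>M) = (\<integral>x. G x * h x \<partial>M)"
    and "(\<integral>x. G x * kint K1 h x \<partial>M) = (\<integral>x. G x * h x \<partial>M) - (\<integral>x. g x * h x \<partial>M) + (\<integral>x. g x * kint K1 h x \<partial>M)"
    and "(\<integral>x. g x * kint K1 h x \<partial>M) = (\<integral>x. kint K1 g x * kint K1 h x \<partial>M)"
    and "(\<integral>x. kint K2 G x * kint K1 h x \<partial>M) = (\<integral>x. G x * h x \<partial>M) - (\<integral>x. g x * h x \<partial>M)"
proof -
  note sq = g1.sq_int_kint(1) g2.sq_int_kint(1)
  note [measurable] = sq_int_measurable[OF g] sq_int_measurable[OF h] sq_int_measurable[OF G]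
  show *: "(\<integral>x. kint K2 G x * h x \<partial>M) = (\<integral>x. G x * h x \<partial>M)"
  proof -
    have "(\<integral>x. G x * kint K2 h x \<partial>M) = (\<integral>x. G x * h x \<partial>M)"
      by (rule integral_cong_AE) (simp_all, use inv in eventually_elim, simp)
    then show ?thesis
      using g2.kint_selfadjoint[OF h G] by simp
  qed
  show "(\<integral>x. g x * kint K1 h x \<partial>M) = (\<integral>x. kint K1 g x * kint K1 h x \<partial>M)"
    using g1.integral_kint_mult[OF g h] by (simp add: mult.commute)
  have Gg: "(\<integral>x. (G x - g x) * h x \<partial>M) = (\<integral>x. G x * h x \<partial>M) - (\<integral>x. g x * h x \<partial>M)"
    using sq_int_mult[OF G h] sq_int_mult[OF g h] by (simp add: left_diff_distrib)
  have Pm[measurable]: "pair_op G \<in> borel_measurable M"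
    by (rule sq_int_measurable[OF pair_op_sq_int[OF G]])
  have "(\<integral>x. kint K2 G x * kint K1 h x \<partial>M) = (\<integral>x. pair_op G x * h x \<partial>M)"
    using g1.kint_selfadjoint[OF h sq(2)[OF G]] by (simp add: pair_op_def)
  also have "\<dots> = (\<integral>x. (G x - g x) * h x \<partial>M)"
    by (rule integral_cong_AE) (simp_all add: Pm, use pois in eventually_elim, simp)
  finally show "(\<integral>x. kint K2 G x * kint K1 h x \<partial>M) = (\<integral>x. G x * h x \<partial>M) - (\<integral>x. g x * h x \<partial>M)"
    using Gg by simp
  have "AE x in M. kint K1 (pair_op G) x = kint K1 (\<lambda>x. G x - g x) x"
    by (rule g1.kint_cong_AE[OF pois]) (simp_all add: Pm)
  moreover have "AE x in M. kint K1 (pair_op G) x = pair_op G x"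
    unfolding pair_op_def by (rule g1.kint_idem[OF g1.sq_int_integrable[OF sq(2)[OF G]]])
  moreover have "AE x in M. kint K1 (\<lambda>x. G x - g x) x = kint K1 G x - kint K1 g x"
    by (rule g1.kint_diff[OF g1.sq_int_integrable[OF G] g1.sq_int_integrable[OF g]])
  ultimately have K1G: "AE x in M. kint K1 G x = G x - g x + kint K1 g x"
    using pois by eventually_elim simp
  have "(\<integral>x. G x * kint K1 h x \<partial>M) = (\<integral>x. kint K1 G x * h x \<partial>M)"
    by (rule g1.kint_selfadjoint[OF h G])
  also have "\<dots> = (\<integral>x. (G x - g x) * h x + kint K1 g x * h x \<partial>M)"
    by (rule integral_cong_AE) (simp_all, use K1G in eventually_elim, simp add: distrib_right)
  also have "\<dots> = (\<integral>x. (G x - g x) * h x \<partial>M) + (\<integral>x. kint K1 g x * h x \<partial>M)"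
    using sq_int_mult[OF sq_int_diff[OF G g] h] sq_int_mult[OF sq(1)[OF g] h] by simp
  also have "(\<integral>x. kint K1 g x * h x \<partial>M) = (\<integral>x. g x * kint K1 h x \<partial>M)"
    by (rule g1.kint_selfadjoint[OF h g, symmetric])
  finally show "(\<integral>x. G x * kint K1 h x \<partial>M) = (\<integral>x. G x * h x \<partial>M) - (\<integral>x. g x * h x \<partial>M) + (\<integral>x. g x * kint K1 h x \<partial>M)"
    using Gg by simp
qed

text \<open>Applied with s . g for \<open>g\<close> and (C s) . g for \<open>h\<close>. Formally
  \<open>u\<close> is the expected sum of all future summands. From phase 0, with P = K1 K2 and K2 g
  = g, the mean of g is P^i g at the times 2 i - 1 and 2 i, which adds up to 2 G - g, and the
  control terms telescope to - h. Phase 1 puts one summand g and one step of K2 in front.\<close>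

lemma control_variate_chain:
  assumes space: "space M = UNIV" and g: "sq_int M g" and h: "sq_int M h" and G: "sq_int M G"
    and inv: "AE x in M. kint K2 g x = g x" "AE x in M. kint K2 h x = h x"
    and pois: "AE x in M. pair_op G x = G x - g x"
    and f_meas: "\<And>t. f t \<in> borel_measurable M" and periodic: "\<And>t. f (Suc (Suc t)) = f t"
    and f0: "AE x in M. f 0 x = g x - h x + kint K1 h x" and f1: "AE x in M. f 1 x = g x"
  defines "u \<equiv> \<lambda>t::nat. if even t then (\<lambda>x. 2 * G x - g x - h x) else (\<lambda>x. 2 * kint K2 G x - h x)"
  shows "poisson_chain M kernels u f"
    and "poisson_chain.s M kernels u f 0 + poisson_chain.s M kernels u f 1
      = 8 * (\<integral>x. G x * g x \<partial>M) - 4 * (\<integral>x. g x * g x \<partial>M) - 4 * (\<integral>x. g x * h x \<partial>M)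
        + (\<integral>x. h x * h x \<partial>M) - (\<integral>x. kint K1 h x * kint K1 h x \<partial>M)"
proof -
  note sq = g1.sq_int_kint(1) g2.sq_int_kint(1)
  have u0: "sq_int M (\<lambda>x. 2 * G x - g x - h x)" and u1: "sq_int M (\<lambda>x. 2 * kint K2 G x - h x)"
    using g h G sq by (auto intro!: sq_int_diff sq_int_cmult)
  note i = g1.sq_int_integrable
  have k1: "AE x in M. kint K1 (\<lambda>x. 2 * kint K2 G x - h x) x = 2 * pair_op G x - kint K1 h x"
    using g1.kint_diff[of "\<lambda>x. 2 * kint K2 G x" h] i[OF h] i[OF sq(2)[OF G]]
    by (simp add: g1.kint_cmult pair_op_def)
  have k2: "AE x in M. kint K2 (\<lambda>x. 2 * G x - g x - h x) x = 2 * kint K2 G x - kint K2 g x - kint K2 h x"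
  proof -
    have "AE x in M. kint K2 (\<lambda>x. 2 * G x - g x - h x) x = kint K2 (\<lambda>x. 2 * G x - g x) x - kint K2 h x"
      using i[OF G] i[OF g] i[OF h] by (intro g2.kint_diff) simp_all
    moreover have "AE x in M. kint K2 (\<lambda>x. 2 * G x - g x) x = kint K2 (\<lambda>x. 2 * G x) x - kint K2 g x"
      using i[OF G] i[OF g] by (intro g2.kint_diff) simp_all
    ultimately show ?thesis
      by eventually_elim (simp add: g2.kint_cmult)
  qed
  show pc: "poisson_chain M kernels u f"
    unfolding u_def
  proof (rule poisson_chainI[where f = f, OF space u0 u1 f_meas periodic])
    show "AE x in M. kint K1 (\<lambda>x. 2 * kint K2 G x - h x) x = 2 * G x - g x - h x - f 0 x"
      using k1 f0 pois by eventually_elim simp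
    show "AE x in M. kint K2 (\<lambda>x. 2 * G x - g x - h x) x = 2 * kint K2 G x - h x - f 1 x"
      using k2 f1 inv by eventually_elim simp
  qed
  interpret P: poisson_chain M kernels u f
    by (rule pc)
  let ?q = "kint K2 G" and ?k = "kint K1 h"
  note m = sq_int_mult
  note ints = m[OF h h] m[OF g g] m[OF sq(1)[OF h] sq(1)[OF h]] m[OF G g] m[OF G sq(1)[OF h]] m[OF g sq(1)[OF h]] m[OF G h] m[OF sq(2)[OF G] g]
  \<comment> \<open>Pairing each square of u with that of u - f at the same phase cancels all terms
    quadratic in \<open>G\<close>.\<close>
  have "P.s 0 + P.s 1 = ((\<integral>x. (u 1 x)\<^sup>2 \<partial>M) - (\<integral>x. (u 0 x - f 0 x)\<^sup>2 \<partial>M)) + ((\<integral>x. (u 0 x)\<^sup>2 \<partial>M) - (\<integral>x. (u 1 x - f 1 x)\<^sup>2 \<partial>M))"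
    using P.s_eq[of 0] P.s_eq[of 1] by (simp add: u_def)
  also have "\<dots> = (\<integral>x. (u 1 x)\<^sup>2 - (u 0 x - f 0 x)\<^sup>2 + ((u 0 x)\<^sup>2 - (u 1 x - f 1 x)\<^sup>2) \<partial>M)"
    using sq_int_square[OF P.u] sq_int_square[OF P.uf] by simp
  also have "\<dots> = (\<integral>x. h x * h x - 4 * (g x * g x) - ?k x * ?k x + 4 * (G x * g x) + 4 * (G x * ?k x) - 4 * (g x * ?k x)
      - 4 * (G x * h x) + 4 * (?q x * g x) \<partial>M)"
  proof (rule integral_cong_AE)
    show "AE x in M. (u 1 x)\<^sup>2 - (u 0 x - f 0 x)\<^sup>2 + ((u 0 x)\<^sup>2 - (u 1 x - f 1 x)\<^sup>2)
      = h x * h x - 4 * (g x * g x) - ?k x * ?k x + 4 * (G x * g x) + 4 * (G x * ?k x) - 4 * (g x * ?k x) - 4 * (G x * h x) + 4 * (?q x * g x)"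
      using f0 f1
    proof eventually_elim
      case (elim x)
      show ?case
        unfolding u_def elim by (simp add: power2_eq_square algebra_simps)
    qed
  qed (use borel_measurable_integrable[OF ints(1)] borel_measurable_integrable[OF ints(2)] borel_measurable_integrable[OF ints(3)]
      borel_measurable_integrable[OF ints(4)] borel_measurable_integrable[OF ints(5)] borel_measurable_integrable[OF ints(6)]
      borel_measurable_integrable[OF ints(7)] borel_measurable_integrable[OF ints(8)] in simp_all)
  also have "\<dots> = (\<integral>x. h x * h x \<partial>M) - 4 * (\<integral>x. g x * g x \<partial>M) - (\<integral>x. ?k x * ?k x \<partial>M) + 4 * (\<integral>x. G x * g x \<partial>M)
      + 4 * (\<integral>x. G x * ?k x \<partial>M) - 4 * (\<integral>x. g x * ?k x \<partial>M) - 4 * (\<integral>x. G x * h x \<partial>M) + 4 * (\<integral>x. ?q x * g x \<partial>M)"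
    using ints by simp
  also have "\<dots> = 8 * (\<integral>x. G x * g x \<partial>M) - 4 * (\<integral>x. g x * g x \<partial>M) - 4 * (\<integral>x. g x * h x \<partial>M)
        + (\<integral>x. h x * h x \<partial>M) - (\<integral>x. ?k x * ?k x \<partial>M)"
    using poisson_inner_products(1)[OF g g G inv(1) pois] poisson_inner_products(2)[OF g h G inv(2) pois] by simp
  finally show "P.s 0 + P.s 1 = 8 * (\<integral>x. G x * g x \<partial>M) - 4 * (\<integral>x. g x * g x \<partial>M) - 4 * (\<integral>x. g x * h x \<partial>M)
        + (\<integral>x. h x * h x \<partial>M) - (\<integral>x. ?k x * ?k x \<partial>M)" .
qed

text \<open>The same construction for the summand K1 g at every time. As K1 is a projection and K2
  fixes g, its mean is P^(i + 1) g at the times 2 i and 2 i + 1, which adds up to 2 (G - g) from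
  phase 0.\<close>

lemma conditional_mean_chain:
  assumes space: "space M = UNIV" and g: "sq_int M g" and G: "sq_int M G"
    and inv: "AE x in M. kint K2 g x = g x" and pois: "AE x in M. pair_op G x = G x - g x"
    and f_meas: "f \<in> borel_measurable M" and f: "AE x in M. f x = kint K1 g x"
  defines "u \<equiv> \<lambda>t::nat. if even t then (\<lambda>x. 2 * G x - 2 * g x) else (\<lambda>x. kint K1 g x + 2 * kint K2 G x - 2 * g x)"
  shows "poisson_chain M kernels u (\<lambda>_. f)"
    and "poisson_chain.s M kernels u (\<lambda>_. f) 0 + poisson_chain.s M kernels u (\<lambda>_. f) 1
      = 8 * (\<integral>x. G x * g x \<partial>M) - 8 * (\<integral>x. g x * g x \<partial>M) - 4 * (\<integral>x. kint K1 g x * kint K1 g x \<partial>M)"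
proof -
  note sq = g1.sq_int_kint(1) g2.sq_int_kint(1)
  have u0: "sq_int M (\<lambda>x. 2 * G x - 2 * g x)" and u1: "sq_int M (\<lambda>x. kint K1 g x + 2 * kint K2 G x - 2 * g x)"
    using g G sq by (auto intro!: sq_int_diff sq_int_add sq_int_cmult)
  note i = g1.sq_int_integrable
  have k1: "AE x in M. kint K1 (\<lambda>x. kint K1 g x + 2 * kint K2 G x - 2 * g x) x = kint K1 g x + 2 * pair_op G x - 2 * kint K1 g x"
  proof -
    have "AE x in M. kint K1 (\<lambda>x. kint K1 g x + 2 * kint K2 G x - 2 * g x) x = kint K1 (\<lambda>x. kint K1 g x + 2 * kint K2 G x) x - kint K1 (\<lambda>x. 2 * g x) x"
      using i[OF sq(1)[OF g]] i[OF sq(2)[OF G]] i[OF g] by (intro g1.kint_diff) simp_all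
    moreover have "AE x in M. kint K1 (\<lambda>x. kint K1 g x + 2 * kint K2 G x) x = kint K1 (kint K1 g) x + kint K1 (\<lambda>x. 2 * kint K2 G x) x"
      using i[OF sq(1)[OF g]] i[OF sq(2)[OF G]] by (intro g1.kint_add) simp_all
    ultimately show ?thesis
      using g1.kint_idem[OF i[OF g]] by eventually_elim (simp add: g1.kint_cmult pair_op_def)
  qed
  have k2: "AE x in M. kint K2 (\<lambda>x. 2 * G x - 2 * g x) x = 2 * kint K2 G x - 2 * kint K2 g x"
    using g2.kint_diff[of "\<lambda>x. 2 * G x" "\<lambda>x. 2 * g x"] i[OF G] i[OF g] by (simp add: g2.kint_cmult)
  show pc: "poisson_chain M kernels u (\<lambda>_. f)"
    unfolding u_def
  proof (rule poisson_chainI[where f = "\<lambda>_. f", OF space u0 u1 f_meas refl])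
    show "AE x in M. kint K1 (\<lambda>x. kint K1 g x + 2 * kint K2 G x - 2 * g x) x = 2 * G x - 2 * g x - f x"
      using k1 f pois by eventually_elim simp
    show "AE x in M. kint K2 (\<lambda>x. 2 * G x - 2 * g x) x = kint K1 g x + 2 * kint K2 G x - 2 * g x - f x"
      using k2 f inv by eventually_elim simp
  qed
  interpret P: poisson_chain M kernels u "\<lambda>_. f"
    by (rule pc)
  let ?q = "kint K2 G" and ?k = "kint K1 g"
  note m = sq_int_mult
  note ints = m[OF sq(2)[OF G] sq(1)[OF g]] m[OF g sq(1)[OF g]] m[OF G sq(1)[OF g]]
  have "P.s 0 + P.s 1 = ((\<integral>x. (u 1 x)\<^sup>2 \<partial>M) - (\<integral>x. (u 0 x - f x)\<^sup>2 \<partial>M)) + ((\<integral>x. (u 0 x)\<^sup>2 \<partial>M) - (\<integral>x. (u 1 x - f x)\<^sup>2 \<partial>M))"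
    using P.s_eq[of 0] P.s_eq[of 1] by (simp add: u_def)
  also have "\<dots> = (\<integral>x. (u 1 x)\<^sup>2 - (u 0 x - f x)\<^sup>2 + ((u 0 x)\<^sup>2 - (u 1 x - f x)\<^sup>2) \<partial>M)"
    using sq_int_square[OF P.u] sq_int_square[OF P.uf] by simp
  also have "\<dots> = (\<integral>x. 4 * (?q x * ?k x) - 8 * (g x * ?k x) + 4 * (G x * ?k x) \<partial>M)"
  proof (rule integral_cong_AE)
    show "AE x in M. (u 1 x)\<^sup>2 - (u 0 x - f x)\<^sup>2 + ((u 0 x)\<^sup>2 - (u 1 x - f x)\<^sup>2) = 4 * (?q x * ?k x) - 8 * (g x * ?k x) + 4 * (G x * ?k x)"
      using f
    proof eventually_elim
      case (elim x)
      show ?case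
        unfolding u_def elim by (simp add: power2_eq_square algebra_simps)
    qed
  qed (use borel_measurable_integrable[OF ints(1)] borel_measurable_integrable[OF ints(2)] borel_measurable_integrable[OF ints(3)] f_meas in simp_all)
  also have "\<dots> = 4 * (\<integral>x. ?q x * ?k x \<partial>M) - 8 * (\<integral>x. g x * ?k x \<partial>M) + 4 * (\<integral>x. G x * ?k x \<partial>M)"
    using ints by simp
  also have "\<dots> = 8 * (\<integral>x. G x * g x \<partial>M) - 8 * (\<integral>x. g x * g x \<partial>M) - 4 * (\<integral>x. ?k x * ?k x \<partial>M)"
    using poisson_inner_products[OF g g G inv pois] by simp
  finally show "P.s 0 + P.s 1 = 8 * (\<integral>x. G x * g x \<partial>M) - 8 * (\<integral>x. g x * g x \<partial>M) - 4 * (\<integral>x. ?k x * ?k x \<partial>M)" .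
qed

end

section \<open>Convergence in distribution of random vectors\<close>

lemma bilinear_sym:
  assumes "transpose S = (S :: real^'d^'d)"
  shows "x \<bullet> (S *v y) = y \<bullet> (S *v x)"
  using dot_lmul_matrix[of x S y] by (metis assms inner_commute transpose_matrix_vector)

text \<open>One step of symmetric Gaussian elimination with pivot S_ii. The form that remains is the
  minimum of the old one over shifts along axis \<open>i\<close>, hence nonnegative. The last part
  keeps rows that are already clear from filling up again.\<close>

lemma pos_semidef_rank_one_step:
  assumes S: "pos_semidef S" and a: "0 < S $ i $ i"
  defines "c \<equiv> (1 / sqrt (S $ i $ i)) *\<^sub>R column i S"
  shows "pos_semidef (S - outer c)" "(S - outer c) *v x = S *v x - (c \<bullet> x) *\<^sub>R c"
    "\<And>j. (S - outer c) $ i $ j = 0" "\<And>j k. S $ j $ i = 0 \<Longrightarrow> (S - outer c) $ j $ k = S $ j $ k"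
proof -
  have sym: "transpose S = S"
    using S by (simp add: pos_semidef_def)
  have sym': "S $ j $ k = S $ k $ j" for j k
    by (subst sym[symmetric]) (simp add: transpose_def)
  have out: "outer c *v x = (c \<bullet> x) *\<^sub>R c" for x
    by (simp add: vec_eq_iff outer_def matrix_vector_mult_def inner_vec_def sum_distrib_right sum_distrib_left mult_ac)
  show mv: "(S - outer c) *v x = S *v x - (c \<bullet> x) *\<^sub>R c" for x
    by (simp add: matrix_vector_mult_diff_rdistrib out)
  have e: "S *v axis i 1 = column i S"
    by (simp add: matrix_vector_mult_basis)
  show "pos_semidef (S - outer c)"
    unfolding pos_semidef_def
  proof (intro conjI allI)
    show "transpose (S - outer c) = S - outer c"
      using sym' by (simp add: vec_eq_iff transpose_def outer_def mult.commute)
    fix x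
    \<comment> \<open>The shift along axis \<open>i\<close> that minimises the form.\<close>
    define t where "t = (x \<bullet> column i S) / S $ i $ i"
    have "0 \<le> (x - t *\<^sub>R axis i 1) \<bullet> (S *v (x - t *\<^sub>R axis i 1))"
      using S by (simp add: pos_semidef_def)
    also have "\<dots> = x \<bullet> (S *v x) - 2 * t * (x \<bullet> column i S) + t\<^sup>2 * S $ i $ i"
    proof -
      have "axis i 1 \<bullet> (S *v x) = x \<bullet> column i S"
        using bilinear_sym[OF sym, of "axis i 1" x] by (simp add: e)
      moreover have "axis i 1 \<bullet> column i S = S $ i $ i"
        by (simp add: inner_axis' column_def)
      ultimately show ?thesis
        by (simp add: matrix_vector_mult_diff_distrib matrix_vector_mult_scaleR inner_diff_left inner_diff_right e
            power2_eq_square algebra_simps)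
    qed
    also have "\<dots> = x \<bullet> (S *v x) - (x \<bullet> c)\<^sup>2"
      using a by (simp add: t_def c_def power2_eq_square field_simps)
    finally show "0 \<le> x \<bullet> ((S - outer c) *v x)"
      by (simp add: mv inner_diff_right power2_eq_square inner_commute)
  qed
  have c: "c $ j = S $ j $ i / sqrt (S $ i $ i)" for j
    by (simp add: c_def column_def)
  show "(S - outer c) $ i $ j = 0" for j
    using a sym'[of i j] by (simp add: outer_def c)
  show "(S - outer c) $ j $ k = S $ j $ k" if "S $ j $ i = 0" for j k
    using that by (simp add: outer_def c)
qed

text \<open>Induction over an index set outside which all rows vanish; a positive pivot contributes
  one square, a zero pivot forces its row to vanish.\<close>

lemma pos_semidef_sum_squares:
  fixes S :: "real^'d^'d"
  assumes "pos_semidef S"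
  obtains r :: "'d \<Rightarrow> real^'d" where "\<And>x. x \<bullet> (S *v x) = (\<Sum>i\<in>UNIV. (x \<bullet> r i)\<^sup>2)"
proof -
  have "\<exists>r :: 'd \<Rightarrow> real^'d. \<forall>x. x \<bullet> (S *v x) = (\<Sum>i\<in>I. (x \<bullet> r i)\<^sup>2)"
    if "finite I" "pos_semidef S" "\<forall>j k. S $ j $ k \<noteq> 0 \<longrightarrow> j \<in> I" for I S
    using that
  proof (induction I arbitrary: S)
    case empty
    then have "S = 0"
      by (simp add: vec_eq_iff)
    then show ?case
      by simp
  next
    case (insert i I)
    have sym: "transpose S = S"
      using insert.prems by (simp add: pos_semidef_def)
    have sym': "S $ j $ k = S $ k $ j" for j k
      by (subst sym[symmetric]) (simp add: transpose_def)
    have ee: "axis j 1 \<bullet> (S *v axis k 1) = S $ j $ k" for j k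
      by (simp add: matrix_vector_mult_basis inner_axis' column_def)
    show ?case
    proof (cases "S $ i $ i = 0")
      case True
      have "S $ i $ j = 0" for j
      proof (rule ccontr)
        assume ne: "S $ i $ j \<noteq> 0"
        \<comment> \<open>With a zero pivot the form is affine in \<open>t\<close>, so a nonzero
          entry would let it take the value -1.\<close>
        define t where "t = - (S $ j $ j + 1) / (2 * S $ i $ j)"
        let ?x = "axis j 1 + t *\<^sub>R axis i 1"
        have "0 \<le> ?x \<bullet> (S *v ?x)"
          using insert.prems by (simp add: pos_semidef_def)
        also have "\<dots> = S $ j $ j + 2 * t * S $ i $ j"
          using True sym'[of i j]
          by (simp add: matrix_vector_right_distrib matrix_vector_mult_scaleR inner_add_left inner_add_right ee algebra_simps)
        also have "\<dots> = - 1"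
          using ne by (simp add: t_def field_simps)
        finally show False
          by simp
      qed
      then have "\<forall>j k. S $ j $ k \<noteq> 0 \<longrightarrow> j \<in> I"
        using insert.prems by blast
      with insert.IH insert.prems obtain r :: "'d \<Rightarrow> real^'d" where r: "\<forall>x. x \<bullet> (S *v x) = (\<Sum>i\<in>I. (x \<bullet> r i)\<^sup>2)"
        by blast
      have "(\<Sum>j\<in>I. (x \<bullet> (r(i := 0)) j)\<^sup>2) = (\<Sum>j\<in>I. (x \<bullet> r j)\<^sup>2)" for x
        using insert.hyps by (intro sum.cong) auto
      then have "\<forall>x. x \<bullet> (S *v x) = (\<Sum>j\<in>insert i I. (x \<bullet> (r(i := 0)) j)\<^sup>2)"
        using r insert.hyps by simp
      then show ?thesis
        by blast
    next
      case False
      have "0 \<le> S $ i $ i"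
        using insert.prems(1) ee[of i i, symmetric] unfolding pos_semidef_def by simp
      then have a: "0 < S $ i $ i"
        using False by simp
      define c where "c = (1 / sqrt (S $ i $ i)) *\<^sub>R column i S"
      note step = pos_semidef_rank_one_step[OF insert.prems(1) a, folded c_def]
      have "\<forall>j k. (S - outer c) $ j $ k \<noteq> 0 \<longrightarrow> j \<in> I"
      proof (intro allI impI)
        fix j k assume jk: "(S - outer c) $ j $ k \<noteq> 0"
        then have "j \<noteq> i"
          using step(3) by auto
        moreover have "j \<in> insert i I"
        proof (cases "S $ j $ i = 0")
          case True
          then show ?thesis
            using jk step(4)[OF True] insert.prems(2) by metis
        qed (use insert.prems(2) in blast)
        ultimately show "j \<in> I"
          by simp
      qed
      with insert.IH step(1) obtain r :: "'d \<Rightarrow> real^'d" where r: "\<forall>x. x \<bullet> ((S - outer c) *v x) = (\<Sum>i\<in>I. (x \<bullet> r i)\<^sup>2)"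
        by blast
      have "(\<Sum>j\<in>I. (x \<bullet> (r(i := c)) j)\<^sup>2) = (\<Sum>j\<in>I. (x \<bullet> r j)\<^sup>2)" for x
        using insert.hyps by (intro sum.cong) auto
      moreover have "x \<bullet> (S *v x) = x \<bullet> ((S - outer c) *v x) + (x \<bullet> c)\<^sup>2" for x
        by (simp add: step(2) inner_diff_right power2_eq_square inner_commute)
      ultimately have "\<forall>x. x \<bullet> (S *v x) = (\<Sum>j\<in>insert i I. (x \<bullet> (r(i := c)) j)\<^sup>2)"
        using r insert.hyps by simp
      then show ?thesis
        by blast
    qed
  qed
  from this[of UNIV S] show ?thesis
    using that assms by auto
qed

text \<open>Independent standard normals, combined with the vectors of the sum of squares: the
  characteristic function factorises and the exponents add up to the form.\<close>

lemma gaussian_exists: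
  fixes S :: "real^'d^'d"
  assumes "pos_semidef S"
  obtains L :: "(real^'d) measure" where "prob_space L" "sets L = sets borel"
    "\<And>x. (CLINT y|L. iexp (x \<bullet> y)) = of_real (exp (- (x \<bullet> (S *v x)) / 2))"
proof -
  obtain r :: "'d \<Rightarrow> real^'d" where r: "\<And>x. x \<bullet> (S *v x) = (\<Sum>i\<in>UNIV. (x \<bullet> r i)\<^sup>2)"
    using pos_semidef_sum_squares[OF assms] by blast
  interpret std: prob_space std_normal_distribution
    using real_dist_normal_dist by (simp add: real_distribution_def)
  interpret G: product_prob_space "\<lambda>_::'d. std_normal_distribution" UNIV ..
  have PP: "prob_space (\<Pi>\<^sub>M i\<in>(UNIV::'d set). std_normal_distribution)"
    by (rule prob_space_PiM) unfold_locales
  define Z where "Z \<omega> = (\<Sum>i\<in>UNIV. \<omega> i *\<^sub>R r i)" for \<omega> :: "'d \<Rightarrow> real"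
  have Z[measurable]: "Z \<in> (\<Pi>\<^sub>M i\<in>UNIV. std_normal_distribution) \<rightarrow>\<^sub>M borel"
    unfolding Z_def by measurable
  show ?thesis
  proof (rule that[of "distr (\<Pi>\<^sub>M i\<in>UNIV. std_normal_distribution) borel Z"])
    show "prob_space (distr (\<Pi>\<^sub>M i\<in>UNIV. std_normal_distribution) borel Z)"
      by (rule prob_space.prob_space_distr[OF PP Z])
    fix x :: "real^'d"
    have "(CLINT y|distr (\<Pi>\<^sub>M i\<in>UNIV. std_normal_distribution) borel Z. iexp (x \<bullet> y))
        = (CLINT \<omega>|(\<Pi>\<^sub>M i\<in>UNIV. std_normal_distribution). iexp (x \<bullet> Z \<omega>))"
      by (rule integral_distr[OF Z]) measurable
    also have "\<dots> = (CLINT \<omega>|(\<Pi>\<^sub>M i\<in>UNIV. std_normal_distribution). (\<Prod>i\<in>UNIV. iexp ((x \<bullet> r i) * \<omega> i)))"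
      by (simp add: Z_def inner_sum_right exp_sum[symmetric] sum_distrib_left mult_ac)
    also have "\<dots> = (\<Prod>i\<in>UNIV. CLINT y|std_normal_distribution. iexp ((x \<bullet> r i) * y))"
      by (rule G.product_integral_prod) (auto intro!: std.integrable_const_bound[where B = 1])
    also have "\<dots> = (\<Prod>i\<in>UNIV. char std_normal_distribution (x \<bullet> r i))"
      by (simp add: char_def)
    also have "\<dots> = complex_of_real (\<Prod>i\<in>UNIV. exp (- (x \<bullet> r i)\<^sup>2 / 2))"
      by (simp add: char_std_normal_distribution)
    also have "(\<Prod>i\<in>UNIV. exp (- (x \<bullet> r i)\<^sup>2 / 2)) = exp (- (x \<bullet> (S *v x)) / 2)"
      by (simp add: exp_sum[symmetric] r sum_negf sum_divide_distrib)
    finally show "(CLINT y|distr (\<Pi>\<^sub>M i\<in>UNIV. std_normal_distribution) borel Z. iexp (x \<bullet> y))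
        = of_real (exp (- (x \<bullet> (S *v x)) / 2))" .
  qed simp
qed

text \<open>Real trigonometric polynomials; the complex coefficient covers sines as well as cosines.
  Their integrals converge whenever characteristic functions do, and they form an algebra, ready for
  Stone--Weierstrass.\<close>

inductive trig :: "(real^'d \<Rightarrow> real) \<Rightarrow> bool" where
  wave: "trig (\<lambda>x. Re (c * iexp (s \<bullet> x)))"
| add: "trig p \<Longrightarrow> trig q \<Longrightarrow> trig (\<lambda>x. p x + q x)"

lemma trig_const: "trig (\<lambda>x. c)"
  using trig.wave[of "complex_of_real c" 0] by simp

lemma trig_continuous: "trig p \<Longrightarrow> continuous_on S p"
  by (induction rule: trig.induct) (auto intro!: continuous_intros)

lemma trig_bounded: "trig p \<Longrightarrow> \<exists>C. \<forall>x. \<bar>p x\<bar> \<le> C"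
proof (induction rule: trig.induct)
  case (wave c s)
  have "\<bar>Re (c * iexp (s \<bullet> x))\<bar> \<le> cmod c" for x
    using abs_Re_le_cmod[of "c * iexp (s \<bullet> x)"] by (simp add: norm_mult)
  then show ?case
    by blast
next
  case (add p q)
  then obtain C C' where "\<forall>x. \<bar>p x\<bar> \<le> C" "\<forall>x. \<bar>q x\<bar> \<le> C'"
    by blast
  then have "\<forall>x. \<bar>p x + q x\<bar> \<le> C + C'"
    by (meson abs_triangle_ineq add_mono order_trans)
  then show ?case
    by blast
qed

text \<open>Re a Re b = Re (a b) / 2 + Re (a conj b) / 2 turns the frequencies s and s' into s + s'
  and s - s'.\<close>

lemma trig_mult:
  assumes "trig p" "trig q"
  shows "trig (\<lambda>x. p x * q x)"
  using assms(1)
proof induction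
  case (wave c s)
  show ?case
    using assms(2)
  proof induction
    case (wave c' s')
    have "Re (c * iexp (s \<bullet> x)) * Re (c' * iexp (s' \<bullet> x))
        = Re ((c * c' / 2) * iexp ((s + s') \<bullet> x)) + Re ((c * cnj c' / 2) * iexp ((s - s') \<bullet> x))" for x
    proof -
      have re: "Re a * Re b = Re (a * b / 2) + Re (a * cnj b / 2)" for a b
        by (simp add: add_divide_distrib diff_divide_distrib)
      have "iexp ((s + s') \<bullet> x) = iexp (s \<bullet> x) * iexp (s' \<bullet> x)"
        by (simp add: inner_add_left exp_add[symmetric] distrib_left)
      then have 1: "c * c' / 2 * iexp ((s + s') \<bullet> x) = c * iexp (s \<bullet> x) * (c' * iexp (s' \<bullet> x)) / 2"
        by simp
      have "iexp ((s - s') \<bullet> x) = iexp (s \<bullet> x) * cnj (iexp (s' \<bullet> x))"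
        by (simp add: inner_diff_left exp_cnj exp_add[symmetric] algebra_simps)
      then have 2: "c * cnj c' / 2 * iexp ((s - s') \<bullet> x) = c * iexp (s \<bullet> x) * cnj (c' * iexp (s' \<bullet> x)) / 2"
        by simp
      show ?thesis
        unfolding 1 2 by (rule re)
    qed
    then show ?case
      by (simp only: trig.intros)
  next
    case (add p q)
    show ?case
      unfolding distrib_left by (rule trig.add[OF add.IH])
  qed
next
  case (add p1 p2)
  show ?case
    unfolding distrib_right by (rule trig.add[OF add.IH])
qed

lemma trig_polynomial: "real_polynomial_function q \<Longrightarrow> trig p \<Longrightarrow> trig (\<lambda>x. q (p x) :: real)"
proof (induction rule: real_polynomial_function.induct)
  case (linear f)
  then have "f (p x) = f 1 * p x" for x
    by (simp add: real_bounded_linear) (metis mult.commute mult_1)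
  then show ?case
    using trig_mult[OF trig_const[of "f 1"] linear(2)] by simp
qed (auto intro: trig_const trig.add trig_mult)

text \<open>Stone--Weierstrass controls the approximant on \<open>K\<close> only. The global bound
  comes from composing it with a real polynomial that approximates clipping to [-B, B] on its whole
  range.\<close>

lemma trig_approx:
  fixes f :: "real^'d \<Rightarrow> real"
  assumes f: "continuous_on UNIV f" and K: "compact K" and B: "\<And>x. \<bar>f x\<bar> \<le> B" and e: "0 < e"
  obtains p where "trig p" "\<And>x. x \<in> K \<Longrightarrow> \<bar>f x - p x\<bar> \<le> e" "\<And>x. \<bar>p x\<bar> \<le> B + e"
proof -
  have "\<exists>p. trig p \<and> (\<forall>x\<in>K. \<bar>f x - p x\<bar> < e / 2)"
  proof (rule Stone_Weierstrass_HOL[OF K])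
    show "\<exists>p. trig p \<and> p x \<noteq> p y" if xy: "x \<in> K \<and> y \<in> K \<and> x \<noteq> y" for x y
    proof (rule ccontr)
      assume no: "\<not> ?thesis"
      \<comment> \<open>Scaled so that the phases at x and y differ by exactly 1, which is not a
        multiple of the period.\<close>
      define s where "s = (1 / ((x - y) \<bullet> (x - y))) *\<^sub>R (x - y)"
      have "(x - y) \<bullet> (x - y) \<noteq> 0"
        using xy by simp
      then have "s \<bullet> x - s \<bullet> y = 1"
        unfolding inner_diff_right[symmetric] by (simp add: s_def)
      then have sx: "s \<bullet> x = s \<bullet> y + 1"
        by simp
      have "Re (1 * iexp (s \<bullet> x)) = Re (1 * iexp (s \<bullet> y))" "Re (- \<i> * iexp (s \<bullet> x)) = Re (- \<i> * iexp (s \<bullet> y))"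
        using no trig.wave[of _ s] by blast+
      then have "iexp (s \<bullet> x) = iexp (s \<bullet> y)"
        by (simp add: complex_eq_iff)
      then have "iexp (s \<bullet> y) * exp \<i> = iexp (s \<bullet> y)"
        unfolding sx by (simp add: exp_add distrib_left)
      then have "exp \<i> = 1"
        by simp
      then have "Re (exp \<i>) = 1"
        by simp
      then have "cos 1 = (1::real)"
        by (simp add: Re_exp)
      moreover have "cos 1 < cos (0::real)"
        using pi_ge_two by (intro cos_monotone_0_pi) auto
      ultimately show False
        by simp
    qed
  qed (use f e in \<open>auto intro: trig_const trig_continuous trig.add trig_mult continuous_on_subset\<close>)
  then obtain p where p: "trig p" "\<And>x. x \<in> K \<Longrightarrow> \<bar>f x - p x\<bar> < e / 2"
    by blast
  obtain C where C: "\<And>x. \<bar>p x\<bar> \<le> C"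
    using trig_bounded[OF p(1)] by blast
  define clip where "clip t = max (- B) (min B t)" for t
  have B0: "0 \<le> B"
    using B abs_ge_zero order_trans by blast
  obtain q where q: "real_polynomial_function q" "\<And>t. t \<in> {- C..C} \<Longrightarrow> \<bar>clip t - q t\<bar> < e / 2"
    by (rule Stone_Weierstrass_real_polynomial_function[of "{- C..C}" clip "e / 2"])
      (use e in \<open>auto simp: clip_def intro!: continuous_intros\<close>)
  have q': "\<bar>clip (p x) - q (p x)\<bar> < e / 2" for x
    using q(2)[of "p x"] C[of x] by (auto simp: abs_le_iff)
  show ?thesis
  proof (rule that)
    show "trig (\<lambda>x. q (p x))"
      by (rule trig_polynomial[OF q(1) p(1)])
    show "\<bar>f x - q (p x)\<bar> \<le> e" if "x \<in> K" for x
    proof -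
      have "\<bar>f x - clip (p x)\<bar> \<le> \<bar>f x - p x\<bar>"
        using B[of x] unfolding clip_def by linarith
      then show ?thesis
        using p(2)[OF that] q'[of x] by linarith
    qed
    show "\<bar>q (p x)\<bar> \<le> B + e" for x
    proof -
      have "\<bar>clip (p x)\<bar> \<le> B"
        using B0 unfolding clip_def by linarith
      then show ?thesis
        using q'[of x] e by linarith
    qed
  qed
qed

text \<open>Fubini with point and frequency exchanged: a Gaussian function is the characteristic
  function of a Gaussian law, so its integral under \<mu> averages the characteristic function of
  \<mu>.\<close>

lemma exp_norm_eq_gaussian_average:
  fixes \<mu> G :: "(real^'d) measure"
  assumes "prob_space \<mu>" "prob_space G" and sets[measurable_cong]: "sets \<mu> = sets borel" "sets G = sets borel"
    and G: "\<And>x. (CLINT y|G. iexp (x \<bullet> y)) = of_real (exp (- (x \<bullet> x) / 2))" and c: "0 \<le> c"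
  shows "complex_of_real (\<integral>x. exp (- c * (x \<bullet> x)) \<partial>\<mu>) = (CLINT z|G. CLINT x|\<mu>. iexp ((sqrt (2 * c) *\<^sub>R z) \<bullet> x))"
proof -
  interpret \<mu>: prob_space \<mu> by fact
  interpret G: prob_space G by fact
  interpret pair_prob_space \<mu> G ..
  have "(CLINT z|G. CLINT x|\<mu>. iexp ((sqrt (2 * c) *\<^sub>R z) \<bullet> x)) = (CLINT x|\<mu>. CLINT z|G. iexp ((sqrt (2 * c) *\<^sub>R z) \<bullet> x))"
    by (rule Fubini_integral) (auto intro!: integrable_const_bound[where B = 1])
  also have "\<dots> = (CLINT x|\<mu>. of_real (exp (- c * (x \<bullet> x))))"
  proof (rule Bochner_Integration.integral_cong[OF refl])
    fix x
    have "(CLINT z|G. iexp ((sqrt (2 * c) *\<^sub>R z) \<bullet> x)) = (CLINT z|G. iexp ((sqrt (2 * c) *\<^sub>R x) \<bullet> z))"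
      by (simp add: inner_commute)
    also have "\<dots> = of_real (exp (- c * (x \<bullet> x)))"
      unfolding G using c by (simp add: mult.assoc[symmetric])
    finally show "(CLINT z|G. iexp ((sqrt (2 * c) *\<^sub>R z) \<bullet> x)) = of_real (exp (- c * (x \<bullet> x)))" .
  qed
  finally show ?thesis
    by simp
qed

text \<open>Trigonometric polynomials approximate \<open>f\<close> on balls only, so tightness is
  required. It comes from the test functions exp(- c |x|^2): their integrals converge, as Gaussian
  averages of characteristic functions, and for small c they are close to 1 under
  \<open>L\<close>.\<close>

theorem multivariate_levy_continuity:
  fixes \<mu> :: "nat \<Rightarrow> (real^'d) measure" and L :: "(real^'d) measure"
  assumes prob: "\<And>n. prob_space (\<mu> n)" "prob_space L"
    and sets[measurable_cong]: "\<And>n. sets (\<mu> n) = sets borel" "sets L = sets borel"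
    and char: "\<And>s. (\<lambda>n. CLINT x|\<mu> n. iexp (s \<bullet> x)) \<longlonglongrightarrow> (CLINT x|L. iexp (s \<bullet> x))"
    and f: "continuous_on UNIV f" "bounded (range f)"
  shows "(\<lambda>n. \<integral>x. f x \<partial>\<mu> n) \<longlonglongrightarrow> (\<integral>x. f x \<partial>L :: real)"
proof -
  have int: "integrable \<nu> h" if "prob_space \<nu>" "sets \<nu> = sets borel" "h \<in> borel_measurable borel" "\<And>x. norm (h x) \<le> C"
    for \<nu> :: "(real^'d) measure" and h :: "real^'d \<Rightarrow> 'c::{banach, second_countable_topology}" and C
  proof -
    interpret prob_space \<nu> by fact
    have "h \<in> borel_measurable \<nu>"
      using that(2,3) measurable_cong_sets by blast
    then show ?thesis
      using that(4) by (intro integrable_const_bound[where B = C]) auto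
  qed
  have intc: "complex_integrable \<nu> (\<lambda>x. iexp (s \<bullet> x))" if "prob_space \<nu>" "sets \<nu> = sets borel"
    for \<nu> :: "(real^'d) measure" and s
  proof -
    interpret prob_space \<nu> by fact
    have "(\<lambda>x. iexp (s \<bullet> x)) \<in> borel_measurable borel"
      by measurable
    then have "(\<lambda>x. iexp (s \<bullet> x)) \<in> borel_measurable \<nu>"
      using that(2) measurable_cong_sets by blast
    then show ?thesis
      by (intro integrable_const_bound[where B = 1]) auto
  qed
  have trig_meas: "p \<in> borel_measurable borel" if "trig p" for p :: "real^'d \<Rightarrow> real"
    using trig_continuous[OF that, of UNIV] by (rule borel_measurable_continuous_onI)
  have trig_lim: "(\<lambda>n. \<integral>x. p x \<partial>\<mu> n) \<longlonglongrightarrow> (\<integral>x. p x \<partial>L)" if "trig p" for p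
    using that
  proof induction
    case (wave c s)
    have eq: "(\<integral>x. Re (c * iexp (s \<bullet> x)) \<partial>\<nu>) = Re (c * (CLINT x|\<nu>. iexp (s \<bullet> x)))"
      if "prob_space \<nu>" "sets \<nu> = sets borel" for \<nu> :: "(real^'d) measure"
      using intc[OF that, of s] by (subst integral_Re) (simp_all del: times_complex.sel)
    show ?case
      unfolding eq[OF prob(1) sets(1)] eq[OF prob(2) sets(2)] by (intro tendsto_intros char)
  next
    case (add p q)
    have i: "integrable \<nu> p" "integrable \<nu> q" if "prob_space \<nu>" "sets \<nu> = sets borel" for \<nu>
      using trig_bounded[OF add(1)] trig_bounded[OF add(2)] int[OF that trig_meas[OF add(1)]] int[OF that trig_meas[OF add(2)]]
      by auto
    show ?case
      using tendsto_add[OF add.IH] i[OF prob(1) sets(1)] i[OF prob(2) sets(2)] by simp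
  qed
  have "pos_semidef (mat 1 :: real^'d^'d)"
    by (simp add: pos_semidef_def transpose_mat)
  then obtain G :: "(real^'d) measure" where G: "prob_space G" "sets G = sets borel"
    "\<And>x. (CLINT y|G. iexp (x \<bullet> y)) = of_real (exp (- (x \<bullet> x) / 2))"
    using gaussian_exists[of "mat 1 :: real^'d^'d"] by auto
  interpret L: prob_space L by fact
  interpret G: prob_space G by fact
  have sq: "(\<lambda>x::real^'d. exp (- c * (x \<bullet> x))) \<in> borel_measurable borel" for c :: real
    by measurable
  have avg: "(\<lambda>n. \<integral>x. exp (- c * (x \<bullet> x)) \<partial>\<mu> n) \<longlonglongrightarrow> (\<integral>x. exp (- c * (x \<bullet> x)) \<partial>L)" if c: "0 \<le> c" for c
  proof -
    have m: "(\<lambda>z. CLINT x|\<nu>. iexp ((sqrt (2 * c) *\<^sub>R z) \<bullet> x)) \<in> borel_measurable G"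
      if "prob_space \<nu>" "sets \<nu> = sets borel" for \<nu>
    proof -
      interpret prob_space \<nu> by fact
      note [measurable_cong] = that(2) G(2)
      show ?thesis
        by (rule borel_measurable_lebesgue_integral) measurable
    qed
    have "(\<lambda>n. CLINT z|G. CLINT x|\<mu> n. iexp ((sqrt (2 * c) *\<^sub>R z) \<bullet> x))
        \<longlonglongrightarrow> (CLINT z|G. CLINT x|L. iexp ((sqrt (2 * c) *\<^sub>R z) \<bullet> x))"
    proof (rule integral_dominated_convergence[where w = "\<lambda>_. 1"])
      show "AE z in G. norm (CLINT x|\<mu> n. iexp ((sqrt (2 * c) *\<^sub>R z) \<bullet> x)) \<le> 1" for n
      proof (rule AE_I2)
        fix z
        interpret \<mu>: prob_space "\<mu> n"
          by (rule prob)
        have "norm (CLINT x|\<mu> n. iexp ((sqrt (2 * c) *\<^sub>R z) \<bullet> x)) \<le> (\<integral>x. norm (iexp ((sqrt (2 * c) *\<^sub>R z) \<bullet> x)) \<partial>\<mu> n)"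
          by (rule integral_norm_bound)
        then show "norm (CLINT x|\<mu> n. iexp ((sqrt (2 * c) *\<^sub>R z) \<bullet> x)) \<le> 1"
          by (simp add: \<mu>.prob_space)
      qed
      show "AE z in G. (\<lambda>n. CLINT x|\<mu> n. iexp ((sqrt (2 * c) *\<^sub>R z) \<bullet> x))
          \<longlonglongrightarrow> (CLINT x|L. iexp ((sqrt (2 * c) *\<^sub>R z) \<bullet> x))"
        by (rule AE_I2) (rule char)
    qed (rule m[OF prob(2) sets(2)], rule m[OF prob(1) sets(1)], simp)
    then show ?thesis
      unfolding exp_norm_eq_gaussian_average[OF prob(1) G(1) sets(1) G(2,3) c, symmetric]
        exp_norm_eq_gaussian_average[OF prob(2) G(1) sets(2) G(2,3) c, symmetric]
      by (simp add: tendsto_of_real_iff)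
  qed
  have tight: "\<exists>R. (\<forall>\<^sub>F n in sequentially. measure (\<mu> n) (- cball 0 R) \<le> e) \<and> measure L (- cball 0 R) \<le> e" if e: "0 < e" for e
  proof -
    have "(\<lambda>k. \<integral>x. exp (- inverse (real (Suc k)) * (x \<bullet> x)) \<partial>L) \<longlonglongrightarrow> (\<integral>x. 1 \<partial>L)"
    proof (rule integral_dominated_convergence[where w = "\<lambda>_. 1"])
      show "AE x in L. (\<lambda>k. exp (- inverse (real (Suc k)) * (x \<bullet> x))) \<longlonglongrightarrow> 1"
      proof (rule AE_I2)
        fix x
        have "(\<lambda>k. exp (- inverse (real (Suc k)) * (x \<bullet> x))) \<longlonglongrightarrow> exp (- 0 * (x \<bullet> x))"
          by (intro tendsto_intros LIMSEQ_inverse_real_of_nat)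
        then show "(\<lambda>k. exp (- inverse (real (Suc k)) * (x \<bullet> x))) \<longlonglongrightarrow> 1"
          by simp
      qed
    qed (auto intro!: AE_I2)
    then have "\<forall>\<^sub>F k in sequentially. 1 - e / 4 < (\<integral>x. exp (- inverse (real (Suc k)) * (x \<bullet> x)) \<partial>L)"
      using e L.prob_space by (intro order_tendstoD(1)) auto
    then obtain k where "1 - e / 4 < (\<integral>x. exp (- inverse (real (Suc k)) * (x \<bullet> x)) \<partial>L)"
      unfolding eventually_sequentially by blast
    moreover define c where "c = inverse (real (Suc k))"
    ultimately have c: "0 < c" "1 - e / 4 < (\<integral>x. exp (- c * (x \<bullet> x)) \<partial>L)"
      by simp_all
    \<comment> \<open>Outside this ball exp(- c |x|^2) is at most 1/2, so 1 - exp(- c |x|^2)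
      dominates half the indicator.\<close>
    define R where "R = sqrt (ln 2 / c)"
    have mark: "measure \<nu> (- cball 0 R) \<le> e" if \<nu>: "prob_space \<nu>" "sets \<nu> = sets borel" and lt: "1 - e / 4 < (\<integral>x. exp (- c * (x \<bullet> x)) \<partial>\<nu>)"
      for \<nu> :: "(real^'d) measure"
    proof -
      interpret prob_space \<nu> by fact
      have A: "- cball 0 R \<in> sets \<nu>"
        unfolding \<nu>(2) by simp
      have i: "integrable \<nu> (\<lambda>x. exp (- c * (x \<bullet> x)))"
        using c by (intro int[OF \<nu> sq, of _ 1]) simp
      have "measure \<nu> (- cball 0 R) / 2 = (\<integral>x. indicator (- cball 0 R) x / 2 \<partial>\<nu>)"
        using A by simp
      also have "\<dots> \<le> (\<integral>x. 1 - exp (- c * (x \<bullet> x)) \<partial>\<nu>)"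
      proof (rule integral_mono)
        show "integrable \<nu> (\<lambda>x. indicator (- cball 0 R) x / 2 :: real)"
          using A by (simp add: emeasure_eq_measure)
        show "integrable \<nu> (\<lambda>x. 1 - exp (- c * (x \<bullet> x)))"
          using i by simp
        fix x :: "real^'d"
        show "indicator (- cball 0 R) x / 2 \<le> 1 - exp (- c * (x \<bullet> x))"
        proof (cases "x \<in> cball 0 R")
          case True
          then show ?thesis
            using c by simp
        next
          case False
          then have "R < norm x"
            by simp
          moreover have "0 \<le> R"
            using c by (simp add: R_def)
          ultimately have "R\<^sup>2 \<le> (norm x)\<^sup>2"
            by (intro power_mono) auto
          then have "ln 2 / c \<le> x \<bullet> x"
            using c by (simp add: R_def dot_square_norm)
          then have "ln 2 \<le> c * (x \<bullet> x)"
            using c by (simp add: field_simps)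
          then have "exp (- c * (x \<bullet> x)) \<le> exp (- ln 2)"
            by simp
          then show ?thesis
            using False by (simp add: exp_minus)
        qed
      qed
      also have "\<dots> < e / 4"
        using i lt by (simp add: prob_space)
      finally show ?thesis
        using e by simp
    qed
    have "\<forall>\<^sub>F n in sequentially. 1 - e / 4 < (\<integral>x. exp (- c * (x \<bullet> x)) \<partial>\<mu> n)"
      using order_tendstoD(1)[OF avg c(2)] c(1) by simp
    then have "\<forall>\<^sub>F n in sequentially. measure (\<mu> n) (- cball 0 R) \<le> e"
      by eventually_elim (rule mark[OF prob(1) sets(1)])
    then show ?thesis
      using mark[OF prob(2) sets(2) c(2)] by blast
  qed
  obtain B where B: "\<And>x. \<bar>f x\<bar> \<le> B"
    using f(2) by (auto simp: bounded_iff)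
  have B0: "0 \<le> B"
    using B abs_ge_zero order_trans by blast
  have f_meas: "f \<in> borel_measurable borel"
    using f(1) by (rule borel_measurable_continuous_onI)
  show ?thesis
  proof (rule LIMSEQ_I)
    fix e' :: real assume e': "0 < e'"
    \<comment> \<open>Off the ball |f - p| \<le> 2 B + e \<le> 2 B + 1, on mass at most e; together
      with e on the ball this is (2 B + 2) e for each of the two laws.\<close>
    define e where "e = min 1 (e' / (4 * (2 * B + 2)))"
    have e: "0 < e" "e \<le> 1" "2 * ((2 * B + 2) * e) < e'"
    proof -
      show "0 < e" "e \<le> 1"
        using e' B0 by (auto simp: e_def)
      have "e \<le> e' / (4 * (2 * B + 2))"
        by (simp add: e_def)
      then have "(2 * B + 2) * e \<le> e' / 4"
        using B0 by (simp add: field_simps)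
      then show "2 * ((2 * B + 2) * e) < e'"
        using e' by simp
    qed
    obtain R where R: "\<forall>\<^sub>F n in sequentially. measure (\<mu> n) (- cball 0 R) \<le> e" "measure L (- cball 0 R) \<le> e"
      using tight[OF e(1)] by blast
    obtain p where p: "trig p" "\<And>x. x \<in> cball 0 R \<Longrightarrow> \<bar>f x - p x\<bar> \<le> e" "\<And>x. \<bar>p x\<bar> \<le> B + e"
      using trig_approx[OF f(1) compact_cball[of 0 R] B e(1)] by blast
    have close: "\<bar>(\<integral>x. f x \<partial>\<nu>) - (\<integral>x. p x \<partial>\<nu>)\<bar> \<le> (2 * B + 2) * e"
      if \<nu>: "prob_space \<nu>" "sets \<nu> = sets borel" and le: "measure \<nu> (- cball 0 R) \<le> e" for \<nu>
    proof -
      interpret prob_space \<nu> by fact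
      have A: "- cball 0 R \<in> sets \<nu>"
        unfolding \<nu>(2) by simp
      have i: "integrable \<nu> f" "integrable \<nu> p"
        using int[OF \<nu> f_meas] int[OF \<nu> trig_meas[OF p(1)]] B p(3) by auto
      have ii: "integrable \<nu> (\<lambda>x. indicator (- cball 0 R) x :: real)"
        using A by (simp add: emeasure_eq_measure)
      have "\<bar>(\<integral>x. f x \<partial>\<nu>) - (\<integral>x. p x \<partial>\<nu>)\<bar> \<le> (\<integral>x. \<bar>f x - p x\<bar> \<partial>\<nu>)"
        using i integral_abs_bound[of \<nu> "\<lambda>x. f x - p x"] by simp
      also have "\<dots> \<le> (\<integral>x. e + (2 * B + 1) * indicator (- cball 0 R) x \<partial>\<nu>)"
      proof (rule integral_mono)
        fix x
        show "\<bar>f x - p x\<bar> \<le> e + (2 * B + 1) * indicator (- cball 0 R) x"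
        proof (cases "x \<in> cball 0 R")
          case True
          then show ?thesis
            using p(2)[OF True] by simp
        next
          case False
          have "\<bar>f x - p x\<bar> \<le> B + (B + e)"
            using B[of x] p(3)[of x] by linarith
          then show ?thesis
            using False e by simp
        qed
      qed (use i ii in simp_all)
      also have "\<dots> = e + (2 * B + 1) * measure \<nu> (- cball 0 R)"
        using A ii by (simp add: prob_space)
      also have "\<dots> \<le> e + (2 * B + 1) * e"
        using le B0 by (intro add_left_mono mult_left_mono) auto
      finally show ?thesis
        by (simp add: algebra_simps)
    qed
    have "\<forall>\<^sub>F n in sequentially. dist (\<integral>x. p x \<partial>\<mu> n) (\<integral>x. p x \<partial>L) < e' - 2 * ((2 * B + 2) * e)"
      using e by (intro tendstoD[OF trig_lim[OF p(1)]]) simp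
    with R(1) have "\<forall>\<^sub>F n in sequentially. norm ((\<integral>x. f x \<partial>\<mu> n) - (\<integral>x. f x \<partial>L)) < e'"
    proof eventually_elim
      case (elim n)
      then show ?case
        using close[OF prob(1) sets(1) elim(1)] close[OF prob(2) sets(2) R(2)]
        unfolding dist_real_def real_norm_def by linarith
    qed
    then show "\<exists>N. \<forall>n\<ge>N. norm ((\<integral>x. f x \<partial>\<mu> n) - (\<integral>x. f x \<partial>L)) < e'"
      by (simp add: eventually_sequentially)
  qed
qed

section \<open>Asymptotic variances\<close>

lemma transpose_scaleR: "transpose (c *\<^sub>R A) = c *\<^sub>R transpose (A :: real^'n^'m)"
  by (simp add: vec_eq_iff transpose_def)

lemma transpose_add: "transpose (A + B) = transpose A + transpose (B :: real^'n^'m)"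
  by (simp add: vec_eq_iff transpose_def)

lemma transpose_diff: "transpose (A - B) = transpose A - transpose (B :: real^'n^'m)"
  by (simp add: vec_eq_iff transpose_def)

lemma mat_eq_scaleR: "mat c = c *\<^sub>R (mat 1 :: real^'n^'n)"
  by (simp add: vec_eq_iff mat_def)

lemma scaleR_matrix_mult_left: "(c *\<^sub>R A) ** B = c *\<^sub>R (A ** (B :: real^'n^'k))"
  by (simp add: vec_eq_iff matrix_matrix_mult_def sum_distrib_left mult.assoc)

lemma scaleR_matrix_mult_right: "A ** (c *\<^sub>R B) = c *\<^sub>R (A ** (B :: real^'n^'k))"
  by (simp add: vec_eq_iff matrix_matrix_mult_def sum_distrib_left mult.left_commute)

lemma matrix_add_rdistrib: "(B + C) ** A = B ** A + (C :: real^'n^'m) ** A"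
  by (simp add: vec_eq_iff matrix_matrix_mult_def distrib_right sum.distrib)

lemma pos_def_imp_pos_semidef: "pos_def A \<Longrightarrow> pos_semidef A"
  unfolding pos_def_def pos_semidef_def by (metis inner_zero_left order_less_imp_le order_refl)

text \<open>Otherwise a move from v against S v makes the form negative: for the small
  \<open>t\<close> chosen below, the linear term - 2 t |S v|^2 beats the quadratic one.\<close>

lemma pos_semidef_null_vector:
  fixes S :: "real^'d^'d"
  assumes S: "pos_semidef S" and v: "v \<bullet> (S *v v) = 0"
  shows "S *v v = 0"
proof (rule ccontr)
  assume ne: "S *v v \<noteq> 0"
  let ?w = "S *v v"
  define t where "t = (?w \<bullet> ?w) / (1 + ?w \<bullet> (S *v ?w))"
  have W: "0 < ?w \<bullet> ?w" "0 \<le> ?w \<bullet> (S *v ?w)"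
    using ne S by (simp_all add: pos_semidef_def)
  then have t: "0 < t"
    by (simp add: t_def)
  have sym: "v \<bullet> (S *v ?w) = ?w \<bullet> ?w"
    using bilinear_sym[of S v ?w] S by (simp add: pos_semidef_def)
  have "0 \<le> (v - t *\<^sub>R ?w) \<bullet> (S *v (v - t *\<^sub>R ?w))"
    using S by (simp add: pos_semidef_def)
  also have "\<dots> = t\<^sup>2 * (?w \<bullet> (S *v ?w)) - 2 * t * (?w \<bullet> ?w)"
    using v sym by (simp add: matrix_vector_mult_diff_distrib matrix_vector_mult_scaleR inner_diff_left inner_diff_right
        power2_eq_square algebra_simps)
  finally have "t * (2 * (?w \<bullet> ?w)) \<le> t * (t * (?w \<bullet> (S *v ?w)))"
    by (simp add: power2_eq_square mult_ac)
  then have "2 * (?w \<bullet> ?w) \<le> t * (?w \<bullet> (S *v ?w))"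
    using t by (simp add: mult_le_cancel_left_pos)
  also have "\<dots> \<le> ?w \<bullet> ?w"
    unfolding t_def using W by (simp add: divide_le_eq mult_left_mono)
  finally show False
    using W by simp
qed

text \<open>The strict order asks for a nonzero eigenvalue. It is the maximum \<open>l\<close> of
  the form on the unit sphere: l I - S is positive semidefinite and its form vanishes at the
  maximiser, which is therefore an eigenvector.\<close>

lemma pos_def_eigenvector:
  fixes S :: "real^'d^'d"
  assumes S: "pos_def S"
  shows "\<exists>l v. l \<noteq> 0 \<and> v \<noteq> 0 \<and> S *v v = l *\<^sub>R v"
proof -
  have ne: "sphere (0 :: real^'d) 1 \<noteq> {}"
    using norm_axis_1 by (metis dist_0_norm empty_iff mem_sphere)
  have "continuous_on (sphere 0 1) (\<lambda>x. x \<bullet> (S *v x))"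
    by (intro continuous_intros matrix_vector_mult_linear_continuous_on)
  from continuous_attains_sup[OF compact_sphere ne this]
  obtain v where v: "norm v = 1" and sup: "\<And>y. norm y = 1 \<Longrightarrow> y \<bullet> (S *v y) \<le> v \<bullet> (S *v v)"
    by auto
  define l where "l = v \<bullet> (S *v v)"
  have v0: "v \<noteq> 0"
    using v by auto
  have l0: "0 < l"
    using S v0 by (simp add: pos_def_def l_def)
  have le: "y \<bullet> (S *v y) \<le> l * (y \<bullet> y)" for y
  proof (cases "y = 0")
    case False
    have "(y /\<^sub>R norm y) \<bullet> (S *v (y /\<^sub>R norm y)) \<le> l"
      unfolding l_def using False by (intro sup) simp
    then have "(y \<bullet> (S *v y)) / (norm y)\<^sup>2 \<le> l"
      by (simp add: matrix_vector_mult_scaleR power2_eq_square divide_inverse mult_ac)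
    then show ?thesis
      using False by (simp add: divide_le_eq dot_square_norm)
  qed simp
  have mv: "(l *\<^sub>R mat 1 - S) *v y = l *\<^sub>R y - S *v y" for y
    by (simp add: matrix_vector_mult_diff_rdistrib scaleR_matrix_vector_assoc[symmetric])
  have "pos_semidef (l *\<^sub>R mat 1 - S)"
    using S le unfolding pos_semidef_def pos_def_def
    by (simp add: mv inner_diff_right transpose_diff transpose_scaleR transpose_mat)
  moreover have "v \<bullet> ((l *\<^sub>R mat 1 - S) *v v) = 0"
    using v by (simp add: mv inner_diff_right dot_square_norm) (simp add: l_def)
  ultimately have "(l *\<^sub>R mat 1 - S) *v v = 0"
    by (rule pos_semidef_null_vector)
  then have "S *v v = l *\<^sub>R v"
    by (simp add: mv)
  with l0 v0 show ?thesis
    by (intro exI[of _ l] exI[of _ v]) auto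
qed

lemma mat_lessI: "pos_def (A - B) \<Longrightarrow> mat_less B A"
  unfolding mat_less_def using pos_def_imp_pos_semidef pos_def_eigenvector by blast

lemma pos_def_invertible:
  fixes S :: "real^'d^'d"
  assumes "pos_def S"
  shows "invertible S"
proof -
  have "x = 0" if "S *v x = 0" for x
    using assms that unfolding pos_def_def by (metis inner_zero_right less_irrefl)
  then show ?thesis
    by (simp add: invertible_left_inverse matrix_left_invertible_ker)
qed

lemma matrix_inv_mult:
  fixes S :: "real^'d^'d"
  assumes "invertible S"
  shows "S ** matrix_inv S = mat 1" "matrix_inv S ** S = mat 1"
proof -
  obtain S' where "S ** S' = mat 1 \<and> S' ** S = mat 1"
    using assms unfolding invertible_def by blast
  then have "S ** matrix_inv S = mat 1 \<and> matrix_inv S ** S = mat 1"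
    unfolding matrix_inv_def by (rule someI)
  then show "S ** matrix_inv S = mat 1" "matrix_inv S ** S = mat 1"
    by auto
qed

lemma transpose_matrix_inv:
  fixes S :: "real^'d^'d"
  assumes S: "invertible S" and sym: "transpose S = S"
  shows "transpose (matrix_inv S) = matrix_inv S"
proof -
  have "S ** transpose (matrix_inv S) = mat 1"
    using arg_cong[OF matrix_inv_mult(2)[OF S], of transpose] by (simp add: matrix_transpose_mul sym transpose_mat)
  then have "matrix_inv S ** (S ** transpose (matrix_inv S)) = matrix_inv S"
    by simp
  then show ?thesis
    by (simp add: matrix_mul_assoc matrix_inv_mult(2)[OF S])
qed

lemma moore_penrose_half:
  fixes S :: "real^'d^'d"
  assumes S: "invertible S"
  shows "moore_penrose ((1/2) *\<^sub>R S) = 2 *\<^sub>R matrix_inv S"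
  by (rule moore_penrose_eqI)
    (simp_all add: matrix_inv_mult[OF S] transpose_mat scaleR_matrix_mult_left scaleR_matrix_mult_right)

text \<open>The limiting covariance as a function of the weight \<open>C\<close>, with \<open>H = E (G g\<^sup>T + g G\<^sup>T)\<close> for the
  Poisson solution \<open>G\<close>.\<close>

definition limit_cov :: "real^'d^'d \<Rightarrow> real^'d^'d \<Rightarrow> real^'d^'d \<Rightarrow> real^'d^'d \<Rightarrow> real^'d^'d" where
  "limit_cov H A B C = 2 *\<^sub>R H - 2 *\<^sub>R A - (A ** C + transpose C ** A) + (1/2) *\<^sub>R (transpose C ** (A - B) ** C)"

lemma limit_cov_mat:
  "limit_cov H A B (mat c) = 2 *\<^sub>R H - 2 *\<^sub>R A - (2 * c) *\<^sub>R A + (c\<^sup>2 / 2) *\<^sub>R (A - B)"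
proof -
  have "transpose (mat c) = (mat c :: real^'a^'a)"
    by (simp add: transpose_mat)
  moreover have "mat c ** X = c *\<^sub>R X" "X ** mat c = c *\<^sub>R X" for X :: "real^'a^'a"
    by (simp_all add: mat_eq_scaleR[of c] scaleR_matrix_mult_left scaleR_matrix_mult_right)
  ultimately show ?thesis
    by (simp add: limit_cov_def power2_eq_square scaleR_add_left[symmetric])
qed

text \<open>With D = A - B and inverse J, substituting A = D + B gives A J A = D + 2 B + B J B,
  while the quadratic has the value 2 H - 2 A - 2 A J A at the weight 2 J A.\<close>

lemma limit_cov_optimal:
  fixes A B :: "real^'d^'d"
  assumes inv: "invertible (A - B)" and sym: "transpose A = A" "transpose B = B"
  shows "limit_cov H A B (2 *\<^sub>R matrix_inv (A - B) ** A) - limit_cov H A B (mat 2)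
      = - (2 *\<^sub>R (B ** matrix_inv (A - B) ** B))"
proof -
  define D J where "D = A - B" and "J = matrix_inv (A - B)"
  have J: "D ** J = mat 1" "J ** D = mat 1" "transpose J = J"
    unfolding D_def J_def using matrix_inv_mult[OF inv] transpose_matrix_inv[OF inv] sym by (simp_all add: transpose_diff)
  have A: "A = D + B"
    by (simp add: D_def)
  have AJA: "A ** J ** A = D + 2 *\<^sub>R B + B ** J ** B"
  proof -
    have "A ** J ** A = (D ** J + B ** J) ** (D + B)"
      unfolding A by (simp add: matrix_add_rdistrib)
    also have "\<dots> = D + B + B ** J ** D + B ** J ** B"
      by (simp add: J matrix_add_ldistrib matrix_add_rdistrib)
    also have "B ** J ** D = B"
      by (metis J(2) matrix_mul_assoc matrix_mul_rid)
    finally show ?thesis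
      by (simp add: scaleR_2)
  qed
  have t: "transpose (2 *\<^sub>R J ** A) = 2 *\<^sub>R (A ** J)"
    by (simp add: matrix_transpose_mul transpose_scaleR sym J scaleR_matrix_mult_left scaleR_matrix_mult_right)
  have 1: "A ** (2 *\<^sub>R J ** A) = 2 *\<^sub>R (A ** J ** A)"
    by (simp add: scaleR_matrix_mult_left scaleR_matrix_mult_right matrix_mul_assoc)
  have 2: "2 *\<^sub>R (A ** J) ** A = 2 *\<^sub>R (A ** J ** A)"
    by (simp add: scaleR_matrix_mult_left)
  have 3: "2 *\<^sub>R (A ** J) ** D ** (2 *\<^sub>R J ** A) = 4 *\<^sub>R (A ** J ** A)"
  proof -
    have "A ** J ** D ** J ** A = A ** (J ** D) ** J ** A"
      by (simp add: matrix_mul_assoc)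
    then have "A ** J ** D ** J ** A = A ** J ** A"
      by (simp add: J)
    then show ?thesis
      by (simp add: scaleR_matrix_mult_left scaleR_matrix_mult_right matrix_mul_assoc)
  qed
  have "limit_cov H A B (2 *\<^sub>R J ** A) = 2 *\<^sub>R H - 2 *\<^sub>R A - (2 *\<^sub>R (A ** J ** A) + 2 *\<^sub>R (A ** J ** A)) + (1/2) *\<^sub>R (4 *\<^sub>R (A ** J ** A))"
    unfolding limit_cov_def t D_def[symmetric] 1 2 3 ..
  also have "\<dots> = 2 *\<^sub>R H - 2 *\<^sub>R A - 2 *\<^sub>R (A ** J ** A)"
    by (simp add: scaleR_2)
  finally have "limit_cov H A B (2 *\<^sub>R J ** A) - limit_cov H A B (mat 2)
      = 4 *\<^sub>R A - 2 *\<^sub>R D - 2 *\<^sub>R (A ** J ** A)"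
    unfolding limit_cov_mat D_def[symmetric] by (simp add: vec_eq_iff)
  also have "\<dots> = - (2 *\<^sub>R (B ** J ** B))"
    unfolding AJA by (simp add: D_def vec_eq_iff)
  finally show ?thesis
    by (simp add: J_def)
qed

lemma limit_cov_form:
  assumes "transpose A = A"
  shows "x \<bullet> (limit_cov H A B C *v x) = 2 * (x \<bullet> (H *v x)) - 2 * (x \<bullet> (A *v x)) - 2 * (x \<bullet> (A *v (C *v x)))
    + (1/2) * ((C *v x) \<bullet> ((A - B) *v (C *v x)))"
proof -
  have t: "x \<bullet> ((transpose C ** X) *v y) = (C *v x) \<bullet> (X *v y)" for X :: "real^'a^'a" and y
    using dot_lmul_matrix[of x "transpose C" "X *v y"] by (simp add: matrix_vector_mul_assoc[symmetric] transpose_matrix_vector)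
  have "x \<bullet> ((transpose C ** A) *v x) = x \<bullet> (A *v (C *v x))"
    unfolding t using bilinear_sym[OF assms] by simp
  moreover have "x \<bullet> ((transpose C ** (A - B) ** C) *v x) = (C *v x) \<bullet> ((A - B) *v (C *v x))"
    using t[of "A - B" "C *v x"] by (simp add: matrix_vector_mul_assoc[symmetric] matrix_mul_assoc)
  ultimately show ?thesis
    unfolding limit_cov_def
    by (simp add: matrix_vector_mult_add_rdistrib matrix_vector_mult_diff_rdistrib scaleR_matrix_vector_assoc[symmetric]
        inner_add_right inner_diff_right matrix_vector_mul_assoc)
qed

section \<open>Second moment matrices\<close>

lemma norm_outer: "norm (outer v) = (norm v)\<^sup>2"
proof -
  have "outer v $ i = v $ i *\<^sub>R v" for i
    by (simp add: vec_eq_iff outer_def)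
  then have "outer v \<bullet> outer v = (v \<bullet> v) * (v \<bullet> v)"
    by (simp add: inner_vec_def[of "outer v"] inner_vec_def[of v v] sum_distrib_right mult_ac)
  then show ?thesis
    by (simp add: norm_eq_sqrt_inner power2_eq_square[symmetric] real_sqrt_unique)
qed

lemma outer_form: "x \<bullet> (outer v *v y) = (x \<bullet> v) * (y \<bullet> v)"
proof -
  have "outer v *v y = (v \<bullet> y) *\<^sub>R v"
    by (simp add: vec_eq_iff outer_def matrix_vector_mult_def inner_vec_def sum_distrib_right sum_distrib_left mult_ac)
  then show ?thesis
    by (simp add: inner_commute)
qed

lemma measurable_outer:
  assumes [measurable]: "F \<in> borel_measurable M"
  shows "(\<lambda>x. outer (F x :: real^'d)) \<in> borel_measurable M"
proof (rule measurable_compose[OF assms borel_measurable_continuous_onI])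
  show "continuous_on UNIV (outer :: real^'d \<Rightarrow> _)"
    unfolding outer_def[abs_def]
    by (intro continuous_on_vec_lambda continuous_on_mult continuous_on_component continuous_on_id)
qed

lemma integrable_outer:
  fixes F :: "'a \<Rightarrow> real^'d"
  assumes F: "F \<in> borel_measurable M" and sq: "\<And>i. sq_int M (\<lambda>x. F x $ i)"
  shows "integrable M (\<lambda>x. outer (F x))"
proof (rule Bochner_Integration.integrable_bound)
  show "integrable M (\<lambda>x. \<Sum>i\<in>UNIV. (F x $ i)\<^sup>2)"
    using sq by (auto simp: sq_int_def)
  show "AE x in M. norm (outer (F x)) \<le> norm (\<Sum>i\<in>UNIV. (F x $ i)\<^sup>2)"
  proof (rule AE_I2)
    fix x
    have "(norm (F x))\<^sup>2 = (\<Sum>i\<in>UNIV. (F x $ i)\<^sup>2)"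
      by (simp add: norm_vec_def L2_set_def sum_nonneg)
    then show "norm (outer (F x)) \<le> norm (\<Sum>i\<in>UNIV. (F x $ i)\<^sup>2)"
      by (simp add: norm_outer)
  qed
qed (rule measurable_outer[OF F])

lemma integral_outer_form:
  fixes F :: "'a \<Rightarrow> real^'d"
  assumes F: "F \<in> borel_measurable M" and sq: "\<And>i. sq_int M (\<lambda>x. F x $ i)"
  shows "s \<bullet> ((\<integral>x. outer (F x) \<partial>M) *v t) = (\<integral>x. (s \<bullet> F x) * (t \<bullet> F x) \<partial>M)"
proof -
  have "bounded_linear (\<lambda>S :: real^'d^'d. s \<bullet> (S *v t))"
    by (rule linear_conv_bounded_linear[THEN iffD1], rule linearI)
      (simp_all add: matrix_vector_mult_add_rdistrib inner_add_right scaleR_matrix_vector_assoc[symmetric])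
  from integral_bounded_linear[OF this integrable_outer[OF F sq]] show ?thesis
    by (simp add: outer_form)
qed

lemma transpose_integral_outer:
  fixes F :: "'a \<Rightarrow> real^'d"
  assumes F: "F \<in> borel_measurable M" and sq: "\<And>i. sq_int M (\<lambda>x. F x $ i)"
  shows "transpose (\<integral>x. outer (F x) \<partial>M) = (\<integral>x. outer (F x) \<partial>M)"
proof -
  let ?S = "\<integral>x. outer (F x) \<partial>M"
  have "?S $ i $ j = axis i 1 \<bullet> (?S *v axis j 1)" for i j
    by (simp add: matrix_vector_mult_basis inner_axis' column_def)
  then have "?S $ i $ j = ?S $ j $ i" for i j
    unfolding integral_outer_form[OF F sq] by (simp add: mult.commute)
  then show ?thesis
    by (simp add: vec_eq_iff transpose_def)
qed

text \<open>Characteristic functions in every fixed direction suffice, since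
  \<open>gaussian_exists\<close> supplies the law to converge to.\<close>

lemma asymptotic_varianceI:
  fixes S :: "nat \<Rightarrow> 'b \<Rightarrow> real^'d"
  assumes N: "prob_space N" and S: "\<And>n. S n \<in> borel_measurable N" and psd: "pos_semidef \<Sigma>"
    and char: "\<And>s. (\<lambda>n. CLINT \<omega>|N. iexp (1 / sqrt (real n) * (s \<bullet> S n \<omega>))) \<longlonglongrightarrow> of_real (exp (- (s \<bullet> (\<Sigma> *v s)) / 2))"
  shows "asymptotic_variance N S \<Sigma>"
proof -
  obtain L :: "(real^'d) measure" where L: "prob_space L" "sets L = sets borel"
    "\<And>x. (CLINT y|L. iexp (x \<bullet> y)) = of_real (exp (- (x \<bullet> (\<Sigma> *v x)) / 2))"
    using gaussian_exists[OF psd] by blast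
  let ?Y = "\<lambda>n \<omega>. (1 / sqrt (real n)) *\<^sub>R S n \<omega>"
  have Y: "?Y n \<in> borel_measurable N" for n
    using S by simp
  have "conv_in_distr N ?Y L"
    unfolding conv_in_distr_def
  proof (intro conjI allI impI)
    fix f :: "real^'d \<Rightarrow> real" assume f: "continuous_on UNIV f \<and> bounded (range f)"
    have "(\<lambda>n. \<integral>x. f x \<partial>distr N borel (?Y n)) \<longlonglongrightarrow> (\<integral>x. f x \<partial>L)"
    proof (rule multivariate_levy_continuity[OF prob_space.prob_space_distr[OF N Y] L(1) _ L(2)])
      fix s
      have "(CLINT x|distr N borel (?Y n). iexp (s \<bullet> x)) = (CLINT \<omega>|N. iexp (1 / sqrt (real n) * (s \<bullet> S n \<omega>)))" for n
        by (subst integral_distr[OF Y]) simp_all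
      then show "(\<lambda>n. CLINT x|distr N borel (?Y n). iexp (s \<bullet> x)) \<longlonglongrightarrow> (CLINT x|L. iexp (s \<bullet> x))"
        using char[of s] by (simp only: L(3))
    qed (use f in simp_all)
    moreover have "(\<integral>x. f x \<partial>distr N borel (?Y n)) = (\<integral>\<omega>. f (?Y n \<omega>) \<partial>N)" for n
      using f by (intro integral_distr[OF Y]) (simp add: borel_measurable_continuous_onI)
    ultimately show "(\<lambda>n. \<integral>\<omega>. f (?Y n \<omega>) \<partial>N) \<longlonglongrightarrow> (\<integral>x. f x \<partial>L)"
      by simp
  qed (rule Y)
  with L psd show ?thesis
    unfolding asymptotic_variance_def by blast
qed

lemma gibbs_kernel_imp_gibbs:
  fixes h :: "'a::polish_space \<Rightarrow> real^'m"
  assumes "prob_space M" and sets: "sets M = sets borel" and h: "h \<in> borel_measurable borel" and P: "gibbs_kernel P h M"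
  shows "gibbs M (vimage_algebra (space M) h borel) P"
proof -
  interpret prob_space M by fact
  have hM: "h \<in> borel_measurable M"
    using h measurable_cong_sets[OF sets refl] by blast
  have PM: "P \<in> M \<rightarrow>\<^sub>M prob_algebra M"
    using P measurable_cong_sets[OF sets refl, of "prob_algebra M"] unfolding gibbs_kernel_def
    by (simp add: prob_algebra_def subprob_algebra_cong[OF sets])
  have "subalgebra M (vimage_algebra (space M) h borel)"
    unfolding subalgebra_def by (intro conjI sets_image_in_sets) (simp_all add: hM)
  moreover have "AE x in M. real_cond_exp M (vimage_algebra (space M) h borel) (\<lambda>x. indicator A x) x = measure (P x) A"
    if "A \<in> sets M" for A
    using P that sets unfolding gibbs_kernel_def by (auto elim: eventually_mono)
  ultimately show ?thesis
    unfolding gibbs_def using PM by unfold_locales auto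
qed

lemma borel_measurable_vec_inner:
  fixes F :: "'a \<Rightarrow> real^'d"
  assumes "\<And>s. (\<lambda>x. s \<bullet> F x) \<in> borel_measurable M"
  shows "F \<in> borel_measurable M"
  unfolding borel_measurable_euclidean_space[of F] using assms by (simp add: inner_commute)

lemma inner_vec_sum: "s \<bullet> (v :: real^'d) = (\<Sum>i\<in>UNIV. s $ i * v $ i)"
  by (simp add: inner_vec_def)

lemma sq_int_inner:
  fixes F :: "'a \<Rightarrow> real^'d"
  assumes "\<And>i. sq_int M (\<lambda>x. F x $ i)"
  shows "sq_int M (\<lambda>x. s \<bullet> F x)"
  unfolding inner_vec_sum by (intro sq_int_sum sq_int_cmult assms)

context stationary_kernel
begin

lemma kernel_vec_component: "kernel_vec K F x $ i = kint K (\<lambda>y. F y $ i) x"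
  by (simp add: kernel_vec_def kint_def)

lemma inner_kernel_vec:
  assumes "\<And>i. sq_int M (\<lambda>x. F x $ i)"
  shows "AE x in M. s \<bullet> kernel_vec K F x = kint K (\<lambda>y. s \<bullet> F y) x"
proof -
  have "AE x in M. kint K (\<lambda>x. \<Sum>i\<in>UNIV. s $ i * F x $ i) x = (\<Sum>i\<in>UNIV. kint K (\<lambda>x. s $ i * F x $ i) x)"
    using sq_int_integrable[OF assms] by (intro kint_sum) simp_all
  then show ?thesis
    unfolding inner_vec_sum kernel_vec_component kint_cmult by eventually_elim simp
qed

lemma sq_int_kernel_vec: "(\<And>i. sq_int M (\<lambda>x. F x $ i)) \<Longrightarrow> sq_int M (\<lambda>x. kernel_vec K F x $ i)"
  unfolding kernel_vec_component by (rule sq_int_kint(1))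

lemma measurable_inner_kernel_vec:
  "(\<And>i. sq_int M (\<lambda>x. F x $ i)) \<Longrightarrow> (\<lambda>x. s \<bullet> kernel_vec K F x) \<in> borel_measurable M"
  by (rule sq_int_measurable[OF sq_int_inner[OF sq_int_kernel_vec]])

end

context sweep_gap
begin

lemma pair_op_inner:
  fixes F :: "'a \<Rightarrow> real^'d"
  assumes F: "\<And>i. sq_int M (\<lambda>x. F x $ i)"
  shows "AE x in M. pair_op (\<lambda>x. s \<bullet> F x) x = (\<Sum>i\<in>UNIV. s $ i * pair_op (\<lambda>x. F x $ i) x)"
proof -
  have 2: "AE x in M. kint K2 (\<lambda>x. s \<bullet> F x) x = s \<bullet> kernel_vec K2 F x"
    using g2.inner_kernel_vec[OF F, of s] by eventually_elim simp
  have "AE x in M. kint K1 (kint K2 (\<lambda>x. s \<bullet> F x)) x = kint K1 (\<lambda>x. s \<bullet> kernel_vec K2 F x) x"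
    by (rule g1.kint_cong_AE[OF 2 sq_int_measurable[OF g2.sq_int_kint(1)[OF sq_int_inner[OF F]]] g2.measurable_inner_kernel_vec[OF F]])
  moreover have "AE x in M. s \<bullet> kernel_vec K1 (kernel_vec K2 F) x = kint K1 (\<lambda>x. s \<bullet> kernel_vec K2 F x) x"
    by (rule g1.inner_kernel_vec[OF g2.sq_int_kernel_vec[OF F]])
  ultimately show ?thesis
    by eventually_elim (simp add: pair_op_def inner_vec_sum g1.kernel_vec_component g2.kernel_vec_component[abs_def])
qed

text \<open>Solved coordinate by coordinate. The exceptional null set may depend on
  \<open>s\<close>, because the sweep operator is linear only almost everywhere.\<close>

lemma vector_poisson_solution:
  fixes g :: "'a \<Rightarrow> real^'d"
  assumes g: "\<And>i. sq_int M (\<lambda>x. g x $ i)" and mean: "\<And>i. (\<integral>x. g x $ i \<partial>M) = 0"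
  obtains G :: "'a \<Rightarrow> real^'d" where "\<And>i. sq_int M (\<lambda>x. G x $ i)"
    "\<And>s. AE x in M. pair_op (\<lambda>x. s \<bullet> G x) x = s \<bullet> G x - s \<bullet> g x"
proof -
  have "\<forall>i. \<exists>G. sq_int M G \<and> (AE x in M. pair_op G x = G x - g x $ i)"
    using poisson_solution[OF g mean] by metis
  from choice[OF this] obtain G' where G': "\<And>i. sq_int M (G' i)" "\<And>i. AE x in M. pair_op (G' i) x = G' i x - g x $ i"
    by blast
  define G where "G x = (\<chi> i. G' i x)" for x
  have Gi: "(\<lambda>x. G x $ i) = G' i" for i
    by (simp add: G_def fun_eq_iff)
  have sq: "sq_int M (\<lambda>x. G x $ i)" for i
    unfolding Gi by (rule G')
  have "AE x in M. pair_op (\<lambda>x. s \<bullet> G x) x = s \<bullet> G x - s \<bullet> g x" for s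
  proof -
    have "AE x in M. \<forall>i. pair_op (G' i) x = G' i x - g x $ i"
      using G'(2) by (simp add: AE_all_countable)
    with pair_op_inner[OF sq, of s] show ?thesis
      unfolding Gi
      by eventually_elim (simp add: inner_vec_sum G_def right_diff_distrib sum_subtractf)
  qed
  with sq that show ?thesis
    by blast
qed

end

lemma integral_inner_mult:
  fixes F G :: "'a \<Rightarrow> real^'d"
  assumes "\<And>i. sq_int M (\<lambda>x. F x $ i)" "\<And>i. sq_int M (\<lambda>x. G x $ i)"
  shows "(\<integral>x. (s \<bullet> F x) * (t \<bullet> G x) \<partial>M) = s \<bullet> ((\<chi> i j. \<integral>x. F x $ i * G x $ j \<partial>M) *v t)"
proof -
  have i: "integrable M (\<lambda>x. (s $ i * F x $ i) * (t $ j * G x $ j))" for i j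
    using assms by (intro sq_int_mult sq_int_cmult)
  have "(\<integral>x. (s \<bullet> F x) * (t \<bullet> G x) \<partial>M) = (\<Sum>i\<in>UNIV. \<Sum>j\<in>UNIV. \<integral>x. (s $ i * F x $ i) * (t $ j * G x $ j) \<partial>M)"
    using i by (simp add: inner_vec_sum sum_product)
  also have "\<dots> = (\<Sum>i\<in>UNIV. \<Sum>j\<in>UNIV. s $ i * ((\<integral>x. F x $ i * G x $ j \<partial>M) * t $ j))"
  proof (intro sum.cong refl)
    fix i j
    have "(\<integral>x. (s $ i * F x $ i) * (t $ j * G x $ j) \<partial>M) = (\<integral>x. (s $ i * t $ j) * (F x $ i * G x $ j) \<partial>M)"
      by (simp add: mult_ac)
    then show "(\<integral>x. (s $ i * F x $ i) * (t $ j * G x $ j) \<partial>M) = s $ i * ((\<integral>x. F x $ i * G x $ j \<partial>M) * t $ j)"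
      by simp
  qed
  finally show ?thesis
    by (simp add: inner_vec_sum matrix_vector_mult_def sum_distrib_left)
qed

text \<open>The two covariances are bound outside the quantifier over chains, which expresses that
  they depend neither on the initial law nor on the probability space.\<close>

theorem proposition2:
  fixes \<pi> \<psi> :: "'a::polish_space measure"
    and Q :: "nat \<Rightarrow> 'a \<Rightarrow> 'a measure"
    and g :: "'a \<Rightarrow> real^'d"
    and h1 :: "'a \<Rightarrow> real^'m1" and h2 :: "'a \<Rightarrow> real^'m2"
    and D :: "nat \<Rightarrow> 'a set" and lam b :: "nat \<Rightarrow> real" and W :: "nat \<Rightarrow> 'a \<Rightarrow> real"
    and A B U V Copt :: "real^'d^'d"
  assumes "prob_space \<pi>" and "sets \<pi> = sets borel"
    and "\<And>k. k \<in> {1,2} \<Longrightarrow> Q k \<in> borel \<rightarrow>\<^sub>M prob_algebra borel"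
    and "g \<in> borel_measurable borel"
    and "h1 \<in> borel_measurable borel" and "gibbs_kernel (Q 1) h1 \<pi>"
    and "h2 \<in> borel_measurable borel" and "gibbs_kernel (Q 2) h2 \<pi>"
    and "prob_space \<psi>" and "sets \<psi> = sets borel"
    and "\<And>k S x. k \<in> {1,2} \<Longrightarrow> S \<in> sets borel \<Longrightarrow> measure \<psi> S > 0 \<Longrightarrow>
           \<exists>t>0. measure (sweep_kernel Q k (2 * t) x) S > 0"
    and "\<And>k. k \<in> {1,2} \<Longrightarrow> small_set (sweep_kernel Q k 2) (D k)"
    and "\<And>k. k \<in> {1,2} \<Longrightarrow> lam k < 1"
    and "\<And>k. k \<in> {1,2} \<Longrightarrow> W k \<in> borel_measurable borel"
    and "\<And>k x. k \<in> {1,2} \<Longrightarrow> W k x \<ge> 1"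
    and "\<And>k x. k \<in> {1,2} \<Longrightarrow>
           (\<integral>\<^sup>+y. ennreal (W k y) \<partial>sweep_kernel Q k 2 x)
             \<le> ennreal (lam k * W k x + b k * indicator (D k) x)"
    and "\<And>k. k \<in> {1,2} \<Longrightarrow> integrable \<pi> (\<lambda>x. (W k x)\<^sup>2)"
    and "\<And>k a x. k \<in> {1,2} \<Longrightarrow> norm a \<le> 1 \<Longrightarrow> \<bar>a \<bullet> g x\<bar> \<le> W k x"
    and "(LINT x|\<pi>. g x) = 0"
    and "AE x in \<pi>. kernel_vec (Q 2) g x = g x"
    and "pos_def (LINT x|\<pi>. outer (g x))"
    and "A = (LINT x|\<pi>. outer (g x))"
    and "B = (LINT x|\<pi>. outer (kernel_vec (Q 1) g x))"
    and "U = (1/2) *\<^sub>R (\<Sum>k\<in>{1,2}. LINT x|\<pi>. outer (g x) - outer (kernel_vec (Q k) g x))"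
    and "V = (LINT x|\<pi>. outer (g x))"
    and "Copt = moore_penrose U ** V"
  shows "\<exists>(Sig :: real^'d^'d \<Rightarrow> real^'d^'d) SigLWK.
     (\<forall>\<nu> (N :: 'b measure) X. sweep_chain Q \<nu> N X \<longrightarrow>
        (\<forall>C. asymptotic_variance N (\<lambda>n \<omega>. \<Sum>t<n. cv_summand Q g C t (X t \<omega>)) (Sig C)) \<and>
        asymptotic_variance N (\<lambda>n \<omega>. \<Sum>t<n. kernel_vec (Q 1) g (X t \<omega>)) SigLWK) \<and>
     Sig (mat 2) = SigLWK \<and>
     mat_le (Sig Copt) (Sig (mat 2)) \<and>
     mat_less (Sig (mat 2)) (Sig (mat 1)) \<and>
     mat_less (Sig (mat 1)) (Sig (mat 0)) \<and>
     invertible (A - B) \<and>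
     Sig Copt - Sig (mat 2) = - (2 *\<^sub>R (B ** matrix_inv (A - B) ** B)) \<and>
     mat_le (- (2 *\<^sub>R (B ** matrix_inv (A - B) ** B))) 0 \<and>
     Sig (mat 2) - Sig (mat 1) = - ((1/2) *\<^sub>R (A + 3 *\<^sub>R B)) \<and>
     mat_less (- ((1/2) *\<^sub>R (A + 3 *\<^sub>R B))) 0 \<and>
     Sig (mat 1) - Sig (mat 0) = - ((1/2) *\<^sub>R (B + 3 *\<^sub>R A)) \<and>
     mat_less (- ((1/2) *\<^sub>R (B + 3 *\<^sub>R A))) 0"
proof -
  note \<pi> = assms(1,2) and Q = assms(3) and g_meas = assms(4) and inv = assms(20) and pd = assms(21)
    and AB = assms(22,23) and U = assms(24) and V = assms(25) and Copt = assms(26)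
  interpret \<pi>: prob_space \<pi> by fact
  have space: "space \<pi> = UNIV"
    using sets_eq_imp_space_eq[OF \<pi>(2)] by simp
  have mcong: "(f \<in> borel_measurable \<pi>) = (f \<in> borel_measurable borel)" for f :: "'a \<Rightarrow> 'c::topological_space"
    using measurable_cong_sets[OF \<pi>(2) refl] by blast
  have tg: "two_gibbs \<pi> (vimage_algebra (space \<pi>) h1 borel) (vimage_algebra (space \<pi>) h2 borel) (Q 1) (Q 2)"
    unfolding two_gibbs_def using assms(5-8) \<pi> by (auto intro: gibbs_kernel_imp_gibbs)
  interpret T: two_gibbs \<pi> "vimage_algebra (space \<pi>) h1 borel" "vimage_algebra (space \<pi>) h2 borel" "Q 1" "Q 2"
    by (rule tg)
  have P: "sweep_kernel Q 1 2 x = Q 1 x \<bind> Q 2" for x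
    by (rule sweep_kernel_two) (rule Q, simp)
  have W: "W 1 \<in> borel_measurable \<pi>" "\<And>x. 1 \<le> W 1 x" "sq_int \<pi> (W 1)"
    using assms(14,15,17)[of 1] by (simp_all add: mcong sq_int_def)
  have W_int: "integrable \<pi> (W 1)"
    by (rule \<pi>.sq_int_integrable[OF W(3)])
  have small: "small_set (sweep_kernel Q 1 2) (D 1)" and lam: "lam 1 < 1"
    and drift: "\<And>x. (\<integral>\<^sup>+y. ennreal (W 1 y) \<partial>sweep_kernel Q 1 2 x) \<le> ennreal (lam 1 * W 1 x + b 1 * indicator (D 1) x)"
    using assms(12,13,16)[of 1] by auto
  obtain r where r: "0 \<le> r" "r < 1" and gap: "\<And>f. sq_int \<pi> f \<Longrightarrow> (\<integral>x. f x \<partial>\<pi>) = 0 \<Longrightarrow> AE x in \<pi>. kint (Q 2) f x = f x \<Longrightarrow>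
      (\<integral>x. (kint (Q 1) f x)\<^sup>2 \<partial>\<pi>) \<le> r * (\<integral>x. (f x)\<^sup>2 \<partial>\<pi>)"
    using spectral_gap[OF tg \<pi>(2) P W(1,2) W_int small lam drift] by blast
  interpret S: sweep_gap \<pi> "vimage_algebra (space \<pi>) h1 borel" "vimage_algebra (space \<pi>) h2 borel" "Q 1" "Q 2" r
    by unfold_locales (use r gap in auto)
  have P_stat: "stationary_kernel \<pi> (sweep_kernel Q 1 2)"
    by (rule stationary_kernel_bind[OF T.g1.stationary_kernel_axioms T.g2.stationary_kernel_axioms P])
  interpret H: drift_kernel \<pi> "sweep_kernel Q 1 2" "W 1" "D 1" "lam 1" "b 1"
    unfolding drift_kernel_def drift_kernel_axioms_def
    using P_stat \<pi>(2) W(1,2) W_int small lam drift by simp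
  have g_norm: "norm (g x) \<le> W 1 x" for x
  proof (cases "g x = 0")
    case False
    then have "\<bar>(g x /\<^sub>R norm (g x)) \<bullet> g x\<bar> \<le> W 1 x"
      by (intro assms(18)) simp_all
    moreover have "(g x /\<^sub>R norm (g x)) \<bullet> g x = norm (g x)"
      using False by (simp add: dot_square_norm power2_eq_square field_simps)
    ultimately show ?thesis
      by linarith
  qed (use W(2)[of x] in simp)
  have g_sq: "sq_int \<pi> (\<lambda>x. g x $ i)" for i
    unfolding sq_int_def
  proof
    show m: "(\<lambda>x. g x $ i) \<in> borel_measurable \<pi>"
      unfolding mcong by (rule measurable_compose[OF g_meas borel_measurable_continuous_onI[OF continuous_on_component[OF continuous_on_id]]])
    show "integrable \<pi> (\<lambda>x. (g x $ i)\<^sup>2)"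
    proof (rule Bochner_Integration.integrable_bound[OF sq_int_square[OF W(3)]])
      show "AE x in \<pi>. norm ((g x $ i)\<^sup>2) \<le> norm ((W 1 x)\<^sup>2)"
        using order_trans[OF component_le_norm_cart g_norm] power_mono[of "\<bar>g _ $ i\<bar>" "W 1 _" 2] by (intro AE_I2) simp
    qed (use m in simp)
  qed
  have g_mean: "(\<integral>x. g x $ i \<partial>\<pi>) = 0" for i
  proof -
    have "integrable \<pi> g"
      using g_norm W(2) g_meas order_trans[OF zero_le_one W(2)]
      by (intro Bochner_Integration.integrable_bound[OF W_int]) (auto simp: mcong)
    then have "(\<integral>x. g x $ i \<partial>\<pi>) = (\<integral>x. g x \<partial>\<pi>) $ i"
      by (rule integral_bounded_linear[OF bounded_linear_vec_nth])
    then show ?thesis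
      by (simp add: assms(19))
  qed
  obtain G where G: "\<And>i. sq_int \<pi> (\<lambda>x. G x $ i)" "\<And>s. AE x in \<pi>. S.pair_op (\<lambda>x. s \<bullet> G x) x = s \<bullet> G x - s \<bullet> g x"
    using S.vector_poisson_solution[OF g_sq g_mean] by blast
  \<comment> \<open>The mixed moment of the Poisson solution with g need not be symmetric;
    \<open>Sig\<close> uses its symmetrisation, which has twice the same quadratic form.\<close>
  define H0 where "H0 = (\<chi> i j. \<integral>x. G x $ i * g x $ j \<partial>\<pi>)"
  define Sig where "Sig = limit_cov (H0 + transpose H0) A B"
  have sq: "sq_int \<pi> (\<lambda>x. s \<bullet> g x)" "sq_int \<pi> (\<lambda>x. s \<bullet> G x)" for s
    by (rule sq_int_inner, rule g_sq, rule sq_int_inner, rule G)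
  have inv_s: "AE x in \<pi>. kint (Q 2) (\<lambda>x. s \<bullet> g x) x = s \<bullet> g x" for s
    using inv T.g2.inner_kernel_vec[OF g_sq, of s] by eventually_elim simp
  have kv1: "AE x in \<pi>. s \<bullet> kernel_vec (Q 1) g x = kint (Q 1) (\<lambda>x. s \<bullet> g x) x" for s
    by (rule T.g1.inner_kernel_vec[OF g_sq])
  have gM: "g \<in> borel_measurable \<pi>"
    unfolding mcong by (rule g_meas)
  have kvM: "kernel_vec (Q 1) g \<in> borel_measurable \<pi>" "kernel_vec (Q 2) g \<in> borel_measurable \<pi>"
    by (rule borel_measurable_vec_inner, rule T.g1.measurable_inner_kernel_vec[OF g_sq],
        rule borel_measurable_vec_inner, rule T.g2.measurable_inner_kernel_vec[OF g_sq])
  have Aform: "s \<bullet> (A *v t) = (\<integral>x. (s \<bullet> g x) * (t \<bullet> g x) \<partial>\<pi>)" for s t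
    unfolding AB by (rule integral_outer_form[OF gM g_sq])
  have Bform: "s \<bullet> (B *v t) = (\<integral>x. kint (Q 1) (\<lambda>x. s \<bullet> g x) x * kint (Q 1) (\<lambda>x. t \<bullet> g x) x \<partial>\<pi>)" for s t
    unfolding AB integral_outer_form[OF kvM(1) T.g1.sq_int_kernel_vec[OF g_sq]]
  proof (rule integral_cong_AE)
    show "AE x in \<pi>. (s \<bullet> kernel_vec (Q 1) g x) * (t \<bullet> kernel_vec (Q 1) g x) = kint (Q 1) (\<lambda>x. s \<bullet> g x) x * kint (Q 1) (\<lambda>x. t \<bullet> g x) x"
      using kv1[of s] kv1[of t] by eventually_elim simp
  qed (use kvM(1) sq_int_measurable[OF T.g1.sq_int_kint(1)[OF sq(1)]] in simp_all)
  have symA: "transpose A = A" and symB: "transpose B = B"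
    unfolding AB by (rule transpose_integral_outer[OF gM g_sq], rule transpose_integral_outer[OF kvM(1) T.g1.sq_int_kernel_vec[OF g_sq]])
  have Hform: "s \<bullet> ((H0 + transpose H0) *v s) = 2 * (\<integral>x. (s \<bullet> G x) * (s \<bullet> g x) \<partial>\<pi>)" for s
  proof -
    have "s \<bullet> (transpose H0 *v s) = s \<bullet> (H0 *v s)"
      using dot_lmul_matrix[of s H0 s] by (simp add: inner_commute transpose_matrix_vector)
    then show ?thesis
      unfolding integral_inner_mult[OF G(1) g_sq] H0_def[symmetric]
      by (simp add: matrix_vector_mult_add_rdistrib inner_add_right)
  qed
  have pdA: "pos_def A"
    using pd AB by simp
  have psdB: "pos_semidef B"
    unfolding pos_semidef_def using symB by (simp add: Bform)
  have pdD: "pos_def (A - B)"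
    unfolding pos_def_def
  proof (intro conjI allI impI)
    show "transpose (A - B) = A - B"
      by (simp add: transpose_diff symA symB)
    fix s :: "real^'d" assume "s \<noteq> 0"
    then have pos: "0 < s \<bullet> (A *v s)"
      using pdA by (simp add: pos_def_def)
    have "(\<integral>x. s \<bullet> g x \<partial>\<pi>) = (\<Sum>i\<in>UNIV. s $ i * (\<integral>x. g x $ i \<partial>\<pi>))"
      unfolding inner_vec_sum using \<pi>.sq_int_integrable[OF g_sq] by simp
    then have mean: "(\<integral>x. s \<bullet> g x \<partial>\<pi>) = 0"
      by (simp add: g_mean)
    have "s \<bullet> (B *v s) \<le> r * (s \<bullet> (A *v s))"
      using gap[OF sq(1)[of s] mean inv_s[of s]] by (simp add: Aform Bform power2_eq_square)
    also have "\<dots> < s \<bullet> (A *v s)"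
      using pos r by simp
    finally show "0 < s \<bullet> ((A - B) *v s)"
      by (simp add: matrix_vector_mult_diff_rdistrib inner_diff_right)
  qed
  have inv_D: "invertible (A - B)"
    by (rule pos_def_invertible[OF pdD])

  have \<kappa>: "S.kernels t = Q (if even t then 1 else 2)" for t
    by (simp add: S.kernels_def del: One_nat_def)
  \<comment> \<open>Total variation speaks of the composed kernel, the gap of two successive
    projections; on bounded functions both act alike at every point.\<close>
  have contraction: "(\<integral>x. (kint (sweep_kernel Q 1 2) h x)\<^sup>2 \<partial>\<pi>) \<le> r * (\<integral>x. (h x)\<^sup>2 \<partial>\<pi>)"
    if h: "h \<in> borel_measurable \<pi>" "\<And>x. \<bar>h x\<bar> \<le> 2" "(\<integral>x. h x \<partial>\<pi>) = 0" for h :: "'a \<Rightarrow> real"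
  proof -
    have "(h x)\<^sup>2 \<le> 2\<^sup>2" for x
      using power_mono[OF h(2)[of x] abs_ge_zero, where n = 2] by simp
    then have "sq_int \<pi> h"
      using h(1) by (auto simp: sq_int_def intro!: \<pi>.integrable_const_bound[where B = 4])
    moreover have "kint (sweep_kernel Q 1 2) h x = S.pair_op h x" for x
    proof -
      have x: "x \<in> space \<pi>"
        by (simp add: space)
      have meas: "Q 2 \<in> Q 1 x \<rightarrow>\<^sub>M subprob_algebra \<pi>"
        by (subst measurable_cong_sets[OF T.g1.sets_K[OF x] refl]) (rule T.g2.K_subprob)
      have Q: "prob_space (Q 1 x)" "prob_space (Q 2 y)" for y
        using T.g1.prob_space_K[OF x] T.g2.prob_space_K[of y] space by simp_all
      have bound: "\<bar>h y\<bar> \<le> 2" for y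
        by (rule h(2))
      show ?thesis
        unfolding kint_def S.pair_op_def P
        by (rule integral_bind[OF h(1) _ meas prob_space.finite_measure[OF Q(1)], where B = 2 and B' = 1])
          (simp_all add: bound prob_space.emeasure_space_1[OF Q(2)])
    qed
    ultimately show ?thesis
      using S.pair_op_contraction[of h] h(3) by simp
  qed

  \<comment> \<open>Common to all summands: a Poisson chain enters the limit through s 0 + s 1
    alone.\<close>
  have limit: "(\<lambda>n. CLINT \<omega>|N. iexp (1 / sqrt (real n) * (\<Sum>t<n. f t (X t \<omega>)))) \<longlonglongrightarrow> of_real (exp (- s2 / 4))"
    if chain: "sweep_chain Q \<nu> N X" and pc: "poisson_chain \<pi> S.kernels u f"
      and s2: "poisson_chain.s \<pi> S.kernels u f 0 + poisson_chain.s \<pi> S.kernels u f 1 = s2"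
    for \<nu> and N :: "'b measure" and X u f s2
  proof -
    interpret C: chain Q \<nu> N X
      by unfold_locales (use Q chain in auto)
    interpret PC: poisson_chain \<pi> S.kernels u f
      by (rule pc)
    have \<kappa>C: "C.\<kappa> = S.kernels"
      unfolding fun_eq_iff[of C.\<kappa>] C.\<kappa>_def sweep_next_iterate \<kappa> by simp
    have f: "f t \<in> borel_measurable borel" for t
      using PC.f_meas mcong by blast
    have probs: "prob_space (S.kernels t x)" for t x
      by (rule PC.prob_\<kappa>)
    have meas: "path_char C.\<kappa> f \<theta> t n \<in> borel_measurable borel" for \<theta> t n
      unfolding \<kappa>C by (rule iffD1[OF mcong], rule path_char_measurable) (rule PC.stat, rule PC.f_meas)
    have tv: "\<exists>n. \<forall>h :: 'a \<Rightarrow> real. h \<in> borel_measurable \<pi> \<longrightarrow> (\<forall>x. \<bar>h x\<bar> \<le> 1) \<longrightarrow>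
        \<bar>(\<integral>x. h x \<partial>distr N borel (X (2 * n))) - (\<integral>x. h x \<partial>\<pi>)\<bar> \<le> e" if "0 < e" for e
      by (rule H.total_variation_convergence[where \<rho> = "\<lambda>n. distr N borel (X (2 * n))", OF contraction r _ _ C.law_even_Suc that])
        (use C.prob_space_distr[OF C.X_meas] \<pi>(2) in simp_all)
    have lim: "(\<lambda>n. CLINT x|\<pi>. path_char C.\<kappa> f (\<theta> n) 0 n x) \<longlonglongrightarrow> of_real (exp (- s2 / 4))"
      if "(\<lambda>n. real n * (\<theta> n)\<^sup>2) \<longlonglongrightarrow> 1" "\<theta> \<longlonglongrightarrow> 0" for \<theta>
      using PC.path_char_limit[OF that] unfolding \<kappa>C s2[symmetric] by (simp add: exp_of_real[symmetric])
    show ?thesis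
      by (rule C.characteristic_function_limit[OF \<pi> f PC.periodic(3) meas _ tv lim])
        (unfold \<kappa>C, rule path_char_bound[OF probs])
  qed

  define ucv where "ucv C s t = (if even t then (\<lambda>x. 2 * (s \<bullet> G x) - s \<bullet> g x - (C *v s) \<bullet> g x)
      else (\<lambda>x. 2 * kint (Q 2) (\<lambda>x. s \<bullet> G x) x - (C *v s) \<bullet> g x))" for C :: "real^'d^'d" and s and t :: nat
  have inner_cv: "s \<bullet> cv_summand Q g C t x = s \<bullet> g x - (C *v s) \<bullet> g x + (C *v s) \<bullet> kernel_vec (Q (if even t then 1 else 2)) g x"
    for C s t x
  proof -
    have "s \<bullet> (transpose C *v v) = (C *v s) \<bullet> v" for v
      using dot_lmul_matrix[of s "transpose C" v] by (simp add: transpose_matrix_vector)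
    then show ?thesis
      unfolding cv_summand_def sweep_next_iterate by (simp add: inner_diff_right)
  qed
  have cv_meas: "(\<lambda>x. s \<bullet> cv_summand Q g C t x) \<in> borel_measurable \<pi>" for C s t
    unfolding inner_cv using gM kvM by (cases "even t") simp_all
  have cv: "poisson_chain \<pi> S.kernels (ucv C s) (\<lambda>t x. s \<bullet> cv_summand Q g C t x)"
    "poisson_chain.s \<pi> S.kernels (ucv C s) (\<lambda>t x. s \<bullet> cv_summand Q g C t x) 0
      + poisson_chain.s \<pi> S.kernels (ucv C s) (\<lambda>t x. s \<bullet> cv_summand Q g C t x) 1 = 2 * (s \<bullet> (Sig C *v s))" for C s
  proof -
    have f0: "AE x in \<pi>. s \<bullet> cv_summand Q g C 0 x = s \<bullet> g x - (C *v s) \<bullet> g x + kint (Q 1) (\<lambda>x. (C *v s) \<bullet> g x) x"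
      using kv1[of "C *v s"] by eventually_elim (simp add: inner_cv)
    have f1: "AE x in \<pi>. s \<bullet> cv_summand Q g C 1 x = s \<bullet> g x"
      using inv by eventually_elim (simp add: inner_cv)
    have per: "(\<lambda>x. s \<bullet> cv_summand Q g C (Suc (Suc t)) x) = (\<lambda>x. s \<bullet> cv_summand Q g C t x)" for t
      by (simp add: inner_cv)
    note cvc = S.control_variate_chain[where f = "\<lambda>t x. s \<bullet> cv_summand Q g C t x",
        OF space sq(1) sq(1) sq(2) inv_s inv_s G(2) cv_meas per f0 f1, folded ucv_def]
    show "poisson_chain \<pi> S.kernels (ucv C s) (\<lambda>t x. s \<bullet> cv_summand Q g C t x)"
      using cvc(1) unfolding ucv_def .
    have "2 * (s \<bullet> (Sig C *v s)) = 8 * (\<integral>x. (s \<bullet> G x) * (s \<bullet> g x) \<partial>\<pi>) - 4 * (s \<bullet> (A *v s)) - 4 * (s \<bullet> (A *v (C *v s)))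
        + ((C *v s) \<bullet> (A *v (C *v s)) - (C *v s) \<bullet> (B *v (C *v s)))"
      unfolding Sig_def limit_cov_form[OF symA] Hform
      by (simp add: matrix_vector_mult_diff_rdistrib inner_diff_right)
    then show "poisson_chain.s \<pi> S.kernels (ucv C s) (\<lambda>t x. s \<bullet> cv_summand Q g C t x) 0
      + poisson_chain.s \<pi> S.kernels (ucv C s) (\<lambda>t x. s \<bullet> cv_summand Q g C t x) 1 = 2 * (s \<bullet> (Sig C *v s))"
      using cvc(2) unfolding ucv_def Aform Bform by simp
  qed
  define ulwk where "ulwk s t = (if even t then (\<lambda>x. 2 * (s \<bullet> G x) - 2 * (s \<bullet> g x))
      else (\<lambda>x. kint (Q 1) (\<lambda>x. s \<bullet> g x) x + 2 * kint (Q 2) (\<lambda>x. s \<bullet> G x) x - 2 * (s \<bullet> g x)))" for s and t :: nat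
  \<comment> \<open>The form found here is the one of the weight 2 I, so the conditional mean
    estimator calls for no matrix of its own.\<close>
  have lwk: "poisson_chain \<pi> S.kernels (ulwk s) (\<lambda>t x. s \<bullet> kernel_vec (Q 1) g x)"
    "poisson_chain.s \<pi> S.kernels (ulwk s) (\<lambda>t x. s \<bullet> kernel_vec (Q 1) g x) 0
      + poisson_chain.s \<pi> S.kernels (ulwk s) (\<lambda>t x. s \<bullet> kernel_vec (Q 1) g x) 1 = 2 * (s \<bullet> (Sig (mat 2) *v s))" for s
  proof -
    note lwkc = S.conditional_mean_chain[OF space sq(1) sq(2) inv_s G(2) T.g1.measurable_inner_kernel_vec[OF g_sq] kv1, of s]
    show "poisson_chain \<pi> S.kernels (ulwk s) (\<lambda>t x. s \<bullet> kernel_vec (Q 1) g x)"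
      using lwkc(1) unfolding ulwk_def .
    have "mat 2 *v s = 2 *\<^sub>R s"
      unfolding mat_eq_scaleR[of 2] by (simp add: scaleR_matrix_vector_assoc[symmetric])
    then have "2 * (s \<bullet> (Sig (mat 2) *v s)) = 8 * (\<integral>x. (s \<bullet> G x) * (s \<bullet> g x) \<partial>\<pi>) - 8 * (s \<bullet> (A *v s)) - 4 * (s \<bullet> (B *v s))"
      unfolding Sig_def limit_cov_form[OF symA] Hform
      by (simp add: matrix_vector_mult_diff_rdistrib inner_diff_right matrix_vector_mult_scaleR)
    then show "poisson_chain.s \<pi> S.kernels (ulwk s) (\<lambda>t x. s \<bullet> kernel_vec (Q 1) g x) 0
      + poisson_chain.s \<pi> S.kernels (ulwk s) (\<lambda>t x. s \<bullet> kernel_vec (Q 1) g x) 1 = 2 * (s \<bullet> (Sig (mat 2) *v s))"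
      using lwkc(2) unfolding ulwk_def Aform Bform by simp
  qed
  \<comment> \<open>Positivity is not visible in the formula; it holds because the form is half the
    sum of two mean conditional variances.\<close>
  have psd_Sig: "pos_semidef (Sig C)" for C
    unfolding pos_semidef_def
  proof (intro conjI allI)
    show "transpose (Sig C) = Sig C"
      by (simp add: Sig_def limit_cov_def transpose_add transpose_diff transpose_scaleR matrix_transpose_mul symA symB
          matrix_mul_assoc add.commute)
    fix s
    have "0 \<le> 2 * (s \<bullet> (Sig C *v s))"
      unfolding cv(2)[symmetric] using poisson_chain.s_nonneg[OF cv(1)] by (intro add_nonneg_nonneg) auto
    then show "0 \<le> s \<bullet> (Sig C *v s)"
      by simp
  qed
  have AV: "asymptotic_variance N (\<lambda>n \<omega>. \<Sum>t<n. cv_summand Q g C t (X t \<omega>)) (Sig C)"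
    "asymptotic_variance N (\<lambda>n \<omega>. \<Sum>t<n. kernel_vec (Q 1) g (X t \<omega>)) (Sig (mat 2))"
    if chain: "sweep_chain Q \<nu> N X" for \<nu> and N :: "'b measure" and X C
  proof -
    have N: "prob_space N" and X: "\<And>t. X t \<in> N \<rightarrow>\<^sub>M borel"
      using chain by (auto simp: sweep_chain_def)
    show "asymptotic_variance N (\<lambda>n \<omega>. \<Sum>t<n. cv_summand Q g C t (X t \<omega>)) (Sig C)"
    proof (rule asymptotic_varianceI[OF N _ psd_Sig])
      have "cv_summand Q g C t \<in> borel_measurable borel" for t
        using borel_measurable_vec_inner[OF cv_meas] mcong by blast
      then show "(\<lambda>\<omega>. \<Sum>t<n. cv_summand Q g C t (X t \<omega>)) \<in> borel_measurable N" for n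
        by (intro borel_measurable_sum measurable_compose[OF X])
      show "(\<lambda>n. CLINT \<omega>|N. iexp (1 / sqrt (real n) * (s \<bullet> (\<Sum>t<n. cv_summand Q g C t (X t \<omega>)))))
          \<longlonglongrightarrow> of_real (exp (- (s \<bullet> (Sig C *v s)) / 2))" for s
        using limit[OF chain cv] by (simp add: inner_sum_right)
    qed
    show "asymptotic_variance N (\<lambda>n \<omega>. \<Sum>t<n. kernel_vec (Q 1) g (X t \<omega>)) (Sig (mat 2))"
    proof (rule asymptotic_varianceI[OF N _ psd_Sig])
      have "kernel_vec (Q 1) g \<in> borel_measurable borel"
        using kvM(1) mcong by blast
      then show "(\<lambda>\<omega>. \<Sum>t<n. kernel_vec (Q 1) g (X t \<omega>)) \<in> borel_measurable N" for n
        by (intro borel_measurable_sum measurable_compose[OF X])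
      show "(\<lambda>n. CLINT \<omega>|N. iexp (1 / sqrt (real n) * (s \<bullet> (\<Sum>t<n. kernel_vec (Q 1) g (X t \<omega>)))))
          \<longlonglongrightarrow> of_real (exp (- (s \<bullet> (Sig (mat 2) *v s)) / 2))" for s
        using limit[OF chain lwk] by (simp add: inner_sum_right)
    qed
  qed

  \<comment> \<open>K2 fixes g, so its term drops out and U is half of the invertible matrix A - B;
    the pseudoinverse becomes an inverse.\<close>
  have U_eq: "U = (1/2) *\<^sub>R (A - B)"
  proof -
    have "(LINT x|\<pi>. outer (g x) - outer (kernel_vec (Q 2) g x)) = (LINT x|\<pi>. 0)"
      using inv by (intro integral_cong_AE borel_measurable_diff measurable_outer gM kvM) auto
    moreover have "(LINT x|\<pi>. outer (g x) - outer (kernel_vec (Q 1) g x)) = A - B"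
      unfolding AB by (intro Bochner_Integration.integral_diff integrable_outer gM kvM g_sq T.g1.sq_int_kernel_vec)
    ultimately show ?thesis
      unfolding U by simp
  qed
  have Copt_eq: "Copt = 2 *\<^sub>R matrix_inv (A - B) ** A"
    unfolding Copt U_eq moore_penrose_half[OF inv_D] using V AB by simp
  have d1: "Sig Copt - Sig (mat 2) = - (2 *\<^sub>R (B ** matrix_inv (A - B) ** B))"
    unfolding Sig_def Copt_eq by (rule limit_cov_optimal[OF inv_D symA symB])
  have d2: "Sig (mat 2) - Sig (mat 1) = - ((1/2) *\<^sub>R (A + 3 *\<^sub>R B))"
    unfolding Sig_def limit_cov_mat by (simp add: vec_eq_iff field_simps)
  have d3: "Sig (mat 1) - Sig (mat 0) = - ((1/2) *\<^sub>R (B + 3 *\<^sub>R A))"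
    unfolding Sig_def limit_cov_mat by (simp add: vec_eq_iff field_simps)
  \<comment> \<open>With w = J B v, J the inverse of A - B, the form of B J B at v is that of A - B
    at w.\<close>
  have psd: "pos_semidef (2 *\<^sub>R (B ** matrix_inv (A - B) ** B))"
    unfolding pos_semidef_def
  proof (intro conjI allI)
    let ?J = "matrix_inv (A - B)"
    have tJ: "transpose ?J = ?J"
      by (rule transpose_matrix_inv[OF inv_D]) (simp add: transpose_diff symA symB)
    show "transpose (2 *\<^sub>R (B ** ?J ** B)) = 2 *\<^sub>R (B ** ?J ** B)"
      by (simp add: transpose_scaleR matrix_transpose_mul symB tJ matrix_mul_assoc)
    fix v
    let ?w = "?J *v (B *v v)"
    have "v \<bullet> ((B ** ?J ** B) *v v) = (B *v v) \<bullet> ?w"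
      using bilinear_sym[OF symB, of v ?w] by (simp add: matrix_vector_mul_assoc[symmetric] inner_commute)
    moreover have "(A - B) *v ?w = B *v v"
      by (simp add: matrix_vector_mul_assoc matrix_mul_assoc matrix_inv_mult[OF inv_D])
    moreover have "0 \<le> ?w \<bullet> ((A - B) *v ?w)"
      using pos_def_imp_pos_semidef[OF pdD] unfolding pos_semidef_def by blast
    ultimately have "0 \<le> v \<bullet> ((B ** ?J ** B) *v v)"
      by (simp only: inner_commute)
    then show "0 \<le> v \<bullet> (2 *\<^sub>R (B ** ?J ** B) *v v)"
      by (simp add: scaleR_matrix_vector_assoc[symmetric])
  qed
  have pos: "v \<noteq> 0 \<Longrightarrow> 0 < v \<bullet> (A *v v)" "0 \<le> v \<bullet> (B *v v)" for v
    using pdA psdB by (simp_all add: pos_def_def pos_semidef_def)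
  have pd_comb: "pos_def ((1/2) *\<^sub>R (A + 3 *\<^sub>R B))" "pos_def ((1/2) *\<^sub>R (B + 3 *\<^sub>R A))"
    unfolding pos_def_def
    by (simp_all add: symA symB transpose_add transpose_scaleR matrix_vector_mult_add_rdistrib
        scaleR_matrix_vector_assoc[symmetric] inner_add_right pos add_pos_nonneg add_nonneg_pos)
  have "mat_le (Sig Copt) (Sig (mat 2))"
    unfolding mat_le_def using psd d1 by (metis minus_diff_eq minus_minus)
  moreover have "mat_le (- (2 *\<^sub>R (B ** matrix_inv (A - B) ** B))) 0"
    unfolding mat_le_def using psd by simp
  moreover have "mat_less (Sig (mat 2)) (Sig (mat 1))" "mat_less (Sig (mat 1)) (Sig (mat 0))"
    using pd_comb d2 d3 by (intro mat_lessI, metis minus_diff_eq minus_minus)+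
  moreover have "mat_less (- ((1/2) *\<^sub>R (A + 3 *\<^sub>R B))) 0" "mat_less (- ((1/2) *\<^sub>R (B + 3 *\<^sub>R A))) 0"
    using pd_comb by (intro mat_lessI, simp)+
  ultimately show ?thesis
    using AV inv_D d1 d2 d3 by (intro exI[of _ Sig] exI[of _ "Sig (mat 2)"]) blast
qed

end
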